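(* Let $k$ be a field and let $Q$ be a strongly locally finite quiver. Then the category $\overline{\mathrm{rep}}(Q)$ is abelian.
   Context: A quiver $Q=(Q_0,Q_1)$ is strongly locally finite if it is locally finite (each vertex is attached to finitely many arrows) and interval-finite (for all vertices $x,y$ the set $Q(x,y)$ of paths from $x$ to $y$, including trivial paths, is finite). $\mathrm{rep}(Q)$ is the abelian category of locally finite dimensional representations $M$ of $Q$ over $k$ ($M(x)$ is finite dimensional for every $x\in Q_0$). For $a\in Q_0$: $P_a$ is the representation with $P_a(x)$ the vector space with basis $Q(a,x)$, arrows acting by extending paths; $I_a$ is the representation with $I_a(x)$ the vector space with basis $Q(x,a)$, an arrow $\alpha:x\to y$ acting by the transpose of the map $kQ(y,a)\to kQ(x,a)$ given by multiplication by $\alpha$. $\mathrm{rep}^+(Q)$ is the full subcategory of $\mathrm{rep}(Q)$ of finitely presented representations: those $M$ with an exact sequence $0\to P'\to P\to M\to 0$ where $P,P'$ are finite direct sums of representations $P_x$. $\mathrm{rep}^-(Q)$ is the full subcategory of finitely co-presented representations: those $M$ with an exact sequence $0\to M\to I\to I'\to 0$ where $I,I'$ are finite direct sums of representations $I_x$. An arrow $\alpha$ supports $M$ if $M(\alpha)\neq 0$. A short exact sequence $0\to L\to M\to N\to 0$ in $\mathrm{rep}(Q)$ is called a finite extension of $N$ by $L$ (and $M$ a finite extension-representation of $N$ by $L$) if all but finitely many arrows supporting $M$ support $L\oplus N$. $\overline{\mathrm{rep}}(Q)$ is the full subcategory of $\mathrm{rep}(Q)$ of those $M$ which are finite extension-representations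 of $N$ by $L$ for some $L\in\mathrm{rep}^+(Q)$ and $N\in\mathrm{rep}^-(Q)$. *)

theory Defs
  imports "Jordan_Normal_Form.Missing_VectorSpace" "Graph_Theory.Arc_Walk"
begin

section \<open>Abelian categories\<close>

text \<open>
  A category with additive structure on its morphism sets. The sets \<open>Mor C X Y\<close> need not be
  disjoint, so composition carries its objects: \<open>Comp C X Y Z g f\<close> is the composite of
  \<open>f : X \<rightarrow> Y\<close> followed by \<open>g : Y \<rightarrow> Z\<close>.
\<close>

record ('o, 'm) add_cat =
  Obj :: "'o set"
  Mor :: "'o \<Rightarrow> 'o \<Rightarrow> 'm set"
  Id :: "'o \<Rightarrow> 'm"
  Comp :: "'o \<Rightarrow> 'o \<Rightarrow> 'o \<Rightarrow> 'm \<Rightarrow> 'm \<Rightarrow> 'm"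
  Add :: "'o \<Rightarrow> 'o \<Rightarrow> 'm \<Rightarrow> 'm \<Rightarrow> 'm"
  Zero :: "'o \<Rightarrow> 'o \<Rightarrow> 'm"

definition mor_group :: "('o, 'm) add_cat \<Rightarrow> 'o \<Rightarrow> 'o \<Rightarrow> 'm monoid" where
  "mor_group C X Y = \<lparr>carrier = Mor C X Y, monoid.mult = Add C X Y, one = Zero C X Y\<rparr>"

locale preadditive_category =
  fixes C :: "('o, 'm) add_cat"
  assumes id_mor: "X \<in> Obj C \<Longrightarrow> Id C X \<in> Mor C X X"
    and comp_mor: "\<lbrakk>X \<in> Obj C; Y \<in> Obj C; Z \<in> Obj C; f \<in> Mor C X Y; g \<in> Mor C Y Z\<rbrakk>
      \<Longrightarrow> Comp C X Y Z g f \<in> Mor C X Z"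
    and comp_id_left: "\<lbrakk>X \<in> Obj C; Y \<in> Obj C; f \<in> Mor C X Y\<rbrakk> \<Longrightarrow> Comp C X Y Y (Id C Y) f = f"
    and comp_id_right: "\<lbrakk>X \<in> Obj C; Y \<in> Obj C; f \<in> Mor C X Y\<rbrakk> \<Longrightarrow> Comp C X X Y f (Id C X) = f"
    and comp_assoc: "\<lbrakk>W \<in> Obj C; X \<in> Obj C; Y \<in> Obj C; Z \<in> Obj C;
        f \<in> Mor C W X; g \<in> Mor C X Y; h \<in> Mor C Y Z\<rbrakk>
      \<Longrightarrow> Comp C W X Z (Comp C X Y Z h g) f = Comp C W Y Z h (Comp C W X Y g f)"
    and mor_comm_group: "\<lbrakk>X \<in> Obj C; Y \<in> Obj C\<rbrakk> \<Longrightarrow> comm_group (mor_group C X Y)"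
    and comp_add_left: "\<lbrakk>X \<in> Obj C; Y \<in> Obj C; Z \<in> Obj C;
        f \<in> Mor C X Y; g \<in> Mor C Y Z; g' \<in> Mor C Y Z\<rbrakk>
      \<Longrightarrow> Comp C X Y Z (Add C Y Z g g') f = Add C X Z (Comp C X Y Z g f) (Comp C X Y Z g' f)"
    and comp_add_right: "\<lbrakk>X \<in> Obj C; Y \<in> Obj C; Z \<in> Obj C;
        f \<in> Mor C X Y; f' \<in> Mor C X Y; g \<in> Mor C Y Z\<rbrakk>
      \<Longrightarrow> Comp C X Y Z g (Add C X Y f f') = Add C X Z (Comp C X Y Z g f) (Comp C X Y Z g f')"

definition zero_object :: "('o, 'm) add_cat \<Rightarrow> 'o \<Rightarrow> bool" where
  "zero_object C Z \<longleftrightarrow> Z \<in> Obj C \<and>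
     (\<forall>X\<in>Obj C. (\<exists>!f. f \<in> Mor C X Z) \<and> (\<exists>!f. f \<in> Mor C Z X))"

definition is_biproduct ::
  "('o, 'm) add_cat \<Rightarrow> 'o \<Rightarrow> 'o \<Rightarrow> 'o \<Rightarrow> 'm \<Rightarrow> 'm \<Rightarrow> 'm \<Rightarrow> 'm \<Rightarrow> bool" where
  "is_biproduct C X Y S i j p q \<longleftrightarrow> S \<in> Obj C \<and>
     i \<in> Mor C X S \<and> j \<in> Mor C Y S \<and> p \<in> Mor C S X \<and> q \<in> Mor C S Y \<and>
     Comp C X S X p i = Id C X \<and> Comp C Y S Y q j = Id C Y \<and>
     Comp C Y S X p j = Zero C Y X \<and> Comp C X S Y q i = Zero C X Y \<and>
     Add C S S (Comp C S X S i p) (Comp C S Y S j q) = Id C S"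

definition is_kernel :: "('o, 'm) add_cat \<Rightarrow> 'o \<Rightarrow> 'o \<Rightarrow> 'm \<Rightarrow> 'o \<Rightarrow> 'm \<Rightarrow> bool" where
  "is_kernel C X Y f A k \<longleftrightarrow> A \<in> Obj C \<and> k \<in> Mor C A X \<and> Comp C A X Y f k = Zero C A Y \<and>
     (\<forall>Z\<in>Obj C. \<forall>g\<in>Mor C Z X. Comp C Z X Y f g = Zero C Z Y \<longrightarrow>
        (\<exists>!h. h \<in> Mor C Z A \<and> Comp C Z A X k h = g))"

definition is_cokernel :: "('o, 'm) add_cat \<Rightarrow> 'o \<Rightarrow> 'o \<Rightarrow> 'm \<Rightarrow> 'o \<Rightarrow> 'm \<Rightarrow> bool" where
  "is_cokernel C X Y f B c \<longleftrightarrow> B \<in> Obj C \<and> c \<in> Mor C Y B \<and> Comp C X Y B c f = Zero C X B \<and>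
     (\<forall>Z\<in>Obj C. \<forall>g\<in>Mor C Y Z. Comp C X Y Z g f = Zero C X Z \<longrightarrow>
        (\<exists>!h. h \<in> Mor C B Z \<and> Comp C Y B Z h c = g))"

definition is_mono :: "('o, 'm) add_cat \<Rightarrow> 'o \<Rightarrow> 'o \<Rightarrow> 'm \<Rightarrow> bool" where
  "is_mono C X Y f \<longleftrightarrow> f \<in> Mor C X Y \<and>
     (\<forall>Z\<in>Obj C. \<forall>g\<in>Mor C Z X. \<forall>h\<in>Mor C Z X. Comp C Z X Y f g = Comp C Z X Y f h \<longrightarrow> g = h)"

definition is_epi :: "('o, 'm) add_cat \<Rightarrow> 'o \<Rightarrow> 'o \<Rightarrow> 'm \<Rightarrow> bool" where
  "is_epi C X Y f \<longleftrightarrow> f \<in> Mor C X Y \<and>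
     (\<forall>Z\<in>Obj C. \<forall>g\<in>Mor C Y Z. \<forall>h\<in>Mor C Y Z. Comp C X Y Z g f = Comp C X Y Z h f \<longrightarrow> g = h)"

locale abelian_category = preadditive_category +
  assumes has_zero_object: "\<exists>Z. zero_object C Z"
    and has_biproducts: "\<lbrakk>X \<in> Obj C; Y \<in> Obj C\<rbrakk> \<Longrightarrow> \<exists>S i j p q. is_biproduct C X Y S i j p q"
    and has_kernels: "\<lbrakk>X \<in> Obj C; Y \<in> Obj C; f \<in> Mor C X Y\<rbrakk> \<Longrightarrow> \<exists>A k. is_kernel C X Y f A k"
    and has_cokernels: "\<lbrakk>X \<in> Obj C; Y \<in> Obj C; f \<in> Mor C X Y\<rbrakk> \<Longrightarrow> \<exists>B c. is_cokernel C X Y f B c"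
    and mono_normal: "\<lbrakk>X \<in> Obj C; Y \<in> Obj C; is_mono C X Y f\<rbrakk>
      \<Longrightarrow> \<exists>Z\<in>Obj C. \<exists>g\<in>Mor C Y Z. is_kernel C Y Z g X f"
    and epi_normal: "\<lbrakk>X \<in> Obj C; Y \<in> Obj C; is_epi C X Y f\<rbrakk>
      \<Longrightarrow> \<exists>Z\<in>Obj C. \<exists>g\<in>Mor C Z X. is_cokernel C Z X g Y f"

definition full_subcategory :: "('o, 'm) add_cat \<Rightarrow> ('o \<Rightarrow> bool) \<Rightarrow> ('o, 'm) add_cat" where
  "full_subcategory C P = C\<lparr>Obj := {X \<in> Obj C. P X}\<rparr>"


section \<open>Strongly locally finite quivers\<close>

text \<open>
  A quiver is a \<^locale>\<open>wf_digraph\<close> (loops and parallel arrows are allowed). A path is the list of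
  its arrows in the order in which they are traversed; \<open>[]\<close> is the trivial path.
\<close>

definition paths :: "('v, 'a) pre_digraph \<Rightarrow> 'v \<Rightarrow> 'v \<Rightarrow> 'a list set" where
  "paths Q x y = {p. pre_digraph.awalk Q x p y}"

definition locally_finite_quiver :: "('v, 'a) pre_digraph \<Rightarrow> bool" where
  "locally_finite_quiver Q \<longleftrightarrow> (\<forall>x\<in>verts Q. finite (in_arcs Q x \<union> out_arcs Q x))"

definition interval_finite :: "('v, 'a) pre_digraph \<Rightarrow> bool" where
  "interval_finite Q \<longleftrightarrow> (\<forall>x\<in>verts Q. \<forall>y\<in>verts Q. finite (paths Q x y))"

definition strongly_locally_finite :: "('v, 'a) pre_digraph \<Rightarrow> bool" where
  "strongly_locally_finite Q \<longleftrightarrow> wf_digraph Q \<and> locally_finite_quiver Q \<and> interval_finite Q"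


section \<open>Representations\<close>

text \<open>
  The vector spaces of a representation may be arbitrary ones whose elements belong to the type
  \<open>'u\<close>. Only the values of \<open>space_at\<close> at vertices, and of \<open>map_at\<close> at arrows, matter.
  The type \<open>'u\<close> plays the role of a universe: once the finite lists of scalars inject into it, every
  finite-dimensional vector space has an isomorphic copy over \<open>'u\<close>.
\<close>

record ('v, 'a, 'k, 'u) rep =
  space_at :: "'v \<Rightarrow> ('k, 'u) module"
  map_at :: "'a \<Rightarrow> 'u \<Rightarrow> 'u"

definition is_rep ::
  "('k, 'r) ring_scheme \<Rightarrow> ('v, 'a) pre_digraph \<Rightarrow> ('v, 'a, 'k, 'u) rep \<Rightarrow> bool" where
  "is_rep K Q M \<longleftrightarrow> (\<forall>x\<in>verts Q. vectorspace K (space_at M x)) \<and>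
     (\<forall>\<alpha>\<in>arcs Q. linear_map K (space_at M (tail Q \<alpha>)) (space_at M (head Q \<alpha>)) (map_at M \<alpha>))"

definition locally_fin_dim ::
  "('k, 'r) ring_scheme \<Rightarrow> ('v, 'a) pre_digraph \<Rightarrow> ('v, 'a, 'k, 'u) rep \<Rightarrow> bool" where
  "locally_fin_dim K Q M \<longleftrightarrow> (\<forall>x\<in>verts Q. vectorspace.fin_dim K (space_at M x))"

text \<open>
  Morphisms are extensional (\<^const>\<open>undefined\<close> off the vertices and off the carriers), so that
  equal morphisms are equal as functions.
\<close>

definition rep_mor ::
  "('k, 'r) ring_scheme \<Rightarrow> ('v, 'a) pre_digraph \<Rightarrow> ('v, 'a, 'k, 'u) rep \<Rightarrow> ('v, 'a, 'k, 'w) rep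
    \<Rightarrow> ('v \<Rightarrow> 'u \<Rightarrow> 'w) set" where
  "rep_mor K Q M N =
     {f \<in> (\<Pi>\<^sub>E x\<in>verts Q. {h \<in> extensional (carrier (space_at M x)).
                           linear_map K (space_at M x) (space_at N x) h}).
      \<forall>\<alpha>\<in>arcs Q. \<forall>v\<in>carrier (space_at M (tail Q \<alpha>)).
        f (head Q \<alpha>) (map_at M \<alpha> v) = map_at N \<alpha> (f (tail Q \<alpha>) v)}"

definition rep_cat :: "('k, 'r) ring_scheme \<Rightarrow> ('v, 'a) pre_digraph
    \<Rightarrow> (('v, 'a, 'k, 'u) rep, 'v \<Rightarrow> 'u \<Rightarrow> 'u) add_cat" where
  "rep_cat K Q =
    \<lparr>Obj = {M. is_rep K Q M \<and> locally_fin_dim K Q M},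
     Mor = rep_mor K Q,
     Id = (\<lambda>M. \<lambda>x\<in>verts Q. \<lambda>v\<in>carrier (space_at M x). v),
     Comp = (\<lambda>L M N g f. \<lambda>x\<in>verts Q. compose (carrier (space_at L x)) (g x) (f x)),
     Add = (\<lambda>M N f g. \<lambda>x\<in>verts Q. \<lambda>v\<in>carrier (space_at M x). f x v \<oplus>\<^bsub>space_at N x\<^esub> g x v),
     Zero = (\<lambda>M N. \<lambda>x\<in>verts Q. \<lambda>v\<in>carrier (space_at M x). \<zero>\<^bsub>space_at N x\<^esub>)\<rparr>"

text \<open>
  Exactness is vertexwise; the three representations may live over different types, as the sums of
  the representations \<open>proj_rep\<close>, \<open>inj_rep\<close> below do not live over \<open>'u\<close>.
\<close>

definition short_exact ::
  "('k, 'r) ring_scheme \<Rightarrow> ('v, 'a) pre_digraph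
    \<Rightarrow> ('v, 'a, 'k, 'u) rep \<Rightarrow> ('v, 'a, 'k, 'w) rep \<Rightarrow> ('v, 'a, 'k, 'z) rep
    \<Rightarrow> ('v \<Rightarrow> 'u \<Rightarrow> 'w) \<Rightarrow> ('v \<Rightarrow> 'w \<Rightarrow> 'z) \<Rightarrow> bool" where
  "short_exact K Q L M N f g \<longleftrightarrow> is_rep K Q L \<and> is_rep K Q M \<and> is_rep K Q N \<and>
     f \<in> rep_mor K Q L M \<and> g \<in> rep_mor K Q M N \<and>
     (\<forall>x\<in>verts Q. inj_on (f x) (carrier (space_at L x)) \<and>
        f x ` carrier (space_at L x) = {v \<in> carrier (space_at M x). g x v = \<zero>\<^bsub>space_at N x\<^esub>} \<and>
        g x ` carrier (space_at M x) = carrier (space_at N x))"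

text \<open>The direct sum of a finite list of representations; its elements are tuples indexed by the
  positions of the list.\<close>

definition sum_space :: "('k, 'u) module list \<Rightarrow> ('k, nat \<Rightarrow> 'u) module" where
  "sum_space Vs = (let I = {..<length Vs} in
    \<lparr>carrier = (\<Pi>\<^sub>E i\<in>I. carrier (Vs ! i)),
     mult = (\<lambda>v w. \<lambda>i\<in>I. v i \<otimes>\<^bsub>Vs ! i\<^esub> w i),
     one = (\<lambda>i\<in>I. \<one>\<^bsub>Vs ! i\<^esub>),
     zero = (\<lambda>i\<in>I. \<zero>\<^bsub>Vs ! i\<^esub>),
     add = (\<lambda>v w. \<lambda>i\<in>I. v i \<oplus>\<^bsub>Vs ! i\<^esub> w i),
     smult = (\<lambda>c v. \<lambda>i\<in>I. c \<odot>\<^bsub>Vs ! i\<^esub> v i)\<rparr>)"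

definition sum_rep :: "('v, 'a, 'k, 'u) rep list \<Rightarrow> ('v, 'a, 'k, nat \<Rightarrow> 'u) rep" where
  "sum_rep Ms =
    \<lparr>space_at = (\<lambda>x. sum_space (map (\<lambda>M. space_at M x) Ms)),
     map_at = (\<lambda>\<alpha> v. \<lambda>i\<in>{..<length Ms}. map_at (Ms ! i) \<alpha> (v i))\<rparr>"


section \<open>Finitely presented and finitely co-presented representations\<close>

text \<open>
  For a finite set \<open>S\<close>, the vector space with basis \<open>S\<close> is \<^term>\<open>ring.func_space K S\<close>, an element
  being the family of its coefficients. For \<open>\<phi> : S \<rightarrow> T\<close>, \<open>basis_map\<close> is the linear map
  sending the basis vector of \<open>s\<close> to that of \<open>\<phi> s\<close>, and \<open>basis_map_transpose\<close> is its transpose.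
\<close>

definition basis_map ::
  "('k, 'r) ring_scheme \<Rightarrow> 's set \<Rightarrow> 't set \<Rightarrow> ('s \<Rightarrow> 't) \<Rightarrow> ('s \<Rightarrow> 'k) \<Rightarrow> ('t \<Rightarrow> 'k)" where
  "basis_map K S T \<phi> f = (\<lambda>t\<in>T. \<Oplus>\<^bsub>K\<^esub>s\<in>{s \<in> S. \<phi> s = t}. f s)"

definition basis_map_transpose :: "'s set \<Rightarrow> ('s \<Rightarrow> 't) \<Rightarrow> ('t \<Rightarrow> 'k) \<Rightarrow> ('s \<Rightarrow> 'k)" where
  "basis_map_transpose S \<phi> f = (\<lambda>s\<in>S. f (\<phi> s))"

definition proj_rep ::
  "('k, 'r) ring_scheme \<Rightarrow> ('v, 'a) pre_digraph \<Rightarrow> 'v \<Rightarrow> ('v, 'a, 'k, 'a list \<Rightarrow> 'k) rep" where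
  "proj_rep K Q a =
    \<lparr>space_at = (\<lambda>x. ring.func_space K (paths Q a x)),
     map_at = (\<lambda>\<alpha>. basis_map K (paths Q a (tail Q \<alpha>)) (paths Q a (head Q \<alpha>)) (\<lambda>p. p @ [\<alpha>]))\<rparr>"

definition inj_rep ::
  "('k, 'r) ring_scheme \<Rightarrow> ('v, 'a) pre_digraph \<Rightarrow> 'v \<Rightarrow> ('v, 'a, 'k, 'a list \<Rightarrow> 'k) rep" where
  "inj_rep K Q a =
    \<lparr>space_at = (\<lambda>x. ring.func_space K (paths Q x a)),
     map_at = (\<lambda>\<alpha>. basis_map_transpose (paths Q (head Q \<alpha>) a) (\<lambda>p. \<alpha> # p))\<rparr>"

definition finitely_presented ::
  "('k, 'r) ring_scheme \<Rightarrow> ('v, 'a) pre_digraph \<Rightarrow> ('v, 'a, 'k, 'u) rep \<Rightarrow> bool" where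
  "finitely_presented K Q M \<longleftrightarrow>
     (\<exists>as bs f g. set as \<subseteq> verts Q \<and> set bs \<subseteq> verts Q \<and>
        short_exact K Q (sum_rep (map (proj_rep K Q) as)) (sum_rep (map (proj_rep K Q) bs)) M f g)"

definition finitely_copresented ::
  "('k, 'r) ring_scheme \<Rightarrow> ('v, 'a) pre_digraph \<Rightarrow> ('v, 'a, 'k, 'u) rep \<Rightarrow> bool" where
  "finitely_copresented K Q M \<longleftrightarrow>
     (\<exists>as bs f g. set as \<subseteq> verts Q \<and> set bs \<subseteq> verts Q \<and>
        short_exact K Q M (sum_rep (map (inj_rep K Q) as)) (sum_rep (map (inj_rep K Q) bs)) f g)"

definition rep_plus :: "('k, 'r) ring_scheme \<Rightarrow> ('v, 'a) pre_digraph
    \<Rightarrow> (('v, 'a, 'k, 'u) rep, 'v \<Rightarrow> 'u \<Rightarrow> 'u) add_cat" where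
  "rep_plus K Q = full_subcategory (rep_cat K Q) (finitely_presented K Q)"

definition rep_minus :: "('k, 'r) ring_scheme \<Rightarrow> ('v, 'a) pre_digraph
    \<Rightarrow> (('v, 'a, 'k, 'u) rep, 'v \<Rightarrow> 'u \<Rightarrow> 'u) add_cat" where
  "rep_minus K Q = full_subcategory (rep_cat K Q) (finitely_copresented K Q)"


section \<open>Finite extensions\<close>

definition supports :: "('v, 'a) pre_digraph \<Rightarrow> 'a \<Rightarrow> ('v, 'a, 'k, 'u) rep \<Rightarrow> bool" where
  "supports Q \<alpha> M \<longleftrightarrow>
     (\<exists>v\<in>carrier (space_at M (tail Q \<alpha>)). map_at M \<alpha> v \<noteq> \<zero>\<^bsub>space_at M (head Q \<alpha>)\<^esub>)"

definition finite_extension_rep :: "('k, 'r) ring_scheme \<Rightarrow> ('v, 'a) pre_digraph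
    \<Rightarrow> ('v, 'a, 'k, 'u) rep \<Rightarrow> ('v, 'a, 'k, 'u) rep \<Rightarrow> ('v, 'a, 'k, 'u) rep \<Rightarrow> bool" where
  "finite_extension_rep K Q M N L \<longleftrightarrow>
     L \<in> Obj (rep_cat K Q) \<and> M \<in> Obj (rep_cat K Q) \<and> N \<in> Obj (rep_cat K Q) \<and>
     (\<exists>f g. short_exact K Q L M N f g) \<and>
     finite {\<alpha> \<in> arcs Q. supports Q \<alpha> M \<and> \<not> supports Q \<alpha> (sum_rep [L, N])}"

definition rep_bar :: "('k, 'r) ring_scheme \<Rightarrow> ('v, 'a) pre_digraph
    \<Rightarrow> (('v, 'a, 'k, 'u) rep, 'v \<Rightarrow> 'u \<Rightarrow> 'u) add_cat" where
  "rep_bar K Q = full_subcategory (rep_cat K Q)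
     (\<lambda>M. \<exists>L\<in>Obj (rep_plus K Q). \<exists>N\<in>Obj (rep_minus K Q). finite_extension_rep K Q M N L)"

end

theory Submission
  imports Defs
begin

text \<open>
  Whether \<open>M\<close> belongs to the category can be read off from its spaces and maps. It does if and only
  if there are finite sets \<open>a\<close>, \<open>b\<close> of vertices such that, with \<open>A\<close> the set of successors of \<open>a\<close> and
  \<open>B\<close> the set of predecessors of \<open>b\<close>, the representation vanishes off \<open>A \<union> B\<close>; at almost all \<open>y \<in> A\<close> the
  map to \<open>M(y)\<close> from the sum of the \<open>M(x)\<close> over the arrows \<open>x \<rightarrow> y\<close> with \<open>x \<in> A\<close> is bijective; at
  almost all \<open>x \<in> B - A\<close> the map from \<open>M(x)\<close> to the product of the \<open>M(y)\<close> over the arrows \<open>x \<rightarrow> y\<close>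
  with \<open>y \<in> B - A\<close> is bijective; and only finitely many arrows from \<open>B - A\<close> to \<open>A\<close> support \<open>M\<close>.

  By interval finiteness such sets \<open>A\<close> and \<open>B\<close> meet in a finite set, so \<open>a\<close> and \<open>b\<close> may be enlarged and
  two representations have them in common; the five lemma then shows that the condition passes to
  kernels, cokernels and biproducts in the abelian category of all locally finite dimensional
  representations.

  For the equivalence, \<open>M\<close> is finitely presented if and only if it vanishes off the successors of a
  finite set and is the sum over its incoming arrows at almost all vertices: generators are needed at
  the exceptional vertices only, and the kernel of the resulting cover by a sum of representations
  \<open>P\<^sub>x\<close> satisfies the same condition, with injectivity at every vertex, so that its own cover is an
  isomorphism. Finitely co-presented representations are characterized dually.
\<close>

section \<open>Linear algebra\<close>

text \<open>An extension with sub \<open>L\<close> and quotient \<open>N\<close> is not functorial: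
  a morphism need not respect the chosen pieces. Once the cones are fixed, \<open>L\<close> can be
  taken to be the restriction of the representation to \<open>A\<close>, which every morphism
  respects; this is why \<open>B\<close> enters only through \<open>B - A\<close>. For a fixed set
  of arrows, the sum over the tails and the product over the heads are exact in the representation,
  so the comparison with the vertex space is a map of exact sequences. The five lemma then works
  vertex by vertex, and the exceptional vertices of a kernel or cokernel lie in the union of two
  finite sets.

  Enlarging the cones changes these arrow sets, but away from the finite overlap an added arrow has
  its tail (for \<open>A\<close>) or head (for \<open>B - A\<close>) at a vertex where the
  representation is zero.

  All objects must live over the one type \<open>'u\<close>. Kernels are carved out of the given
  spaces and quotients are replaced by complements, so neither leaves that type. The injection
  \<open>\<iota>\<close> is what brings the zero object and biproducts back to it: a vector is
  encoded by the list of its values under finitely many functionals.\<close>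

lemma vectorspaceD:
  assumes "vectorspace K V"
  shows vs_zero_closed: "\<zero>\<^bsub>V\<^esub> \<in> carrier V"
    and vs_add_closed: "u \<in> carrier V \<Longrightarrow> v \<in> carrier V \<Longrightarrow> u \<oplus>\<^bsub>V\<^esub> v \<in> carrier V"
    and vs_minus_closed: "u \<in> carrier V \<Longrightarrow> v \<in> carrier V \<Longrightarrow> u \<ominus>\<^bsub>V\<^esub> v \<in> carrier V"
    and vs_smult_closed: "c \<in> carrier K \<Longrightarrow> v \<in> carrier V \<Longrightarrow> c \<odot>\<^bsub>V\<^esub> v \<in> carrier V"
    and vs_add_zero: "v \<in> carrier V \<Longrightarrow> v \<oplus>\<^bsub>V\<^esub> \<zero>\<^bsub>V\<^esub> = v"
    and vs_zero_add: "v \<in> carrier V \<Longrightarrow> \<zero>\<^bsub>V\<^esub> \<oplus>\<^bsub>V\<^esub> v = v"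
    and vs_minus_self: "v \<in> carrier V \<Longrightarrow> v \<ominus>\<^bsub>V\<^esub> v = \<zero>\<^bsub>V\<^esub>"
    and vs_minus_zero_iff: "u \<in> carrier V \<Longrightarrow> v \<in> carrier V \<Longrightarrow> u \<ominus>\<^bsub>V\<^esub> v = \<zero>\<^bsub>V\<^esub> \<longleftrightarrow> u = v"
    and vs_minus_add: "u \<in> carrier V \<Longrightarrow> v \<in> carrier V \<Longrightarrow> (u \<ominus>\<^bsub>V\<^esub> v) \<oplus>\<^bsub>V\<^esub> v = u"
    and vs_add_comm: "u \<in> carrier V \<Longrightarrow> v \<in> carrier V \<Longrightarrow> u \<oplus>\<^bsub>V\<^esub> v = v \<oplus>\<^bsub>V\<^esub> u"
    and vs_smult_zero: "c \<in> carrier K \<Longrightarrow> c \<odot>\<^bsub>V\<^esub> \<zero>\<^bsub>V\<^esub> = \<zero>\<^bsub>V\<^esub>"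
    and vs_finsum_closed: "w \<in> S \<rightarrow> carrier V \<Longrightarrow> (\<Oplus>\<^bsub>V\<^esub>s\<in>S. w s) \<in> carrier V"
    and vs_field: "field K" and vs_abelian_monoid: "abelian_monoid V"
proof -
  interpret vectorspace K V by fact
  show "\<zero>\<^bsub>V\<^esub> \<in> carrier V" by simp
  show "u \<in> carrier V \<Longrightarrow> v \<in> carrier V \<Longrightarrow> u \<oplus>\<^bsub>V\<^esub> v \<in> carrier V" by simp
  show "u \<in> carrier V \<Longrightarrow> v \<in> carrier V \<Longrightarrow> u \<ominus>\<^bsub>V\<^esub> v \<in> carrier V" by simp
  show "c \<in> carrier K \<Longrightarrow> v \<in> carrier V \<Longrightarrow> c \<odot>\<^bsub>V\<^esub> v \<in> carrier V" by simp
  show "v \<in> carrier V \<Longrightarrow> v \<oplus>\<^bsub>V\<^esub> \<zero>\<^bsub>V\<^esub> = v" by simp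
  show "v \<in> carrier V \<Longrightarrow> \<zero>\<^bsub>V\<^esub> \<oplus>\<^bsub>V\<^esub> v = v" by simp
  show "v \<in> carrier V \<Longrightarrow> v \<ominus>\<^bsub>V\<^esub> v = \<zero>\<^bsub>V\<^esub>" by simp
  show "u \<in> carrier V \<Longrightarrow> v \<in> carrier V \<Longrightarrow> u \<ominus>\<^bsub>V\<^esub> v = \<zero>\<^bsub>V\<^esub> \<longleftrightarrow> u = v"
    by simp
  show "u \<in> carrier V \<Longrightarrow> v \<in> carrier V \<Longrightarrow> (u \<ominus>\<^bsub>V\<^esub> v) \<oplus>\<^bsub>V\<^esub> v = u"
    by (simp add: a_minus_def M.a_assoc M.l_neg)
  show "u \<in> carrier V \<Longrightarrow> v \<in> carrier V \<Longrightarrow> u \<oplus>\<^bsub>V\<^esub> v = v \<oplus>\<^bsub>V\<^esub> u" by (rule M.a_comm)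
  show "c \<in> carrier K \<Longrightarrow> c \<odot>\<^bsub>V\<^esub> \<zero>\<^bsub>V\<^esub> = \<zero>\<^bsub>V\<^esub>" by simp
  show "w \<in> S \<rightarrow> carrier V \<Longrightarrow> (\<Oplus>\<^bsub>V\<^esub>s\<in>S. w s) \<in> carrier V" by (rule M.finsum_closed)
  show "field K" "abelian_monoid V" by unfold_locales
qed

lemma linear_mapI:
  assumes "vectorspace K V" and "vectorspace K W"
    and "\<And>v. v \<in> carrier V \<Longrightarrow> h v \<in> carrier W"
    and "\<And>u v. u \<in> carrier V \<Longrightarrow> v \<in> carrier V \<Longrightarrow> h (u \<oplus>\<^bsub>V\<^esub> v) = h u \<oplus>\<^bsub>W\<^esub> h v"
    and "\<And>c v. c \<in> carrier K \<Longrightarrow> v \<in> carrier V \<Longrightarrow> h (c \<odot>\<^bsub>V\<^esub> v) = c \<odot>\<^bsub>W\<^esub> h v"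
  shows "linear_map K V W h"
  using assms unfolding linear_map_def mod_hom_def mod_hom_axioms_def LinearCombinations.module_hom_def vectorspace_def
  by auto

lemma linear_mapD:
  assumes "linear_map K V W h"
  shows linear_map_source: "vectorspace K V" and linear_map_target: "vectorspace K W"
    and linear_map_closed: "v \<in> carrier V \<Longrightarrow> h v \<in> carrier W"
    and linear_map_add: "u \<in> carrier V \<Longrightarrow> v \<in> carrier V \<Longrightarrow> h (u \<oplus>\<^bsub>V\<^esub> v) = h u \<oplus>\<^bsub>W\<^esub> h v"
    and linear_map_smult: "c \<in> carrier K \<Longrightarrow> v \<in> carrier V \<Longrightarrow> h (c \<odot>\<^bsub>V\<^esub> v) = c \<odot>\<^bsub>W\<^esub> h v"
    and linear_map_zero: "h \<zero>\<^bsub>V\<^esub> = \<zero>\<^bsub>W\<^esub>"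
    and linear_map_minus: "u \<in> carrier V \<Longrightarrow> v \<in> carrier V \<Longrightarrow> h (u \<ominus>\<^bsub>V\<^esub> v) = h u \<ominus>\<^bsub>W\<^esub> h v"
proof -
  interpret linear_map K V W h by fact
  show "vectorspace K V" "vectorspace K W" by unfold_locales
  show "v \<in> carrier V \<Longrightarrow> h v \<in> carrier W" by auto
  show "u \<in> carrier V \<Longrightarrow> v \<in> carrier V \<Longrightarrow> h (u \<oplus>\<^bsub>V\<^esub> v) = h u \<oplus>\<^bsub>W\<^esub> h v" by auto
  show "c \<in> carrier K \<Longrightarrow> v \<in> carrier V \<Longrightarrow> h (c \<odot>\<^bsub>V\<^esub> v) = c \<odot>\<^bsub>W\<^esub> h v" by auto
  show "h \<zero>\<^bsub>V\<^esub> = \<zero>\<^bsub>W\<^esub>" by simp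
  show "u \<in> carrier V \<Longrightarrow> v \<in> carrier V \<Longrightarrow> h (u \<ominus>\<^bsub>V\<^esub> v) = h u \<ominus>\<^bsub>W\<^esub> h v" by auto
qed

lemma linear_map_compose:
  assumes "linear_map K U V h" and "linear_map K V W g"
  shows "linear_map K U W (\<lambda>v. g (h v))"
  by (rule linear_mapI) (simp_all add: linear_mapD[OF assms(1)] linear_mapD[OF assms(2)])

lemma linear_map_cong:
  assumes "linear_map K V W h" and "\<And>v. v \<in> carrier V \<Longrightarrow> h' v = h v"
  shows "linear_map K V W h'"
proof -
  interpret linear_map K V W h by fact
  show ?thesis
    by (rule linear_mapI) (use assms linear_mapD[OF assms(1)] in \<open>auto simp: vectorspaceD[OF linear_map_source[OF assms(1)]]\<close>)
qed

text \<open>Over an infinite \<open>S\<close> both sums are zero by convention, and \<open>h\<close>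
  preserves zero; hence the induction rule with a case for infinite sets.\<close>

lemma linear_map_finsum:
  assumes "linear_map K V W h" and w: "w \<in> S \<rightarrow> carrier V"
  shows "h (\<Oplus>\<^bsub>V\<^esub>s\<in>S. w s) = (\<Oplus>\<^bsub>W\<^esub>s\<in>S. h (w s))"
proof -
  interpret linear_map K V W h by fact
  show ?thesis using w
  proof (induct S rule: infinite_finite_induct)
    case (insert s S)
    then have "w s \<in> carrier V" "w \<in> S \<rightarrow> carrier V" "(\<lambda>s. h (w s)) \<in> S \<rightarrow> carrier W"
      by auto
    with insert show ?case by (simp add: linear_mapD[OF assms(1)])
  qed auto
qed

lemma linear_map_inj_iff:
  assumes "linear_map K V W h"
  shows "inj_on h (carrier V) \<longleftrightarrow> (\<forall>v\<in>carrier V. h v = \<zero>\<^bsub>W\<^esub> \<longrightarrow> v = \<zero>\<^bsub>V\<^esub>)"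
proof
  assume "inj_on h (carrier V)"
  then show "\<forall>v\<in>carrier V. h v = \<zero>\<^bsub>W\<^esub> \<longrightarrow> v = \<zero>\<^bsub>V\<^esub>"
    by (metis assms inj_onD linear_map_source linear_map_zero vs_zero_closed)
next
  assume *: "\<forall>v\<in>carrier V. h v = \<zero>\<^bsub>W\<^esub> \<longrightarrow> v = \<zero>\<^bsub>V\<^esub>"
  show "inj_on h (carrier V)"
  proof (rule inj_onI)
    fix u v assume uv: "u \<in> carrier V" "v \<in> carrier V" "h u = h v"
    then have "h (u \<ominus>\<^bsub>V\<^esub> v) = \<zero>\<^bsub>W\<^esub>"
      by (simp add: linear_mapD[OF assms] vs_minus_self[OF linear_map_target[OF assms]])
    then show "u = v"
      using * uv vs_minus_closed[OF linear_map_source[OF assms]] vs_minus_zero_iff[OF linear_map_source[OF assms]]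
      by blast
  qed
qed

lemma linear_map_inv_into:
  assumes h: "linear_map K V W h" and bij: "bij_betw h (carrier V) (carrier W)"
  shows "linear_map K W V (inv_into (carrier V) h)"
proof -
  have inj: "inj_on h (carrier V)" and im: "h ` carrier V = carrier W"
    using bij by (auto simp: bij_betw_def)
  note D = linear_mapD[OF h]
  let ?g = "inv_into (carrier V) h"
  have g: "\<And>w. w \<in> carrier W \<Longrightarrow> ?g w \<in> carrier V" "\<And>w. w \<in> carrier W \<Longrightarrow> h (?g w) = w"
    using im by (auto intro: inv_into_into f_inv_into_f)
  have eq: "?g w = v" if "v \<in> carrier V" "h v = w" for v w
    using that inj by auto
  show ?thesis
    by (rule linear_mapI) (use g D in \<open>auto intro!: eq simp: vectorspaceD[OF D(1)]\<close>)
qed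

lemma subspaceI:
  assumes "vectorspace K V" and "W \<subseteq> carrier V" and "\<zero>\<^bsub>V\<^esub> \<in> W"
    and "\<And>u v. u \<in> W \<Longrightarrow> v \<in> W \<Longrightarrow> u \<oplus>\<^bsub>V\<^esub> v \<in> W"
    and "\<And>c v. c \<in> carrier K \<Longrightarrow> v \<in> W \<Longrightarrow> c \<odot>\<^bsub>V\<^esub> v \<in> W"
  shows "VectorSpace.subspace K W V"
  using assms unfolding VectorSpace.subspace_def submodule_def vectorspace_def by auto

lemma subspaceD:
  assumes "VectorSpace.subspace K W V"
  shows subspace_ambient: "vectorspace K V" and subspace_subset: "W \<subseteq> carrier V"
    and subspace_zero: "\<zero>\<^bsub>V\<^esub> \<in> W"
    and subspace_add: "u \<in> W \<Longrightarrow> v \<in> W \<Longrightarrow> u \<oplus>\<^bsub>V\<^esub> v \<in> W"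
    and subspace_smult: "c \<in> carrier K \<Longrightarrow> v \<in> W \<Longrightarrow> c \<odot>\<^bsub>V\<^esub> v \<in> W"
    and subspace_vectorspace: "vectorspace K (V\<lparr>carrier := W\<rparr>)"
  using assms vectorspace.subspace_is_vs[OF VectorSpace.subspace.vs[OF assms] assms]
  unfolding VectorSpace.subspace_def submodule_def by auto

lemma subspace_kernel:
  assumes "linear_map K V W h"
  shows "VectorSpace.subspace K {v \<in> carrier V. h v = \<zero>\<^bsub>W\<^esub>} V"
  by (rule subspaceI)
    (auto simp: linear_mapD[OF assms] vectorspaceD[OF linear_map_source[OF assms]]
      vectorspaceD[OF linear_map_target[OF assms]])

lemma subspace_image:
  assumes "linear_map K V W h"
  shows "VectorSpace.subspace K (h ` carrier V) W"
proof (rule subspaceI)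
  note D = linear_mapD[OF assms]
  note DV = vectorspaceD[OF D(1)]
  show "vectorspace K W" "h ` carrier V \<subseteq> carrier W" using D by auto
  show "\<zero>\<^bsub>W\<^esub> \<in> h ` carrier V" using D(6) DV(1) by (metis imageI)
  show "u \<oplus>\<^bsub>W\<^esub> v \<in> h ` carrier V" if "u \<in> h ` carrier V" "v \<in> h ` carrier V" for u v
    using that D(4)[symmetric] DV by auto
  show "c \<odot>\<^bsub>W\<^esub> v \<in> h ` carrier V" if "c \<in> carrier K" "v \<in> h ` carrier V" for c v
    using that D(5)[symmetric] DV by auto
qed

section \<open>Linear functionals, separating families and dual systems\<close>

definition linear_functional :: "('k, 'r) ring_scheme \<Rightarrow> ('k, 'u, 'z) module_scheme \<Rightarrow> ('u \<Rightarrow> 'k) \<Rightarrow> bool"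
  where "linear_functional K V \<xi> \<longleftrightarrow> \<xi> \<in> carrier V \<rightarrow> carrier K \<and>
    (\<forall>u\<in>carrier V. \<forall>v\<in>carrier V. \<xi> (u \<oplus>\<^bsub>V\<^esub> v) = \<xi> u \<oplus>\<^bsub>K\<^esub> \<xi> v) \<and>
    (\<forall>c\<in>carrier K. \<forall>v\<in>carrier V. \<xi> (c \<odot>\<^bsub>V\<^esub> v) = c \<otimes>\<^bsub>K\<^esub> \<xi> v)"

lemma linear_functionalD:
  assumes "linear_functional K V \<xi>"
  shows linear_functional_closed: "v \<in> carrier V \<Longrightarrow> \<xi> v \<in> carrier K"
    and linear_functional_add: "u \<in> carrier V \<Longrightarrow> v \<in> carrier V \<Longrightarrow> \<xi> (u \<oplus>\<^bsub>V\<^esub> v) = \<xi> u \<oplus>\<^bsub>K\<^esub> \<xi> v"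
    and linear_functional_smult: "c \<in> carrier K \<Longrightarrow> v \<in> carrier V \<Longrightarrow> \<xi> (c \<odot>\<^bsub>V\<^esub> v) = c \<otimes>\<^bsub>K\<^esub> \<xi> v"
  using assms unfolding linear_functional_def by auto

lemma linear_functional_zero:
  assumes "vectorspace K V" and "linear_functional K V \<xi>"
  shows "\<xi> \<zero>\<^bsub>V\<^esub> = \<zero>\<^bsub>K\<^esub>"
proof -
  interpret vectorspace K V by fact
  have "\<xi> (\<zero>\<^bsub>K\<^esub> \<odot>\<^bsub>V\<^esub> \<zero>\<^bsub>V\<^esub>) = \<zero>\<^bsub>K\<^esub> \<otimes>\<^bsub>K\<^esub> \<xi> \<zero>\<^bsub>V\<^esub>"
    by (rule linear_functional_smult[OF assms(2)]) auto
  then show ?thesis using linear_functional_closed[OF assms(2)] by simp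
qed

lemma linear_functional_minus:
  assumes "vectorspace K V" and "linear_functional K V \<xi>" and "u \<in> carrier V" "v \<in> carrier V"
  shows "\<xi> (u \<ominus>\<^bsub>V\<^esub> v) = \<xi> u \<ominus>\<^bsub>K\<^esub> \<xi> v"
proof -
  interpret vectorspace K V by fact
  have c: "\<xi> u \<in> carrier K" "\<xi> v \<in> carrier K"
    using assms by (auto simp: linear_functional_closed)
  have "u \<ominus>\<^bsub>V\<^esub> v = u \<oplus>\<^bsub>V\<^esub> (\<ominus>\<^bsub>K\<^esub> \<one>\<^bsub>K\<^esub>) \<odot>\<^bsub>V\<^esub> v"
    using assms by (simp add: smult_minus_1 a_minus_def)
  then have "\<xi> (u \<ominus>\<^bsub>V\<^esub> v) = \<xi> u \<oplus>\<^bsub>K\<^esub> (\<ominus>\<^bsub>K\<^esub> \<one>\<^bsub>K\<^esub>) \<otimes>\<^bsub>K\<^esub> \<xi> v"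
    using assms by (simp add: linear_functionalD)
  then show ?thesis using c by (simp add: R.l_minus a_minus_def)
qed

lemma linear_functional_finsum:
  assumes "vectorspace K V" and "linear_functional K V \<xi>" and "w \<in> S \<rightarrow> carrier V"
  shows "\<xi> (\<Oplus>\<^bsub>V\<^esub>s\<in>S. w s) = (\<Oplus>\<^bsub>K\<^esub>s\<in>S. \<xi> (w s))"
proof -
  interpret vectorspace K V by fact
  show ?thesis using assms(3)
  proof (induct S rule: infinite_finite_induct)
    case (insert s S)
    then have "w s \<in> carrier V" "w \<in> S \<rightarrow> carrier V" "(\<lambda>s. \<xi> (w s)) \<in> S \<rightarrow> carrier K"
      using linear_functional_closed[OF assms(2)] by (auto simp: Pi_iff)
    with insert show ?case using assms(2) by (simp add: linear_functionalD)
  qed (auto simp: linear_functional_zero[OF assms(1,2)])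
qed

lemma linear_functional_compose:
  assumes "linear_map K V W h" and "linear_functional K W \<xi>"
  shows "linear_functional K V (\<lambda>v. \<xi> (h v))"
  unfolding linear_functional_def
  by (auto simp: linear_mapD[OF assms(1)] linear_functionalD[OF assms(2)])

text \<open>A finite separating family replaces a basis as witness of finite dimension. Unlike a
  spanning set it restricts to subspaces and pulls back along injective maps without further
  choices.\<close>

definition separating ::
  "('k, 'r) ring_scheme \<Rightarrow> ('k, 'u, 'z) module_scheme \<Rightarrow> 'u set \<Rightarrow> 't set \<Rightarrow> ('t \<Rightarrow> 'u \<Rightarrow> 'k) \<Rightarrow> bool"
  where "separating K V W T \<xi> \<longleftrightarrow> finite T \<and> (\<forall>t\<in>T. linear_functional K V (\<xi> t)) \<and>
    (\<forall>v\<in>W. (\<forall>t\<in>T. \<xi> t v = \<zero>\<^bsub>K\<^esub>) \<longrightarrow> v = \<zero>\<^bsub>V\<^esub>)"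

text \<open>A biorthogonal family. If the functionals also separate the points of the subspace
  \<open>W\<close>, the vectors \<open>w t\<close> form a basis of \<open>W\<close> whose
  coordinates are the \<open>\<xi> t\<close>.\<close>

definition dual_family :: "('k, 'r) ring_scheme \<Rightarrow> 'u set \<Rightarrow> 't set \<Rightarrow> ('t \<Rightarrow> 'u \<Rightarrow> 'k) \<Rightarrow> ('t \<Rightarrow> 'u) \<Rightarrow> bool"
  where "dual_family K W T \<xi> w \<longleftrightarrow> (\<forall>t\<in>T. w t \<in> W) \<and>
    (\<forall>s\<in>T. \<forall>t\<in>T. \<xi> s (w t) = (if s = t then \<one>\<^bsub>K\<^esub> else \<zero>\<^bsub>K\<^esub>))"

lemma separatingD:
  assumes "separating K V W T \<xi>"
  shows separating_finite: "finite T"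
    and separating_functional: "t \<in> T \<Longrightarrow> linear_functional K V (\<xi> t)"
    and separating_eq_zero: "v \<in> W \<Longrightarrow> (\<And>t. t \<in> T \<Longrightarrow> \<xi> t v = \<zero>\<^bsub>K\<^esub>) \<Longrightarrow> v = \<zero>\<^bsub>V\<^esub>"
  using assms unfolding separating_def by blast+

lemma dual_familyD:
  assumes "dual_family K W T \<xi> w"
  shows dual_family_in: "t \<in> T \<Longrightarrow> w t \<in> W"
    and dual_family_eq: "s \<in> T \<Longrightarrow> t \<in> T \<Longrightarrow> \<xi> s (w t) = (if s = t then \<one>\<^bsub>K\<^esub> else \<zero>\<^bsub>K\<^esub>)"
  using assms unfolding dual_family_def by blast+

text \<open>A minimal subfamily that still separates the points of \<open>W\<close> does it.\<close>

lemma dual_system: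
  assumes sub: "VectorSpace.subspace K W V" and T: "separating K V W T \<xi>"
  shows "\<exists>S w. S \<subseteq> T \<and> separating K V W S \<xi> \<and> dual_family K W S \<xi> w"
proof -
  note fins = separating_finite[OF T] and lfn = separating_functional[OF T]
    and sep = separating_eq_zero[OF T]
  interpret vectorspace K V using sub by (rule subspace_ambient)
  let ?P = "\<lambda>S. S \<subseteq> T \<and> (\<forall>v\<in>W. (\<forall>t\<in>S. \<xi> t v = \<zero>\<^bsub>K\<^esub>) \<longrightarrow> v = \<zero>\<^bsub>V\<^esub>)"
  have "?P T" using sep by auto
  then obtain S where S: "?P S" and min: "\<And>S'. ?P S' \<Longrightarrow> card S \<le> card S'"
    using ex_has_least_nat[of ?P T card] by blast
  have finS: "finite S" using S fins by (blast intro: finite_subset)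
  have "\<exists>u. u \<in> W \<and> (\<forall>s\<in>S. \<xi> s u = (if s = t then \<one>\<^bsub>K\<^esub> else \<zero>\<^bsub>K\<^esub>))" if t: "t \<in> S" for t
  proof -
    \<comment> \<open>By minimality some nonzero \<open>v\<close> in \<open>W\<close> is killed by
      all functionals but \<open>\<xi> t\<close>; dividing by \<open>\<xi> t v\<close> turns it into
      the dual vector.\<close>
    have "card (S - {t}) < card S" using t finS by (meson card_Diff1_less)
    then have "\<not> ?P (S - {t})" using min by (meson not_le)
    then obtain v where v: "v \<in> W" "\<forall>s\<in>S - {t}. \<xi> s v = \<zero>\<^bsub>K\<^esub>" "v \<noteq> \<zero>\<^bsub>V\<^esub>" using S by blast
    then have nz: "\<xi> t v \<noteq> \<zero>\<^bsub>K\<^esub>" using S by blast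
    have vV: "v \<in> carrier V" using v subspace_subset[OF sub] by auto
    have cK: "\<xi> s v \<in> carrier K" if "s \<in> S" for s
      using that S vV linear_functional_closed[OF lfn] by blast
    have inv: "inv\<^bsub>K\<^esub> (\<xi> t v) \<in> carrier K" using cK[OF t] nz by simp
    have "\<xi> s (inv\<^bsub>K\<^esub> (\<xi> t v) \<odot>\<^bsub>V\<^esub> v) = (if s = t then \<one>\<^bsub>K\<^esub> else \<zero>\<^bsub>K\<^esub>)" if s: "s \<in> S" for s
    proof -
      have "\<xi> s (inv\<^bsub>K\<^esub> (\<xi> t v) \<odot>\<^bsub>V\<^esub> v) = inv\<^bsub>K\<^esub> (\<xi> t v) \<otimes>\<^bsub>K\<^esub> \<xi> s v"
        using s S inv vV by (meson lfn linear_functional_smult subsetD)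
      then show ?thesis using v(2) s inv cK[OF t] nz by (auto simp: R.Units_l_inv field_Units)
    qed
    moreover have "inv\<^bsub>K\<^esub> (\<xi> t v) \<odot>\<^bsub>V\<^esub> v \<in> W" using inv v(1) by (rule subspace_smult[OF sub])
    ultimately show ?thesis by blast
  qed
  then obtain w where "\<forall>t\<in>S. w t \<in> W \<and> (\<forall>s\<in>S. \<xi> s (w t) = (if s = t then \<one>\<^bsub>K\<^esub> else \<zero>\<^bsub>K\<^esub>))"
    by metis
  then have "dual_family K W S \<xi> w" unfolding dual_family_def by blast
  moreover have "separating K V W S \<xi>" unfolding separating_def using S finS lfn by blast
  ultimately show ?thesis using S by blast
qed

text \<open>The functionals are the coordinates for a finite basis, indexed by the basis vectors
  themselves. So the index set lives in the element type \<open>'u\<close>, and choices over several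
  spaces can be made uniformly.\<close>

lemma fin_dim_functionals:
  fixes V :: "('k, 'u, 'z) module_scheme"
  assumes "vectorspace K V" and "vectorspace.fin_dim K V"
  shows "\<exists>(T :: 'u set) \<xi>. separating K V (carrier V) T \<xi>"
proof -
  interpret vectorspace K V by fact
  obtain B where B: "finite B" "basis B" using finite_basis_exists assms(2) by blast
  have BV: "B \<subseteq> carrier V" using B(2) by (simp add: basis_def)
  define crd where "crd v = (THE a. a \<in> B \<rightarrow>\<^sub>E carrier K \<and> lincomb a B = v)" for v
  have ex1: "\<exists>!a. a \<in> B \<rightarrow>\<^sub>E carrier K \<and> lincomb a B = v" if "v \<in> carrier V" for v
    using basis_criterion[OF B(1) BV] B(2) that by blast
  have crd: "crd v \<in> B \<rightarrow>\<^sub>E carrier K" "lincomb (crd v) B = v" if "v \<in> carrier V" for v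
    using theI'[OF ex1[OF that]] unfolding crd_def by auto
  \<comment> \<open>Uniqueness of coordinates lets any combination giving \<open>v\<close> be
    recognised as \<open>crd v\<close>; linearity of \<open>crd\<close> thereby follows from
    linearity of \<open>lincomb\<close>.\<close>
  have crdI: "crd v = a" if "a \<in> B \<rightarrow>\<^sub>E carrier K" "lincomb a B = v" for a v
  proof -
    have "v \<in> carrier V" using that BV B(1) by (auto intro!: lincomb_closed)
    then show ?thesis unfolding crd_def using that by (intro the1_equality[OF ex1]) auto
  qed
  have cl: "crd v b \<in> carrier K" if "v \<in> carrier V" "b \<in> B" for v b
    using crd(1)[OF that(1)] that(2) by auto
  interpret L: linear_map K "func_space B" V "\<lambda>a. lincomb a B"
    by (rule lincomb_is_linear[OF B(1) BV])
  have "crd (u \<oplus>\<^bsub>V\<^esub> v) = (\<lambda>b\<in>B. crd u b \<oplus>\<^bsub>K\<^esub> crd v b)" if uv: "u \<in> carrier V" "v \<in> carrier V" for u v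
  proof (rule crdI)
    show "(\<lambda>b\<in>B. crd u b \<oplus>\<^bsub>K\<^esub> crd v b) \<in> B \<rightarrow>\<^sub>E carrier K" using cl uv by auto
    show "lincomb (\<lambda>b\<in>B. crd u b \<oplus>\<^bsub>K\<^esub> crd v b) B = u \<oplus>\<^bsub>V\<^esub> v"
      using L.T_add[of "crd u" "crd v"] crd[OF uv(1)] crd[OF uv(2)] by (simp add: func_space_def)
  qed
  moreover have "crd (c \<odot>\<^bsub>V\<^esub> v) = (\<lambda>b\<in>B. c \<otimes>\<^bsub>K\<^esub> crd v b)" if cv: "c \<in> carrier K" "v \<in> carrier V" for c v
  proof (rule crdI)
    show "(\<lambda>b\<in>B. c \<otimes>\<^bsub>K\<^esub> crd v b) \<in> B \<rightarrow>\<^sub>E carrier K" using cl cv by auto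
    show "lincomb (\<lambda>b\<in>B. c \<otimes>\<^bsub>K\<^esub> crd v b) B = c \<odot>\<^bsub>V\<^esub> v"
      using L.T_smult[of c "crd v"] crd[OF cv(2)] cv(1) by (simp add: func_space_def)
  qed
  ultimately have lfn: "linear_functional K V (\<lambda>v. crd v b)" if "b \<in> B" for b
    unfolding linear_functional_def using that cl by (simp add: Pi_iff)
  have "v = \<zero>\<^bsub>V\<^esub>" if v: "v \<in> carrier V" and 0: "\<forall>t\<in>B. crd v t = \<zero>\<^bsub>K\<^esub>" for v
  proof -
    have "lincomb (crd v) B = (\<Oplus>\<^bsub>V\<^esub>b\<in>B. \<zero>\<^bsub>V\<^esub>)"
      unfolding lincomb_def by (rule M.finsum_cong') (use 0 BV in auto)
    then show ?thesis using crd(2)[OF v] by simp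
  qed
  then have "separating K V (carrier V) B (\<lambda>b v. crd v b)"
    unfolding separating_def using B(1) lfn by blast
  then show ?thesis by blast
qed

text \<open>Only the summand at \<open>s\<close> survives the duality relations, so coefficients of
  a combination of dual vectors can be read off.\<close>

lemma dual_system_expansion:
  assumes W: "VectorSpace.subspace K W V" and S: "separating K V W S \<xi>" and w': "dual_family K W S \<xi> w"
    and c: "c \<in> S \<rightarrow> carrier K" and s: "s \<in> S"
  shows "\<xi> s (\<Oplus>\<^bsub>V\<^esub>t\<in>S. c t \<odot>\<^bsub>V\<^esub> w t) = c s"
proof -
  note fins = separating_finite[OF S] and lfn = separating_functional[OF S] and dual = dual_family_eq[OF w']
  have V: "vectorspace K V" using W by (rule subspace_ambient)
  interpret vectorspace K V by fact
  have w: "w t \<in> carrier V" if "t \<in> S" for t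
    using dual_family_in[OF w' that] subspace_subset[OF W] by auto
  have cc: "\<And>t. t \<in> S \<Longrightarrow> c t \<in> carrier K" using c by auto
  have "\<xi> s (\<Oplus>\<^bsub>V\<^esub>t\<in>S. c t \<odot>\<^bsub>V\<^esub> w t) = (\<Oplus>\<^bsub>K\<^esub>t\<in>S. \<xi> s (c t \<odot>\<^bsub>V\<^esub> w t))"
    by (rule linear_functional_finsum[OF V lfn[OF s]]) (use w cc in auto)
  also have "\<dots> = (\<Oplus>\<^bsub>K\<^esub>t\<in>S. if s = t then c t else \<zero>\<^bsub>K\<^esub>)"
    by (rule R.finsum_cong') (use cc s w dual in \<open>auto simp: linear_functional_smult[OF lfn[OF s]]\<close>)
  also have "\<dots> = c s"
    by (rule R.add.finprod_singleton) (use fins c s in auto)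
  finally show ?thesis .
qed

text \<open>The difference of the two sides lies in \<open>W\<close> and is killed by every
  \<open>\<xi> t\<close>, so separation makes it zero.\<close>

lemma separating_expansion:
  assumes W: "VectorSpace.subspace K W V" and S: "separating K V W S \<xi>" and w': "dual_family K W S \<xi> w"
    and v: "v \<in> W"
  shows "v = (\<Oplus>\<^bsub>V\<^esub>t\<in>S. \<xi> t v \<odot>\<^bsub>V\<^esub> w t)"
proof -
  note fins = separating_finite[OF S] and lfn = separating_functional[OF S]
    and w = dual_family_in[OF w'] and sep = separating_eq_zero[OF S]
  have V: "vectorspace K V" using W by (rule subspace_ambient)
  interpret vectorspace K V by fact
  interpret W: vectorspace K "V\<lparr>carrier := W\<rparr>" using W by (rule subspace_vectorspace)
  have wV: "w t \<in> carrier V" if "t \<in> S" for t using w[OF that] subspace_subset[OF W] by auto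
  have vV: "v \<in> carrier V" using v subspace_subset[OF W] by auto
  let ?s = "\<Oplus>\<^bsub>V\<^esub>t\<in>S. \<xi> t v \<odot>\<^bsub>V\<^esub> w t"
  have c: "(\<lambda>t. \<xi> t v) \<in> S \<rightarrow> carrier K" using vV by (auto simp: linear_functional_closed[OF lfn])
  have "(\<Oplus>\<^bsub>V\<^esub>t\<in>R. \<xi> t v \<odot>\<^bsub>V\<^esub> w t) \<in> W" if "R \<subseteq> S" for R
    using finite_subset[OF that fins] that
  proof (induct R rule: finite_induct)
    case (insert r R)
    have "\<xi> r v \<odot>\<^bsub>V\<^esub> w r \<in> W" using insert c w subspace_smult[OF W] by auto
    moreover have "(\<lambda>t. \<xi> t v \<odot>\<^bsub>V\<^esub> w t) \<in> R \<rightarrow> carrier V" using insert.prems c wV by auto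
    ultimately show ?case using insert subspace_add[OF W] subspace_subset[OF W] by (auto simp: subset_iff)
  qed (simp add: subspace_zero[OF W])
  then have s: "?s \<in> W" by simp
  then have sV: "?s \<in> carrier V" using subspace_subset[OF W] by auto
  have "\<xi> t (v \<ominus>\<^bsub>V\<^esub> ?s) = \<zero>\<^bsub>K\<^esub>" if "t \<in> S" for t
    using dual_system_expansion[OF W S w' c that] linear_functional_minus[OF V lfn[OF that] vV sV] linear_functional_closed[OF lfn[OF that] vV] by simp
  moreover have "v \<ominus>\<^bsub>V\<^esub> ?s \<in> W"
  proof -
    have "v \<ominus>\<^bsub>V\<^esub> ?s = v \<oplus>\<^bsub>V\<^esub> (\<ominus>\<^bsub>K\<^esub> \<one>\<^bsub>K\<^esub>) \<odot>\<^bsub>V\<^esub> ?s" using vV sV by (simp add: smult_minus_1 a_minus_def)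
    then show ?thesis using v s subspace_add[OF W] subspace_smult[OF W] by auto
  qed
  ultimately have "v \<ominus>\<^bsub>V\<^esub> ?s = \<zero>\<^bsub>V\<^esub>" using sep by blast
  then show ?thesis using vV sV by simp
qed

lemma subspace_carrier: "vectorspace K V \<Longrightarrow> VectorSpace.subspace K (carrier V) V"
  by (rule subspaceI) (auto simp: vectorspaceD)

text \<open>A subfamily has dual vectors by \<open>dual_system\<close>, and
  \<open>separating_expansion\<close> shows that these span.\<close>

lemma fin_dimI_functionals:
  assumes V: "vectorspace K V" and T: "separating K V (carrier V) T \<xi>"
  shows "vectorspace.fin_dim K V"
proof -
  interpret vectorspace K V by fact
  obtain S w where S': "separating K V (carrier V) S \<xi>" "dual_family K (carrier V) S \<xi> w"
    using dual_system[OF subspace_carrier[OF V] T] by blast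
  note finS = separating_finite[OF S'(1)] and lfn = separating_functional[OF S'(1)]
    and w = dual_family_in[OF S'(2)] and dual = dual_family_eq[OF S'(2)]
  \<comment> \<open>\<open>lincomb\<close> sums over a set of vectors, so the expansion indexed by
    \<open>S\<close> has to be reindexed by the image of \<open>S\<close> under
    \<open>w\<close>.\<close>
  have inj: "inj_on w S"
  proof (rule inj_onI)
    fix s t assume "s \<in> S" "t \<in> S" "w s = w t"
    then have "(if s = t then \<one>\<^bsub>K\<^esub> else \<zero>\<^bsub>K\<^esub>) = \<one>\<^bsub>K\<^esub>" using dual[of s s] dual[of s t] by simp
    then show "s = t" by (simp split: if_splits)
  qed
  have "v \<in> span (w ` S)" if v: "v \<in> carrier V" for v
  proof -
    have c: "\<And>t. t \<in> S \<Longrightarrow> \<xi> t v \<in> carrier K" using v by (auto simp: linear_functional_closed[OF lfn])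
    have "v = (\<Oplus>\<^bsub>V\<^esub>t\<in>S. \<xi> t v \<odot>\<^bsub>V\<^esub> w t)"
      using separating_expansion[OF subspace_carrier[OF V] S' v] .
    also have "\<dots> = lincomb (\<lambda>u. \<xi> (inv_into S w u) v) (w ` S)"
      unfolding lincomb_def using c w inj
      by (subst M.add.finprod_reindex) (auto intro!: M.finsum_cong')
    also have "\<dots> \<in> span (w ` S)"
    proof -
      have "(\<lambda>u. \<xi> (inv_into S w u) v) \<in> w ` S \<rightarrow> carrier K" using c inj by auto
      then show ?thesis unfolding span_def using finS by blast
    qed
    finally show ?thesis .
  qed
  moreover have "span (w ` S) \<subseteq> carrier V"
    using w by (intro span_is_subset2) blast
  ultimately have "span (w ` S) = carrier V" by auto
  then show ?thesis unfolding fin_dim_def using finS w by (intro exI[of _ "w ` S"]) auto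
qed

text \<open>A separating family of \<open>W\<close> stays separating after composition with an
  injective \<open>h\<close>.\<close>

lemma fin_dim_inj:
  fixes W :: "('k, 'w, 'z) module_scheme"
  assumes h: "linear_map K V W h" and "inj_on h (carrier V)" and W: "vectorspace.fin_dim K W"
  shows "vectorspace.fin_dim K V"
proof -
  obtain T :: "'w set" and \<xi> where T: "separating K W (carrier W) T \<xi>"
    using fin_dim_functionals[OF linear_map_target[OF h] W] by blast
  have "v = \<zero>\<^bsub>V\<^esub>" if "v \<in> carrier V" "\<forall>t\<in>T. \<xi> t (h v) = \<zero>\<^bsub>K\<^esub>" for v
    using separating_eq_zero[OF T linear_map_closed[OF h that(1)]] that assms(2) linear_map_inj_iff[OF h]
    by blast
  then have "separating K V (carrier V) T (\<lambda>t v. \<xi> t (h v))"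
    unfolding separating_def
    using separating_finite[OF T] linear_functional_compose[OF h separating_functional[OF T]] by blast
  then show ?thesis by (rule fin_dimI_functionals[OF linear_map_source[OF h]])
qed

lemma linear_map_subspace_inclusion:
  assumes "VectorSpace.subspace K W V"
  shows "linear_map K (V\<lparr>carrier := W\<rparr>) V (\<lambda>v. v)"
  by (rule linear_mapI) (use subspaceD[OF assms] in auto)

definition projection_along ::
  "('k, 'r) ring_scheme \<Rightarrow> ('k, 'u, 'z) module_scheme \<Rightarrow> 'u set \<Rightarrow> 'u set \<Rightarrow> ('u \<Rightarrow> 'u) \<Rightarrow> bool"
  where "projection_along K V W C \<pi> \<longleftrightarrow> VectorSpace.subspace K C V \<and>
    linear_map K V (V\<lparr>carrier := C\<rparr>) \<pi> \<and> \<pi> ` carrier V = C \<and>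
    {v \<in> carrier V. \<pi> v = \<zero>\<^bsub>V\<^esub>} = W \<and> (\<forall>v\<in>C. \<pi> v = v)"

text \<open>The quotient by \<open>W\<close> is modelled by a complement, so that it stays in the same type.\<close>

lemma complement_projection:
  fixes V :: "('k, 'u, 'z) module_scheme"
  assumes W: "VectorSpace.subspace K W V" and fd: "vectorspace.fin_dim K V"
  shows "\<exists>C \<pi>. projection_along K V W C \<pi>"
proof -
  have V: "vectorspace K V" using W by (rule subspace_ambient)
  interpret vectorspace K V by fact
  obtain T :: "'u set" and \<xi> where T: "separating K V (carrier V) T \<xi>"
    using fin_dim_functionals[OF V fd] by blast
  then have "separating K V W T \<xi>" using subspace_subset[OF W] unfolding separating_def by blast
  then obtain S w where S: "separating K V W S \<xi>" and w: "dual_family K W S \<xi> w"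
    using dual_system[OF W] by blast
  note fins = separating_finite[OF S] and lfn = separating_functional[OF S]
    and wW = dual_family_in[OF w]
  have wV: "w t \<in> carrier V" if "t \<in> S" for t using wW[OF that] subspace_subset[OF W] by auto
  have cl: "\<xi> t v \<in> carrier K" if "t \<in> S" "v \<in> carrier V" for t v
    using that by (auto simp: linear_functional_closed[OF lfn])
  \<comment> \<open>\<open>\<sigma>\<close> is the projection onto \<open>W\<close> given by the
    dual system, \<open>\<pi>\<close> the complementary projection, and \<open>C\<close> the common
    zero set of the functionals, which is both the kernel of \<open>\<sigma>\<close> and the image
    of \<open>\<pi>\<close>.\<close>
  define \<sigma> where "\<sigma> v = (\<Oplus>\<^bsub>V\<^esub>t\<in>S. \<xi> t v \<odot>\<^bsub>V\<^esub> w t)" for v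
  define \<pi> where "\<pi> v = v \<ominus>\<^bsub>V\<^esub> \<sigma> v" for v
  define C where "C = {v \<in> carrier V. \<forall>t\<in>S. \<xi> t v = \<zero>\<^bsub>K\<^esub>}"
  have \<sigma>V: "\<sigma> v \<in> carrier V" if "v \<in> carrier V" for v
    unfolding \<sigma>_def using cl wV that by (intro M.finsum_closed) auto
  have \<pi>V: "\<pi> v \<in> carrier V" if "v \<in> carrier V" for v
    unfolding \<pi>_def using \<sigma>V that by simp
  have \<xi>\<sigma>: "\<xi> t (\<sigma> v) = \<xi> t v" if "t \<in> S" "v \<in> carrier V" for t v
    unfolding \<sigma>_def using dual_system_expansion[OF W S w _ that(1), of "\<lambda>t. \<xi> t v"] cl that(2) by blast
  have \<pi>C: "\<pi> v \<in> C" if "v \<in> carrier V" for v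
  proof -
    have "\<xi> t (\<pi> v) = \<zero>\<^bsub>K\<^esub>" if "t \<in> S" for t
      using linear_functional_minus[OF V lfn[OF that] \<open>v \<in> carrier V\<close> \<sigma>V[OF \<open>v \<in> carrier V\<close>]]
        \<xi>\<sigma>[OF that \<open>v \<in> carrier V\<close>] cl[OF that \<open>v \<in> carrier V\<close>] by (simp add: \<pi>_def)
    then show ?thesis using \<pi>V[OF that] by (simp add: C_def)
  qed
  have \<sigma>0: "\<sigma> v = \<zero>\<^bsub>V\<^esub>" if "v \<in> C" for v
  proof -
    have "\<sigma> v = (\<Oplus>\<^bsub>V\<^esub>t\<in>S. \<zero>\<^bsub>V\<^esub>)" unfolding \<sigma>_def
      by (rule M.finsum_cong') (use that wV in \<open>auto simp: C_def\<close>)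
    then show ?thesis by simp
  qed
  have CV: "C \<subseteq> carrier V" by (auto simp: C_def)
  have id: "\<pi> v = v" if "v \<in> C" for v using \<sigma>0[OF that] that CV by (auto simp: \<pi>_def a_minus_def)
  have C: "VectorSpace.subspace K C V"
    unfolding C_def
    by (rule subspaceI[OF V]) (auto simp: linear_functional_zero[OF V lfn]
        linear_functional_add[OF lfn] linear_functional_smult[OF lfn])
  have "\<sigma> (u \<oplus>\<^bsub>V\<^esub> v) = \<sigma> u \<oplus>\<^bsub>V\<^esub> \<sigma> v" if uv: "u \<in> carrier V" "v \<in> carrier V" for u v
  proof -
    have "\<sigma> (u \<oplus>\<^bsub>V\<^esub> v) = (\<Oplus>\<^bsub>V\<^esub>t\<in>S. \<xi> t u \<odot>\<^bsub>V\<^esub> w t \<oplus>\<^bsub>V\<^esub> \<xi> t v \<odot>\<^bsub>V\<^esub> w t)" unfolding \<sigma>_def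
      by (rule M.finsum_cong') (use uv cl wV in \<open>auto simp: linear_functional_add[OF lfn] smult_l_distr\<close>)
    also have "\<dots> = \<sigma> u \<oplus>\<^bsub>V\<^esub> \<sigma> v" unfolding \<sigma>_def
      by (rule M.finsum_addf) (use uv cl wV in auto)
    finally show ?thesis .
  qed
  note \<sigma>add = this
  have \<pi>add: "\<pi> (u \<oplus>\<^bsub>V\<^esub> v) = \<pi> u \<oplus>\<^bsub>V\<^esub> \<pi> v" if uv: "u \<in> carrier V" "v \<in> carrier V" for u v
    using uv \<sigma>V[OF uv(1)] \<sigma>V[OF uv(2)]
    by (simp add: \<pi>_def a_minus_def M.minus_add \<sigma>add M.a_assoc) (simp add: M.a_lcomm)
  have "\<sigma> (c \<odot>\<^bsub>V\<^esub> v) = c \<odot>\<^bsub>V\<^esub> \<sigma> v" if cv: "c \<in> carrier K" "v \<in> carrier V" for c v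
  proof -
    have "\<sigma> (c \<odot>\<^bsub>V\<^esub> v) = (\<Oplus>\<^bsub>V\<^esub>t\<in>S. c \<odot>\<^bsub>V\<^esub> (\<xi> t v \<odot>\<^bsub>V\<^esub> w t))" unfolding \<sigma>_def
      by (rule M.finsum_cong') (use cv cl wV in \<open>auto simp: linear_functional_smult[OF lfn] smult_assoc1\<close>)
    also have "\<dots> = c \<odot>\<^bsub>V\<^esub> \<sigma> v" unfolding \<sigma>_def
      by (rule finsum_smult[symmetric]) (use cv cl wV in auto)
    finally show ?thesis .
  qed
  note \<sigma>smult = this
  have \<pi>smult: "\<pi> (c \<odot>\<^bsub>V\<^esub> v) = c \<odot>\<^bsub>V\<^esub> \<pi> v" if cv: "c \<in> carrier K" "v \<in> carrier V" for c v
  proof -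
    have "c \<odot>\<^bsub>V\<^esub> (\<ominus>\<^bsub>V\<^esub> \<sigma> v) = \<ominus>\<^bsub>V\<^esub> (c \<odot>\<^bsub>V\<^esub> \<sigma> v)"
      using cv \<sigma>V[OF cv(2)] by (simp add: R.m_comm flip: smult_minus_1 smult_assoc1)
    then show ?thesis using cv \<sigma>V[OF cv(2)] \<sigma>smult[OF cv]
      by (simp add: \<pi>_def a_minus_def smult_r_distr)
  qed
  have lin: "linear_map K V (V\<lparr>carrier := C\<rparr>) \<pi>"
    by (rule linear_mapI[OF V subspace_vectorspace[OF C]]) (use \<pi>C \<pi>add \<pi>smult in auto)
  have im: "\<pi> ` carrier V = C"
  proof
    show "\<pi> ` carrier V \<subseteq> C" using \<pi>C by auto
    show "C \<subseteq> \<pi> ` carrier V" using id CV by force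
  qed
  have "\<pi> v = \<zero>\<^bsub>V\<^esub> \<longleftrightarrow> v \<in> W" if v: "v \<in> carrier V" for v
  proof
    assume "\<pi> v = \<zero>\<^bsub>V\<^esub>"
    then have "v = \<sigma> v" using v \<sigma>V by (simp add: \<pi>_def)
    moreover have "(\<Oplus>\<^bsub>V\<^esub>t\<in>R. \<xi> t v \<odot>\<^bsub>V\<^esub> w t) \<in> W" if "R \<subseteq> S" for R
      using finite_subset[OF that fins] that
    proof (induct R rule: finite_induct)
      case (insert r R)
      have "\<xi> r v \<odot>\<^bsub>V\<^esub> w r \<in> W" using insert cl[OF _ v] wW subspace_smult[OF W] by auto
      moreover have "(\<lambda>t. \<xi> t v \<odot>\<^bsub>V\<^esub> w t) \<in> R \<rightarrow> carrier V" using insert.prems cl[OF _ v] wV by auto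
      ultimately show ?case using insert subspace_add[OF W] subspace_subset[OF W] by (auto simp: subset_iff)
    qed (simp add: subspace_zero[OF W])
    ultimately show "v \<in> W" unfolding \<sigma>_def by (metis order_refl)
  next
    assume "v \<in> W"
    then have "v = \<sigma> v" unfolding \<sigma>_def using separating_expansion[OF W S w] by blast
    then show "\<pi> v = \<zero>\<^bsub>V\<^esub>" using v by (simp add: \<pi>_def)
  qed
  then have ker: "{v \<in> carrier V. \<pi> v = \<zero>\<^bsub>V\<^esub>} = W" using subspace_subset[OF W] by blast
  have "projection_along K V W C \<pi>"
    unfolding projection_along_def using C lin im ker id by blast
  then show ?thesis by blast
qed

text \<open>The \<open>u t\<close> are to form a basis of a complement of \<open>W\<close>, the
  complement itself staying unnamed: the last two clauses are spanning and independence modulo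
  \<open>W\<close>.\<close>

definition complement_basis ::
  "('k, 'r) ring_scheme \<Rightarrow> ('k, 'u, 'z) module_scheme \<Rightarrow> 'u set \<Rightarrow> 't set \<Rightarrow> ('t \<Rightarrow> 'u) \<Rightarrow> bool"
  where "complement_basis K V W T u \<longleftrightarrow> finite T \<and> (\<forall>t\<in>T. u t \<in> carrier V) \<and>
    (\<forall>v\<in>carrier V. \<exists>c\<in>T \<rightarrow> carrier K. \<exists>w\<in>W. v = (\<Oplus>\<^bsub>V\<^esub>t\<in>T. c t \<odot>\<^bsub>V\<^esub> u t) \<oplus>\<^bsub>V\<^esub> w) \<and>
    (\<forall>c\<in>T \<rightarrow> carrier K. \<forall>w\<in>W. (\<Oplus>\<^bsub>V\<^esub>t\<in>T. c t \<odot>\<^bsub>V\<^esub> u t) \<oplus>\<^bsub>V\<^esub> w = \<zero>\<^bsub>V\<^esub> \<longrightarrow>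
      (\<forall>t\<in>T. c t = \<zero>\<^bsub>K\<^esub>) \<and> w = \<zero>\<^bsub>V\<^esub>)"

text \<open>The dual vectors of a separating family on the complement from
  \<open>complement_projection\<close> serve as basis. The \<open>W\<close>-part of \<open>v\<close>
  is \<open>v\<close> minus its projection, and applying \<open>\<pi>\<close> to a relation removes
  its \<open>W\<close>-part.\<close>

lemma complement_basis_exists:
  fixes V :: "('k, 'u, 'z) module_scheme"
  assumes W: "VectorSpace.subspace K W V" and fd: "vectorspace.fin_dim K V"
  shows "\<exists>(T :: 'u set) u. complement_basis K V W T u"
proof -
  have V: "vectorspace K V" using W by (rule subspace_ambient)
  interpret vectorspace K V by fact
  obtain C \<pi> where P: "projection_along K V W C \<pi>"
    using complement_projection[OF W fd] by blast
  have C: "VectorSpace.subspace K C V" and lin: "linear_map K V (V\<lparr>carrier := C\<rparr>) \<pi>"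
    and im: "\<pi> ` carrier V = C" and ker: "{v \<in> carrier V. \<pi> v = \<zero>\<^bsub>V\<^esub>} = W"
    and id: "\<And>v. v \<in> C \<Longrightarrow> \<pi> v = v"
    using P unfolding projection_along_def by blast+
  note D = linear_mapD[OF lin, simplified]
  obtain T :: "'u set" and \<xi> where T: "separating K V (carrier V) T \<xi>"
    using fin_dim_functionals[OF V fd] by blast
  then have "separating K V C T \<xi>" using subspace_subset[OF C] unfolding separating_def by blast
  then obtain S u where S: "separating K V C S \<xi>" and u: "dual_family K C S \<xi> u"
    using dual_system[OF C] by blast
  have uC: "u t \<in> C" if "t \<in> S" for t using dual_family_in[OF u that] .
  have uV: "u t \<in> carrier V" if "t \<in> S" for t using uC[OF that] subspace_subset[OF C] by auto
  have CV: "v \<in> carrier V" if "v \<in> C" for v using that subspace_subset[OF C] by auto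
  have sumC: "\<pi> (\<Oplus>\<^bsub>V\<^esub>t\<in>S. c t \<odot>\<^bsub>V\<^esub> u t) = (\<Oplus>\<^bsub>V\<^esub>t\<in>S. c t \<odot>\<^bsub>V\<^esub> u t)" if c: "c \<in> S \<rightarrow> carrier K" for c
  proof -
    have "(\<Oplus>\<^bsub>V\<^esub>t\<in>R. c t \<odot>\<^bsub>V\<^esub> u t) \<in> C" if "R \<subseteq> S" for R
      using finite_subset[OF that separating_finite[OF S]] that
    proof (induct R rule: finite_induct)
      case (insert r R)
      have "c r \<odot>\<^bsub>V\<^esub> u r \<in> C" using insert c uC subspace_smult[OF C] by auto
      moreover have "(\<lambda>t. c t \<odot>\<^bsub>V\<^esub> u t) \<in> R \<rightarrow> carrier V" using insert.prems c uV by auto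
      ultimately show ?case using insert subspace_add[OF C] CV by auto
    qed (simp add: subspace_zero[OF C])
    then show ?thesis using id by blast
  qed
  have sumV: "(\<Oplus>\<^bsub>V\<^esub>t\<in>S. c t \<odot>\<^bsub>V\<^esub> u t) \<in> carrier V" if "c \<in> S \<rightarrow> carrier K" for c
    using that uV by (intro M.finsum_closed) auto
  have "\<exists>c\<in>S \<rightarrow> carrier K. \<exists>w\<in>W. v = (\<Oplus>\<^bsub>V\<^esub>t\<in>S. c t \<odot>\<^bsub>V\<^esub> u t) \<oplus>\<^bsub>V\<^esub> w" if v: "v \<in> carrier V" for v
  proof -
    have \<pi>v: "\<pi> v \<in> C" using im v by blast
    have c: "(\<lambda>t. \<xi> t (\<pi> v)) \<in> S \<rightarrow> carrier K"
      using linear_functional_closed[OF separating_functional[OF S] CV[OF \<pi>v]] by auto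
    have "\<pi> v = (\<Oplus>\<^bsub>V\<^esub>t\<in>S. \<xi> t (\<pi> v) \<odot>\<^bsub>V\<^esub> u t)"
      using separating_expansion[OF C S u \<pi>v] .
    moreover have "v \<ominus>\<^bsub>V\<^esub> \<pi> v \<in> W"
    proof -
      have "\<pi> (v \<ominus>\<^bsub>V\<^esub> \<pi> v) \<oplus>\<^bsub>V\<^esub> \<pi> (\<pi> v) = \<pi> v"
        using D(4)[of "v \<ominus>\<^bsub>V\<^esub> \<pi> v" "\<pi> v"] v CV[OF \<pi>v] vs_minus_add[OF V] by simp
      then have "\<pi> (v \<ominus>\<^bsub>V\<^esub> \<pi> v) = \<zero>\<^bsub>V\<^esub>"
        using id[OF \<pi>v] CV[OF \<pi>v] CV[OF D(3)[of "v \<ominus>\<^bsub>V\<^esub> \<pi> v"]] v by simp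
      then show ?thesis using ker v CV[OF \<pi>v] by blast
    qed
    moreover have "v = \<pi> v \<oplus>\<^bsub>V\<^esub> (v \<ominus>\<^bsub>V\<^esub> \<pi> v)"
      using vs_minus_add[OF V v CV[OF \<pi>v]] v CV[OF \<pi>v] by (simp add: M.a_comm)
    ultimately have "v = (\<Oplus>\<^bsub>V\<^esub>t\<in>S. \<xi> t (\<pi> v) \<odot>\<^bsub>V\<^esub> u t) \<oplus>\<^bsub>V\<^esub> (v \<ominus>\<^bsub>V\<^esub> \<pi> v)" by simp
    then show ?thesis using \<open>v \<ominus>\<^bsub>V\<^esub> \<pi> v \<in> W\<close> by (intro bexI[OF _ c] bexI)
  qed
  moreover have "(\<forall>t\<in>S. c t = \<zero>\<^bsub>K\<^esub>) \<and> w = \<zero>\<^bsub>V\<^esub>"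
    if c: "c \<in> S \<rightarrow> carrier K" and w: "w \<in> W" and 0: "(\<Oplus>\<^bsub>V\<^esub>t\<in>S. c t \<odot>\<^bsub>V\<^esub> u t) \<oplus>\<^bsub>V\<^esub> w = \<zero>\<^bsub>V\<^esub>" for c w
  proof -
    have wV: "w \<in> carrier V" and \<pi>w: "\<pi> w = \<zero>\<^bsub>V\<^esub>" using w ker by blast+
    have "\<pi> (\<Oplus>\<^bsub>V\<^esub>t\<in>S. c t \<odot>\<^bsub>V\<^esub> u t) \<oplus>\<^bsub>V\<^esub> \<pi> w = \<zero>\<^bsub>V\<^esub>"
      using D(4)[OF sumV[OF c] wV] 0 D(6) by simp
    then have s0: "(\<Oplus>\<^bsub>V\<^esub>t\<in>S. c t \<odot>\<^bsub>V\<^esub> u t) = \<zero>\<^bsub>V\<^esub>"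
      using sumC[OF c] \<pi>w sumV[OF c] by simp
    have "c t = \<zero>\<^bsub>K\<^esub>" if "t \<in> S" for t
      using dual_system_expansion[OF C S u c that] s0 linear_functional_zero[OF V separating_functional[OF S that]]
      by simp
    then show ?thesis using s0 0 wV by simp
  qed
  ultimately have "complement_basis K V W S u"
    unfolding complement_basis_def using separating_finite[OF S] uV by blast
  then show ?thesis by blast
qed

text \<open>A vector is determined by the list of its values under a finite separating family, and
  \<open>\<iota>\<close> turns this list into an element of \<open>'u\<close>; the operations are
  carried along the resulting bijection.\<close>

lemma transport_space:
  fixes V :: "('k, 'w) module" and \<iota> :: "'k list \<Rightarrow> 'u"
  assumes V: "vectorspace K V" and fd: "vectorspace.fin_dim K V" and \<iota>: "inj_on \<iota> (lists (carrier K))"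
  shows "\<exists>(V' :: ('k, 'u) module) \<phi>. linear_map K V V' \<phi> \<and> bij_betw \<phi> (carrier V) (carrier V')"
proof -
  interpret vectorspace K V by fact
  obtain T :: "'w set" and \<xi> where T: "separating K V (carrier V) T \<xi>"
    using fin_dim_functionals[OF V fd] by blast
  obtain ts where ts: "set ts = T" using finite_list[OF separating_finite[OF T]] by blast
  define \<phi> where "\<phi> v = \<iota> (map (\<lambda>t. \<xi> t v) ts)" for v
  have cl: "\<xi> t v \<in> carrier K" if "t \<in> T" "v \<in> carrier V" for t v
    using linear_functional_closed[OF separating_functional[OF T that(1)] that(2)] .
  have inj: "inj_on \<phi> (carrier V)"
  proof (rule inj_onI)
    fix u v assume uv: "u \<in> carrier V" "v \<in> carrier V" "\<phi> u = \<phi> v"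
    have "map (\<lambda>t. \<xi> t u) ts = map (\<lambda>t. \<xi> t v) ts"
      using uv cl ts by (intro inj_onD[OF \<iota>]) (auto simp: \<phi>_def)
    then have "\<xi> t (u \<ominus>\<^bsub>V\<^esub> v) = \<zero>\<^bsub>K\<^esub>" if "t \<in> T" for t
      using linear_functional_minus[OF V separating_functional[OF T that] uv(1,2)] cl[OF that uv(2)] that ts
      by auto
    then have "u \<ominus>\<^bsub>V\<^esub> v = \<zero>\<^bsub>V\<^esub>" using separating_eq_zero[OF T] uv by simp
    then show "u = v" using uv by simp
  qed
  define \<psi> where "\<psi> = inv_into (carrier V) \<phi>"
  have \<psi>: "\<psi> (\<phi> v) = v" if "v \<in> carrier V" for v unfolding \<psi>_def using inj that by simp
  define V' :: "('k, 'u) module" where "V' = \<lparr>carrier = \<phi> ` carrier V, monoid.mult = undefined, one = undefined,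
    zero = \<phi> \<zero>\<^bsub>V\<^esub>, add = (\<lambda>a b. \<phi> (\<psi> a \<oplus>\<^bsub>V\<^esub> \<psi> b)), smult = (\<lambda>c a. \<phi> (c \<odot>\<^bsub>V\<^esub> \<psi> a))\<rparr>"
  have V': "vectorspace K V'"
  proof (rule vs_criteria)
    show "field K" using V by (rule vs_field)
    show "\<forall>v\<in>carrier V'. \<exists>neg_v\<in>carrier V'. v \<oplus>\<^bsub>V'\<^esub> neg_v = \<zero>\<^bsub>V'\<^esub>"
    proof
      fix a assume "a \<in> carrier V'"
      then obtain v where v: "v \<in> carrier V" "a = \<phi> v" by (auto simp: V'_def)
      then have "a \<oplus>\<^bsub>V'\<^esub> \<phi> (\<ominus>\<^bsub>V\<^esub> v) = \<zero>\<^bsub>V'\<^esub>" by (simp add: V'_def \<psi> M.r_neg)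
      then show "\<exists>neg_v\<in>carrier V'. a \<oplus>\<^bsub>V'\<^esub> neg_v = \<zero>\<^bsub>V'\<^esub>" using v by (auto simp: V'_def)
    qed
  qed (auto simp: V'_def \<psi> M.a_ac smult_assoc1 smult_l_distr smult_r_distr)
  have "linear_map K V V' \<phi>"
    by (rule linear_mapI[OF V V']) (auto simp: V'_def \<psi>)
  moreover have "bij_betw \<phi> (carrier V) (carrier V')" using inj by (auto simp: bij_betw_def V'_def)
  ultimately show ?thesis by blast
qed

text \<open>The existence half of the universal property of a kernel, at a single vertex. Linearity
  of the lift is tested after the injective \<open>k\<close>.\<close>

lemma linear_lift_inj:
  assumes k: "linear_map K A X k" and inj: "inj_on k (carrier A)" and g: "linear_map K Z X g"
    and sub: "g ` carrier Z \<subseteq> k ` carrier A"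
  shows "\<exists>h. linear_map K Z A h \<and> (\<forall>v\<in>carrier Z. k (h v) = g v)"
proof -
  define h where "h v = inv_into (carrier A) k (g v)" for v
  have h: "h v \<in> carrier A" "k (h v) = g v" if "v \<in> carrier Z" for v
    proof -
    have "g v \<in> k ` carrier A" using that sub by blast
    then show "h v \<in> carrier A" "k (h v) = g v" unfolding h_def by (rule inv_into_into, rule f_inv_into_f)
  qed
  note Dk = linear_mapD[OF k] and Dg = linear_mapD[OF g]
  note A = vectorspaceD[OF Dk(1)] and Z = vectorspaceD[OF Dg(1)]
  have "linear_map K Z A h"
  proof (rule linear_mapI[OF Dg(1) Dk(1)])
    show "h (u \<oplus>\<^bsub>Z\<^esub> v) = h u \<oplus>\<^bsub>A\<^esub> h v" if "u \<in> carrier Z" "v \<in> carrier Z" for u v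
      by (rule inj_onD[OF inj]) (use that h Dk Dg A Z in auto)
    show "h (c \<odot>\<^bsub>Z\<^esub> v) = c \<odot>\<^bsub>A\<^esub> h v" if "c \<in> carrier K" "v \<in> carrier Z" for c v
      by (rule inj_onD[OF inj]) (use that h Dk Dg A Z in auto)
  qed (use h in auto)
  with h show ?thesis by blast
qed

text \<open>The existence half of the universal property of a cokernel, at a single vertex. The lift
  takes an arbitrary preimage; \<open>sub\<close> makes the result independent of it.\<close>

lemma linear_lift_surj:
  assumes c: "linear_map K Y B c" and surj: "c ` carrier Y = carrier B" and g: "linear_map K Y Z g"
    and sub: "\<And>v. v \<in> carrier Y \<Longrightarrow> c v = \<zero>\<^bsub>B\<^esub> \<Longrightarrow> g v = \<zero>\<^bsub>Z\<^esub>"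
  shows "\<exists>h. linear_map K B Z h \<and> (\<forall>v\<in>carrier Y. h (c v) = g v)"
proof -
  note Dc = linear_mapD[OF c] and Dg = linear_mapD[OF g]
  note Y = vectorspaceD[OF Dc(1)] and Z = vectorspaceD[OF Dg(2)] and B = vectorspaceD[OF Dc(2)]
  define h where "h b = g (inv_into (carrier Y) c b)" for b
  have hc: "h (c v) = g v" if v: "v \<in> carrier Y" for v
  proof -
    let ?u = "inv_into (carrier Y) c (c v)"
    have u: "?u \<in> carrier Y" "c ?u = c v" using v by (auto intro: inv_into_into f_inv_into_f)
    then have "c (?u \<ominus>\<^bsub>Y\<^esub> v) = \<zero>\<^bsub>B\<^esub>" using v Dc B by simp
    then have "g (?u \<ominus>\<^bsub>Y\<^esub> v) = \<zero>\<^bsub>Z\<^esub>" using sub u v Y by simp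
    then have "g ?u \<ominus>\<^bsub>Z\<^esub> g v = \<zero>\<^bsub>Z\<^esub>" using Dg(7)[OF u(1) v] by simp
    then show ?thesis using vs_minus_zero_iff[OF Dg(2)] Dg(3) u v by (simp add: h_def)
  qed
  have ex: "\<exists>v\<in>carrier Y. c v = b" if "b \<in> carrier B" for b proof -
    have "b \<in> c ` carrier Y" using surj that by simp
    then show ?thesis by blast
  qed
  have "linear_map K B Z h"
  proof (rule linear_mapI[OF Dc(2) Dg(2)])
    show "h b \<in> carrier Z" if b: "b \<in> carrier B" for b
    proof -
      obtain v where "v \<in> carrier Y" "c v = b" using ex[OF b] by auto
      then show ?thesis using hc[of v] Dg(3)[of v] by simp
    qed
    show "h (a \<oplus>\<^bsub>B\<^esub> b) = h a \<oplus>\<^bsub>Z\<^esub> h b" if a: "a \<in> carrier B" and b: "b \<in> carrier B" for a b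
    proof -
      obtain u v where uv: "u \<in> carrier Y" "v \<in> carrier Y" "c u = a" "c v = b"
        using ex[OF a] ex[OF b] by auto
      then have "a \<oplus>\<^bsub>B\<^esub> b = c (u \<oplus>\<^bsub>Y\<^esub> v)" using Dc(4) by simp
      then show ?thesis
        using hc[OF Y(2)[OF uv(1,2)]] Dg(4)[OF uv(1,2)] hc[OF uv(1)] hc[OF uv(2)] uv(3,4) by simp
    qed
    show "h (t \<odot>\<^bsub>B\<^esub> b) = t \<odot>\<^bsub>Z\<^esub> h b" if t: "t \<in> carrier K" and "b \<in> carrier B" for t b
    proof -
      obtain v where v: "v \<in> carrier Y" "c v = b" using ex[OF \<open>b \<in> carrier B\<close>] by auto
      then have "t \<odot>\<^bsub>B\<^esub> b = c (t \<odot>\<^bsub>Y\<^esub> v)" using Dc(5) t by simp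
      then show ?thesis using hc[OF Y(4)[OF t v(1)]] Dg(5)[OF t v(1)] hc[OF v(1)] v(2) by simp
    qed
  qed
  with hc show ?thesis by blast
qed

section \<open>Finite direct sums of vector spaces\<close>

lemma sum_space_simps:
  "carrier (sum_space Vs) = (\<Pi>\<^sub>E i\<in>{..<length Vs}. carrier (Vs ! i))"
  "\<zero>\<^bsub>sum_space Vs\<^esub> = (\<lambda>i\<in>{..<length Vs}. \<zero>\<^bsub>Vs ! i\<^esub>)"
  "v \<oplus>\<^bsub>sum_space Vs\<^esub> w = (\<lambda>i\<in>{..<length Vs}. v i \<oplus>\<^bsub>Vs ! i\<^esub> w i)"
  "c \<odot>\<^bsub>sum_space Vs\<^esub> v = (\<lambda>i\<in>{..<length Vs}. c \<odot>\<^bsub>Vs ! i\<^esub> v i)"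
  by (simp_all add: sum_space_def Let_def)

lemma sum_space_vectorspace:
  assumes K: "field K" and VS: "\<forall>V\<in>set Vs. vectorspace K V"
  shows "vectorspace K (sum_space Vs)"
proof (rule vs_criteria[OF K])
  have Vs: "vectorspace K (Vs ! i)" if "i < length Vs" for i using VS that by simp
  have mod: "Module.module K (Vs ! i)" if "i < length Vs" for i
    using Vs[OF that] by (simp add: vectorspace_def)
  show "\<zero>\<^bsub>sum_space Vs\<^esub> \<in> carrier (sum_space Vs)"
    using vs_zero_closed[OF Vs] by (auto simp: sum_space_simps)
  show "\<forall>v w. v \<in> carrier (sum_space Vs) \<and> w \<in> carrier (sum_space Vs) \<longrightarrow>
      v \<oplus>\<^bsub>sum_space Vs\<^esub> w \<in> carrier (sum_space Vs)"
    using vs_add_closed[OF Vs] by (auto simp: sum_space_simps PiE_iff)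
  show "\<forall>c v. c \<in> carrier K \<and> v \<in> carrier (sum_space Vs) \<longrightarrow>
      c \<odot>\<^bsub>sum_space Vs\<^esub> v \<in> carrier (sum_space Vs)"
    using vs_smult_closed[OF Vs] by (auto simp: sum_space_simps PiE_iff)
  show "\<forall>v\<in>carrier (sum_space Vs). \<exists>w\<in>carrier (sum_space Vs). v \<oplus>\<^bsub>sum_space Vs\<^esub> w = \<zero>\<^bsub>sum_space Vs\<^esub>"
  proof
    fix v assume v: "v \<in> carrier (sum_space Vs)"
    let ?w = "\<lambda>i\<in>{..<length Vs}. \<ominus>\<^bsub>Vs ! i\<^esub> v i"
    have "\<ominus>\<^bsub>Vs ! i\<^esub> v i \<in> carrier (Vs ! i) \<and> v i \<oplus>\<^bsub>Vs ! i\<^esub> \<ominus>\<^bsub>Vs ! i\<^esub> v i = \<zero>\<^bsub>Vs ! i\<^esub>" if "i < length Vs" for i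
    proof -
      interpret Module.module K "Vs ! i" using mod[OF that] .
      show ?thesis using v that by (auto simp: sum_space_simps PiE_iff M.r_neg)
    qed
    then have "?w \<in> carrier (sum_space Vs)" "v \<oplus>\<^bsub>sum_space Vs\<^esub> ?w = \<zero>\<^bsub>sum_space Vs\<^esub>"
      by (auto simp: sum_space_simps intro!: restrict_ext)
    then show "\<exists>w\<in>carrier (sum_space Vs). v \<oplus>\<^bsub>sum_space Vs\<^esub> w = \<zero>\<^bsub>sum_space Vs\<^esub>" by blast
  qed
  show "\<forall>v w. v \<in> carrier (sum_space Vs) \<and> w \<in> carrier (sum_space Vs) \<longrightarrow>
      v \<oplus>\<^bsub>sum_space Vs\<^esub> w = w \<oplus>\<^bsub>sum_space Vs\<^esub> v"
    using vs_add_comm[OF Vs] by (auto simp: sum_space_simps PiE_iff intro!: restrict_ext)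
  show "\<forall>v w x. v \<in> carrier (sum_space Vs) \<and> w \<in> carrier (sum_space Vs) \<and> x \<in> carrier (sum_space Vs) \<longrightarrow>
      v \<oplus>\<^bsub>sum_space Vs\<^esub> w \<oplus>\<^bsub>sum_space Vs\<^esub> x = v \<oplus>\<^bsub>sum_space Vs\<^esub> (w \<oplus>\<^bsub>sum_space Vs\<^esub> x)"
    using abelian_monoid.a_assoc[OF vs_abelian_monoid[OF Vs]]
    by (auto simp: sum_space_simps PiE_iff intro!: restrict_ext)
  show "\<forall>v\<in>carrier (sum_space Vs). v \<oplus>\<^bsub>sum_space Vs\<^esub> \<zero>\<^bsub>sum_space Vs\<^esub> = v"
    using vs_add_zero[OF Vs]
    by (auto simp: sum_space_simps PiE_iff fun_eq_iff extensional_def)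
  show "\<forall>a b v. a \<in> carrier K \<and> b \<in> carrier K \<and> v \<in> carrier (sum_space Vs) \<longrightarrow>
      a \<otimes>\<^bsub>K\<^esub> b \<odot>\<^bsub>sum_space Vs\<^esub> v = a \<odot>\<^bsub>sum_space Vs\<^esub> (b \<odot>\<^bsub>sum_space Vs\<^esub> v)"
    using Module.module.smult_assoc1[OF mod] by (auto simp: sum_space_simps PiE_iff intro!: restrict_ext)
  show "\<forall>v\<in>carrier (sum_space Vs). \<one>\<^bsub>K\<^esub> \<odot>\<^bsub>sum_space Vs\<^esub> v = v"
    using Module.module.smult_one[OF mod] by (auto simp: sum_space_simps PiE_iff fun_eq_iff extensional_def)
  show "\<forall>a b v. a \<in> carrier K \<and> b \<in> carrier K \<and> v \<in> carrier (sum_space Vs) \<longrightarrow>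
      (a \<oplus>\<^bsub>K\<^esub> b) \<odot>\<^bsub>sum_space Vs\<^esub> v = a \<odot>\<^bsub>sum_space Vs\<^esub> v \<oplus>\<^bsub>sum_space Vs\<^esub> b \<odot>\<^bsub>sum_space Vs\<^esub> v"
    using Module.module.smult_l_distr[OF mod] by (auto simp: sum_space_simps PiE_iff intro!: restrict_ext)
  show "\<forall>a v w. a \<in> carrier K \<and> v \<in> carrier (sum_space Vs) \<and> w \<in> carrier (sum_space Vs) \<longrightarrow>
      a \<odot>\<^bsub>sum_space Vs\<^esub> (v \<oplus>\<^bsub>sum_space Vs\<^esub> w) = a \<odot>\<^bsub>sum_space Vs\<^esub> v \<oplus>\<^bsub>sum_space Vs\<^esub> a \<odot>\<^bsub>sum_space Vs\<^esub> w"
    using Module.module.smult_r_distr[OF mod] by (auto simp: sum_space_simps PiE_iff intro!: restrict_ext)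
qed

lemma sum_space_projection:
  assumes K: "field K" and VS: "\<forall>V\<in>set Vs. vectorspace K V" and i: "i < length Vs"
  shows "linear_map K (sum_space Vs) (Vs ! i) (\<lambda>v. v i)"
  by (rule linear_mapI[OF sum_space_vectorspace[OF K VS]])
    (use i VS in \<open>auto simp: sum_space_simps\<close>)

text \<open>The separating families of the summands, pulled back along the projections, are jointly
  separating; the index is a pair of a position and an index for that summand.\<close>

lemma sum_space_fin_dim:
  fixes Vs :: "('k, 'u) module list"
  assumes K: "field K" and VS: "\<forall>V\<in>set Vs. vectorspace K V"
    and FD: "\<forall>V\<in>set Vs. vectorspace.fin_dim K V"
  shows "vectorspace.fin_dim K (sum_space Vs)"
proof -
  have Vs: "vectorspace K (Vs ! i)" and fd: "vectorspace.fin_dim K (Vs ! i)" if "i < length Vs" for i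
    using VS FD that by simp_all
  have "\<forall>i\<in>{..<length Vs}. \<exists>p. separating K (Vs ! i) (carrier (Vs ! i)) (fst p :: 'u set) (snd p)"
    using fin_dim_functionals[OF Vs fd] by auto
  then obtain p :: "nat \<Rightarrow> 'u set \<times> ('u \<Rightarrow> 'u \<Rightarrow> 'k)"
    where p: "\<forall>i\<in>{..<length Vs}. separating K (Vs ! i) (carrier (Vs ! i)) (fst (p i)) (snd (p i))"
    using bchoice[of "{..<length Vs}" "\<lambda>i p. separating K (Vs ! i) (carrier (Vs ! i)) (fst p) (snd p)"] by blast
  have P: "separating K (Vs ! i) (carrier (Vs ! i)) (fst (p i)) (snd (p i))" if "i < length Vs" for i
    using p that by simp
  let ?T = "Sigma {..<length Vs} (\<lambda>i. fst (p i))"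
  have fin: "finite ?T" using separating_finite[OF P] by auto
  have lf: "linear_functional K (sum_space Vs) (\<lambda>v. snd (p i) t (v i))" if "i < length Vs" "t \<in> fst (p i)" for i t
    using linear_functional_compose[OF sum_space_projection[OF K VS that(1)] separating_functional[OF P[OF that(1)] that(2)]] .
  have "v = \<zero>\<^bsub>sum_space Vs\<^esub>"
    if v: "v \<in> carrier (sum_space Vs)" and 0: "\<forall>t\<in>?T. snd (p (fst t)) (snd t) (v (fst t)) = \<zero>\<^bsub>K\<^esub>" for v
  proof -
    have "v i = \<zero>\<^bsub>Vs ! i\<^esub>" if "i < length Vs" for i
      by (rule separating_eq_zero[OF P[OF that]]) (use v 0 that in \<open>auto simp: sum_space_simps\<close>)
    then show ?thesis using v by (auto simp: sum_space_simps PiE_iff fun_eq_iff extensional_def)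
  qed
  then have "separating K (sum_space Vs) (carrier (sum_space Vs)) ?T (\<lambda>t v. snd (p (fst t)) (snd t) (v (fst t)))"
    unfolding separating_def using fin lf by auto
  then show ?thesis by (rule fin_dimI_functionals[OF sum_space_vectorspace[OF K VS]])
qed

section \<open>Representations and their morphisms\<close>

abbreviation fiber :: "('v, 'a, 'k, 'u) rep \<Rightarrow> 'v \<Rightarrow> 'u set"
  where "fiber M x \<equiv> carrier (space_at M x)"

locale quiver_reps =
  fixes K :: "('k, 'r) ring_scheme" and Q :: "('v, 'a) pre_digraph"
  assumes field: "field K" and quiver: "strongly_locally_finite Q"
begin

lemma wf: "wf_digraph Q"
  using quiver by (simp add: strongly_locally_finite_def)

lemma tail_verts [simp]: "\<alpha> \<in> arcs Q \<Longrightarrow> tail Q \<alpha> \<in> verts Q"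
  and head_verts [simp]: "\<alpha> \<in> arcs Q \<Longrightarrow> head Q \<alpha> \<in> verts Q"
  using wf by (auto simp: wf_digraph_def)

lemma finite_arcs_at: "x \<in> verts Q \<Longrightarrow> finite {\<alpha> \<in> arcs Q. tail Q \<alpha> = x \<or> head Q \<alpha> = x}"
proof -
  assume "x \<in> verts Q"
  then have "finite (in_arcs Q x \<union> out_arcs Q x)"
    using quiver by (simp add: strongly_locally_finite_def locally_finite_quiver_def)
  moreover have "{\<alpha> \<in> arcs Q. tail Q \<alpha> = x \<or> head Q \<alpha> = x} = in_arcs Q x \<union> out_arcs Q x"
    by (auto simp: in_arcs_def out_arcs_def)
  ultimately show ?thesis by simp
qed

lemma finite_paths: "x \<in> verts Q \<Longrightarrow> y \<in> verts Q \<Longrightarrow> finite (paths Q x y)"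
  using quiver by (simp add: strongly_locally_finite_def interval_finite_def)

lemma rep_space: "is_rep K Q M \<Longrightarrow> x \<in> verts Q \<Longrightarrow> vectorspace K (space_at M x)"
  by (simp add: is_rep_def)

lemma rep_map: "is_rep K Q M \<Longrightarrow> \<alpha> \<in> arcs Q \<Longrightarrow>
    linear_map K (space_at M (tail Q \<alpha>)) (space_at M (head Q \<alpha>)) (map_at M \<alpha>)"
  by (simp add: is_rep_def)

lemma mor_map: "f \<in> rep_mor K Q M N \<Longrightarrow> x \<in> verts Q \<Longrightarrow> linear_map K (space_at M x) (space_at N x) (f x)"
  by (auto simp: rep_mor_def)

lemma mor_natural: "f \<in> rep_mor K Q M N \<Longrightarrow> \<alpha> \<in> arcs Q \<Longrightarrow> v \<in> fiber M (tail Q \<alpha>) \<Longrightarrow>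
    f (head Q \<alpha>) (map_at M \<alpha> v) = map_at N \<alpha> (f (tail Q \<alpha>) v)"
  by (auto simp: rep_mor_def)

lemmas rep_map_closed = linear_map_closed[OF rep_map]
  and mor_closed = linear_map_closed[OF mor_map]

lemma rep_mor_eqI:
  assumes "f \<in> rep_mor K Q M N" and "g \<in> rep_mor K Q M N"
    and "\<And>x v. x \<in> verts Q \<Longrightarrow> v \<in> fiber M x \<Longrightarrow> f x v = g x v"
  shows "f = g"
proof
  fix x show "f x = g x"
  proof (cases "x \<in> verts Q")
    case True
    then have "f x \<in> extensional (fiber M x)" "g x \<in> extensional (fiber M x)"
      using assms(1,2) by (auto simp: rep_mor_def)
    then show ?thesis using assms(3)[OF True] by (rule extensionalityI)
  next
    case False
    then show ?thesis using assms(1,2) by (auto simp: rep_mor_def PiE_def extensional_def)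
  qed
qed

text \<open>Makes a family of maps extensional, as \<open>rep_mor\<close> demands. Every morphism
  below is built in this form, so that only linearity and naturality remain to be shown.\<close>

definition rep_hom :: "('v, 'a, 'k, 'u) rep \<Rightarrow> ('v \<Rightarrow> 'u \<Rightarrow> 'w) \<Rightarrow> 'v \<Rightarrow> 'u \<Rightarrow> 'w"
  where "rep_hom M h = (\<lambda>x\<in>verts Q. \<lambda>v\<in>fiber M x. h x v)"

lemma rep_hom_apply [simp]: "x \<in> verts Q \<Longrightarrow> v \<in> fiber M x \<Longrightarrow> rep_hom M h x v = h x v"
  by (simp add: rep_hom_def)

lemma rep_hom_mor:
  assumes M: "is_rep K Q M"
    and lin: "\<And>x. x \<in> verts Q \<Longrightarrow> linear_map K (space_at M x) (space_at N x) (h x)"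
    and nat: "\<And>\<alpha> v. \<alpha> \<in> arcs Q \<Longrightarrow> v \<in> fiber M (tail Q \<alpha>) \<Longrightarrow>
      h (head Q \<alpha>) (map_at M \<alpha> v) = map_at N \<alpha> (h (tail Q \<alpha>) v)"
  shows "rep_hom M h \<in> rep_mor K Q M N"
  unfolding rep_mor_def
proof (intro CollectI conjI ballI)
  show "rep_hom M h \<in> (\<Pi>\<^sub>E x\<in>verts Q. {h \<in> extensional (fiber M x). linear_map K (space_at M x) (space_at N x) h})"
    unfolding rep_hom_def using lin by (auto intro!: linear_map_cong[OF lin])
  show "rep_hom M h (head Q \<alpha>) (map_at M \<alpha> v) = map_at N \<alpha> (rep_hom M h (tail Q \<alpha>) v)"
    if "\<alpha> \<in> arcs Q" "v \<in> fiber M (tail Q \<alpha>)" for \<alpha> v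
    using that nat rep_map_closed[OF M] by simp
qed

section \<open>Factoring morphisms; subrepresentations and quotients\<close>

definition injective :: "('v, 'a, 'k, 'u) rep \<Rightarrow> ('v \<Rightarrow> 'u \<Rightarrow> 'w) \<Rightarrow> bool"
  where "injective A k \<longleftrightarrow> (\<forall>x\<in>verts Q. inj_on (k x) (fiber A x))"

definition surjective :: "('v, 'a, 'k, 'u) rep \<Rightarrow> ('v, 'a, 'k, 'w) rep \<Rightarrow> ('v \<Rightarrow> 'u \<Rightarrow> 'w) \<Rightarrow> bool"
  where "surjective Y B c \<longleftrightarrow> (\<forall>x\<in>verts Q. c x ` fiber Y x = fiber B x)"

lemma injectiveD: "injective A k \<Longrightarrow> x \<in> verts Q \<Longrightarrow> inj_on (k x) (fiber A x)"
  by (simp add: injective_def)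

lemma surjectiveD: "surjective Y B c \<Longrightarrow> x \<in> verts Q \<Longrightarrow> c x ` fiber Y x = fiber B x"
  by (simp add: surjective_def)

text \<open>The lifts exist vertexwise by \<open>linear_lift_inj\<close>. They commute with the
  arrows because this can be tested after the injective \<open>k\<close>, where it is naturality of
  \<open>g\<close> and \<open>k\<close>.\<close>

lemma lift_inj:
  assumes A: "is_rep K Q A" and Z: "is_rep K Q Z"
    and k: "k \<in> rep_mor K Q A X" and INJ: "injective A k"
    and g: "g \<in> rep_mor K Q Z X" and sub: "\<forall>x\<in>verts Q. g x ` fiber Z x \<subseteq> k x ` fiber A x"
  shows "\<exists>h\<in>rep_mor K Q Z A. \<forall>x\<in>verts Q. \<forall>v\<in>fiber Z x. k x (h x v) = g x v"
proof -
  note inj = injectiveD[OF INJ]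
  have "\<forall>x\<in>verts Q. \<exists>h. linear_map K (space_at Z x) (space_at A x) h \<and> (\<forall>v\<in>fiber Z x. k x (h v) = g x v)"
    using linear_lift_inj[OF mor_map[OF k] inj mor_map[OF g]] sub by blast
  then obtain h where h: "\<forall>x\<in>verts Q. linear_map K (space_at Z x) (space_at A x) (h x) \<and> (\<forall>v\<in>fiber Z x. k x (h x v) = g x v)"
    using bchoice[of "verts Q" "\<lambda>x h. linear_map K (space_at Z x) (space_at A x) h \<and> (\<forall>v\<in>fiber Z x. k x (h v) = g x v)"]
    by blast
  then have lin: "\<And>x. x \<in> verts Q \<Longrightarrow> linear_map K (space_at Z x) (space_at A x) (h x)"
    and kh: "\<And>x v. x \<in> verts Q \<Longrightarrow> v \<in> fiber Z x \<Longrightarrow> k x (h x v) = g x v" by blast+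
  have "h (head Q \<alpha>) (map_at Z \<alpha> v) = map_at A \<alpha> (h (tail Q \<alpha>) v)"
    if \<alpha>: "\<alpha> \<in> arcs Q" and v: "v \<in> fiber Z (tail Q \<alpha>)" for \<alpha> v
  proof (rule inj_onD[OF inj[OF head_verts[OF \<alpha>]]])
    note hv = linear_map_closed[OF lin[OF tail_verts[OF \<alpha>]] v]
    note zv = rep_map_closed[OF Z \<alpha> v]
    show "h (head Q \<alpha>) (map_at Z \<alpha> v) \<in> fiber A (head Q \<alpha>)"
      using linear_map_closed[OF lin[OF head_verts[OF \<alpha>]] zv] .
    show "map_at A \<alpha> (h (tail Q \<alpha>) v) \<in> fiber A (head Q \<alpha>)"
      using rep_map_closed[OF A \<alpha> hv] .
    show "k (head Q \<alpha>) (h (head Q \<alpha>) (map_at Z \<alpha> v)) = k (head Q \<alpha>) (map_at A \<alpha> (h (tail Q \<alpha>) v))"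
      using mor_natural[OF k \<alpha> hv] mor_natural[OF g \<alpha> v] kh zv v \<alpha> by simp
  qed
  then have "rep_hom Z h \<in> rep_mor K Q Z A" using lin by (intro rep_hom_mor[OF Z])
  moreover have "\<forall>x\<in>verts Q. \<forall>v\<in>fiber Z x. k x (rep_hom Z h x v) = g x v" using kh by simp
  ultimately show ?thesis by blast
qed

text \<open>Compatibility of the vertexwise lifts with an arrow is checked on vectors of the form
  \<open>c x v\<close>, which are all vectors.\<close>

lemma lift_surj:
  assumes Y: "is_rep K Q Y" and B: "is_rep K Q B"
    and c: "c \<in> rep_mor K Q Y B" and SURJ: "surjective Y B c"
    and g: "g \<in> rep_mor K Q Y Z"
    and sub: "\<forall>x\<in>verts Q. \<forall>v\<in>fiber Y x. c x v = \<zero>\<^bsub>space_at B x\<^esub> \<longrightarrow> g x v = \<zero>\<^bsub>space_at Z x\<^esub>"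
  shows "\<exists>h\<in>rep_mor K Q B Z. \<forall>x\<in>verts Q. \<forall>v\<in>fiber Y x. h x (c x v) = g x v"
proof -
  note surj = surjectiveD[OF SURJ]
  have "\<forall>x\<in>verts Q. \<exists>h. linear_map K (space_at B x) (space_at Z x) h \<and> (\<forall>v\<in>fiber Y x. h (c x v) = g x v)"
    using linear_lift_surj[OF mor_map[OF c] surj mor_map[OF g]] sub by blast
  then obtain h where h: "\<forall>x\<in>verts Q. linear_map K (space_at B x) (space_at Z x) (h x) \<and> (\<forall>v\<in>fiber Y x. h x (c x v) = g x v)"
    using bchoice[of "verts Q" "\<lambda>x h. linear_map K (space_at B x) (space_at Z x) h \<and> (\<forall>v\<in>fiber Y x. h (c x v) = g x v)"]
    by blast
  then have lin: "\<And>x. x \<in> verts Q \<Longrightarrow> linear_map K (space_at B x) (space_at Z x) (h x)"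
    and hc: "\<And>x v. x \<in> verts Q \<Longrightarrow> v \<in> fiber Y x \<Longrightarrow> h x (c x v) = g x v" by blast+
  have "h (head Q \<alpha>) (map_at B \<alpha> b) = map_at Z \<alpha> (h (tail Q \<alpha>) b)"
    if \<alpha>: "\<alpha> \<in> arcs Q" and b: "b \<in> fiber B (tail Q \<alpha>)" for \<alpha> b
  proof -
    obtain v where v: "v \<in> fiber Y (tail Q \<alpha>)" "b = c (tail Q \<alpha>) v"
      using surj[OF tail_verts[OF \<alpha>]] b by auto
    show ?thesis
      using mor_natural[OF c \<alpha> v(1)] mor_natural[OF g \<alpha> v(1)] hc v \<alpha> rep_map_closed[OF Y \<alpha> v(1)]
      by (metis head_verts tail_verts)
  qed
  then have "rep_hom B h \<in> rep_mor K Q B Z" using lin by (intro rep_hom_mor[OF B])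
  moreover have "\<forall>x\<in>verts Q. \<forall>v\<in>fiber Y x. rep_hom B h x (c x v) = g x v"
    using hc mor_closed[OF c] by simp
  ultimately show ?thesis by blast
qed

lemma identity_mor: "is_rep K Q M \<Longrightarrow> rep_hom M (\<lambda>x v. v) \<in> rep_mor K Q M M"
  by (rule rep_hom_mor) (auto intro!: linear_mapI rep_space)

lemma compose_mor:
  assumes L: "is_rep K Q L" and f: "f \<in> rep_mor K Q L M" and g: "g \<in> rep_mor K Q M N"
  shows "rep_hom L (\<lambda>x v. g x (f x v)) \<in> rep_mor K Q L N"
proof (rule rep_hom_mor[OF L])
  show "linear_map K (space_at L x) (space_at N x) (\<lambda>v. g x (f x v))" if "x \<in> verts Q" for x
    by (rule linear_map_compose[OF mor_map[OF f that] mor_map[OF g that]])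
  show "g (head Q \<alpha>) (f (head Q \<alpha>) (map_at L \<alpha> v)) = map_at N \<alpha> (g (tail Q \<alpha>) (f (tail Q \<alpha>) v))"
    if "\<alpha> \<in> arcs Q" "v \<in> fiber L (tail Q \<alpha>)" for \<alpha> v
    using that mor_natural[OF f] mor_natural[OF g] mor_closed[OF f tail_verts] by simp
qed

text \<open>The inverse is the lift of the identity through \<open>k\<close>; that it is also a left
  inverse follows by cancelling \<open>k\<close>.\<close>

lemma inverse_mor:
  assumes A: "is_rep K Q A" and X: "is_rep K Q X"
    and k: "k \<in> rep_mor K Q A X" and bij: "injective A k" "surjective A X k"
  shows "\<exists>h\<in>rep_mor K Q X A. \<forall>x\<in>verts Q. (\<forall>v\<in>fiber X x. k x (h x v) = v) \<and> (\<forall>v\<in>fiber A x. h x (k x v) = v)"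
proof -
  note inj = injectiveD[OF bij(1)]
  have "\<exists>h\<in>rep_mor K Q X A. \<forall>x\<in>verts Q. \<forall>v\<in>fiber X x. k x (h x v) = rep_hom X (\<lambda>x v. v) x v"
    by (rule lift_inj[OF A X k bij(1) identity_mor[OF X]]) (use surjectiveD[OF bij(2)] in auto)
  then obtain h where h: "h \<in> rep_mor K Q X A" "\<forall>x\<in>verts Q. \<forall>v\<in>fiber X x. k x (h x v) = v"
    by auto
  moreover have "h x (k x v) = v" if "x \<in> verts Q" "v \<in> fiber A x" for x v
    by (rule inj_onD[OF inj[OF that(1)]])
      (use h that mor_closed[OF k] mor_closed[OF h(1)] in auto)
  ultimately show ?thesis by blast
qed

text \<open>A subrepresentation, recorded by its subspaces alone.\<close>

definition stable :: "('v, 'a, 'k, 'u) rep \<Rightarrow> ('v \<Rightarrow> 'u set) \<Rightarrow> bool"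
  where "stable M W \<longleftrightarrow> (\<forall>x\<in>verts Q. VectorSpace.subspace K (W x) (space_at M x)) \<and>
    (\<forall>\<alpha>\<in>arcs Q. map_at M \<alpha> ` W (tail Q \<alpha>) \<subseteq> W (head Q \<alpha>))"

lemma stable_kernel:
  assumes M: "is_rep K Q M" and N: "is_rep K Q N" and f: "f \<in> rep_mor K Q M N"
  shows "stable M (\<lambda>x. {v \<in> fiber M x. f x v = \<zero>\<^bsub>space_at N x\<^esub>})"
  unfolding stable_def
  using subspace_kernel[OF mor_map[OF f]] mor_natural[OF f] rep_map_closed[OF M] linear_map_zero[OF rep_map[OF N]]
  by auto

lemma stable_image:
  assumes M: "is_rep K Q M" and f: "f \<in> rep_mor K Q M N"
  shows "stable N (\<lambda>x. f x ` fiber M x)"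
  unfolding stable_def
proof (intro conjI ballI)
  show "map_at N \<alpha> ` f (tail Q \<alpha>) ` fiber M (tail Q \<alpha>) \<subseteq> f (head Q \<alpha>) ` fiber M (head Q \<alpha>)"
    if "\<alpha> \<in> arcs Q" for \<alpha>
    using mor_natural[OF f that, symmetric] rep_map_closed[OF M that] by auto
qed (use subspace_image[OF mor_map[OF f]] in auto)

text \<open>The result is an injective morphism with image \<open>W\<close>, not a literal subset,
  so that all later arguments are invariant under isomorphism.\<close>

lemma subrep_exists:
  fixes M :: "('v, 'a, 'k, 'u) rep"
  assumes M: "is_rep K Q M" and W: "stable M W"
  shows "\<exists>(A :: ('v, 'a, 'k, 'u) rep) k. is_rep K Q A \<and> k \<in> rep_mor K Q A M \<and>
    injective A k \<and> (\<forall>x\<in>verts Q. k x ` fiber A x = W x)"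
proof -
  define A where "A = M\<lparr>space_at := \<lambda>x. (space_at M x)\<lparr>carrier := W x\<rparr>\<rparr>"
  have sub: "VectorSpace.subspace K (W x) (space_at M x)" if "x \<in> verts Q" for x
    using W that by (simp add: stable_def)
  have st: "map_at M \<alpha> v \<in> W (head Q \<alpha>)" if "\<alpha> \<in> arcs Q" "v \<in> W (tail Q \<alpha>)" for \<alpha> v
    using W that by (auto simp: stable_def)
  have WM: "v \<in> fiber M x" if "x \<in> verts Q" "v \<in> W x" for x v
    using subspace_subset[OF sub[OF that(1)]] that(2) by auto
  have A: "is_rep K Q A"
    unfolding is_rep_def
  proof (intro conjI ballI)
    show "vectorspace K (space_at A x)" if "x \<in> verts Q" for x
      using subspace_vectorspace[OF sub[OF that]] by (simp add: A_def)
    show "linear_map K (space_at A (tail Q \<alpha>)) (space_at A (head Q \<alpha>)) (map_at A \<alpha>)" if \<alpha>: "\<alpha> \<in> arcs Q" for \<alpha>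
      unfolding A_def
      by (rule linear_mapI) (use \<alpha> subspace_vectorspace[OF sub] st linear_mapD(4,5)[OF rep_map[OF M \<alpha>]] WM in auto)
  qed
  have "rep_hom A (\<lambda>x v. v) \<in> rep_mor K Q A M"
  proof (rule rep_hom_mor[OF A])
    show "linear_map K (space_at A x) (space_at M x) (\<lambda>v. v)" if "x \<in> verts Q" for x
      using linear_map_subspace_inclusion[OF sub[OF that]] by (simp add: A_def)
  qed (simp add: A_def)
  moreover have "injective A (rep_hom A (\<lambda>x v. v))" "\<forall>x\<in>verts Q. rep_hom A (\<lambda>x v. v) x ` fiber A x = W x"
    by (auto simp: A_def injective_def inj_on_def image_def)
  ultimately show ?thesis using A
    by (intro exI[of _ A] exI[of _ "rep_hom A (\<lambda>x v. v)"] conjI)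
qed

text \<open>The quotient is realised on complements of the \<open>W x\<close>, chosen vertex by
  vertex and hence not stable; an arrow acts as in \<open>M\<close> and is followed by the
  projection.\<close>

lemma quotient_exists:
  fixes M :: "('v, 'a, 'k, 'u) rep"
  assumes M: "is_rep K Q M" and fd: "locally_fin_dim K Q M" and W: "stable M W"
  shows "\<exists>(B :: ('v, 'a, 'k, 'u) rep) c. is_rep K Q B \<and> c \<in> rep_mor K Q M B \<and>
    surjective M B c \<and> (\<forall>x\<in>verts Q. {v \<in> fiber M x. c x v = \<zero>\<^bsub>space_at B x\<^esub>} = W x)"
proof -
  have sub: "VectorSpace.subspace K (W x) (space_at M x)" if "x \<in> verts Q" for x
    using W that by (simp add: stable_def)
  have st: "map_at M \<alpha> v \<in> W (head Q \<alpha>)" if "\<alpha> \<in> arcs Q" "v \<in> W (tail Q \<alpha>)" for \<alpha> v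
    using W that by (auto simp: stable_def)
  have "\<forall>x\<in>verts Q. \<exists>p. projection_along K (space_at M x) (W x) (fst p) (snd p)"
    using complement_projection[OF sub] fd by (auto simp: locally_fin_dim_def)
  then obtain p where p: "\<forall>x\<in>verts Q. projection_along K (space_at M x) (W x) (fst (p x)) (snd (p x))"
    using bchoice[of "verts Q" "\<lambda>x p. projection_along K (space_at M x) (W x) (fst p) (snd p)"] by blast
  define C \<pi> where "C x = fst (p x)" and "\<pi> x = snd (p x)" for x
  have C: "VectorSpace.subspace K (C x) (space_at M x)"
    and lin: "linear_map K (space_at M x) ((space_at M x)\<lparr>carrier := C x\<rparr>) (\<pi> x)"
    and im: "\<pi> x ` fiber M x = C x" and ker: "{v \<in> fiber M x. \<pi> x v = \<zero>\<^bsub>space_at M x\<^esub>} = W x"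
    and id: "\<And>v. v \<in> C x \<Longrightarrow> \<pi> x v = v" if "x \<in> verts Q" for x
    using p that unfolding projection_along_def C_def \<pi>_def by blast+
  define B where "B = \<lparr>space_at = (\<lambda>x. (space_at M x)\<lparr>carrier := C x\<rparr>), map_at = (\<lambda>\<alpha> v. \<pi> (head Q \<alpha>) (map_at M \<alpha> v))\<rparr>"
  have B: "is_rep K Q B"
    unfolding is_rep_def
  proof (intro conjI ballI)
    show "vectorspace K (space_at B x)" if "x \<in> verts Q" for x
      using subspace_vectorspace[OF C[OF that]] by (simp add: B_def)
    show "linear_map K (space_at B (tail Q \<alpha>)) (space_at B (head Q \<alpha>)) (map_at B \<alpha>)" if \<alpha>: "\<alpha> \<in> arcs Q" for \<alpha>
      using linear_map_compose[OF linear_map_compose[OF linear_map_subspace_inclusion[OF C[OF tail_verts[OF \<alpha>]]] rep_map[OF M \<alpha>]] lin[OF head_verts[OF \<alpha>]]]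
      by (simp add: B_def)
  qed
  \<comment> \<open>Naturality of the projections. The vector \<open>v\<close> minus its projection
    lies in \<open>W\<close>, stability moves it into \<open>W\<close> at the head, and the
    projection there kills it.\<close>
  have "\<pi> (head Q \<alpha>) (map_at M \<alpha> v) = \<pi> (head Q \<alpha>) (map_at M \<alpha> (\<pi> (tail Q \<alpha>) v))"
    if \<alpha>: "\<alpha> \<in> arcs Q" and v: "v \<in> fiber M (tail Q \<alpha>)" for \<alpha> v
  proof -
    let ?x = "tail Q \<alpha>" and ?y = "head Q \<alpha>"
    note x = tail_verts[OF \<alpha>] and y = head_verts[OF \<alpha>]
    note X = rep_space[OF M x] and Y = rep_space[OF M y]
    have \<pi>v: "\<pi> ?x v \<in> C ?x" using im[OF x] v by auto
    then have \<pi>M: "\<pi> ?x v \<in> fiber M ?x" using subspace_subset[OF C[OF x]] by auto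
    let ?d = "v \<ominus>\<^bsub>space_at M ?x\<^esub> \<pi> ?x v"
    have dM: "?d \<in> fiber M ?x" using vs_minus_closed[OF X v \<pi>M] .
    have "\<pi> ?x (?d \<oplus>\<^bsub>space_at M ?x\<^esub> \<pi> ?x v) = \<pi> ?x ?d \<oplus>\<^bsub>space_at M ?x\<^esub> \<pi> ?x (\<pi> ?x v)"
      using linear_map_add[OF lin[OF x] dM \<pi>M] by simp
    then have "\<pi> ?x ?d \<oplus>\<^bsub>space_at M ?x\<^esub> \<pi> ?x v = \<pi> ?x v"
      using vs_minus_add[OF X v \<pi>M] id[OF x \<pi>v] by simp
    moreover have "\<pi> ?x ?d \<in> fiber M ?x" using im[OF x] dM subspace_subset[OF C[OF x]] by auto
    moreover have "abelian_group (space_at M ?x)" using X unfolding vectorspace_def Module.module_def by blast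
    ultimately have "\<pi> ?x ?d = \<zero>\<^bsub>space_at M ?x\<^esub>"
      using \<pi>M by (metis abelian_group.show_l_zero)
    then have "?d \<in> W ?x" using ker[OF x] dM by auto
    then have "map_at M \<alpha> ?d \<in> W ?y" by (rule st[OF \<alpha>])
    then have 0: "\<pi> ?y (map_at M \<alpha> ?d) = \<zero>\<^bsub>space_at M ?y\<^esub>" using ker[OF y] by auto
    note mv = rep_map_closed[OF M \<alpha> v] and mp = rep_map_closed[OF M \<alpha> \<pi>M] and md = rep_map_closed[OF M \<alpha> dM]
    have "map_at M \<alpha> v = map_at M \<alpha> ?d \<oplus>\<^bsub>space_at M ?y\<^esub> map_at M \<alpha> (\<pi> ?x v)"
      using linear_map_add[OF rep_map[OF M \<alpha>] dM \<pi>M] vs_minus_add[OF X v \<pi>M] by simp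
    then have "\<pi> ?y (map_at M \<alpha> v) = \<zero>\<^bsub>space_at M ?y\<^esub> \<oplus>\<^bsub>space_at M ?y\<^esub> \<pi> ?y (map_at M \<alpha> (\<pi> ?x v))"
      using linear_map_add[OF lin[OF y] md mp] 0 by simp
    moreover have "\<pi> ?y (map_at M \<alpha> (\<pi> ?x v)) \<in> fiber M ?y"
      using im[OF y] mp subspace_subset[OF C[OF y]] by auto
    ultimately show ?thesis using vs_zero_add[OF Y] by simp
  qed
  then have "rep_hom M \<pi> \<in> rep_mor K Q M B"
    using lin by (intro rep_hom_mor[OF M]) (auto simp: B_def)
  moreover have "surjective M B (rep_hom M \<pi>)" "\<forall>x\<in>verts Q. {v \<in> fiber M x. rep_hom M \<pi> x v = \<zero>\<^bsub>space_at B x\<^esub>} = W x"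
  proof -
    show "surjective M B (rep_hom M \<pi>)" using im by (auto simp: B_def surjective_def image_def)
    show "\<forall>x\<in>verts Q. {v \<in> fiber M x. rep_hom M \<pi> x v = \<zero>\<^bsub>space_at B x\<^esub>} = W x"
      by (auto simp: B_def ker[symmetric])
  qed
  ultimately show ?thesis using B by (intro exI[of _ B] exI[of _ "rep_hom M \<pi>"] conjI)
qed

lemma locally_fin_dim_inj:
  assumes k: "k \<in> rep_mor K Q A X" and "injective A k"
    and "locally_fin_dim K Q X"
  shows "locally_fin_dim K Q A"
  unfolding locally_fin_dim_def
  using fin_dim_inj[OF mor_map[OF k]] assms by (auto simp: locally_fin_dim_def injective_def)

lemma locally_fin_dim_surj:
  assumes c: "c \<in> rep_mor K Q Y B" and "surjective Y B c"
    and "locally_fin_dim K Q Y"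
  shows "locally_fin_dim K Q B"
  unfolding locally_fin_dim_def
  using linear_map.surj_fin_dim[OF mor_map[OF c]] assms by (auto simp: locally_fin_dim_def surjective_def)

text \<open>Arrows act by conjugation with the vertexwise bijections. In this way a direct sum,
  whose elements are tuples, gets a copy over \<open>'u\<close>.\<close>

lemma transport_rep:
  fixes M :: "('v, 'a, 'k, 'w) rep" and \<iota> :: "'k list \<Rightarrow> 'u"
  assumes M: "is_rep K Q M" and fd: "locally_fin_dim K Q M" and \<iota>: "inj_on \<iota> (lists (carrier K))"
  shows "\<exists>(M' :: ('v, 'a, 'k, 'u) rep) \<phi>. is_rep K Q M' \<and> \<phi> \<in> rep_mor K Q M M' \<and>
    injective M \<phi> \<and> surjective M M' \<phi>"
proof -
  let ?P = "\<lambda>x (p :: ('k, 'u) module \<times> ('w \<Rightarrow> 'u)). linear_map K (space_at M x) (fst p) (snd p) \<and> bij_betw (snd p) (fiber M x) (carrier (fst p))"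
  have "\<forall>x\<in>verts Q. \<exists>p. ?P x p"
    using transport_space[OF rep_space[OF M] _ \<iota>] fd by (auto simp: locally_fin_dim_def)
  then obtain p where p: "\<forall>x\<in>verts Q. ?P x (p x)" using bchoice[of "verts Q" ?P] by blast
  define V \<phi> where "V x = fst (p x)" and "\<phi> x = snd (p x)" for x
  have lin: "linear_map K (space_at M x) (V x) (\<phi> x)" and bij: "bij_betw (\<phi> x) (fiber M x) (carrier (V x))"
    if "x \<in> verts Q" for x using p that by (auto simp: V_def \<phi>_def)
  define \<psi> where "\<psi> x = inv_into (fiber M x) (\<phi> x)" for x
  have inv: "linear_map K (V x) (space_at M x) (\<psi> x)" if "x \<in> verts Q" for x
    unfolding \<psi>_def using linear_map_inv_into[OF lin[OF that] bij[OF that]] .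
  have \<psi>\<phi>: "\<psi> x (\<phi> x v) = v" if "x \<in> verts Q" "v \<in> fiber M x" for x v
    unfolding \<psi>_def using bij[OF that(1)] that(2) by (simp add: bij_betw_def)
  define M' where "M' = \<lparr>space_at = V, map_at = (\<lambda>\<alpha> v. \<phi> (head Q \<alpha>) (map_at M \<alpha> (\<psi> (tail Q \<alpha>) v)))\<rparr>"
  have M': "is_rep K Q M'"
    unfolding is_rep_def
  proof (intro conjI ballI)
    show "vectorspace K (space_at M' x)" if "x \<in> verts Q" for x
      using linear_map_target[OF lin[OF that]] by (simp add: M'_def)
    show "linear_map K (space_at M' (tail Q \<alpha>)) (space_at M' (head Q \<alpha>)) (map_at M' \<alpha>)" if \<alpha>: "\<alpha> \<in> arcs Q" for \<alpha>
      using linear_map_compose[OF linear_map_compose[OF inv[OF tail_verts[OF \<alpha>]] rep_map[OF M \<alpha>]] lin[OF head_verts[OF \<alpha>]]]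
      by (simp add: M'_def)
  qed
  have "rep_hom M \<phi> \<in> rep_mor K Q M M'"
    by (rule rep_hom_mor[OF M]) (use lin \<psi>\<phi> in \<open>auto simp: M'_def\<close>)
  moreover have bij': "\<forall>x\<in>verts Q. bij_betw (rep_hom M \<phi> x) (fiber M x) (fiber M' x)"
  proof
    fix x assume x: "x \<in> verts Q"
    have "bij_betw (rep_hom M \<phi> x) (fiber M x) (fiber M' x) = bij_betw (\<phi> x) (fiber M x) (fiber M' x)"
      by (rule bij_betw_cong) (use x in auto)
    then show "bij_betw (rep_hom M \<phi> x) (fiber M x) (fiber M' x)" using bij[OF x] by (simp add: M'_def)
  qed
  moreover from bij' have "injective M (rep_hom M \<phi>)" "surjective M M' (rep_hom M \<phi>)"
    by (auto simp: injective_def surjective_def bij_betw_def)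
  ultimately show ?thesis using M' by blast
qed

lemma sum_rep_rep:
  assumes MS: "\<forall>M\<in>set Ms. is_rep K Q M"
  shows "is_rep K Q (sum_rep Ms)"
  unfolding is_rep_def
proof (intro conjI ballI)
  show V: "vectorspace K (space_at (sum_rep Ms) x)" if "x \<in> verts Q" for x
    unfolding sum_rep_def using MS that by (auto intro!: sum_space_vectorspace[OF field] rep_space)
  show "linear_map K (space_at (sum_rep Ms) (tail Q \<alpha>)) (space_at (sum_rep Ms) (head Q \<alpha>)) (map_at (sum_rep Ms) \<alpha>)"
    if \<alpha>: "\<alpha> \<in> arcs Q" for \<alpha>
  proof -
    have Ms: "is_rep K Q (Ms ! i)" if "i < length Ms" for i using MS that by simp
    show ?thesis
      by (rule linear_mapI[OF V V])
      (use \<alpha> linear_mapD(3-5)[OF rep_map[OF Ms \<alpha>]] in \<open>auto simp: sum_rep_def sum_space_simps PiE_iff intro!: restrict_ext\<close>)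
  qed
qed

lemma sum_rep_fin_dim:
  assumes "\<forall>M\<in>set Ms. is_rep K Q M" and "\<forall>M\<in>set Ms. locally_fin_dim K Q M"
  shows "locally_fin_dim K Q (sum_rep Ms)"
  unfolding locally_fin_dim_def sum_rep_def
  using assms by (auto intro!: sum_space_fin_dim[OF field] rep_space simp: locally_fin_dim_def)

end

section \<open>Full subcategories of representations: when they are abelian\<close>

lemma linear_map_zero_map:
  assumes "vectorspace K V" and W: "vectorspace K W"
  shows "linear_map K V W (\<lambda>v. \<zero>\<^bsub>W\<^esub>)"
  by (rule linear_mapI[OF assms]) (auto simp: vectorspaceD[OF W])

lemma linear_map_sum:
  assumes f: "linear_map K V W f" and g: "linear_map K V W g"
  shows "linear_map K V W (\<lambda>v. f v \<oplus>\<^bsub>W\<^esub> g v)"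
proof -
  interpret W: vectorspace K W using f by (rule linear_map_target)
  note F = linear_mapD[OF f] and G = linear_mapD[OF g]
  show ?thesis
    by (rule linear_mapI[OF F(1,2)]) (auto simp: F(3-5) G(3-5) W.M.a_ac W.smult_r_distr)
qed

lemma linear_map_neg:
  assumes f: "linear_map K V W f"
  shows "linear_map K V W (\<lambda>v. \<ominus>\<^bsub>W\<^esub> f v)"
proof -
  interpret W: vectorspace K W using f by (rule linear_map_target)
  note F = linear_mapD[OF f]
  have "c \<odot>\<^bsub>W\<^esub> (\<ominus>\<^bsub>W\<^esub> w) = \<ominus>\<^bsub>W\<^esub> (c \<odot>\<^bsub>W\<^esub> w)" if "c \<in> carrier K" "w \<in> carrier W" for c w
    using that by (simp add: W.R.m_comm flip: W.smult_minus_1 W.smult_assoc1)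
  then show ?thesis
    by (intro linear_mapI[OF F(1,2)]) (auto simp: F(3-5) W.M.minus_add)
qed

context quiver_reps
begin

lemma rep_hom_eq_iff:
  "rep_hom M h = rep_hom M h' \<longleftrightarrow> (\<forall>x\<in>verts Q. \<forall>v\<in>fiber M x. h x v = h' x v)"
proof
  assume eq: "rep_hom M h = rep_hom M h'"
  show "\<forall>x\<in>verts Q. \<forall>v\<in>fiber M x. h x v = h' x v"
  proof (intro ballI)
    fix x v assume "x \<in> verts Q" "v \<in> fiber M x"
    then show "h x v = h' x v" using fun_cong[OF fun_cong[OF eq, of x], of v] by simp
  qed
qed (auto simp: rep_hom_def intro!: restrict_ext)

lemma rep_hom_id:
  assumes "f \<in> rep_mor K Q M N"
  shows "rep_hom M f = f"
proof
  fix x show "rep_hom M f x = f x"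
  proof (cases "x \<in> verts Q")
    case True
    then have "f x \<in> extensional (fiber M x)" using assms by (auto simp: rep_mor_def)
    then show ?thesis using True by (simp add: rep_hom_def extensional_restrict)
  next
    case False
    then show ?thesis using assms by (auto simp: rep_hom_def rep_mor_def PiE_def extensional_def)
  qed
qed

lemma rep_hom_eq_mor_iff:
  assumes "f \<in> rep_mor K Q M N"
  shows "rep_hom M h = f \<longleftrightarrow> (\<forall>x\<in>verts Q. \<forall>v\<in>fiber M x. h x v = f x v)"
  using rep_hom_eq_iff[of M h f] rep_hom_id[OF assms] by simp

lemma zero_mor:
  assumes M: "is_rep K Q M" and N: "is_rep K Q N"
  shows "rep_hom M (\<lambda>x v. \<zero>\<^bsub>space_at N x\<^esub>) \<in> rep_mor K Q M N"
  by (rule rep_hom_mor[OF M])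
    (use linear_map_zero_map[OF rep_space[OF M] rep_space[OF N]] linear_map_zero[OF rep_map[OF N]] in auto)

lemma add_mor:
  assumes M: "is_rep K Q M" and N: "is_rep K Q N" and f: "f \<in> rep_mor K Q M N" and g: "g \<in> rep_mor K Q M N"
  shows "rep_hom M (\<lambda>x v. f x v \<oplus>\<^bsub>space_at N x\<^esub> g x v) \<in> rep_mor K Q M N"
proof (rule rep_hom_mor[OF M])
  fix \<alpha> v assume \<alpha>: "\<alpha> \<in> arcs Q" and v: "v \<in> fiber M (tail Q \<alpha>)"
  show "f (head Q \<alpha>) (map_at M \<alpha> v) \<oplus>\<^bsub>space_at N (head Q \<alpha>)\<^esub> g (head Q \<alpha>) (map_at M \<alpha> v) =
      map_at N \<alpha> (f (tail Q \<alpha>) v \<oplus>\<^bsub>space_at N (tail Q \<alpha>)\<^esub> g (tail Q \<alpha>) v)"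
    using mor_natural[OF f \<alpha> v] mor_natural[OF g \<alpha> v]
      linear_map_add[OF rep_map[OF N \<alpha>] mor_closed[OF f tail_verts[OF \<alpha>] v] mor_closed[OF g tail_verts[OF \<alpha>] v]]
    by simp
qed (rule linear_map_sum[OF mor_map[OF f] mor_map[OF g]])

lemma neg_mor:
  assumes M: "is_rep K Q M" and N: "is_rep K Q N" and f: "f \<in> rep_mor K Q M N"
  shows "rep_hom M (\<lambda>x v. \<ominus>\<^bsub>space_at N x\<^esub> f x v) \<in> rep_mor K Q M N"
proof (rule rep_hom_mor[OF M])
  fix \<alpha> v assume \<alpha>: "\<alpha> \<in> arcs Q" and v: "v \<in> fiber M (tail Q \<alpha>)"
  interpret linear_map K "space_at N (tail Q \<alpha>)" "space_at N (head Q \<alpha>)" "map_at N \<alpha>" using rep_map[OF N \<alpha>] .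
  show "\<ominus>\<^bsub>space_at N (head Q \<alpha>)\<^esub> f (head Q \<alpha>) (map_at M \<alpha> v) = map_at N \<alpha> (\<ominus>\<^bsub>space_at N (tail Q \<alpha>)\<^esub> f (tail Q \<alpha>) v)"
    using mor_natural[OF f \<alpha> v] mor_closed[OF f tail_verts[OF \<alpha>] v] by simp
qed (rule linear_map_neg[OF mor_map[OF f]])

text \<open>The property stays a parameter, so that \<open>subcat_abelian\<close> can reduce
  abelianness to closure properties of \<open>P\<close>.\<close>

definition subcat where "subcat P = full_subcategory (rep_cat K Q) P"

text \<open>All operations are expressed by \<open>rep_hom\<close>; with
  \<open>rep_hom_eq_iff\<close> every equation between morphisms becomes pointwise.\<close>

lemma subcat_simps:
  "X \<in> Obj (subcat P) \<longleftrightarrow> is_rep K Q X \<and> locally_fin_dim K Q X \<and> P X"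
  "Mor (subcat P) = rep_mor K Q"
  "Id (subcat P) M = rep_hom M (\<lambda>x v. v)"
  "Comp (subcat P) L M N g f = rep_hom L (\<lambda>x v. g x (f x v))"
  "Add (subcat P) M N f g = rep_hom M (\<lambda>x v. f x v \<oplus>\<^bsub>space_at N x\<^esub> g x v)"
  "Zero (subcat P) M N = rep_hom M (\<lambda>x v. \<zero>\<^bsub>space_at N x\<^esub>)"
  by (simp_all add: subcat_def full_subcategory_def rep_cat_def rep_hom_def compose_def)

lemma subcat_obj: "X \<in> Obj (subcat P) \<Longrightarrow> is_rep K Q X"
  by (simp add: subcat_simps)

lemma mor_comm_group:
  assumes X: "is_rep K Q X" and Y: "is_rep K Q Y"
  shows "comm_group (mor_group (subcat P) X Y)" (is "comm_group ?G")
proof (rule comm_groupI)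
  have car: "carrier ?G = rep_mor K Q X Y"
    and mult: "\<And>a b. a \<otimes>\<^bsub>?G\<^esub> b = rep_hom X (\<lambda>x v. a x v \<oplus>\<^bsub>space_at Y x\<^esub> b x v)"
    and one: "\<one>\<^bsub>?G\<^esub> = rep_hom X (\<lambda>x v. \<zero>\<^bsub>space_at Y x\<^esub>)"
    by (simp_all add: mor_group_def subcat_simps)
  show "\<one>\<^bsub>?G\<^esub> \<in> carrier ?G" unfolding car one by (rule zero_mor[OF X Y])
  show "a \<otimes>\<^bsub>?G\<^esub> b \<in> carrier ?G" if "a \<in> carrier ?G" "b \<in> carrier ?G" for a b
    using that unfolding car mult by (rule add_mor[OF X Y])
  show "a \<otimes>\<^bsub>?G\<^esub> b \<otimes>\<^bsub>?G\<^esub> c = a \<otimes>\<^bsub>?G\<^esub> (b \<otimes>\<^bsub>?G\<^esub> c)"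
    if "a \<in> carrier ?G" "b \<in> carrier ?G" "c \<in> carrier ?G" for a b c
    using that abelian_monoid.a_assoc[OF vs_abelian_monoid[OF rep_space[OF Y]]]
    unfolding car mult by (simp add: rep_hom_eq_iff mor_closed)
  show "a \<otimes>\<^bsub>?G\<^esub> b = b \<otimes>\<^bsub>?G\<^esub> a" if "a \<in> carrier ?G" "b \<in> carrier ?G" for a b
    using that vs_add_comm[OF rep_space[OF Y]] unfolding car mult by (simp add: rep_hom_eq_iff mor_closed)
  fix a assume "a \<in> carrier ?G"
  then have a: "a \<in> rep_mor K Q X Y" by (simp add: car)
  show "\<one>\<^bsub>?G\<^esub> \<otimes>\<^bsub>?G\<^esub> a = a"
    unfolding one mult using vs_zero_add[OF rep_space[OF Y]] mor_closed[OF a] by (simp add: rep_hom_eq_mor_iff[OF a])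
  have "\<ominus>\<^bsub>space_at Y x\<^esub> a x v \<oplus>\<^bsub>space_at Y x\<^esub> a x v = \<zero>\<^bsub>space_at Y x\<^esub>" if "x \<in> verts Q" "v \<in> fiber X x" for x v
  proof -
    interpret vectorspace K "space_at Y x" using rep_space[OF Y that(1)] .
    show ?thesis using mor_closed[OF a that] by (simp add: M.l_neg)
  qed
  then show "\<exists>b\<in>carrier ?G. b \<otimes>\<^bsub>?G\<^esub> a = \<one>\<^bsub>?G\<^esub>"
    unfolding car mult one by (intro bexI[OF _ neg_mor[OF X Y a]]) (simp add: rep_hom_eq_iff)
qed

lemma subcat_preadditive: "preadditive_category (subcat P)"
proof (rule preadditive_category.intro)
  show "Id (subcat P) X \<in> Mor (subcat P) X X" if "X \<in> Obj (subcat P)" for X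
    using identity_mor[OF subcat_obj[OF that]] by (simp add: subcat_simps)
  show "comm_group (mor_group (subcat P) X Y)" if "X \<in> Obj (subcat P)" "Y \<in> Obj (subcat P)" for X Y
    using that by (intro mor_comm_group subcat_obj)
  show "Comp (subcat P) X Y Z g f \<in> Mor (subcat P) X Z"
    if "X \<in> Obj (subcat P)" "Y \<in> Obj (subcat P)" "Z \<in> Obj (subcat P)"
      "f \<in> Mor (subcat P) X Y" "g \<in> Mor (subcat P) Y Z" for X Y Z f g
    using that compose_mor[of X f Y g Z] by (simp add: subcat_simps)
  show "Comp (subcat P) X Y Y (Id (subcat P) Y) f = f" "Comp (subcat P) X X Y f (Id (subcat P) X) = f"
    if "X \<in> Obj (subcat P)" "Y \<in> Obj (subcat P)" "f \<in> Mor (subcat P) X Y" for X Y f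
    using that by (simp_all add: subcat_simps rep_hom_eq_mor_iff mor_closed)
  show "Comp (subcat P) W X Z (Comp (subcat P) X Y Z h g) f = Comp (subcat P) W Y Z h (Comp (subcat P) W X Y g f)"
    if "W \<in> Obj (subcat P)" "X \<in> Obj (subcat P)" "Y \<in> Obj (subcat P)" "Z \<in> Obj (subcat P)"
      "f \<in> Mor (subcat P) W X" "g \<in> Mor (subcat P) X Y" "h \<in> Mor (subcat P) Y Z" for W X Y Z f g h
    using that by (simp add: subcat_simps rep_hom_eq_iff mor_closed)
  show "Comp (subcat P) X Y Z (Add (subcat P) Y Z g g') f =
      Add (subcat P) X Z (Comp (subcat P) X Y Z g f) (Comp (subcat P) X Y Z g' f)"
    if "X \<in> Obj (subcat P)" "Y \<in> Obj (subcat P)" "Z \<in> Obj (subcat P)"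
      "f \<in> Mor (subcat P) X Y" "g \<in> Mor (subcat P) Y Z" "g' \<in> Mor (subcat P) Y Z" for X Y Z f g g'
    using that by (simp add: subcat_simps rep_hom_eq_iff mor_closed)
  show "Comp (subcat P) X Y Z g (Add (subcat P) X Y f f') =
      Add (subcat P) X Z (Comp (subcat P) X Y Z g f) (Comp (subcat P) X Y Z g f')"
    if "X \<in> Obj (subcat P)" "Y \<in> Obj (subcat P)" "Z \<in> Obj (subcat P)"
      "f \<in> Mor (subcat P) X Y" "f' \<in> Mor (subcat P) X Y" "g \<in> Mor (subcat P) Y Z" for X Y Z f f' g
    using that linear_map_add[OF mor_map[of g Y Z]] by (simp add: subcat_simps rep_hom_eq_iff mor_closed)
qed

text \<open>A kernel computed vertexwise in all representations, without reference to a subcategory.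
  The closure hypotheses of \<open>subcat_abelian\<close> are stated for these concrete kernels, and
  dually for cokernels.\<close>

definition kernel_of where
  "kernel_of X Y f A k \<longleftrightarrow> is_rep K Q A \<and> k \<in> rep_mor K Q A X \<and> injective A k \<and>
    (\<forall>x\<in>verts Q. k x ` fiber A x = {v \<in> fiber X x. f x v = \<zero>\<^bsub>space_at Y x\<^esub>})"

definition cokernel_of where
  "cokernel_of X Y f B c \<longleftrightarrow> is_rep K Q B \<and> c \<in> rep_mor K Q Y B \<and> surjective Y B c \<and>
    (\<forall>x\<in>verts Q. {v \<in> fiber Y x. c x v = \<zero>\<^bsub>space_at B x\<^esub>} = f x ` fiber X x)"

lemma kernel_ofD:
  assumes "kernel_of X Y f A k"
  shows "is_rep K Q A" and "k \<in> rep_mor K Q A X" and "injective A k"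
    and "x \<in> verts Q \<Longrightarrow> k x ` fiber A x = {v \<in> fiber X x. f x v = \<zero>\<^bsub>space_at Y x\<^esub>}"
  using assms by (auto simp: kernel_of_def)

lemma cokernel_ofD:
  assumes "cokernel_of X Y f B c"
  shows "is_rep K Q B" and "c \<in> rep_mor K Q Y B" and "surjective Y B c"
    and "x \<in> verts Q \<Longrightarrow> {v \<in> fiber Y x. c x v = \<zero>\<^bsub>space_at B x\<^esub>} = f x ` fiber X x"
  using assms by (auto simp: cokernel_of_def)

lemma kernel_exists:
  fixes X :: "('v, 'a, 'k, 'u) rep"
  assumes "is_rep K Q X" "is_rep K Q Y" "f \<in> rep_mor K Q X Y"
  shows "\<exists>(A :: ('v, 'a, 'k, 'u) rep) k. kernel_of X Y f A k"
  using subrep_exists[OF assms(1) stable_kernel[OF assms]] unfolding kernel_of_def .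

lemma cokernel_exists:
  fixes Y :: "('v, 'a, 'k, 'u) rep"
  assumes "is_rep K Q X" "is_rep K Q Y" "locally_fin_dim K Q Y" "f \<in> rep_mor K Q X Y"
  shows "\<exists>(B :: ('v, 'a, 'k, 'u) rep) c. cokernel_of X Y f B c"
  using quotient_exists[OF assms(2,3) stable_image[OF assms(1,4)]] unfolding cokernel_of_def .

text \<open>A vertexwise kernel has the universal property against every representation by
  \<open>lift_inj\<close>, hence within each full subcategory that contains it.\<close>

lemma is_kernelI:
  assumes X: "X \<in> Obj (subcat P)" and A: "A \<in> Obj (subcat P)" and ker: "kernel_of X Y f A k"
  shows "is_kernel (subcat P) X Y f A k"
  unfolding is_kernel_def
proof (intro conjI ballI impI)
  note kA = kernel_ofD[OF ker]
  show "A \<in> Obj (subcat P)" by fact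
  show "k \<in> Mor (subcat P) A X" using kA by (simp add: subcat_simps)
  show "Comp (subcat P) A X Y f k = Zero (subcat P) A Y"
    using kA(4) by (auto simp: subcat_simps rep_hom_eq_iff)
  fix Z g assume "Z \<in> Obj (subcat P)" "g \<in> Mor (subcat P) Z X"
    and 0: "Comp (subcat P) Z X Y f g = Zero (subcat P) Z Y"
  then have Z: "is_rep K Q Z" and g: "g \<in> rep_mor K Q Z X" by (simp_all add: subcat_simps)
  have "\<forall>x\<in>verts Q. g x ` fiber Z x \<subseteq> k x ` fiber A x"
    using 0 kA(4) mor_closed[OF g] by (auto simp: subcat_simps rep_hom_eq_iff)
  then obtain h where h: "h \<in> rep_mor K Q Z A" "\<forall>x\<in>verts Q. \<forall>v\<in>fiber Z x. k x (h x v) = g x v"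
    using lift_inj[OF kA(1) Z kA(2,3) g] by blast
  show "\<exists>!h. h \<in> Mor (subcat P) Z A \<and> Comp (subcat P) Z A X k h = g"
  proof (rule ex1I[of _ h])
    show "h \<in> Mor (subcat P) Z A \<and> Comp (subcat P) Z A X k h = g"
      using h by (simp add: subcat_simps rep_hom_eq_mor_iff[OF g])
    fix h' assume "h' \<in> Mor (subcat P) Z A \<and> Comp (subcat P) Z A X k h' = g"
    then have h': "h' \<in> rep_mor K Q Z A" "\<forall>x\<in>verts Q. \<forall>v\<in>fiber Z x. k x (h' x v) = g x v"
      by (simp_all add: subcat_simps rep_hom_eq_mor_iff[OF g])
    show "h' = h"
    proof (rule rep_mor_eqI[OF h'(1) h(1)])
      show "h' x v = h x v" if x: "x \<in> verts Q" and v: "v \<in> fiber Z x" for x v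
        by (rule inj_onD[OF injectiveD[OF kA(3) x]])
          (use h h' x v mor_closed[OF h(1) x v] mor_closed[OF h'(1) x v] in auto)
    qed
  qed
qed

text \<open>Existence of the factorization is \<open>lift_surj\<close>; uniqueness holds because
  \<open>c\<close> is onto at every vertex.\<close>

lemma is_cokernelI:
  assumes Y: "Y \<in> Obj (subcat P)" and B: "B \<in> Obj (subcat P)" and X: "is_rep K Q X"
    and f: "f \<in> rep_mor K Q X Y" and cok: "cokernel_of X Y f B c"
  shows "is_cokernel (subcat P) X Y f B c"
  unfolding is_cokernel_def
proof (intro conjI ballI impI)
  note cB = cokernel_ofD[OF cok]
  have YR: "is_rep K Q Y" using Y by (simp add: subcat_simps)
  show "B \<in> Obj (subcat P)" by fact
  show "c \<in> Mor (subcat P) Y B" using cB by (simp add: subcat_simps)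
  show "Comp (subcat P) X Y B c f = Zero (subcat P) X B"
    using cB(4) mor_closed[OF f] by (auto simp: subcat_simps rep_hom_eq_iff)
  fix Z g assume "Z \<in> Obj (subcat P)" "g \<in> Mor (subcat P) Y Z"
    and 0: "Comp (subcat P) X Y Z g f = Zero (subcat P) X Z"
  then have Z: "is_rep K Q Z" and g: "g \<in> rep_mor K Q Y Z" by (simp_all add: subcat_simps)
  have g0: "g x (f x v) = \<zero>\<^bsub>space_at Z x\<^esub>" if "x \<in> verts Q" "v \<in> fiber X x" for x v
    using 0 that by (simp add: subcat_simps rep_hom_eq_iff)
  have "\<forall>x\<in>verts Q. \<forall>v\<in>fiber Y x. c x v = \<zero>\<^bsub>space_at B x\<^esub> \<longrightarrow> g x v = \<zero>\<^bsub>space_at Z x\<^esub>"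
  proof (intro ballI impI)
    fix x v assume x: "x \<in> verts Q" and "v \<in> fiber Y x" "c x v = \<zero>\<^bsub>space_at B x\<^esub>"
    then have "v \<in> f x ` fiber X x" using cB(4)[OF x] by blast
    then show "g x v = \<zero>\<^bsub>space_at Z x\<^esub>" using g0[OF x] by auto
  qed
  then obtain h where h: "h \<in> rep_mor K Q B Z" "\<forall>x\<in>verts Q. \<forall>v\<in>fiber Y x. h x (c x v) = g x v"
    using lift_surj[OF YR cB(1-3) g] by blast
  show "\<exists>!h. h \<in> Mor (subcat P) B Z \<and> Comp (subcat P) Y B Z h c = g"
  proof (rule ex1I[of _ h])
    show "h \<in> Mor (subcat P) B Z \<and> Comp (subcat P) Y B Z h c = g"
      using h by (simp add: subcat_simps rep_hom_eq_mor_iff[OF g])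
    fix h' assume "h' \<in> Mor (subcat P) B Z \<and> Comp (subcat P) Y B Z h' c = g"
    then have h': "h' \<in> rep_mor K Q B Z" "\<forall>x\<in>verts Q. \<forall>v\<in>fiber Y x. h' x (c x v) = g x v"
      by (simp_all add: subcat_simps rep_hom_eq_mor_iff[OF g])
    show "h' = h"
    proof (rule rep_mor_eqI[OF h'(1) h(1)])
      fix x b assume x: "x \<in> verts Q" and "b \<in> fiber B x"
      then obtain v where "v \<in> fiber Y x" "b = c x v" using surjectiveD[OF cB(3) x] by auto
      then show "h' x b = h x b" using h h' x by simp
    qed
  qed
qed

text \<open>The transport bijection is inverted so that \<open>\<psi>\<close> leads from the copy to
  the tuples; its components will be the projections.\<close>

lemma sum_copy_exists:
  fixes X Y :: "('v, 'a, 'k, 'u) rep" and \<iota> :: "'k list \<Rightarrow> 'u"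
  assumes X: "is_rep K Q X" and Y: "is_rep K Q Y" and fX: "locally_fin_dim K Q X" and fY: "locally_fin_dim K Q Y"
    and \<iota>: "inj_on \<iota> (lists (carrier K))"
  shows "\<exists>(S :: ('v, 'a, 'k, 'u) rep) \<psi>. is_rep K Q S \<and> locally_fin_dim K Q S \<and>
    \<psi> \<in> rep_mor K Q S (sum_rep [X, Y]) \<and> injective S \<psi> \<and> surjective S (sum_rep [X, Y]) \<psi>"
proof -
  have T: "is_rep K Q (sum_rep [X, Y])" using X Y by (intro sum_rep_rep) auto
  have fT: "locally_fin_dim K Q (sum_rep [X, Y])" using X Y fX fY by (intro sum_rep_fin_dim) auto
  obtain S :: "('v, 'a, 'k, 'u) rep" and \<phi>
    where S: "is_rep K Q S" "\<phi> \<in> rep_mor K Q (sum_rep [X, Y]) S"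
      "injective (sum_rep [X, Y]) \<phi>" "surjective (sum_rep [X, Y]) S \<phi>"
    using transport_rep[OF T fT \<iota>] by blast
  obtain \<psi> where \<psi>: "\<psi> \<in> rep_mor K Q S (sum_rep [X, Y])"
    "\<forall>x\<in>verts Q. (\<forall>v\<in>fiber S x. \<phi> x (\<psi> x v) = v) \<and> (\<forall>v\<in>fiber (sum_rep [X, Y]) x. \<psi> x (\<phi> x v) = v)"
    using inverse_mor[OF T S] by blast
  have "injective S \<psi>"
    unfolding injective_def
  proof
    fix x assume "x \<in> verts Q"
    then show "inj_on (\<psi> x) (fiber S x)" using \<psi>(2) by (intro inj_on_inverseI[of _ "\<phi> x"]) simp
  qed
  moreover have "surjective S (sum_rep [X, Y]) \<psi>"
    unfolding surjective_def
  proof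
    fix x assume x: "x \<in> verts Q"
    show "\<psi> x ` fiber S x = fiber (sum_rep [X, Y]) x"
    proof
      show "\<psi> x ` fiber S x \<subseteq> fiber (sum_rep [X, Y]) x" using mor_closed[OF \<psi>(1) x] by auto
      show "fiber (sum_rep [X, Y]) x \<subseteq> \<psi> x ` fiber S x"
      proof
        fix v assume v: "v \<in> fiber (sum_rep [X, Y]) x"
        then have "v = \<psi> x (\<phi> x v)" using \<psi>(2) x by simp
        then show "v \<in> \<psi> x ` fiber S x" using mor_closed[OF S(2) x v] by blast
      qed
    qed
  qed
  ultimately show ?thesis
    using S(1) \<psi>(1) locally_fin_dim_surj[OF S(2,4) fT] by (intro exI[of _ S] exI[of _ \<psi>] conjI)
qed

text \<open>Describes a vertexwise product by its projections only, so that later arguments see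
  neither the tuples of \<open>sum_rep\<close> nor the transport to \<open>'u\<close>.\<close>

definition product_of where
  "product_of X Y S p q \<longleftrightarrow> is_rep K Q S \<and> p \<in> rep_mor K Q S X \<and> q \<in> rep_mor K Q S Y \<and>
    (\<forall>x\<in>verts Q. \<forall>u\<in>fiber X x. \<forall>v\<in>fiber Y x. \<exists>!s. s \<in> fiber S x \<and> p x s = u \<and> q x s = v)"

lemma product_ofD:
  assumes "product_of X Y S p q"
  shows "is_rep K Q S" and "p \<in> rep_mor K Q S X" and "q \<in> rep_mor K Q S Y"
    and "x \<in> verts Q \<Longrightarrow> u \<in> fiber X x \<Longrightarrow> v \<in> fiber Y x \<Longrightarrow> \<exists>!s. s \<in> fiber S x \<and> p x s = u \<and> q x s = v"
  using assms unfolding product_of_def by blast+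

lemma product_eqI:
  assumes P: "product_of X Y S p q" and x: "x \<in> verts Q" and s: "s \<in> fiber S x" "s' \<in> fiber S x"
    and eq: "p x s = p x s'" "q x s = q x s'"
  shows "s = s'"
  using product_ofD(4)[OF P x mor_closed[OF product_ofD(2)[OF P] x s(1)] mor_closed[OF product_ofD(3)[OF P] x s(1)]]
    s eq by auto

lemma product_exists:
  fixes X Y :: "('v, 'a, 'k, 'u) rep" and \<iota> :: "'k list \<Rightarrow> 'u"
  assumes X: "is_rep K Q X" and Y: "is_rep K Q Y" and fX: "locally_fin_dim K Q X" and fY: "locally_fin_dim K Q Y"
    and \<iota>: "inj_on \<iota> (lists (carrier K))"
  shows "\<exists>(S :: ('v, 'a, 'k, 'u) rep) p q. locally_fin_dim K Q S \<and> product_of X Y S p q"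
proof -
  have T: "is_rep K Q (sum_rep [X, Y])" using X Y by (intro sum_rep_rep) auto
  obtain S :: "('v, 'a, 'k, 'u) rep" and \<psi> where S: "is_rep K Q S" "locally_fin_dim K Q S"
    and \<psi>: "\<psi> \<in> rep_mor K Q S (sum_rep [X, Y])" "injective S \<psi>" "surjective S (sum_rep [X, Y]) \<psi>"
    using sum_copy_exists[OF assms] by blast
  have space: "space_at (sum_rep [X, Y]) x = sum_space [space_at X x, space_at Y x]" for x
    by (simp add: sum_rep_def)
  have proj: "rep_hom S (\<lambda>x v. \<psi> x v i) \<in> rep_mor K Q S ([X, Y] ! i)" if i: "i < 2" for i
  proof (rule rep_hom_mor[OF S(1)])
    fix x assume x: "x \<in> verts Q"
    have "linear_map K (sum_space [space_at X x, space_at Y x]) ([space_at X x, space_at Y x] ! i) (\<lambda>v. v i)"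
      using rep_space[OF X x] rep_space[OF Y x] i by (intro sum_space_projection[OF field]) auto
    from linear_map_compose[OF mor_map[OF \<psi>(1) x, unfolded space] this]
    show "linear_map K (space_at S x) (space_at ([X, Y] ! i) x) (\<lambda>v. \<psi> x v i)"
      using i by (auto simp: less_2_cases_iff)
  next
    fix \<alpha> v assume \<alpha>: "\<alpha> \<in> arcs Q" and v: "v \<in> fiber S (tail Q \<alpha>)"
    show "\<psi> (head Q \<alpha>) (map_at S \<alpha> v) i = map_at ([X, Y] ! i) \<alpha> (\<psi> (tail Q \<alpha>) v i)"
      using mor_natural[OF \<psi>(1) \<alpha> v] i by (simp add: sum_rep_def)
  qed
  have "product_of X Y S (rep_hom S (\<lambda>x v. \<psi> x v 0)) (rep_hom S (\<lambda>x v. \<psi> x v 1))"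
    unfolding product_of_def
  proof (intro conjI ballI)
    show "rep_hom S (\<lambda>x v. \<psi> x v 0) \<in> rep_mor K Q S X" "rep_hom S (\<lambda>x v. \<psi> x v 1) \<in> rep_mor K Q S Y"
      using proj[of 0] proj[of 1] by simp_all
    fix x u v assume x: "x \<in> verts Q" and u: "u \<in> fiber X x" and v: "v \<in> fiber Y x"
    let ?w = "\<lambda>i\<in>{..<2::nat}. if i = 0 then u else v"
    have fib: "fiber (sum_rep [X, Y]) x = (\<Pi>\<^sub>E i\<in>{..<2}. [fiber X x, fiber Y x] ! i)"
    proof -
      have len: "{..<length [space_at X x, space_at Y x]} = {..<2}" by auto
      have car: "carrier ([space_at X x, space_at Y x] ! i) = [fiber X x, fiber Y x] ! i" if "i < 2" for i
        using that by (auto simp: less_2_cases_iff)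
      show ?thesis unfolding space sum_space_simps len by (rule PiE_cong) (simp add: car del: nth_Cons')
    qed
    have "?w \<in> fiber (sum_rep [X, Y]) x" using u v unfolding fib by (auto simp: less_2_cases_iff)
    then have "?w \<in> \<psi> x ` fiber S x" unfolding surjectiveD[OF \<psi>(3) x] .
    then obtain s where s: "s \<in> fiber S x" "\<psi> x s = ?w" by (metis imageE)
    show "\<exists>!s. s \<in> fiber S x \<and> rep_hom S (\<lambda>x v. \<psi> x v 0) x s = u \<and> rep_hom S (\<lambda>x v. \<psi> x v 1) x s = v"
    proof (rule ex1I[of _ s])
      fix s' assume s': "s' \<in> fiber S x \<and> rep_hom S (\<lambda>x v. \<psi> x v 0) x s' = u \<and> rep_hom S (\<lambda>x v. \<psi> x v 1) x s' = v"
      have "\<psi> x s' \<in> fiber (sum_rep [X, Y]) x" using mor_closed[OF \<psi>(1) x] s' by blast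
      then have "\<psi> x s' \<in> extensional {..<2}" unfolding fib by (simp add: PiE_def)
      then have "\<psi> x s' = ?w"
        by (rule extensionalityI[of _ "{..<2}"]) (use s' x in \<open>auto simp: less_2_cases_iff\<close>)
      then show "s' = s" using inj_onD[OF injectiveD[OF \<psi>(2) x], of s' s] s s' by simp
    qed (use s x in simp)
  qed (rule S(1))
  then show ?thesis using S(2) by blast
qed

text \<open>The pairing picks the unique element with the prescribed components. Linearity and
  naturality hold because both projections together detect equality, by
  \<open>product_eqI\<close>.\<close>

lemma product_pair:
  assumes P: "product_of X Y S p q" and Z: "is_rep K Q Z" and X: "is_rep K Q X" and Y: "is_rep K Q Y"
    and f: "f \<in> rep_mor K Q Z X" and g: "g \<in> rep_mor K Q Z Y"
  shows "\<exists>h\<in>rep_mor K Q Z S. \<forall>x\<in>verts Q. \<forall>v\<in>fiber Z x. p x (h x v) = f x v \<and> q x (h x v) = g x v"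
proof -
  note S = product_ofD(1)[OF P] and p = product_ofD(2)[OF P] and q = product_ofD(3)[OF P]
  define h where "h x v = (THE s. s \<in> fiber S x \<and> p x s = f x v \<and> q x s = g x v)" for x v
  have h: "h x v \<in> fiber S x \<and> p x (h x v) = f x v \<and> q x (h x v) = g x v" if "x \<in> verts Q" "v \<in> fiber Z x" for x v
    unfolding h_def
    by (rule theI'[OF product_ofD(4)[OF P that(1) mor_closed[OF f that] mor_closed[OF g that]]])
  have "rep_hom Z h \<in> rep_mor K Q Z S"
  proof (rule rep_hom_mor[OF Z])
    fix x assume x: "x \<in> verts Q"
    note F = linear_mapD[OF mor_map[OF f x]] and G = linear_mapD[OF mor_map[OF g x]]
    note PP = linear_mapD[OF mor_map[OF p x]] and QQ = linear_mapD[OF mor_map[OF q x]]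
    note SS = vectorspaceD[OF rep_space[OF S x]] and ZZ = vectorspaceD[OF rep_space[OF Z x]]
    show "linear_map K (space_at Z x) (space_at S x) (h x)"
    proof (rule linear_mapI[OF rep_space[OF Z x] rep_space[OF S x]])
      fix u v assume u: "u \<in> fiber Z x" and v: "v \<in> fiber Z x"
      show "h x (u \<oplus>\<^bsub>space_at Z x\<^esub> v) = h x u \<oplus>\<^bsub>space_at S x\<^esub> h x v"
        by (rule product_eqI[OF P x])
          (use h[OF x u] h[OF x v] h[OF x ZZ(2)[OF u v]] SS(2) PP(4) QQ(4) F(4) G(4) u v in simp_all)
    next
      fix c v assume c: "c \<in> carrier K" and v: "v \<in> fiber Z x"
      show "h x (c \<odot>\<^bsub>space_at Z x\<^esub> v) = c \<odot>\<^bsub>space_at S x\<^esub> h x v"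
        by (rule product_eqI[OF P x])
          (use h[OF x v] h[OF x ZZ(4)[OF c v]] SS(4) PP(5) QQ(5) F(5) G(5) c v in simp_all)
    qed (use h[OF x] in simp)
  next
    fix \<alpha> v assume \<alpha>: "\<alpha> \<in> arcs Q" and v: "v \<in> fiber Z (tail Q \<alpha>)"
    note t = tail_verts[OF \<alpha>] and hd = head_verts[OF \<alpha>]
    note hv = h[OF t v] and hz = h[OF hd rep_map_closed[OF Z \<alpha> v]]
    have hv': "h (tail Q \<alpha>) v \<in> fiber S (tail Q \<alpha>)" using hv by simp
    show "h (head Q \<alpha>) (map_at Z \<alpha> v) = map_at S \<alpha> (h (tail Q \<alpha>) v)"
      by (rule product_eqI[OF P hd])
        (use hv hz rep_map_closed[OF S \<alpha> hv'] mor_natural[OF p \<alpha> hv'] mor_natural[OF q \<alpha> hv']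
          mor_natural[OF f \<alpha> v] mor_natural[OF g \<alpha> v] in simp_all)
  qed
  then show ?thesis by (rule bexI[rotated]) (use h in simp)
qed

text \<open>The injections are the pairings of the identity with zero. The identity for the sum of
  the two composites is checked on both projections.\<close>

lemma is_biproductI:
  assumes X: "X \<in> Obj (subcat P)" and Y: "Y \<in> Obj (subcat P)" and S: "S \<in> Obj (subcat P)"
    and prod: "product_of X Y S p q"
  shows "\<exists>i j. is_biproduct (subcat P) X Y S i j p q"
proof -
  note XR = subcat_obj[OF X] and YR = subcat_obj[OF Y] and SR = subcat_obj[OF S]
  note p = product_ofD(2)[OF prod] and q = product_ofD(3)[OF prod]
  obtain i where i: "i \<in> rep_mor K Q X S"
    "\<forall>x\<in>verts Q. \<forall>v\<in>fiber X x. p x (i x v) = rep_hom X (\<lambda>x v. v) x v \<and> q x (i x v) = rep_hom X (\<lambda>x v. \<zero>\<^bsub>space_at Y x\<^esub>) x v"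
    using product_pair[OF prod XR XR YR identity_mor[OF XR] zero_mor[OF XR YR]] by blast
  obtain j where j: "j \<in> rep_mor K Q Y S"
    "\<forall>x\<in>verts Q. \<forall>v\<in>fiber Y x. p x (j x v) = rep_hom Y (\<lambda>x v. \<zero>\<^bsub>space_at X x\<^esub>) x v \<and> q x (j x v) = rep_hom Y (\<lambda>x v. v) x v"
    using product_pair[OF prod YR XR YR zero_mor[OF YR XR] identity_mor[OF YR]] by blast
  have "i x (p x s) \<oplus>\<^bsub>space_at S x\<^esub> j x (q x s) = s" if x: "x \<in> verts Q" and s: "s \<in> fiber S x" for x s
  proof (rule product_eqI[OF prod x])
    note ps = mor_closed[OF p x s] and qs = mor_closed[OF q x s]
    note ip = mor_closed[OF i(1) x ps] and jq = mor_closed[OF j(1) x qs]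
    show "i x (p x s) \<oplus>\<^bsub>space_at S x\<^esub> j x (q x s) \<in> fiber S x"
      using vs_add_closed[OF rep_space[OF SR x] ip jq] .
    show "p x (i x (p x s) \<oplus>\<^bsub>space_at S x\<^esub> j x (q x s)) = p x s"
      using linear_map_add[OF mor_map[OF p x] ip jq] i(2) j(2) x ps qs vs_add_zero[OF rep_space[OF XR x] ps] by simp
    show "q x (i x (p x s) \<oplus>\<^bsub>space_at S x\<^esub> j x (q x s)) = q x s"
      using linear_map_add[OF mor_map[OF q x] ip jq] i(2) j(2) x ps qs vs_zero_add[OF rep_space[OF YR x] qs] by simp
  qed (rule s)
  then have "is_biproduct (subcat P) X Y S i j p q"
    unfolding is_biproduct_def using S p q i j
    by (simp add: subcat_simps rep_hom_eq_iff mor_closed)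
  then show ?thesis by blast
qed

definition zero_rep :: "('v, 'a, 'k, 'u) rep \<Rightarrow> bool"
  where "zero_rep Z \<longleftrightarrow> is_rep K Q Z \<and> (\<forall>x\<in>verts Q. fiber Z x = {\<zero>\<^bsub>space_at Z x\<^esub>})"

text \<open>The empty direct sum has one-point fibres; its copy over \<open>'u\<close> is the
  required object.\<close>

lemma zero_rep_exists:
  fixes \<iota> :: "'k list \<Rightarrow> 'u"
  assumes \<iota>: "inj_on \<iota> (lists (carrier K))"
  shows "\<exists>Z :: ('v, 'a, 'k, 'u) rep. zero_rep Z \<and> locally_fin_dim K Q Z"
proof -
  let ?O = "sum_rep ([] :: ('v, 'a, 'k, 'u) rep list)"
  have O: "is_rep K Q ?O" "locally_fin_dim K Q ?O" by (auto intro!: sum_rep_rep sum_rep_fin_dim)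
  obtain Z :: "('v, 'a, 'k, 'u) rep" and \<phi> where Z: "is_rep K Q Z" "\<phi> \<in> rep_mor K Q ?O Z" "surjective ?O Z \<phi>"
    using transport_rep[OF O \<iota>] by blast
  have "fiber Z x = {\<zero>\<^bsub>space_at Z x\<^esub>}" if x: "x \<in> verts Q" for x
  proof -
    have "fiber Z x = \<phi> x ` fiber ?O x" using surjectiveD[OF Z(3) x] by simp
    then have "fiber Z x = {\<phi> x (\<lambda>_. undefined)}" by (simp add: sum_rep_def sum_space_simps)
    then show ?thesis using vs_zero_closed[OF rep_space[OF Z(1) x]] by simp
  qed
  then have "zero_rep Z" using Z(1) by (simp add: zero_rep_def)
  then show ?thesis using locally_fin_dim_surj[OF Z(2,3) O(2)] by blast
qed

lemma zero_objectI:
  assumes Z: "Z \<in> Obj (subcat P)" and zero: "zero_rep Z"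
  shows "zero_object (subcat P) Z"
  unfolding zero_object_def
proof (intro conjI ballI)
  note ZR = subcat_obj[OF Z]
  have fib: "fiber Z x = {\<zero>\<^bsub>space_at Z x\<^esub>}" if "x \<in> verts Q" for x using zero that by (simp add: zero_rep_def)
  fix X assume "X \<in> Obj (subcat P)"
  then have X: "is_rep K Q X" by (rule subcat_obj)
  show "\<exists>!f. f \<in> Mor (subcat P) X Z"
  proof (rule ex1I)
    show "rep_hom X (\<lambda>x v. \<zero>\<^bsub>space_at Z x\<^esub>) \<in> Mor (subcat P) X Z"
      using zero_mor[OF X ZR] by (simp add: subcat_simps)
    fix f assume "f \<in> Mor (subcat P) X Z"
    then have f: "f \<in> rep_mor K Q X Z" by (simp add: subcat_simps)
    show "f = rep_hom X (\<lambda>x v. \<zero>\<^bsub>space_at Z x\<^esub>)"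
      by (rule rep_mor_eqI[OF f zero_mor[OF X ZR]]) (use mor_closed[OF f] fib in auto)
  qed
  show "\<exists>!f. f \<in> Mor (subcat P) Z X"
  proof (rule ex1I)
    show "rep_hom Z (\<lambda>x v. \<zero>\<^bsub>space_at X x\<^esub>) \<in> Mor (subcat P) Z X"
      using zero_mor[OF ZR X] by (simp add: subcat_simps)
    fix f assume "f \<in> Mor (subcat P) Z X"
    then have f: "f \<in> rep_mor K Q Z X" by (simp add: subcat_simps)
    show "f = rep_hom Z (\<lambda>x v. \<zero>\<^bsub>space_at X x\<^esub>)"
      by (rule rep_mor_eqI[OF f zero_mor[OF ZR X]]) (use linear_map_zero[OF mor_map[OF f]] fib in auto)
  qed
qed (rule Z)

text \<open>Because kernels and cokernels stay in the subcategory and are vertexwise, monomorphisms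
  and epimorphisms of the subcategory turn out to be injective and surjective at every vertex. A
  vertexwise injective map is the kernel of its cokernel, and dually.\<close>

lemma subcat_abelian:
  fixes P :: "('v, 'a, 'k, 'u) rep \<Rightarrow> bool" and \<iota> :: "'k list \<Rightarrow> 'u"
  assumes \<iota>: "inj_on \<iota> (lists (carrier K))"
    and zero: "\<And>Z. zero_rep Z \<Longrightarrow> P Z"
    and ker: "\<And>X Y f A k. \<lbrakk>X \<in> Obj (subcat P); Y \<in> Obj (subcat P); f \<in> rep_mor K Q X Y;
      kernel_of X Y f A k\<rbrakk> \<Longrightarrow> P A"
    and cok: "\<And>X Y f B c. \<lbrakk>X \<in> Obj (subcat P); Y \<in> Obj (subcat P); f \<in> rep_mor K Q X Y;
      cokernel_of X Y f B c\<rbrakk> \<Longrightarrow> P B"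
    and prod: "\<And>X Y S p q. \<lbrakk>X \<in> Obj (subcat P); Y \<in> Obj (subcat P); locally_fin_dim K Q S;
      product_of X Y S p q\<rbrakk> \<Longrightarrow> P S"
  shows "abelian_category (subcat P)"
proof -
  have ker_ex: "\<exists>A k. A \<in> Obj (subcat P) \<and> kernel_of X Y f A k"
    if X: "X \<in> Obj (subcat P)" and Y: "Y \<in> Obj (subcat P)" and f: "f \<in> rep_mor K Q X Y" for X Y f
  proof -
    obtain A :: "('v, 'a, 'k, 'u) rep" and k where A: "kernel_of X Y f A k"
      using kernel_exists[OF subcat_obj[OF X] subcat_obj[OF Y] f] by blast
    have "locally_fin_dim K Q A"
      using locally_fin_dim_inj[OF kernel_ofD(2,3)[OF A]] X by (simp add: subcat_simps)
    then have "A \<in> Obj (subcat P)" using kernel_ofD(1)[OF A] ker[OF X Y f A] by (simp add: subcat_simps)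
    then show ?thesis using A by blast
  qed
  have cok_ex: "\<exists>B c. B \<in> Obj (subcat P) \<and> cokernel_of X Y f B c"
    if X: "X \<in> Obj (subcat P)" and Y: "Y \<in> Obj (subcat P)" and f: "f \<in> rep_mor K Q X Y" for X Y f
  proof -
    have fY: "locally_fin_dim K Q Y" using Y by (simp add: subcat_simps)
    obtain B :: "('v, 'a, 'k, 'u) rep" and c where B: "cokernel_of X Y f B c"
      using cokernel_exists[OF subcat_obj[OF X] subcat_obj[OF Y] fY f] by blast
    have "locally_fin_dim K Q B" using locally_fin_dim_surj[OF cokernel_ofD(2,3)[OF B] fY] .
    then have "B \<in> Obj (subcat P)" using cokernel_ofD(1)[OF B] cok[OF X Y f B] by (simp add: subcat_simps)
    then show ?thesis using B by blast
  qed
  show ?thesis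
  proof (rule abelian_category.intro[OF subcat_preadditive], rule abelian_category_axioms.intro)
    obtain Z :: "('v, 'a, 'k, 'u) rep" where Z: "zero_rep Z" "locally_fin_dim K Q Z"
      using zero_rep_exists[OF \<iota>] by blast
    then have "Z \<in> Obj (subcat P)" using zero[OF Z(1)] by (simp add: subcat_simps zero_rep_def)
    then show "\<exists>Z. zero_object (subcat P) Z" using zero_objectI Z(1) by blast
  next
    fix X Y assume X: "X \<in> Obj (subcat P)" and Y: "Y \<in> Obj (subcat P)"
    then have XY: "is_rep K Q X" "is_rep K Q Y" "locally_fin_dim K Q X" "locally_fin_dim K Q Y"
      by (simp_all add: subcat_simps)
    obtain S :: "('v, 'a, 'k, 'u) rep" and p q where S: "locally_fin_dim K Q S" "product_of X Y S p q"
      using product_exists[OF XY \<iota>] by blast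
    then have "S \<in> Obj (subcat P)" using prod[OF X Y S] product_ofD(1)[OF S(2)] by (simp add: subcat_simps)
    then show "\<exists>S i j p q. is_biproduct (subcat P) X Y S i j p q" using is_biproductI[OF X Y _ S(2)] by blast
  next
    fix X Y f assume X: "X \<in> Obj (subcat P)" and Y: "Y \<in> Obj (subcat P)" and "f \<in> Mor (subcat P) X Y"
    then have f: "f \<in> rep_mor K Q X Y" by (simp add: subcat_simps)
    show "\<exists>A k. is_kernel (subcat P) X Y f A k" using ker_ex[OF X Y f] is_kernelI[OF X] by blast
    show "\<exists>B c. is_cokernel (subcat P) X Y f B c"
      using cok_ex[OF X Y f] is_cokernelI[OF Y _ subcat_obj[OF X] f] by blast
  next
    fix X Y f assume X: "X \<in> Obj (subcat P)" and Y: "Y \<in> Obj (subcat P)" and mono: "is_mono (subcat P) X Y f"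
    note XR = subcat_obj[OF X]
    have f: "f \<in> rep_mor K Q X Y" using mono by (simp add: is_mono_def subcat_simps)
    obtain A k where A: "A \<in> Obj (subcat P)" "kernel_of X Y f A k" using ker_ex[OF X Y f] by blast
    note k = kernel_ofD[OF A(2)]
    have z: "rep_hom A (\<lambda>x v. \<zero>\<^bsub>space_at X x\<^esub>) \<in> Mor (subcat P) A X" "k \<in> Mor (subcat P) A X"
      using zero_mor[OF k(1) XR] k(2) by (simp_all add: subcat_simps)
    \<comment> \<open>The kernel inclusion and the zero morphism become equal after
      \<open>f\<close>; as \<open>A\<close> belongs to the subcategory, \<open>f\<close> may be
      cancelled.\<close>
    have "Comp (subcat P) A X Y f k = Comp (subcat P) A X Y f (rep_hom A (\<lambda>x v. \<zero>\<^bsub>space_at X x\<^esub>))"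
      using k(4) linear_map_zero[OF mor_map[OF f]] by (auto simp: subcat_simps rep_hom_eq_iff)
    then have k0: "k = rep_hom A (\<lambda>x v. \<zero>\<^bsub>space_at X x\<^esub>)"
      using mono A(1) z unfolding is_mono_def by blast
    have inj: "injective X f"
      unfolding injective_def
    proof
      fix x assume x: "x \<in> verts Q"
      show "inj_on (f x) (fiber X x)"
        unfolding linear_map_inj_iff[OF mor_map[OF f x]]
      proof (intro ballI impI)
        fix v assume "v \<in> fiber X x" "f x v = \<zero>\<^bsub>space_at Y x\<^esub>"
        then have "v \<in> k x ` fiber A x" using k(4)[OF x] by blast
        then show "v = \<zero>\<^bsub>space_at X x\<^esub>" using x by (auto simp: k0)
      qed
    qed
    obtain B c where B: "B \<in> Obj (subcat P)" "cokernel_of X Y f B c" using cok_ex[OF X Y f] by blast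
    \<comment> \<open>The vectors killed by the cokernel map are exactly the image of
      \<open>f\<close>, and \<open>f\<close> is injective.\<close>
    have "kernel_of Y B c X f"
      unfolding kernel_of_def using XR f inj cokernel_ofD(4)[OF B(2)] by simp
    then have "is_kernel (subcat P) Y B c X f" by (rule is_kernelI[OF Y X])
    moreover have "c \<in> Mor (subcat P) Y B" using cokernel_ofD(2)[OF B(2)] by (simp add: subcat_simps)
    ultimately show "\<exists>Z\<in>Obj (subcat P). \<exists>g\<in>Mor (subcat P) Y Z. is_kernel (subcat P) Y Z g X f"
      using B(1) by (intro bexI[of _ B] bexI[of _ c])
  next
    fix X Y f assume X: "X \<in> Obj (subcat P)" and Y: "Y \<in> Obj (subcat P)" and epi: "is_epi (subcat P) X Y f"
    note YR = subcat_obj[OF Y] and XR = subcat_obj[OF X]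
    have f: "f \<in> rep_mor K Q X Y" using epi by (simp add: is_epi_def subcat_simps)
    obtain B c where B: "B \<in> Obj (subcat P)" "cokernel_of X Y f B c" using cok_ex[OF X Y f] by blast
    note c = cokernel_ofD[OF B(2)]
    have z: "rep_hom Y (\<lambda>x v. \<zero>\<^bsub>space_at B x\<^esub>) \<in> Mor (subcat P) Y B" "c \<in> Mor (subcat P) Y B"
      using zero_mor[OF YR c(1)] c(2) by (simp_all add: subcat_simps)
    \<comment> \<open>The cokernel map and zero agree after precomposition with the epimorphism, so
      the cokernel map is zero and \<open>f\<close> is onto.\<close>
    have "Comp (subcat P) X Y B c f = Comp (subcat P) X Y B (rep_hom Y (\<lambda>x v. \<zero>\<^bsub>space_at B x\<^esub>)) f"
      using c(4) mor_closed[OF f] by (auto simp: subcat_simps rep_hom_eq_iff)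
    then have c0: "c = rep_hom Y (\<lambda>x v. \<zero>\<^bsub>space_at B x\<^esub>)"
      using epi B(1) z unfolding is_epi_def by blast
    have surj: "surjective X Y f"
      unfolding surjective_def
    proof
      fix x assume x: "x \<in> verts Q"
      have "{v \<in> fiber Y x. c x v = \<zero>\<^bsub>space_at B x\<^esub>} = fiber Y x" using x by (auto simp: c0)
      then show "f x ` fiber X x = fiber Y x" using c(4)[OF x] by simp
    qed
    obtain A k where A: "A \<in> Obj (subcat P)" "kernel_of X Y f A k" using ker_ex[OF X Y f] by blast
    note k = kernel_ofD[OF A(2)]
    have "cokernel_of A X k Y f"
      unfolding cokernel_of_def using YR f surj k(4) by simp
    then have "is_cokernel (subcat P) A X k Y f" by (rule is_cokernelI[OF X Y k(1,2)])
    moreover have "k \<in> Mor (subcat P) A X" using k(2) by (simp add: subcat_simps)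
    ultimately show "\<exists>Z\<in>Obj (subcat P). \<exists>g\<in>Mor (subcat P) Z X. is_cokernel (subcat P) Z X g Y f"
      using A(1) by (intro bexI[of _ A] bexI[of _ k])
  qed
qed

end

section \<open>Local generation and cogeneration\<close>

lemma Pi_lift:
  assumes "\<And>\<alpha>. \<alpha> \<in> S \<Longrightarrow> w \<alpha> \<in> h \<alpha> ` X \<alpha>"
  shows "\<exists>u\<in>Pi S X. \<forall>\<alpha>\<in>S. h \<alpha> (u \<alpha>) = w \<alpha>"
proof -
  have "\<forall>\<alpha>\<in>S. \<exists>u. u \<in> X \<alpha> \<and> h \<alpha> u = w \<alpha>" using assms by force
  then obtain u where "\<forall>\<alpha>\<in>S. u \<alpha> \<in> X \<alpha> \<and> h \<alpha> (u \<alpha>) = w \<alpha>"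
    using bchoice[of S "\<lambda>\<alpha> u. u \<in> X \<alpha> \<and> h \<alpha> u = w \<alpha>"] by blast
  then show ?thesis by (intro bexI[of _ u]) auto
qed

context quiver_reps
begin

text \<open>A tuple stands for an element of the sum of the spaces at the tails. Tuples are not
  extensional and must be compared on \<open>S\<close> only.\<close>

definition tail_tuples where "tail_tuples M S = (\<Pi> \<alpha>\<in>S. fiber M (tail Q \<alpha>))"
definition head_tuples where "head_tuples M S = (\<Pi> \<alpha>\<in>S. fiber M (head Q \<alpha>))"

definition arrow_sum where
  "arrow_sum M S y w = (\<Oplus>\<^bsub>space_at M y\<^esub>\<alpha>\<in>S. map_at M \<alpha> (w \<alpha>))"

text \<open>This and the next three definitions express injectivity and surjectivity of the
  comparison maps, from the sum over the tails to \<open>M(y)\<close> and from \<open>M(x)\<close>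
  to the product over the heads, without forming these spaces.\<close>

definition gen_surj where
  "gen_surj M S y \<longleftrightarrow> (\<forall>v\<in>fiber M y. \<exists>w\<in>tail_tuples M S. v = arrow_sum M S y w)"
definition gen_inj where
  "gen_inj M S y \<longleftrightarrow> (\<forall>w\<in>tail_tuples M S. arrow_sum M S y w = \<zero>\<^bsub>space_at M y\<^esub> \<longrightarrow>
    (\<forall>\<alpha>\<in>S. w \<alpha> = \<zero>\<^bsub>space_at M (tail Q \<alpha>)\<^esub>))"
definition cog_inj where
  "cog_inj M S x \<longleftrightarrow> (\<forall>v\<in>fiber M x. (\<forall>\<alpha>\<in>S. map_at M \<alpha> v = \<zero>\<^bsub>space_at M (head Q \<alpha>)\<^esub>) \<longrightarrow>
    v = \<zero>\<^bsub>space_at M x\<^esub>)"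
definition cog_surj where
  "cog_surj M S x \<longleftrightarrow> (\<forall>w\<in>head_tuples M S. \<exists>v\<in>fiber M x. \<forall>\<alpha>\<in>S. map_at M \<alpha> v = w \<alpha>)"

text \<open>The arrow set depends on \<open>A\<close> and the vertex but not on the representation.
  A morphism therefore induces a map between the sums for two representations, as the diagram chases
  require. For \<open>A = UNIV\<close> all incoming arrows are meant.\<close>

definition into where "into A y = {\<alpha> \<in> arcs Q. head Q \<alpha> = y \<and> tail Q \<alpha> \<in> A}"
definition out_to where "out_to A x = {\<alpha> \<in> arcs Q. tail Q \<alpha> = x \<and> head Q \<alpha> \<in> A}"

lemma into_mono: "A \<subseteq> A' \<Longrightarrow> into A y \<subseteq> into A' y"
  and out_to_mono: "A \<subseteq> A' \<Longrightarrow> out_to A x \<subseteq> out_to A' x"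
  by (auto simp: into_def out_to_def)

lemma intoD: "\<alpha> \<in> into A y \<Longrightarrow> \<alpha> \<in> arcs Q" "\<alpha> \<in> into A y \<Longrightarrow> head Q \<alpha> = y" "\<alpha> \<in> into A y \<Longrightarrow> tail Q \<alpha> \<in> A"
  by (auto simp: into_def)

lemma out_toD: "\<alpha> \<in> out_to A y \<Longrightarrow> \<alpha> \<in> arcs Q" "\<alpha> \<in> out_to A y \<Longrightarrow> tail Q \<alpha> = y" "\<alpha> \<in> out_to A y \<Longrightarrow> head Q \<alpha> \<in> A"
  by (auto simp: out_to_def)

lemma finite_into: "y \<in> verts Q \<Longrightarrow> finite (into A y)"
  by (rule finite_subset[OF _ finite_arcs_at]) (auto simp: into_def)

lemma tail_tuples_map:
  assumes M: "is_rep K Q M" and w: "w \<in> tail_tuples M (into A y)"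
  shows "(\<lambda>\<alpha>. map_at M \<alpha> (w \<alpha>)) \<in> into A y \<rightarrow> fiber M y"
proof
  fix \<alpha> assume \<alpha>: "\<alpha> \<in> into A y"
  then have "w \<alpha> \<in> fiber M (tail Q \<alpha>)" using w by (auto simp: tail_tuples_def)
  then show "map_at M \<alpha> (w \<alpha>) \<in> fiber M y" using rep_map_closed[OF M intoD(1)[OF \<alpha>]] intoD(2)[OF \<alpha>] by simp
qed

lemma arrow_sum_closed:
  assumes M: "is_rep K Q M" and y: "y \<in> verts Q" and w: "w \<in> tail_tuples M (into A y)"
  shows "arrow_sum M (into A y) y w \<in> fiber M y"
  unfolding arrow_sum_def by (rule vs_finsum_closed[OF rep_space[OF M y] tail_tuples_map[OF M w]])

lemma arrow_sum_cong:
  assumes M: "is_rep K Q M" and y: "y \<in> verts Q" and w: "w \<in> tail_tuples M (into A y)"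
    and eq: "\<forall>\<alpha>\<in>into A y. w' \<alpha> = w \<alpha>"
  shows "arrow_sum M (into A y) y w' = arrow_sum M (into A y) y w"
  unfolding arrow_sum_def
  by (rule abelian_monoid.finsum_cong'[OF vs_abelian_monoid[OF rep_space[OF M y]] refl tail_tuples_map[OF M w]])
    (use eq in simp)

lemma arrow_sum_add:
  assumes M: "is_rep K Q M" and y: "y \<in> verts Q" and w: "w \<in> tail_tuples M (into A y)" and w': "w' \<in> tail_tuples M (into A y)"
  shows "arrow_sum M (into A y) y (\<lambda>\<alpha>. w \<alpha> \<oplus>\<^bsub>space_at M (tail Q \<alpha>)\<^esub> w' \<alpha>) =
    arrow_sum M (into A y) y w \<oplus>\<^bsub>space_at M y\<^esub> arrow_sum M (into A y) y w'"
proof -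
  interpret vectorspace K "space_at M y" using rep_space[OF M y] .
  note c = tail_tuples_map[OF M w] tail_tuples_map[OF M w']
  have "arrow_sum M (into A y) y (\<lambda>\<alpha>. w \<alpha> \<oplus>\<^bsub>space_at M (tail Q \<alpha>)\<^esub> w' \<alpha>) =
      (\<Oplus>\<^bsub>space_at M y\<^esub>\<alpha>\<in>into A y. map_at M \<alpha> (w \<alpha>) \<oplus>\<^bsub>space_at M y\<^esub> map_at M \<alpha> (w' \<alpha>))"
    unfolding arrow_sum_def
  proof (rule M.finsum_cong'[OF refl])
    fix \<alpha> assume \<alpha>: "\<alpha> \<in> into A y"
    have "w \<alpha> \<in> fiber M (tail Q \<alpha>)" "w' \<alpha> \<in> fiber M (tail Q \<alpha>)"
      using w w' \<alpha> by (auto simp: tail_tuples_def)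
    then show "map_at M \<alpha> (w \<alpha> \<oplus>\<^bsub>space_at M (tail Q \<alpha>)\<^esub> w' \<alpha>) = map_at M \<alpha> (w \<alpha>) \<oplus>\<^bsub>space_at M y\<^esub> map_at M \<alpha> (w' \<alpha>)"
      using linear_map_add[OF rep_map[OF M intoD(1)[OF \<alpha>]]] intoD(2)[OF \<alpha>] by simp
  qed (use c in auto)
  also have "\<dots> = arrow_sum M (into A y) y w \<oplus>\<^bsub>space_at M y\<^esub> arrow_sum M (into A y) y w'"
    unfolding arrow_sum_def by (rule M.finsum_addf) (use c in auto)
  finally show ?thesis .
qed

text \<open>The commuting square underlying every chase with incoming arrows.\<close>

lemma arrow_sum_mor:
  assumes f: "f \<in> rep_mor K Q M N" and M: "is_rep K Q M" and N: "is_rep K Q N" and y: "y \<in> verts Q"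
    and w: "w \<in> tail_tuples M (into A y)"
  shows "f y (arrow_sum M (into A y) y w) = arrow_sum N (into A y) y (\<lambda>\<alpha>. f (tail Q \<alpha>) (w \<alpha>))"
    and "(\<lambda>\<alpha>. f (tail Q \<alpha>) (w \<alpha>)) \<in> tail_tuples N (into A y)"
proof -
  show fw: "(\<lambda>\<alpha>. f (tail Q \<alpha>) (w \<alpha>)) \<in> tail_tuples N (into A y)"
    unfolding tail_tuples_def
  proof
    fix \<alpha> assume \<alpha>: "\<alpha> \<in> into A y"
    then have "w \<alpha> \<in> fiber M (tail Q \<alpha>)" using w by (auto simp: tail_tuples_def)
    then show "f (tail Q \<alpha>) (w \<alpha>) \<in> fiber N (tail Q \<alpha>)"
      using mor_closed[OF f tail_verts[OF intoD(1)[OF \<alpha>]]] by blast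
  qed
  have "f y (arrow_sum M (into A y) y w) = (\<Oplus>\<^bsub>space_at N y\<^esub>\<alpha>\<in>into A y. f y (map_at M \<alpha> (w \<alpha>)))"
    unfolding arrow_sum_def by (rule linear_map_finsum[OF mor_map[OF f y] tail_tuples_map[OF M w]])
  also have "\<dots> = arrow_sum N (into A y) y (\<lambda>\<alpha>. f (tail Q \<alpha>) (w \<alpha>))"
    unfolding arrow_sum_def
  proof (rule abelian_monoid.finsum_cong'[OF vs_abelian_monoid[OF rep_space[OF N y]] refl tail_tuples_map[OF N fw]])
    fix \<alpha> assume \<alpha>: "\<alpha> \<in> into A y"
    then have "w \<alpha> \<in> fiber M (tail Q \<alpha>)" using w by (auto simp: tail_tuples_def)
    then show "f y (map_at M \<alpha> (w \<alpha>)) = map_at N \<alpha> (f (tail Q \<alpha>) (w \<alpha>))"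
      using mor_natural[OF f intoD(1)[OF \<alpha>]] intoD(2)[OF \<alpha>] by simp
  qed
  finally show "f y (arrow_sum M (into A y) y w) = arrow_sum N (into A y) y (\<lambda>\<alpha>. f (tail Q \<alpha>) (w \<alpha>))" .
qed

lemma tail_tuples_minus:
  assumes "is_rep K Q M" and "w \<in> tail_tuples M (into A y)" and "w' \<in> tail_tuples M (into A y)"
  shows "(\<lambda>\<alpha>. w \<alpha> \<ominus>\<^bsub>space_at M (tail Q \<alpha>)\<^esub> w' \<alpha>) \<in> tail_tuples M (into A y)"
  unfolding tail_tuples_def
proof
  fix \<alpha> assume \<alpha>: "\<alpha> \<in> into A y"
  then have "w \<alpha> \<in> fiber M (tail Q \<alpha>)" "w' \<alpha> \<in> fiber M (tail Q \<alpha>)"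
    using assms(2,3) by (auto simp: tail_tuples_def)
  then show "w \<alpha> \<ominus>\<^bsub>space_at M (tail Q \<alpha>)\<^esub> w' \<alpha> \<in> fiber M (tail Q \<alpha>)"
    by (rule vs_minus_closed[OF rep_space[OF assms(1) tail_verts[OF intoD(1)[OF \<alpha>]]]])
qed

text \<open>\<open>gen_inj\<close> speaks of the kernel only; subtracting the two tuples recovers
  cancellation.\<close>

lemma gen_inj_eq:
  assumes inj: "gen_inj M (into A y) y" and M: "is_rep K Q M" and y: "y \<in> verts Q"
    and w: "w \<in> tail_tuples M (into A y)" and w': "w' \<in> tail_tuples M (into A y)"
    and eq: "arrow_sum M (into A y) y w = arrow_sum M (into A y) y w'" and \<alpha>: "\<alpha> \<in> into A y"
  shows "w \<alpha> = w' \<alpha>"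
proof -
  interpret V: vectorspace K "space_at M y" using rep_space[OF M y] .
  let ?d = "\<lambda>\<alpha>. w \<alpha> \<ominus>\<^bsub>space_at M (tail Q \<alpha>)\<^esub> w' \<alpha>"
  note d = tail_tuples_minus[OF M w w']
  have wc: "w \<alpha> \<in> fiber M (tail Q \<alpha>)" "w' \<alpha> \<in> fiber M (tail Q \<alpha>)" if "\<alpha> \<in> into A y" for \<alpha>
    using that w w' by (auto simp: tail_tuples_def)
  have "arrow_sum M (into A y) y w = arrow_sum M (into A y) y (\<lambda>\<alpha>. ?d \<alpha> \<oplus>\<^bsub>space_at M (tail Q \<alpha>)\<^esub> w' \<alpha>)"
    by (rule arrow_sum_cong[OF M y w, symmetric])
      (use vs_minus_add[OF rep_space[OF M tail_verts]] wc in \<open>auto simp: into_def\<close>)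
  also have "\<dots> = arrow_sum M (into A y) y ?d \<oplus>\<^bsub>space_at M y\<^esub> arrow_sum M (into A y) y w'"
    by (rule arrow_sum_add[OF M y d w'])
  finally have "arrow_sum M (into A y) y ?d \<oplus>\<^bsub>space_at M y\<^esub> arrow_sum M (into A y) y w' = arrow_sum M (into A y) y w'"
    using eq by simp
  then have "arrow_sum M (into A y) y ?d = \<zero>\<^bsub>space_at M y\<^esub>"
    using arrow_sum_closed[OF M y d] arrow_sum_closed[OF M y w'] by (simp only: V.M.show_l_zero)
  then have "?d \<alpha> = \<zero>\<^bsub>space_at M (tail Q \<alpha>)\<^esub>" by (rule inj[unfolded gen_inj_def, rule_format, OF d _ \<alpha>])
  then show ?thesis
    using vs_minus_zero_iff[OF rep_space[OF M tail_verts[OF intoD(1)[OF \<alpha>]]] wc[OF \<alpha>]] by simp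
qed

lemma gen_injI:
  assumes "\<And>w. w \<in> tail_tuples M (into A y) \<Longrightarrow> arrow_sum M (into A y) y w = \<zero>\<^bsub>space_at M y\<^esub> \<Longrightarrow>
    \<forall>\<alpha>\<in>into A y. w \<alpha> = \<zero>\<^bsub>space_at M (tail Q \<alpha>)\<^esub>"
  shows "gen_inj M (into A y) y"
  using assms unfolding gen_inj_def by blast

lemma gen_injD:
  "gen_inj M (into A y) y \<Longrightarrow> w \<in> tail_tuples M (into A y) \<Longrightarrow> arrow_sum M (into A y) y w = \<zero>\<^bsub>space_at M y\<^esub> \<Longrightarrow>
    \<alpha> \<in> into A y \<Longrightarrow> w \<alpha> = \<zero>\<^bsub>space_at M (tail Q \<alpha>)\<^esub>"
  unfolding gen_inj_def by blast

lemma gen_surjD: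
  assumes "gen_surj M (into A y) y" and "v \<in> fiber M y"
  obtains w where "w \<in> tail_tuples M (into A y)" and "v = arrow_sum M (into A y) y w"
  using assms unfolding gen_surj_def by blast

lemma tail_tuples_lift:
  assumes "\<And>\<alpha>. \<alpha> \<in> into A y \<Longrightarrow> w \<alpha> \<in> f (tail Q \<alpha>) ` fiber M (tail Q \<alpha>)"
  shows "\<exists>u\<in>tail_tuples M (into A y). \<forall>\<alpha>\<in>into A y. f (tail Q \<alpha>) (u \<alpha>) = w \<alpha>"
  unfolding tail_tuples_def
  using Pi_lift[of "into A y" w "\<lambda>\<alpha>. f (tail Q \<alpha>)" "\<lambda>\<alpha>. fiber M (tail Q \<alpha>)"] assms by blast

lemma mor_zero_iff:
  assumes k: "k \<in> rep_mor K Q A X" and "inj_on (k x) (fiber A x)" and x: "x \<in> verts Q" and v: "v \<in> fiber A x"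
  shows "k x v = \<zero>\<^bsub>space_at X x\<^esub> \<longleftrightarrow> v = \<zero>\<^bsub>space_at A x\<^esub>"
  using assms linear_map_inj_iff[OF mor_map[OF k x]] linear_map_zero[OF mor_map[OF k x]] by auto

text \<open>Here and in the next lemmas the five lemma is split into halves with hypotheses at
  \<open>y\<close> and at the relevant tails only. The same halves then serve kernels, cokernels and
  morphisms that are isomorphisms merely near \<open>y\<close>.\<close>

lemma gen_inj_sub:
  assumes k: "k \<in> rep_mor K Q N X" and N: "is_rep K Q N" and X: "is_rep K Q X" and y: "y \<in> verts Q"
    and inj: "\<And>\<alpha>. \<alpha> \<in> into A y \<Longrightarrow> inj_on (k (tail Q \<alpha>)) (fiber N (tail Q \<alpha>))"
    and gX: "gen_inj X (into A y) y"
  shows "gen_inj N (into A y) y"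
proof (rule gen_injI, rule ballI)
  fix w \<alpha> assume w: "w \<in> tail_tuples N (into A y)" and 0: "arrow_sum N (into A y) y w = \<zero>\<^bsub>space_at N y\<^esub>"
    and \<alpha>: "\<alpha> \<in> into A y"
  have "arrow_sum X (into A y) y (\<lambda>\<alpha>. k (tail Q \<alpha>) (w \<alpha>)) = \<zero>\<^bsub>space_at X y\<^esub>"
    using arrow_sum_mor(1)[OF k N X y w] 0 linear_map_zero[OF mor_map[OF k y]] by simp
  then have "k (tail Q \<alpha>) (w \<alpha>) = \<zero>\<^bsub>space_at X (tail Q \<alpha>)\<^esub>"
    using gen_injD[OF gX arrow_sum_mor(2)[OF k N X y w] _ \<alpha>] by simp
  moreover have "w \<alpha> \<in> fiber N (tail Q \<alpha>)" using w \<alpha> by (auto simp: tail_tuples_def)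
  ultimately show "w \<alpha> = \<zero>\<^bsub>space_at N (tail Q \<alpha>)\<^esub>"
    using mor_zero_iff[OF k inj[OF \<alpha>] tail_verts[OF intoD(1)[OF \<alpha>]]] by simp
qed

text \<open>The hypothesis \<open>lift\<close> is what the chase has to supply: a tuple of
  \<open>X\<close> whose sum comes from \<open>N\<close> comes from \<open>N\<close> entrywise. For
  a kernel it follows from injectivity on the target of the map.\<close>

lemma gen_surj_sub:
  assumes k: "k \<in> rep_mor K Q N X" and N: "is_rep K Q N" and X: "is_rep K Q X" and y: "y \<in> verts Q"
    and inj: "inj_on (k y) (fiber N y)"
    and lift: "\<And>w \<alpha>. w \<in> tail_tuples X (into A y) \<Longrightarrow> arrow_sum X (into A y) y w \<in> k y ` fiber N y \<Longrightarrow>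
      \<alpha> \<in> into A y \<Longrightarrow> w \<alpha> \<in> k (tail Q \<alpha>) ` fiber N (tail Q \<alpha>)"
    and gX: "gen_surj X (into A y) y"
  shows "gen_surj N (into A y) y"
  unfolding gen_surj_def
proof
  fix v assume v: "v \<in> fiber N y"
  obtain w where w: "w \<in> tail_tuples X (into A y)" and kv: "k y v = arrow_sum X (into A y) y w"
    using gen_surjD[OF gX mor_closed[OF k y v]] by blast
  have "arrow_sum X (into A y) y w \<in> k y ` fiber N y" using imageI[OF v, of "k y"] kv by simp
  then have "w \<alpha> \<in> k (tail Q \<alpha>) ` fiber N (tail Q \<alpha>)" if "\<alpha> \<in> into A y" for \<alpha>
    using lift[OF w _ that] by blast
  then obtain u where u: "u \<in> tail_tuples N (into A y)" "\<forall>\<alpha>\<in>into A y. k (tail Q \<alpha>) (u \<alpha>) = w \<alpha>"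
    using tail_tuples_lift[of A y w k N] by blast
  have "k y (arrow_sum N (into A y) y u) = k y v"
    using arrow_sum_mor(1)[OF k N X y u(1)] arrow_sum_cong[OF X y w, of "\<lambda>\<alpha>. k (tail Q \<alpha>) (u \<alpha>)"] u(2) kv by simp
  then have "v = arrow_sum N (into A y) y u"
    using inj_onD[OF inj _ arrow_sum_closed[OF N y u(1)] v] by simp
  then show "\<exists>w\<in>tail_tuples N (into A y). v = arrow_sum N (into A y) y w" using u(1) by blast
qed

lemma gen_surj_quot:
  assumes c: "c \<in> rep_mor K Q X N" and X: "is_rep K Q X" and N: "is_rep K Q N" and y: "y \<in> verts Q"
    and surj: "c y ` fiber X y = fiber N y" and gX: "gen_surj X (into A y) y"
  shows "gen_surj N (into A y) y"
  unfolding gen_surj_def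
proof
  fix v assume "v \<in> fiber N y"
  then obtain u where u: "u \<in> fiber X y" "v = c y u" using surj by blast
  obtain w where w: "w \<in> tail_tuples X (into A y)" "u = arrow_sum X (into A y) y w"
    using gen_surjD[OF gX u(1)] by blast
  then show "\<exists>w\<in>tail_tuples N (into A y). v = arrow_sum N (into A y) y w"
    using u(2) arrow_sum_mor[OF c X N y w(1)] by auto
qed

text \<open>A tuple over \<open>N\<close> with zero sum is lifted to \<open>X\<close>. Its sum is
  killed by \<open>c\<close>, so by \<open>lift\<close> it is also the sum of a tuple killed
  entrywise, and injectivity on \<open>X\<close> identifies the two tuples.\<close>

lemma gen_inj_quot:
  assumes c: "c \<in> rep_mor K Q X N" and X: "is_rep K Q X" and N: "is_rep K Q N" and y: "y \<in> verts Q"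
    and surj: "\<And>\<alpha>. \<alpha> \<in> into A y \<Longrightarrow> c (tail Q \<alpha>) ` fiber X (tail Q \<alpha>) = fiber N (tail Q \<alpha>)"
    and lift: "\<And>v. v \<in> fiber X y \<Longrightarrow> c y v = \<zero>\<^bsub>space_at N y\<^esub> \<Longrightarrow>
      \<exists>w\<in>tail_tuples X (into A y). v = arrow_sum X (into A y) y w \<and>
        (\<forall>\<alpha>\<in>into A y. c (tail Q \<alpha>) (w \<alpha>) = \<zero>\<^bsub>space_at N (tail Q \<alpha>)\<^esub>)"
    and gX: "gen_inj X (into A y) y"
  shows "gen_inj N (into A y) y"
proof (rule gen_injI, rule ballI)
  fix w \<alpha> assume w: "w \<in> tail_tuples N (into A y)" and 0: "arrow_sum N (into A y) y w = \<zero>\<^bsub>space_at N y\<^esub>"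
    and \<alpha>: "\<alpha> \<in> into A y"
  have "w \<alpha> \<in> c (tail Q \<alpha>) ` fiber X (tail Q \<alpha>)" if "\<alpha> \<in> into A y" for \<alpha>
    using surj[OF that] w that by (auto simp: tail_tuples_def)
  then obtain u where u: "u \<in> tail_tuples X (into A y)" "\<forall>\<alpha>\<in>into A y. c (tail Q \<alpha>) (u \<alpha>) = w \<alpha>"
    using tail_tuples_lift[of A y w c X] by blast
  have "c y (arrow_sum X (into A y) y u) = \<zero>\<^bsub>space_at N y\<^esub>"
    using arrow_sum_mor(1)[OF c X N y u(1)] arrow_sum_cong[OF N y w, of "\<lambda>\<alpha>. c (tail Q \<alpha>) (u \<alpha>)"] u(2) 0 by simp
  then obtain u' where u': "u' \<in> tail_tuples X (into A y)" "arrow_sum X (into A y) y u = arrow_sum X (into A y) y u'"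
      "\<forall>\<alpha>\<in>into A y. c (tail Q \<alpha>) (u' \<alpha>) = \<zero>\<^bsub>space_at N (tail Q \<alpha>)\<^esub>"
    using lift[OF arrow_sum_closed[OF X y u(1)]] by blast
  have "u \<alpha> = u' \<alpha>" using gen_inj_eq[OF gX X y u(1) u'(1,2) \<alpha>] .
  then show "w \<alpha> = \<zero>\<^bsub>space_at N (tail Q \<alpha>)\<^esub>" using u(2) u'(3) \<alpha> by metis
qed

section \<open>The same chases for outgoing arrows\<close>

lemma head_tuples_lift:
  assumes "\<And>\<alpha>. \<alpha> \<in> out_to D x \<Longrightarrow> w \<alpha> \<in> f (head Q \<alpha>) ` fiber M (head Q \<alpha>)"
  shows "\<exists>u\<in>head_tuples M (out_to D x). \<forall>\<alpha>\<in>out_to D x. f (head Q \<alpha>) (u \<alpha>) = w \<alpha>"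
  unfolding head_tuples_def
  using Pi_lift[of "out_to D x" w "\<lambda>\<alpha>. f (head Q \<alpha>)" "\<lambda>\<alpha>. fiber M (head Q \<alpha>)"] assms by blast

lemma out_natural:
  "f \<in> rep_mor K Q M N \<Longrightarrow> \<alpha> \<in> out_to D x \<Longrightarrow> v \<in> fiber M x \<Longrightarrow>
    f (head Q \<alpha>) (map_at M \<alpha> v) = map_at N \<alpha> (f x v)"
  using mor_natural[of f M N \<alpha> v] by (auto simp: out_to_def)

lemma out_closed:
  "is_rep K Q M \<Longrightarrow> \<alpha> \<in> out_to D x \<Longrightarrow> v \<in> fiber M x \<Longrightarrow> map_at M \<alpha> v \<in> fiber M (head Q \<alpha>)"
  using rep_map_closed[of M \<alpha> v] by (auto simp: out_to_def)

lemma out_minus: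
  "is_rep K Q M \<Longrightarrow> \<alpha> \<in> out_to D x \<Longrightarrow> u \<in> fiber M x \<Longrightarrow> v \<in> fiber M x \<Longrightarrow>
    map_at M \<alpha> (u \<ominus>\<^bsub>space_at M x\<^esub> v) = map_at M \<alpha> u \<ominus>\<^bsub>space_at M (head Q \<alpha>)\<^esub> map_at M \<alpha> v"
  using linear_map_minus[OF rep_map[of M \<alpha>], of u v] by (auto simp: out_to_def)

lemma cog_inj_sub:
  assumes k: "k \<in> rep_mor K Q N X" and X: "is_rep K Q X" and x: "x \<in> verts Q"
    and inj: "inj_on (k x) (fiber N x)" and gX: "cog_inj X (out_to D x) x"
  shows "cog_inj N (out_to D x) x"
  unfolding cog_inj_def
proof (intro ballI impI)
  fix v assume v: "v \<in> fiber N x" and 0: "\<forall>\<alpha>\<in>out_to D x. map_at N \<alpha> v = \<zero>\<^bsub>space_at N (head Q \<alpha>)\<^esub>"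
  have "map_at X \<alpha> (k x v) = \<zero>\<^bsub>space_at X (head Q \<alpha>)\<^esub>" if "\<alpha> \<in> out_to D x" for \<alpha>
    using out_natural[OF k that v] 0 that linear_map_zero[OF mor_map[OF k head_verts[OF out_toD(1)[OF that]]]] by simp
  then have "k x v = \<zero>\<^bsub>space_at X x\<^esub>" using gX mor_closed[OF k x v] unfolding cog_inj_def by blast
  then show "v = \<zero>\<^bsub>space_at N x\<^esub>" using mor_zero_iff[OF k inj x v] by simp
qed

text \<open>The prescribed values are realised in \<open>X\<close> first; \<open>lift\<close> says
  that a vector whose images all come from \<open>N\<close> comes from \<open>N\<close>
  itself.\<close>

lemma cog_surj_sub:
  assumes k: "k \<in> rep_mor K Q N X" and N: "is_rep K Q N" and x: "x \<in> verts Q"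
    and inj: "\<And>\<alpha>. \<alpha> \<in> out_to D x \<Longrightarrow> inj_on (k (head Q \<alpha>)) (fiber N (head Q \<alpha>))"
    and lift: "\<And>v. v \<in> fiber X x \<Longrightarrow> (\<And>\<alpha>. \<alpha> \<in> out_to D x \<Longrightarrow> map_at X \<alpha> v \<in> k (head Q \<alpha>) ` fiber N (head Q \<alpha>)) \<Longrightarrow>
      v \<in> k x ` fiber N x"
    and gX: "cog_surj X (out_to D x) x"
  shows "cog_surj N (out_to D x) x"
  unfolding cog_surj_def
proof
  fix w assume w: "w \<in> head_tuples N (out_to D x)"
  have wc: "w \<alpha> \<in> fiber N (head Q \<alpha>)" if "\<alpha> \<in> out_to D x" for \<alpha> using w that by (auto simp: head_tuples_def)
  have "(\<lambda>\<alpha>. k (head Q \<alpha>) (w \<alpha>)) \<in> head_tuples X (out_to D x)"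
    using mor_closed[OF k head_verts[OF out_toD(1)] wc] by (auto simp: head_tuples_def)
  from gX[unfolded cog_surj_def, rule_format, OF this]
  obtain v where v: "v \<in> fiber X x" "\<forall>\<alpha>\<in>out_to D x. map_at X \<alpha> v = k (head Q \<alpha>) (w \<alpha>)"
    by blast
  have "v \<in> k x ` fiber N x" by (rule lift[OF v(1)]) (use v(2) wc in auto)
  then obtain u where u: "u \<in> fiber N x" "v = k x u" by blast
  have "map_at N \<alpha> u = w \<alpha>" if "\<alpha> \<in> out_to D x" for \<alpha>
    by (rule inj_onD[OF inj[OF that]])
      (use out_natural[OF k that u(1)] v(2) u that wc[OF that] out_closed[OF N that u(1)] in auto)
  then show "\<exists>v\<in>fiber N x. \<forall>\<alpha>\<in>out_to D x. map_at N \<alpha> v = w \<alpha>" using u(1) by blast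
qed

lemma cog_surj_quot:
  assumes c: "c \<in> rep_mor K Q X N" and x: "x \<in> verts Q"
    and surj: "\<And>\<alpha>. \<alpha> \<in> out_to D x \<Longrightarrow> c (head Q \<alpha>) ` fiber X (head Q \<alpha>) = fiber N (head Q \<alpha>)"
    and gX: "cog_surj X (out_to D x) x"
  shows "cog_surj N (out_to D x) x"
  unfolding cog_surj_def
proof
  fix w assume w: "w \<in> head_tuples N (out_to D x)"
  have "w \<alpha> \<in> c (head Q \<alpha>) ` fiber X (head Q \<alpha>)" if "\<alpha> \<in> out_to D x" for \<alpha>
    using surj[OF that] w that by (auto simp: head_tuples_def)
  then obtain u where u: "u \<in> head_tuples X (out_to D x)" "\<forall>\<alpha>\<in>out_to D x. c (head Q \<alpha>) (u \<alpha>) = w \<alpha>"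
    using head_tuples_lift[of D x w c X] by blast
  then obtain v where v: "v \<in> fiber X x" "\<forall>\<alpha>\<in>out_to D x. map_at X \<alpha> v = u \<alpha>"
    using gX unfolding cog_surj_def by blast
  have "map_at N \<alpha> (c x v) = w \<alpha>" if "\<alpha> \<in> out_to D x" for \<alpha>
    using out_natural[OF c that v(1)] v(2) u(2) that by simp
  then show "\<exists>v\<in>fiber N x. \<forall>\<alpha>\<in>out_to D x. map_at N \<alpha> v = w \<alpha>"
    using mor_closed[OF c x v(1)] by blast
qed

text \<open>By \<open>lift\<close>, a representative \<open>v\<close> has the same arrow images as
  some \<open>u\<close> killed by \<open>c\<close>. Injectivity on \<open>X\<close> gives that they
  are equal, so the class of \<open>v\<close> is zero.\<close>

lemma cog_inj_quot:
  assumes c: "c \<in> rep_mor K Q X N" and X: "is_rep K Q X" and x: "x \<in> verts Q"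
    and surj: "c x ` fiber X x = fiber N x"
    and lift: "\<And>v. v \<in> fiber X x \<Longrightarrow> (\<And>\<alpha>. \<alpha> \<in> out_to D x \<Longrightarrow> c (head Q \<alpha>) (map_at X \<alpha> v) = \<zero>\<^bsub>space_at N (head Q \<alpha>)\<^esub>) \<Longrightarrow>
      \<exists>u\<in>fiber X x. c x u = \<zero>\<^bsub>space_at N x\<^esub> \<and> (\<forall>\<alpha>\<in>out_to D x. map_at X \<alpha> u = map_at X \<alpha> v)"
    and gX: "cog_inj X (out_to D x) x"
  shows "cog_inj N (out_to D x) x"
  unfolding cog_inj_def
proof (intro ballI impI)
  fix b assume "b \<in> fiber N x" and 0: "\<forall>\<alpha>\<in>out_to D x. map_at N \<alpha> b = \<zero>\<^bsub>space_at N (head Q \<alpha>)\<^esub>"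
  then obtain v where v: "v \<in> fiber X x" "b = c x v" using surj by blast
  have "c (head Q \<alpha>) (map_at X \<alpha> v) = \<zero>\<^bsub>space_at N (head Q \<alpha>)\<^esub>" if "\<alpha> \<in> out_to D x" for \<alpha>
    using out_natural[OF c that v(1)] 0 v(2) that by simp
  then obtain u where u: "u \<in> fiber X x" "c x u = \<zero>\<^bsub>space_at N x\<^esub>" "\<forall>\<alpha>\<in>out_to D x. map_at X \<alpha> u = map_at X \<alpha> v"
    using lift[OF v(1)] by blast
  have "map_at X \<alpha> (v \<ominus>\<^bsub>space_at X x\<^esub> u) = \<zero>\<^bsub>space_at X (head Q \<alpha>)\<^esub>" if \<alpha>: "\<alpha> \<in> out_to D x" for \<alpha>
    using out_minus[OF X \<alpha> v(1) u(1)] u(3) \<alpha>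
      vs_minus_self[OF rep_space[OF X head_verts[OF out_toD(1)[OF \<alpha>]]] out_closed[OF X \<alpha> v(1)]] by simp
  then have "v \<ominus>\<^bsub>space_at X x\<^esub> u = \<zero>\<^bsub>space_at X x\<^esub>"
    using gX vs_minus_closed[OF rep_space[OF X x] v(1) u(1)] unfolding cog_inj_def by blast
  then have "v = u" using vs_minus_zero_iff[OF rep_space[OF X x] v(1) u(1)] by simp
  then show "b = \<zero>\<^bsub>space_at N x\<^esub>" using u(2) v(2) by simp
qed

definition gen_bij where "gen_bij M S y \<longleftrightarrow> gen_surj M S y \<and> gen_inj M S y"
definition cog_bij where "cog_bij M S x \<longleftrightarrow> cog_surj M S x \<and> cog_inj M S x"

text \<open>If the sum of a tuple over \<open>X\<close> lies in the kernel of \<open>f\<close>, the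
  image tuple has sum zero in \<open>Y\<close>. Injectivity there kills its entries, so the tuple
  already lies over the kernel.\<close>

lemma gen_bij_kernel:
  assumes ker: "kernel_of X Y f N k" and X: "is_rep K Q X" and Y: "is_rep K Q Y" and f: "f \<in> rep_mor K Q X Y"
    and y: "y \<in> verts Q" and gX: "gen_bij X (into A y) y" and gY: "gen_inj Y (into A y) y"
  shows "gen_bij N (into A y) y"
  unfolding gen_bij_def
proof
  note k = kernel_ofD[OF ker]
  show "gen_inj N (into A y) y"
    by (rule gen_inj_sub[OF k(2,1) X y])
      (use injectiveD[OF k(3)] gX in \<open>auto simp: gen_bij_def into_def\<close>)
  show "gen_surj N (into A y) y"
  proof (rule gen_surj_sub[OF k(2,1) X y injectiveD[OF k(3) y]])
    fix w \<alpha> assume w: "w \<in> tail_tuples X (into A y)" and s: "arrow_sum X (into A y) y w \<in> k y ` fiber N y"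
      and \<alpha>: "\<alpha> \<in> into A y"
    have "arrow_sum Y (into A y) y (\<lambda>\<alpha>. f (tail Q \<alpha>) (w \<alpha>)) = \<zero>\<^bsub>space_at Y y\<^esub>"
      using s k(4)[OF y] arrow_sum_mor(1)[OF f X Y y w] by simp
    then have "f (tail Q \<alpha>) (w \<alpha>) = \<zero>\<^bsub>space_at Y (tail Q \<alpha>)\<^esub>"
      using gen_injD[OF gY arrow_sum_mor(2)[OF f X Y y w] _ \<alpha>] by simp
    then show "w \<alpha> \<in> k (tail Q \<alpha>) ` fiber N (tail Q \<alpha>)"
      using k(4)[OF tail_verts[OF intoD(1)[OF \<alpha>]]] w \<alpha> by (auto simp: tail_tuples_def)
  qed (use gX in \<open>simp add: gen_bij_def\<close>)
qed

text \<open>A vector killed by \<open>c\<close> is \<open>f\<close> of something generated by a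
  tuple over \<open>X\<close>; the image of this tuple under \<open>f\<close> vanishes entrywise in
  the cokernel.\<close>

lemma gen_bij_cokernel:
  assumes cok: "cokernel_of X Y f N c" and X: "is_rep K Q X" and Y: "is_rep K Q Y" and f: "f \<in> rep_mor K Q X Y"
    and y: "y \<in> verts Q" and gX: "gen_surj X (into A y) y" and gY: "gen_bij Y (into A y) y"
  shows "gen_bij N (into A y) y"
  unfolding gen_bij_def
proof
  note c = cokernel_ofD[OF cok]
  show "gen_surj N (into A y) y"
    by (rule gen_surj_quot[OF c(2) Y c(1) y surjectiveD[OF c(3) y]]) (use gY in \<open>simp add: gen_bij_def\<close>)
  show "gen_inj N (into A y) y"
  proof (rule gen_inj_quot[OF c(2) Y c(1) y])
    show "c (tail Q \<alpha>) ` fiber Y (tail Q \<alpha>) = fiber N (tail Q \<alpha>)" if "\<alpha> \<in> into A y" for \<alpha>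
      by (rule surjectiveD[OF c(3) tail_verts[OF intoD(1)[OF that]]])
    fix v assume "v \<in> fiber Y y" "c y v = \<zero>\<^bsub>space_at N y\<^esub>"
    then have "v \<in> f y ` fiber X y" using c(4)[OF y] by blast
    then obtain u where u: "u \<in> fiber X y" "v = f y u" by blast
    obtain w where w: "w \<in> tail_tuples X (into A y)" "u = arrow_sum X (into A y) y w"
      using gen_surjD[OF gX u(1)] by blast
    have "c (tail Q \<alpha>) (f (tail Q \<alpha>) (w \<alpha>)) = \<zero>\<^bsub>space_at N (tail Q \<alpha>)\<^esub>" if \<alpha>: "\<alpha> \<in> into A y" for \<alpha>
      using c(4)[OF tail_verts[OF intoD(1)[OF \<alpha>]]] w \<alpha> by (auto simp: tail_tuples_def)
    then show "\<exists>w\<in>tail_tuples Y (into A y). v = arrow_sum Y (into A y) y w \<and>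
        (\<forall>\<alpha>\<in>into A y. c (tail Q \<alpha>) (w \<alpha>) = \<zero>\<^bsub>space_at N (tail Q \<alpha>)\<^esub>)"
      using arrow_sum_mor[OF f X Y y w(1)] u(2) w(2) by (intro bexI[of _ "\<lambda>\<alpha>. f (tail Q \<alpha>) (w \<alpha>)"]) auto
  qed (use gY in \<open>simp add: gen_bij_def\<close>)
qed

text \<open>If all arrow images of \<open>v\<close> lie in the kernel of \<open>f\<close>, the
  outgoing arrows kill \<open>f x v\<close>, and injectivity on \<open>Y\<close> makes it
  zero.\<close>

lemma cog_bij_kernel:
  assumes ker: "kernel_of X Y f N k" and X: "is_rep K Q X" and f: "f \<in> rep_mor K Q X Y"
    and x: "x \<in> verts Q" and gX: "cog_bij X (out_to D x) x" and gY: "cog_inj Y (out_to D x) x"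
  shows "cog_bij N (out_to D x) x"
  unfolding cog_bij_def
proof
  note k = kernel_ofD[OF ker]
  show "cog_inj N (out_to D x) x"
    by (rule cog_inj_sub[OF k(2) X x injectiveD[OF k(3) x]]) (use gX in \<open>simp add: cog_bij_def\<close>)
  show "cog_surj N (out_to D x) x"
  proof (rule cog_surj_sub[OF k(2,1) x])
    show "inj_on (k (head Q \<alpha>)) (fiber N (head Q \<alpha>))" if "\<alpha> \<in> out_to D x" for \<alpha>
      by (rule injectiveD[OF k(3) head_verts[OF out_toD(1)[OF that]]])
    fix v assume v: "v \<in> fiber X x"
      and kv: "\<And>\<alpha>. \<alpha> \<in> out_to D x \<Longrightarrow> map_at X \<alpha> v \<in> k (head Q \<alpha>) ` fiber N (head Q \<alpha>)"
    have "map_at Y \<alpha> (f x v) = \<zero>\<^bsub>space_at Y (head Q \<alpha>)\<^esub>" if \<alpha>: "\<alpha> \<in> out_to D x" for \<alpha>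
      using kv[OF \<alpha>] k(4)[OF head_verts[OF out_toD(1)[OF \<alpha>]]] out_natural[OF f \<alpha> v] by simp
    then have "f x v = \<zero>\<^bsub>space_at Y x\<^esub>" using gY mor_closed[OF f x v] unfolding cog_inj_def by blast
    then show "v \<in> k x ` fiber N x" using k(4)[OF x] v by simp
  qed (use gX in \<open>simp add: cog_bij_def\<close>)
qed

text \<open>Arrow images that vanish in the cokernel lift through \<open>f\<close>; surjectivity on
  \<open>X\<close> realises the lifts by one vector \<open>u\<close>, and \<open>f x u\<close> is
  the required correction.\<close>

lemma cog_bij_cokernel:
  assumes cok: "cokernel_of X Y f N c" and Y: "is_rep K Q Y" and f: "f \<in> rep_mor K Q X Y"
    and x: "x \<in> verts Q" and gX: "cog_surj X (out_to D x) x" and gY: "cog_bij Y (out_to D x) x"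
  shows "cog_bij N (out_to D x) x"
  unfolding cog_bij_def
proof
  note c = cokernel_ofD[OF cok]
  show "cog_surj N (out_to D x) x"
    by (rule cog_surj_quot[OF c(2) x])
      (use surjectiveD[OF c(3) head_verts[OF out_toD(1)]] gY in \<open>auto simp: cog_bij_def\<close>)
  show "cog_inj N (out_to D x) x"
  proof (rule cog_inj_quot[OF c(2) Y x surjectiveD[OF c(3) x]])
    fix v assume v: "v \<in> fiber Y x"
      and 0: "\<And>\<alpha>. \<alpha> \<in> out_to D x \<Longrightarrow> c (head Q \<alpha>) (map_at Y \<alpha> v) = \<zero>\<^bsub>space_at N (head Q \<alpha>)\<^esub>"
    have "map_at Y \<alpha> v \<in> f (head Q \<alpha>) ` fiber X (head Q \<alpha>)" if \<alpha>: "\<alpha> \<in> out_to D x" for \<alpha>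
      using c(4)[OF head_verts[OF out_toD(1)[OF \<alpha>]]] 0[OF \<alpha>] out_closed[OF Y \<alpha> v] by blast
    then obtain w where w: "w \<in> head_tuples X (out_to D x)" "\<forall>\<alpha>\<in>out_to D x. f (head Q \<alpha>) (w \<alpha>) = map_at Y \<alpha> v"
      using head_tuples_lift[of D x "\<lambda>\<alpha>. map_at Y \<alpha> v" f X] by blast
    then obtain u where u: "u \<in> fiber X x" "\<forall>\<alpha>\<in>out_to D x. map_at X \<alpha> u = w \<alpha>"
      using gX unfolding cog_surj_def by blast
    have "c x (f x u) = \<zero>\<^bsub>space_at N x\<^esub>" using c(4)[OF x] u(1) by blast
    moreover have "\<forall>\<alpha>\<in>out_to D x. map_at Y \<alpha> (f x u) = map_at Y \<alpha> v"
      using out_natural[OF f _ u(1)] u(2) w(2) by fastforce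
    ultimately show "\<exists>u\<in>fiber Y x. c x u = \<zero>\<^bsub>space_at N x\<^esub> \<and> (\<forall>\<alpha>\<in>out_to D x. map_at Y \<alpha> u = map_at Y \<alpha> v)"
      using mor_closed[OF f x u(1)] by blast
  qed (use gY in \<open>simp add: cog_bij_def\<close>)
qed

definition bij_at where "bij_at M N f x \<longleftrightarrow> bij_betw (f x) (fiber M x) (fiber N x)"

lemma bij_atD: "bij_at M N f x \<Longrightarrow> inj_on (f x) (fiber M x)" "bij_at M N f x \<Longrightarrow> f x ` fiber M x = fiber N x"
  by (auto simp: bij_at_def bij_betw_def)

text \<open>Only bijectivity at \<open>y\<close> and at the tails is assumed, because in an
  extension the sub and the whole agree on part of the quiver only. One direction uses the quotient
  half of the five lemma, the other the subobject half.\<close>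

lemma gen_bij_transfer:
  assumes f: "f \<in> rep_mor K Q L M" and L: "is_rep K Q L" and M: "is_rep K Q M" and y: "y \<in> verts Q"
    and bY: "bij_at L M f y" and bt: "\<And>\<alpha>. \<alpha> \<in> into A y \<Longrightarrow> bij_at L M f (tail Q \<alpha>)"
  shows "gen_bij L (into A y) y \<longleftrightarrow> gen_bij M (into A y) y"
proof
  assume gL: "gen_bij L (into A y) y"
  show "gen_bij M (into A y) y"
    unfolding gen_bij_def
  proof
    show "gen_surj M (into A y) y"
      using gen_surj_quot[OF f L M y bij_atD(2)[OF bY]] gL by (simp add: gen_bij_def)
    show "gen_inj M (into A y) y"
    proof (rule gen_inj_quot[OF f L M y bij_atD(2)[OF bt]])
      fix v assume v: "v \<in> fiber L y" "f y v = \<zero>\<^bsub>space_at M y\<^esub>"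
      \<comment> \<open>Injectivity at \<open>y\<close> makes \<open>v\<close> zero, so every tuple
        generating it has zero entries.\<close>
      then have v0: "v = \<zero>\<^bsub>space_at L y\<^esub>" using mor_zero_iff[OF f bij_atD(1)[OF bY] y] by simp
      obtain w where w: "w \<in> tail_tuples L (into A y)" "v = arrow_sum L (into A y) y w"
        using gen_surjD[OF _ v(1)] gL unfolding gen_bij_def by metis
      then have "w \<alpha> = \<zero>\<^bsub>space_at L (tail Q \<alpha>)\<^esub>" if "\<alpha> \<in> into A y" for \<alpha>
        using gen_injD[OF _ w(1) _ that] gL v0 unfolding gen_bij_def by simp
      then have "\<forall>\<alpha>\<in>into A y. f (tail Q \<alpha>) (w \<alpha>) = \<zero>\<^bsub>space_at M (tail Q \<alpha>)\<^esub>"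
        using linear_map_zero[OF mor_map[OF f tail_verts[OF intoD(1)]]] by metis
      then show "\<exists>w\<in>tail_tuples L (into A y). v = arrow_sum L (into A y) y w \<and>
        (\<forall>\<alpha>\<in>into A y. f (tail Q \<alpha>) (w \<alpha>) = \<zero>\<^bsub>space_at M (tail Q \<alpha>)\<^esub>)" using w by blast
    qed (use gL in \<open>auto simp: gen_bij_def\<close>)
  qed
next
  assume gM: "gen_bij M (into A y) y"
  show "gen_bij L (into A y) y"
    unfolding gen_bij_def
  proof
    show "gen_inj L (into A y) y"
      by (rule gen_inj_sub[OF f L M y bij_atD(1)[OF bt]]) (use gM in \<open>auto simp: gen_bij_def\<close>)
    show "gen_surj L (into A y) y"
      by (rule gen_surj_sub[OF f L M y bij_atD(1)[OF bY]])
        (use gM bij_atD(2)[OF bt] in \<open>auto simp: gen_bij_def tail_tuples_def\<close>)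
  qed
qed

lemma cog_bij_transfer:
  assumes f: "f \<in> rep_mor K Q M N" and M: "is_rep K Q M" and N: "is_rep K Q N" and x: "x \<in> verts Q"
    and bx: "bij_at M N f x" and bh: "\<And>\<alpha>. \<alpha> \<in> out_to D x \<Longrightarrow> bij_at M N f (head Q \<alpha>)"
  shows "cog_bij M (out_to D x) x \<longleftrightarrow> cog_bij N (out_to D x) x"
proof
  assume gN: "cog_bij N (out_to D x) x"
  show "cog_bij M (out_to D x) x"
    unfolding cog_bij_def
  proof
    show "cog_inj M (out_to D x) x"
      using cog_inj_sub[OF f N x bij_atD(1)[OF bx]] gN by (simp add: cog_bij_def)
    show "cog_surj M (out_to D x) x"
      by (rule cog_surj_sub[OF f M x bij_atD(1)[OF bh]]) (use gN bij_atD(2)[OF bx] in \<open>auto simp: cog_bij_def\<close>)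
  qed
next
  assume gM: "cog_bij M (out_to D x) x"
  show "cog_bij N (out_to D x) x"
    unfolding cog_bij_def
  proof
    show "cog_surj N (out_to D x) x"
      by (rule cog_surj_quot[OF f x bij_atD(2)[OF bh]]) (use gM in \<open>auto simp: cog_bij_def\<close>)
    show "cog_inj N (out_to D x) x"
    proof (rule cog_inj_quot[OF f M x bij_atD(2)[OF bx]])
      fix v assume v: "v \<in> fiber M x"
        and 0: "\<And>\<alpha>. \<alpha> \<in> out_to D x \<Longrightarrow> f (head Q \<alpha>) (map_at M \<alpha> v) = \<zero>\<^bsub>space_at N (head Q \<alpha>)\<^esub>"
      have "map_at M \<alpha> v = \<zero>\<^bsub>space_at M (head Q \<alpha>)\<^esub>" if "\<alpha> \<in> out_to D x" for \<alpha>
        using 0[OF that] mor_zero_iff[OF f bij_atD(1)[OF bh[OF that]] head_verts[OF out_toD(1)[OF that]] out_closed[OF M that v]]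
        by simp
      then have "v = \<zero>\<^bsub>space_at M x\<^esub>" using gM v unfolding cog_bij_def cog_inj_def by blast
      then show "\<exists>u\<in>fiber M x. f x u = \<zero>\<^bsub>space_at N x\<^esub> \<and> (\<forall>\<alpha>\<in>out_to D x. map_at M \<alpha> u = map_at M \<alpha> v)"
        using v linear_map_zero[OF mor_map[OF f x]] by blast
    qed (use gM in \<open>simp add: cog_bij_def\<close>)
  qed
qed

section \<open>Paths and cones\<close>

lemma paths_Nil_iff: "[] \<in> paths Q x y \<longleftrightarrow> x = y \<and> x \<in> verts Q"
  using wf_digraph.awalk_Nil_iff[OF wf] by (simp add: paths_def)

lemma paths_Cons_iff: "\<alpha> # p \<in> paths Q x y \<longleftrightarrow> \<alpha> \<in> arcs Q \<and> x = tail Q \<alpha> \<and> p \<in> paths Q (head Q \<alpha>) y"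
  using wf_digraph.awalk_Cons_iff[OF wf] by (simp add: paths_def)

lemma paths_append: "p \<in> paths Q x y \<Longrightarrow> q \<in> paths Q y z \<Longrightarrow> p @ q \<in> paths Q x z"
  by (induct p arbitrary: x) (auto simp: paths_Nil_iff paths_Cons_iff)

lemma paths_snoc_iff: "p @ [\<alpha>] \<in> paths Q x y \<longleftrightarrow> p \<in> paths Q x (tail Q \<alpha>) \<and> \<alpha> \<in> arcs Q \<and> y = head Q \<alpha>"
  by (induct p arbitrary: x) (auto simp: paths_Nil_iff paths_Cons_iff)

definition succs where "succs a = {y \<in> verts Q. \<exists>x\<in>a. paths Q x y \<noteq> {}}"
definition preds where "preds b = {x \<in> verts Q. \<exists>y\<in>b. paths Q x y \<noteq> {}}"

lemma succs_mono: "a \<subseteq> a' \<Longrightarrow> succs a \<subseteq> succs a'" and preds_mono: "b \<subseteq> b' \<Longrightarrow> preds b \<subseteq> preds b'"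
  by (auto simp: succs_def preds_def)

lemma succs_verts: "x \<in> succs a \<Longrightarrow> x \<in> verts Q"
  by (simp add: succs_def)

lemma succs_closed: "\<alpha> \<in> arcs Q \<Longrightarrow> tail Q \<alpha> \<in> succs a \<Longrightarrow> head Q \<alpha> \<in> succs a"
proof -
  assume \<alpha>: "\<alpha> \<in> arcs Q" and "tail Q \<alpha> \<in> succs a"
  then obtain x p where "x \<in> a" "p \<in> paths Q x (tail Q \<alpha>)" by (auto simp: succs_def)
  then have "p @ [\<alpha>] \<in> paths Q x (head Q \<alpha>)" using \<alpha> by (simp add: paths_snoc_iff)
  then show ?thesis using \<open>x \<in> a\<close> \<alpha> by (auto simp: succs_def)
qed

lemma preds_closed: "\<alpha> \<in> arcs Q \<Longrightarrow> head Q \<alpha> \<in> preds b \<Longrightarrow> tail Q \<alpha> \<in> preds b"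
proof -
  assume \<alpha>: "\<alpha> \<in> arcs Q" and "head Q \<alpha> \<in> preds b"
  then obtain y p where "y \<in> b" "p \<in> paths Q (head Q \<alpha>) y" by (auto simp: preds_def)
  then have "\<alpha> # p \<in> paths Q (tail Q \<alpha>) y" using \<alpha> by (simp add: paths_Cons_iff)
  then show ?thesis using \<open>y \<in> b\<close> \<alpha> by (auto simp: preds_def)
qed

text \<open>A vertex of both cones lies on a path from \<open>a\<close> to \<open>b\<close>, and
  there are finitely many of these. It is the starting vertex or the head of one of the arrows of
  the path.\<close>

lemma finite_succs_preds:
  assumes a: "finite a" "a \<subseteq> verts Q" and b: "finite b" "b \<subseteq> verts Q"
  shows "finite (succs a \<inter> preds b)"
proof (rule finite_subset)
  show "succs a \<inter> preds b \<subseteq> a \<union> (\<Union>x\<in>a. \<Union>z\<in>b. \<Union>r\<in>paths Q x z. head Q ` set r)"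
  proof
    fix y assume "y \<in> succs a \<inter> preds b"
    then obtain x z p q where x: "x \<in> a" "z \<in> b" and p: "p \<in> paths Q x y" "q \<in> paths Q y z"
      by (auto simp: succs_def preds_def)
    show "y \<in> a \<union> (\<Union>x\<in>a. \<Union>z\<in>b. \<Union>r\<in>paths Q x z. head Q ` set r)"
    proof (cases p rule: rev_cases)
      case Nil
      then show ?thesis using p x by (simp add: paths_Nil_iff)
    next
      case (snoc p' \<alpha>)
      then have "y = head Q \<alpha>" "\<alpha> \<in> set (p @ q)" using p by (simp_all add: paths_snoc_iff)
      moreover have "p @ q \<in> paths Q x z" using p by (rule paths_append)
      ultimately show ?thesis using x by blast
    qed
  qed
  show "finite (a \<union> (\<Union>x\<in>a. \<Union>z\<in>b. \<Union>r\<in>paths Q x z. head Q ` set r))"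
    using a b by (auto intro!: finite_paths)
qed

text \<open>The arrow set at a vertex can meet a finite set \<open>F\<close> only if the vertex is a
  neighbour of \<open>F\<close>. Local finiteness keeps the exceptional sets finite after neighbours
  are added.\<close>

definition neighbours where
  "neighbours F = {y. \<exists>\<alpha>\<in>arcs Q. tail Q \<alpha> \<in> F \<and> y = head Q \<alpha> \<or> head Q \<alpha> \<in> F \<and> y = tail Q \<alpha>}"
definition arcs_at where
  "arcs_at F = {\<alpha> \<in> arcs Q. tail Q \<alpha> \<in> F \<or> head Q \<alpha> \<in> F}"

lemma finite_arcs_at_set:
  assumes "finite F" and "F \<subseteq> verts Q"
  shows "finite (arcs_at F)"
proof -
  have "arcs_at F = (\<Union>x\<in>F. {\<alpha> \<in> arcs Q. tail Q \<alpha> = x \<or> head Q \<alpha> = x})" by (auto simp: arcs_at_def)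
  then show ?thesis using assms finite_arcs_at by auto
qed

lemma finite_neighbours:
  assumes "finite F" and "F \<subseteq> verts Q"
  shows "finite (neighbours F)"
  by (rule finite_subset[of _ "tail Q ` arcs_at F \<union> head Q ` arcs_at F"])
    (use finite_arcs_at_set[OF assms] in \<open>auto simp: neighbours_def arcs_at_def\<close>)

section \<open>Changing the set of arrows\<close>

definition vanishes where "vanishes M x \<longleftrightarrow> fiber M x = {\<zero>\<^bsub>space_at M x\<^esub>}"

lemma vanishesD: "vanishes M x \<Longrightarrow> v \<in> fiber M x \<Longrightarrow> v = \<zero>\<^bsub>space_at M x\<^esub>"
  by (simp add: vanishes_def)

lemma vanishesI: "is_rep K Q M \<Longrightarrow> x \<in> verts Q \<Longrightarrow> (\<And>v. v \<in> fiber M x \<Longrightarrow> v = \<zero>\<^bsub>space_at M x\<^esub>) \<Longrightarrow> vanishes M x"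
  using vs_zero_closed[OF rep_space] by (auto simp: vanishes_def)

lemma arrow_sum_change:
  assumes M: "is_rep K Q M" and y: "y \<in> verts Q" and sub: "into A y \<subseteq> into A' y"
    and van: "\<And>\<alpha>. \<alpha> \<in> into A' y - into A y \<Longrightarrow> vanishes M (tail Q \<alpha>)" and w: "w \<in> tail_tuples M (into A' y)"
  shows "arrow_sum M (into A' y) y w = arrow_sum M (into A y) y w"
proof -
  interpret vectorspace K "space_at M y" using rep_space[OF M y] .
  have "map_at M \<alpha> (w \<alpha>) = \<zero>\<^bsub>space_at M y\<^esub>" if \<alpha>: "\<alpha> \<in> into A' y - into A y" for \<alpha>
  proof -
    have "w \<alpha> \<in> fiber M (tail Q \<alpha>)" using w \<alpha> by (auto simp: tail_tuples_def)
    then have "w \<alpha> = \<zero>\<^bsub>space_at M (tail Q \<alpha>)\<^esub>" using van[OF \<alpha>] by (simp add: vanishes_def)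
    then show ?thesis using linear_map_zero[OF rep_map[OF M, of \<alpha>]] \<alpha> by (auto simp: into_def)
  qed
  then show ?thesis unfolding arrow_sum_def
    by (intro M.add.finprod_mono_neutral_cong_left[symmetric] finite_into[OF y] sub tail_tuples_map[OF M w]) auto
qed

text \<open>An arrow with zero space at its tail contributes nothing: tuples restrict, or extend by
  zero, without changing the sum.\<close>

lemma gen_bij_change:
  assumes M: "is_rep K Q M" and y: "y \<in> verts Q" and sub: "into A y \<subseteq> into A' y"
    and van: "\<And>\<alpha>. \<alpha> \<in> into A' y - into A y \<Longrightarrow> vanishes M (tail Q \<alpha>)"
  shows "gen_bij M (into A' y) y \<longleftrightarrow> gen_bij M (into A y) y"
proof -
  have ext: "\<exists>w'\<in>tail_tuples M (into A' y). (\<forall>\<alpha>\<in>into A y. w' \<alpha> = w \<alpha>) \<and>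
      arrow_sum M (into A' y) y w' = arrow_sum M (into A y) y w"
    if w: "w \<in> tail_tuples M (into A y)" for w
  proof -
    let ?w = "\<lambda>\<alpha>. if \<alpha> \<in> into A y then w \<alpha> else \<zero>\<^bsub>space_at M (tail Q \<alpha>)\<^esub>"
    have "?w \<in> tail_tuples M (into A' y)"
      using w vs_zero_closed[OF rep_space[OF M tail_verts[OF intoD(1)]]] by (auto simp: tail_tuples_def)
    moreover have "arrow_sum M (into A y) y ?w = arrow_sum M (into A y) y w"
      by (rule arrow_sum_cong[OF M y w]) simp
    ultimately show ?thesis using arrow_sum_change[OF M y sub van, of ?w] by (intro bexI[of _ ?w]) auto
  qed
  have res: "w \<in> tail_tuples M (into A y)" if "w \<in> tail_tuples M (into A' y)" for w
    using that sub by (auto simp: tail_tuples_def)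
  note sum = arrow_sum_change[OF M y sub van]
  have "gen_surj M (into A' y) y \<longleftrightarrow> gen_surj M (into A y) y"
  proof
    assume g: "gen_surj M (into A' y) y"
    show "gen_surj M (into A y) y"
      unfolding gen_surj_def
    proof
      fix v assume "v \<in> fiber M y"
      then obtain w where w: "w \<in> tail_tuples M (into A' y)" "v = arrow_sum M (into A' y) y w"
        using gen_surjD[OF g] by blast
      then have "v = arrow_sum M (into A y) y w" using sum[of w] by simp
      then show "\<exists>w\<in>tail_tuples M (into A y). v = arrow_sum M (into A y) y w" using res[OF w(1)] by blast
    qed
  next
    assume g: "gen_surj M (into A y) y"
    show "gen_surj M (into A' y) y"
      unfolding gen_surj_def
    proof
      fix v assume "v \<in> fiber M y"
      then obtain w where w: "w \<in> tail_tuples M (into A y)" "v = arrow_sum M (into A y) y w"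
        using gen_surjD[OF g] by blast
      then show "\<exists>w\<in>tail_tuples M (into A' y). v = arrow_sum M (into A' y) y w" using ext[OF w(1)] by metis
    qed
  qed
  moreover have "gen_inj M (into A' y) y \<longleftrightarrow> gen_inj M (into A y) y"
  proof
    assume g: "gen_inj M (into A' y) y"
    show "gen_inj M (into A y) y"
    proof (rule gen_injI, rule ballI)
      fix w \<alpha> assume "w \<in> tail_tuples M (into A y)" "arrow_sum M (into A y) y w = \<zero>\<^bsub>space_at M y\<^esub>" and \<alpha>: "\<alpha> \<in> into A y"
      then obtain w' where w': "w' \<in> tail_tuples M (into A' y)" "\<forall>\<alpha>\<in>into A y. w' \<alpha> = w \<alpha>"
        "arrow_sum M (into A' y) y w' = \<zero>\<^bsub>space_at M y\<^esub>" using ext[of w] by auto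
      show "w \<alpha> = \<zero>\<^bsub>space_at M (tail Q \<alpha>)\<^esub>"
        using gen_injD[OF g w'(1,3) subsetD[OF sub \<alpha>]] w'(2)[rule_format, OF \<alpha>] by simp
    qed
  next
    assume g: "gen_inj M (into A y) y"
    show "gen_inj M (into A' y) y"
    proof (rule gen_injI, rule ballI)
      fix w \<alpha> assume w: "w \<in> tail_tuples M (into A' y)" "arrow_sum M (into A' y) y w = \<zero>\<^bsub>space_at M y\<^esub>" and \<alpha>: "\<alpha> \<in> into A' y"
      show "w \<alpha> = \<zero>\<^bsub>space_at M (tail Q \<alpha>)\<^esub>"
      proof (cases "\<alpha> \<in> into A y")
        case True
        have "arrow_sum M (into A y) y w = \<zero>\<^bsub>space_at M y\<^esub>" using sum[of w] w by simp
        then show ?thesis using gen_injD[OF g res[OF w(1)] _ True] by simp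
      next
        case False
        have "w \<alpha> \<in> fiber M (tail Q \<alpha>)" using w(1) \<alpha> by (auto simp: tail_tuples_def)
        then show ?thesis using vanishesD[OF van] \<alpha> False by simp
      qed
    qed
  qed
  ultimately show ?thesis by (simp add: gen_bij_def)
qed

text \<open>Reduction to the empty set of arrows, where the sum is zero and so is the space at
  \<open>y\<close>.\<close>

lemma gen_bij_vanishes:
  assumes M: "is_rep K Q M" and y: "y \<in> verts Q" and van: "vanishes M y"
    and tails: "\<And>\<alpha>. \<alpha> \<in> into A y \<Longrightarrow> vanishes M (tail Q \<alpha>)"
  shows "gen_bij M (into A y) y"
proof -
  interpret vectorspace K "space_at M y" using rep_space[OF M y] .
  have emp: "into {} y = {}" by (auto simp: into_def)
  have "gen_bij M (into {} y) y"
    using van unfolding emp by (auto simp: gen_bij_def gen_surj_def gen_inj_def tail_tuples_def arrow_sum_def vanishes_def)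
  then show ?thesis using gen_bij_change[OF M y, of "{}" A] tails by (simp add: emp)
qed

text \<open>At an arrow with zero space at its head both the arrow image and the prescribed value
  are zero, so the arrow imposes no condition.\<close>

lemma cog_bij_change:
  assumes M: "is_rep K Q M" and x: "x \<in> verts Q" and sub: "out_to D x \<subseteq> out_to D' x"
    and van: "\<And>\<alpha>. \<alpha> \<in> out_to D' x - out_to D x \<Longrightarrow> vanishes M (head Q \<alpha>)"
  shows "cog_bij M (out_to D' x) x \<longleftrightarrow> cog_bij M (out_to D x) x"
proof -
  have zero: "map_at M \<alpha> v = \<zero>\<^bsub>space_at M (head Q \<alpha>)\<^esub>" if "\<alpha> \<in> out_to D' x - out_to D x" "v \<in> fiber M x" for \<alpha> v
    using vanishesD[OF van[OF that(1)]] out_closed[OF M _ that(2), of \<alpha> D'] that(1) by blast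
  have "cog_inj M (out_to D' x) x \<longleftrightarrow> cog_inj M (out_to D x) x"
    unfolding cog_inj_def using zero sub by blast
  moreover have "cog_surj M (out_to D' x) x \<longleftrightarrow> cog_surj M (out_to D x) x"
  proof
    assume g: "cog_surj M (out_to D' x) x"
    show "cog_surj M (out_to D x) x"
      unfolding cog_surj_def
    proof
      fix w assume w: "w \<in> head_tuples M (out_to D x)"
      let ?w = "\<lambda>\<alpha>. if \<alpha> \<in> out_to D x then w \<alpha> else \<zero>\<^bsub>space_at M (head Q \<alpha>)\<^esub>"
      have "?w \<in> head_tuples M (out_to D' x)"
        using w vs_zero_closed[OF rep_space[OF M head_verts[OF out_toD(1)]]] by (auto simp: head_tuples_def)
      from g[unfolded cog_surj_def, rule_format, OF this]
      obtain v where "v \<in> fiber M x" "\<forall>\<alpha>\<in>out_to D' x. map_at M \<alpha> v = ?w \<alpha>" by blast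
      then show "\<exists>v\<in>fiber M x. \<forall>\<alpha>\<in>out_to D x. map_at M \<alpha> v = w \<alpha>" using sub by (intro bexI[of _ v]) auto
    qed
  next
    assume g: "cog_surj M (out_to D x) x"
    show "cog_surj M (out_to D' x) x"
      unfolding cog_surj_def
    proof
      fix w assume w: "w \<in> head_tuples M (out_to D' x)"
      then have "w \<in> head_tuples M (out_to D x)" using sub by (auto simp: head_tuples_def)
      from g[unfolded cog_surj_def, rule_format, OF this]
      obtain v where v: "v \<in> fiber M x" "\<forall>\<alpha>\<in>out_to D x. map_at M \<alpha> v = w \<alpha>" by blast
      have "map_at M \<alpha> v = w \<alpha>" if \<alpha>: "\<alpha> \<in> out_to D' x" for \<alpha>
      proof (cases "\<alpha> \<in> out_to D x")
        case False
        have "w \<alpha> \<in> fiber M (head Q \<alpha>)" using w \<alpha> by (auto simp: head_tuples_def)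
        then show ?thesis using zero[OF _ v(1)] vanishesD[OF van] False \<alpha> by simp
      qed (use v in simp)
      then show "\<exists>v\<in>fiber M x. \<forall>\<alpha>\<in>out_to D' x. map_at M \<alpha> v = w \<alpha>" using v(1) by blast
    qed
  qed
  ultimately show ?thesis by (simp add: cog_bij_def)
qed

lemma cog_bij_vanishes:
  assumes M: "is_rep K Q M" and x: "x \<in> verts Q" and van: "vanishes M x"
    and heads: "\<And>\<alpha>. \<alpha> \<in> out_to D x \<Longrightarrow> vanishes M (head Q \<alpha>)"
  shows "cog_bij M (out_to D x) x"
proof -
  have emp: "out_to {} x = {}" by (auto simp: out_to_def)
  have "cog_bij M (out_to {} x) x"
    using van unfolding emp by (auto simp: cog_bij_def cog_surj_def cog_inj_def vanishes_def)
  then show ?thesis using cog_bij_change[OF M x, of "{}" D] heads by (simp add: emp)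
qed

text \<open>Everything is tested on the two projections; generating tuples for the two components
  are glued entrywise.\<close>

lemma gen_bij_product:
  assumes P: "product_of X Y S p q" and X: "is_rep K Q X" and Y: "is_rep K Q Y" and y: "y \<in> verts Q"
    and gX: "gen_bij X (into A y) y" and gY: "gen_bij Y (into A y) y"
  shows "gen_bij S (into A y) y"
  unfolding gen_bij_def
proof
  note S = product_ofD(1)[OF P] and p = product_ofD(2)[OF P] and q = product_ofD(3)[OF P]
  show "gen_inj S (into A y) y"
  proof (rule gen_injI, rule ballI)
    fix w \<alpha> assume w: "w \<in> tail_tuples S (into A y)" and 0: "arrow_sum S (into A y) y w = \<zero>\<^bsub>space_at S y\<^esub>"
      and \<alpha>: "\<alpha> \<in> into A y"
    note t = tail_verts[OF intoD(1)[OF \<alpha>]]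
    have wc: "w \<alpha> \<in> fiber S (tail Q \<alpha>)" using w \<alpha> by (auto simp: tail_tuples_def)
    have "p (tail Q \<alpha>) (w \<alpha>) = \<zero>\<^bsub>space_at X (tail Q \<alpha>)\<^esub>"
      using gen_injD[OF _ arrow_sum_mor(2)[OF p S X y w] _ \<alpha>] gX arrow_sum_mor(1)[OF p S X y w] 0
        linear_map_zero[OF mor_map[OF p y]] by (simp add: gen_bij_def)
    moreover have "q (tail Q \<alpha>) (w \<alpha>) = \<zero>\<^bsub>space_at Y (tail Q \<alpha>)\<^esub>"
      using gen_injD[OF _ arrow_sum_mor(2)[OF q S Y y w] _ \<alpha>] gY arrow_sum_mor(1)[OF q S Y y w] 0
        linear_map_zero[OF mor_map[OF q y]] by (simp add: gen_bij_def)
    ultimately show "w \<alpha> = \<zero>\<^bsub>space_at S (tail Q \<alpha>)\<^esub>"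
      using linear_map_zero[OF mor_map[OF p t]] linear_map_zero[OF mor_map[OF q t]]
      by (intro product_eqI[OF P t wc vs_zero_closed[OF rep_space[OF S t]]]) simp_all
  qed
  show "gen_surj S (into A y) y"
    unfolding gen_surj_def
  proof
    fix v assume v: "v \<in> fiber S y"
    obtain u where u: "u \<in> tail_tuples X (into A y)" "p y v = arrow_sum X (into A y) y u"
      using gen_surjD[OF _ mor_closed[OF p y v]] gX unfolding gen_bij_def by metis
    obtain u' where u': "u' \<in> tail_tuples Y (into A y)" "q y v = arrow_sum Y (into A y) y u'"
      using gen_surjD[OF _ mor_closed[OF q y v]] gY unfolding gen_bij_def by metis
    have "\<exists>s. s \<in> fiber S (tail Q \<alpha>) \<and> p (tail Q \<alpha>) s = u \<alpha> \<and> q (tail Q \<alpha>) s = u' \<alpha>" if \<alpha>: "\<alpha> \<in> into A y" for \<alpha>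
    proof -
      have "u \<alpha> \<in> fiber X (tail Q \<alpha>)" "u' \<alpha> \<in> fiber Y (tail Q \<alpha>)" using u(1) u'(1) \<alpha> by (auto simp: tail_tuples_def)
      from product_ofD(4)[OF P tail_verts[OF intoD(1)[OF \<alpha>]] this] show ?thesis by blast
    qed
    then obtain s where s: "\<forall>\<alpha>\<in>into A y. s \<alpha> \<in> fiber S (tail Q \<alpha>) \<and> p (tail Q \<alpha>) (s \<alpha>) = u \<alpha> \<and> q (tail Q \<alpha>) (s \<alpha>) = u' \<alpha>"
      using bchoice[of "into A y" "\<lambda>\<alpha> s. s \<in> fiber S (tail Q \<alpha>) \<and> p (tail Q \<alpha>) s = u \<alpha> \<and> q (tail Q \<alpha>) s = u' \<alpha>"] by blast
    then have st: "s \<in> tail_tuples S (into A y)" by (auto simp: tail_tuples_def)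
    have "v = arrow_sum S (into A y) y s"
    proof (rule product_eqI[OF P y v arrow_sum_closed[OF S y st]])
      show "p y v = p y (arrow_sum S (into A y) y s)"
        using arrow_sum_mor(1)[OF p S X y st] arrow_sum_cong[OF X y u(1), of "\<lambda>\<alpha>. p (tail Q \<alpha>) (s \<alpha>)"] s u(2) by simp
      show "q y v = q y (arrow_sum S (into A y) y s)"
        using arrow_sum_mor(1)[OF q S Y y st] arrow_sum_cong[OF Y y u'(1), of "\<lambda>\<alpha>. q (tail Q \<alpha>) (s \<alpha>)"] s u'(2) by simp
    qed
    then show "\<exists>w\<in>tail_tuples S (into A y). v = arrow_sum S (into A y) y w" using st by blast
  qed
qed

lemma cog_bij_product:
  assumes P: "product_of X Y S p q" and x: "x \<in> verts Q"
    and gX: "cog_bij X (out_to D x) x" and gY: "cog_bij Y (out_to D x) x"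
  shows "cog_bij S (out_to D x) x"
  unfolding cog_bij_def
proof
  note S = product_ofD(1)[OF P] and p = product_ofD(2)[OF P] and q = product_ofD(3)[OF P]
  show "cog_inj S (out_to D x) x"
    unfolding cog_inj_def
  proof (intro ballI impI)
    fix v assume v: "v \<in> fiber S x" and 0: "\<forall>\<alpha>\<in>out_to D x. map_at S \<alpha> v = \<zero>\<^bsub>space_at S (head Q \<alpha>)\<^esub>"
    have "\<forall>\<alpha>\<in>out_to D x. map_at X \<alpha> (p x v) = \<zero>\<^bsub>space_at X (head Q \<alpha>)\<^esub>"
      using out_natural[OF p _ v] 0 linear_map_zero[OF mor_map[OF p head_verts[OF out_toD(1)]]] by metis
    then have p0: "p x v = \<zero>\<^bsub>space_at X x\<^esub>" using gX mor_closed[OF p x v] unfolding cog_bij_def cog_inj_def by blast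
    have "\<forall>\<alpha>\<in>out_to D x. map_at Y \<alpha> (q x v) = \<zero>\<^bsub>space_at Y (head Q \<alpha>)\<^esub>"
      using out_natural[OF q _ v] 0 linear_map_zero[OF mor_map[OF q head_verts[OF out_toD(1)]]] by metis
    then have q0: "q x v = \<zero>\<^bsub>space_at Y x\<^esub>" using gY mor_closed[OF q x v] unfolding cog_bij_def cog_inj_def by blast
    show "v = \<zero>\<^bsub>space_at S x\<^esub>"
      using p0 q0 linear_map_zero[OF mor_map[OF p x]] linear_map_zero[OF mor_map[OF q x]]
      by (intro product_eqI[OF P x v vs_zero_closed[OF rep_space[OF S x]]]) simp_all
  qed
  show "cog_surj S (out_to D x) x"
    unfolding cog_surj_def
  proof
    fix w assume w: "w \<in> head_tuples S (out_to D x)"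
    have wc: "w \<alpha> \<in> fiber S (head Q \<alpha>)" if "\<alpha> \<in> out_to D x" for \<alpha> using w that by (auto simp: head_tuples_def)
    have "(\<lambda>\<alpha>. p (head Q \<alpha>) (w \<alpha>)) \<in> head_tuples X (out_to D x)"
      using mor_closed[OF p head_verts[OF out_toD(1)] wc] by (auto simp: head_tuples_def)
    from gX[unfolded cog_bij_def cog_surj_def, THEN conjunct1, rule_format, OF this]
    obtain u where u: "u \<in> fiber X x" "\<forall>\<alpha>\<in>out_to D x. map_at X \<alpha> u = p (head Q \<alpha>) (w \<alpha>)" by blast
    have "(\<lambda>\<alpha>. q (head Q \<alpha>) (w \<alpha>)) \<in> head_tuples Y (out_to D x)"
      using mor_closed[OF q head_verts[OF out_toD(1)] wc] by (auto simp: head_tuples_def)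
    from gY[unfolded cog_bij_def cog_surj_def, THEN conjunct1, rule_format, OF this]
    obtain u' where u': "u' \<in> fiber Y x" "\<forall>\<alpha>\<in>out_to D x. map_at Y \<alpha> u' = q (head Q \<alpha>) (w \<alpha>)" by blast
    obtain v where v: "v \<in> fiber S x" "p x v = u" "q x v = u'" using product_ofD(4)[OF P x u(1) u'(1)] by blast
    have "map_at S \<alpha> v = w \<alpha>" if \<alpha>: "\<alpha> \<in> out_to D x" for \<alpha>
      by (rule product_eqI[OF P head_verts[OF out_toD(1)[OF \<alpha>]] out_closed[OF S \<alpha> v(1)] wc[OF \<alpha>]])
        (use out_natural[OF p \<alpha> v(1)] out_natural[OF q \<alpha> v(1)] u(2) u'(2) v(2,3) \<alpha> in simp_all)
    then show "\<exists>v\<in>fiber S x. \<forall>\<alpha>\<in>out_to D x. map_at S \<alpha> v = w \<alpha>" using v(1) by blast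
  qed
qed

section \<open>The intrinsic description of finite extensions\<close>

text \<open>The overlap of the cones is assigned to \<open>A\<close>. For successor-closed
  \<open>A\<close> the restriction to \<open>A\<close> is a subrepresentation, its quotient lives on
  \<open>B - A\<close>, and the last clause is about the arrows joining the two pieces.\<close>

definition bar_at where
  "bar_at M A B \<longleftrightarrow> (\<forall>x\<in>verts Q. x \<notin> A \<longrightarrow> x \<notin> B \<longrightarrow> vanishes M x) \<and>
    finite {y \<in> verts Q. y \<in> A \<and> \<not> gen_bij M (into A y) y} \<and>
    finite {x \<in> verts Q. x \<in> B - A \<and> \<not> cog_bij M (out_to (B - A) x) x} \<and>
    finite {\<alpha> \<in> arcs Q. tail Q \<alpha> \<in> B - A \<and> head Q \<alpha> \<in> A \<and> supports Q \<alpha> M}"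

lemma vanishes_sub:
  assumes "k \<in> rep_mor K Q N X" and "is_rep K Q N" and "inj_on (k x) (fiber N x)" and "x \<in> verts Q" and "vanishes X x"
  shows "vanishes N x"
  by (rule vanishesI[OF assms(2,4)])
    (use mor_zero_iff[OF assms(1,3,4)] vanishesD[OF assms(5) mor_closed[OF assms(1,4)]] in blast)

lemma vanishes_quot:
  assumes c: "c \<in> rep_mor K Q X N" and "is_rep K Q N" and surj: "c x ` fiber X x = fiber N x" and x: "x \<in> verts Q" and "vanishes X x"
  shows "vanishes N x"
  using surj assms(5) linear_map_zero[OF mor_map[OF c x]] unfolding vanishes_def by auto

lemma supports_sub:
  assumes k: "k \<in> rep_mor K Q N X" and N: "is_rep K Q N" and inj: "injective N k" and \<alpha>: "\<alpha> \<in> arcs Q" and "supports Q \<alpha> N"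
  shows "supports Q \<alpha> X"
proof -
  obtain v where v: "v \<in> fiber N (tail Q \<alpha>)" "map_at N \<alpha> v \<noteq> \<zero>\<^bsub>space_at N (head Q \<alpha>)\<^esub>"
    using assms(5) by (auto simp: supports_def)
  then have "map_at X \<alpha> (k (tail Q \<alpha>) v) \<noteq> \<zero>\<^bsub>space_at X (head Q \<alpha>)\<^esub>"
    using mor_natural[OF k \<alpha> v(1)] rep_map_closed[OF N \<alpha> v(1)]
      mor_zero_iff[OF k injectiveD[OF inj] head_verts[OF \<alpha>]] head_verts[OF \<alpha>] by metis
  then show ?thesis using mor_closed[OF k tail_verts[OF \<alpha>] v(1)] by (auto simp: supports_def)
qed

lemma supports_quot:
  assumes c: "c \<in> rep_mor K Q X N" and surj: "surjective X N c" and \<alpha>: "\<alpha> \<in> arcs Q" and "supports Q \<alpha> N"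
  shows "supports Q \<alpha> X"
proof -
  obtain b where "b \<in> fiber N (tail Q \<alpha>)" "map_at N \<alpha> b \<noteq> \<zero>\<^bsub>space_at N (head Q \<alpha>)\<^esub>"
    using assms(4) by (auto simp: supports_def)
  moreover then have "b \<in> c (tail Q \<alpha>) ` fiber X (tail Q \<alpha>)" using surjectiveD[OF surj tail_verts[OF \<alpha>]] by simp
  ultimately obtain v where v: "v \<in> fiber X (tail Q \<alpha>)" "map_at N \<alpha> (c (tail Q \<alpha>) v) \<noteq> \<zero>\<^bsub>space_at N (head Q \<alpha>)\<^esub>"
    by blast
  then have "map_at X \<alpha> v \<noteq> \<zero>\<^bsub>space_at X (head Q \<alpha>)\<^esub>"
    using mor_natural[OF c \<alpha> v(1)] linear_map_zero[OF mor_map[OF c head_verts[OF \<alpha>]]] by metis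
  then show ?thesis using v(1) by (auto simp: supports_def)
qed

text \<open>Apart from the vanishing clause, each clause of \<open>bar_at\<close> allows a finite
  exceptional set, so a construction that inherits the local properties from \<open>X\<close> and
  \<open>Y\<close> inherits \<open>bar_at\<close> with the union of the two sets. Both
  representations must use the same cones.\<close>

lemma bar_at_combine:
  assumes X: "bar_at X A B" and Y: "bar_at Y A B"
    and van: "\<And>x. x \<in> verts Q \<Longrightarrow> vanishes X x \<Longrightarrow> vanishes Y x \<Longrightarrow> vanishes N x"
    and gen: "\<And>y. y \<in> verts Q \<Longrightarrow> gen_bij X (into A y) y \<Longrightarrow> gen_bij Y (into A y) y \<Longrightarrow> gen_bij N (into A y) y"
    and cog: "\<And>x. x \<in> verts Q \<Longrightarrow> cog_bij X (out_to (B - A) x) x \<Longrightarrow> cog_bij Y (out_to (B - A) x) x \<Longrightarrow>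
      cog_bij N (out_to (B - A) x) x"
    and sup: "\<And>\<alpha>. \<alpha> \<in> arcs Q \<Longrightarrow> supports Q \<alpha> N \<Longrightarrow> supports Q \<alpha> X \<or> supports Q \<alpha> Y"
  shows "bar_at N A B"
  unfolding bar_at_def
proof (intro conjI)
  show "\<forall>x\<in>verts Q. x \<notin> A \<longrightarrow> x \<notin> B \<longrightarrow> vanishes N x"
    using X Y van unfolding bar_at_def by blast
  show "finite {y \<in> verts Q. y \<in> A \<and> \<not> gen_bij N (into A y) y}"
    by (rule finite_subset[of _ "{y \<in> verts Q. y \<in> A \<and> \<not> gen_bij X (into A y) y} \<union> {y \<in> verts Q. y \<in> A \<and> \<not> gen_bij Y (into A y) y}"])
      (use gen X Y in \<open>auto simp: bar_at_def\<close>)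
  show "finite {x \<in> verts Q. x \<in> B - A \<and> \<not> cog_bij N (out_to (B - A) x) x}"
    by (rule finite_subset[of _ "{x \<in> verts Q. x \<in> B - A \<and> \<not> cog_bij X (out_to (B - A) x) x} \<union> {x \<in> verts Q. x \<in> B - A \<and> \<not> cog_bij Y (out_to (B - A) x) x}"])
      (use cog X Y in \<open>auto simp: bar_at_def\<close>)
  show "finite {\<alpha> \<in> arcs Q. tail Q \<alpha> \<in> B - A \<and> head Q \<alpha> \<in> A \<and> supports Q \<alpha> N}"
    by (rule finite_subset[of _ "{\<alpha> \<in> arcs Q. tail Q \<alpha> \<in> B - A \<and> head Q \<alpha> \<in> A \<and> supports Q \<alpha> X} \<union> {\<alpha> \<in> arcs Q. tail Q \<alpha> \<in> B - A \<and> head Q \<alpha> \<in> A \<and> supports Q \<alpha> Y}"])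
      (use sup X Y in \<open>auto simp: bar_at_def\<close>)
qed

lemma bar_at_kernel:
  assumes ker: "kernel_of X Y f N k" and X: "is_rep K Q X" and Y: "is_rep K Q Y" and f: "f \<in> rep_mor K Q X Y"
    and "bar_at X A B" and "bar_at Y A B"
  shows "bar_at N A B"
proof (rule bar_at_combine[OF assms(5,6)])
  note k = kernel_ofD[OF ker]
  show "vanishes N x" if "x \<in> verts Q" "vanishes X x" for x
    using vanishes_sub[OF k(2,1) injectiveD[OF k(3) that(1)] that] .
  show "gen_bij N (into A y) y" if "y \<in> verts Q" "gen_bij X (into A y) y" "gen_bij Y (into A y) y" for y
    using gen_bij_kernel[OF ker X Y f that(1,2)] that(3) by (simp add: gen_bij_def)
  show "cog_bij N (out_to (B - A) x) x"
    if "x \<in> verts Q" "cog_bij X (out_to (B - A) x) x" "cog_bij Y (out_to (B - A) x) x" for x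
    using cog_bij_kernel[OF ker X f that(1,2)] that(3) by (simp add: cog_bij_def)
  show "supports Q \<alpha> X \<or> supports Q \<alpha> Y" if "\<alpha> \<in> arcs Q" "supports Q \<alpha> N" for \<alpha>
    using supports_sub[OF k(2,1,3) that] by simp
qed

lemma bar_at_cokernel:
  assumes cok: "cokernel_of X Y f N c" and X: "is_rep K Q X" and Y: "is_rep K Q Y" and f: "f \<in> rep_mor K Q X Y"
    and "bar_at X A B" and "bar_at Y A B"
  shows "bar_at N A B"
proof (rule bar_at_combine[OF assms(5,6)])
  note c = cokernel_ofD[OF cok]
  show "vanishes N x" if "x \<in> verts Q" "vanishes Y x" for x
    using vanishes_quot[OF c(2,1) surjectiveD[OF c(3) that(1)] that] .
  show "gen_bij N (into A y) y" if "y \<in> verts Q" "gen_bij X (into A y) y" "gen_bij Y (into A y) y" for y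
    using gen_bij_cokernel[OF cok X Y f that(1) _ that(3)] that(2) by (simp add: gen_bij_def)
  show "cog_bij N (out_to (B - A) x) x"
    if "x \<in> verts Q" "cog_bij X (out_to (B - A) x) x" "cog_bij Y (out_to (B - A) x) x" for x
    using cog_bij_cokernel[OF cok Y f that(1) _ that(3)] that(2) by (simp add: cog_bij_def)
  show "supports Q \<alpha> X \<or> supports Q \<alpha> Y" if "\<alpha> \<in> arcs Q" "supports Q \<alpha> N" for \<alpha>
    using supports_quot[OF c(2,3) that] by simp
qed

lemma bar_at_product:
  assumes P: "product_of X Y S p q" and X: "is_rep K Q X" and Y: "is_rep K Q Y"
    and "bar_at X A B" and "bar_at Y A B"
  shows "bar_at S A B"
proof (rule bar_at_combine[OF assms(4,5)])
  note S = product_ofD(1)[OF P] and p = product_ofD(2)[OF P] and q = product_ofD(3)[OF P]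
  show "vanishes S x" if x: "x \<in> verts Q" and "vanishes X x" "vanishes Y x" for x
  proof (rule vanishesI[OF S x])
    fix v assume v: "v \<in> fiber S x"
    show "v = \<zero>\<^bsub>space_at S x\<^esub>"
      using vanishesD[OF that(2) mor_closed[OF p x v]] vanishesD[OF that(3) mor_closed[OF q x v]]
        linear_map_zero[OF mor_map[OF p x]] linear_map_zero[OF mor_map[OF q x]]
      by (intro product_eqI[OF P x v vs_zero_closed[OF rep_space[OF S x]]]) simp_all
  qed
  show "gen_bij S (into A y) y" if "y \<in> verts Q" "gen_bij X (into A y) y" "gen_bij Y (into A y) y" for y
    using gen_bij_product[OF P X Y that] .
  show "cog_bij S (out_to (B - A) x) x"
    if "x \<in> verts Q" "cog_bij X (out_to (B - A) x) x" "cog_bij Y (out_to (B - A) x) x" for x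
    using cog_bij_product[OF P that] .
  show "supports Q \<alpha> X \<or> supports Q \<alpha> Y" if \<alpha>: "\<alpha> \<in> arcs Q" and sup: "supports Q \<alpha> S" for \<alpha>
  proof -
    obtain v where v: "v \<in> fiber S (tail Q \<alpha>)" "map_at S \<alpha> v \<noteq> \<zero>\<^bsub>space_at S (head Q \<alpha>)\<^esub>"
      using sup by (auto simp: supports_def)
    note h = head_verts[OF \<alpha>] and Sv = rep_map_closed[OF S \<alpha> v(1)]
    have "p (head Q \<alpha>) (map_at S \<alpha> v) \<noteq> \<zero>\<^bsub>space_at X (head Q \<alpha>)\<^esub> \<or> q (head Q \<alpha>) (map_at S \<alpha> v) \<noteq> \<zero>\<^bsub>space_at Y (head Q \<alpha>)\<^esub>"
      using product_eqI[OF P h Sv vs_zero_closed[OF rep_space[OF S h]]] v(2)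
        linear_map_zero[OF mor_map[OF p h]] linear_map_zero[OF mor_map[OF q h]] by auto
    then show ?thesis
      using mor_natural[OF p \<alpha> v(1)] mor_natural[OF q \<alpha> v(1)]
        mor_closed[OF p tail_verts[OF \<alpha>] v(1)] mor_closed[OF q tail_verts[OF \<alpha>] v(1)]
      by (auto simp: supports_def)
  qed
qed

lemma bar_at_zero: "zero_rep Z \<Longrightarrow> bar_at Z {} {}"
  by (simp add: bar_at_def zero_rep_def vanishes_def)

lemma supports_not_vanishes:
  assumes M: "is_rep K Q M" and \<alpha>: "\<alpha> \<in> arcs Q" and "supports Q \<alpha> M"
  shows "\<not> vanishes M (tail Q \<alpha>)" and "\<not> vanishes M (head Q \<alpha>)"
proof -
  obtain v where v: "v \<in> fiber M (tail Q \<alpha>)" "map_at M \<alpha> v \<noteq> \<zero>\<^bsub>space_at M (head Q \<alpha>)\<^esub>"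
    using assms(3) by (auto simp: supports_def)
  show "\<not> vanishes M (head Q \<alpha>)" using vanishesD[OF _ rep_map_closed[OF M \<alpha> v(1)]] v(2) by auto
  show "\<not> vanishes M (tail Q \<alpha>)"
    using v vanishesD[of M "tail Q \<alpha>" v] linear_map_zero[OF rep_map[OF M \<alpha>]] by auto
qed

text \<open>Enlarging the two cones changes the arrow sets only near the finite intersections of
  successor and predecessor cones.\<close>

lemma bar_at_mono:
  assumes M: "is_rep K Q M" and bar: "bar_at M (succs a) (preds b)"
    and a: "a \<subseteq> a'" "finite a'" "a' \<subseteq> verts Q" and b: "b \<subseteq> b'" "finite b'" "b' \<subseteq> verts Q"
  shows "bar_at M (succs a') (preds b')"
proof -
  define A A' B B' where "A = succs a" and "A' = succs a'" and "B = preds b" and "B' = preds b'"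
  have AA: "A \<subseteq> A'" and BB: "B \<subseteq> B'" using succs_mono[OF a(1)] preds_mono[OF b(1)] by (auto simp: A_def A'_def B_def B'_def)
  define F where "F = A' \<inter> B'"
  have F: "finite F" "F \<subseteq> verts Q"
    using finite_succs_preds[OF a(2,3) b(2,3)] succs_verts by (auto simp: F_def A'_def B'_def)
  note finN = finite_neighbours[OF F] and finA = finite_arcs_at_set[OF F]
  have Asucc: "head Q \<alpha> \<in> A" if "\<alpha> \<in> arcs Q" "tail Q \<alpha> \<in> A" for \<alpha> using succs_closed that by (simp add: A_def)
  have Bpred: "tail Q \<alpha> \<in> B" if "\<alpha> \<in> arcs Q" "head Q \<alpha> \<in> B" for \<alpha> using preds_closed that by (simp add: B_def)
  have van: "vanishes M x" if "x \<in> verts Q" "x \<notin> A" "x \<notin> B" for x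
    using bar that unfolding bar_at_def A_def B_def by blast
  \<comment> \<open>A vertex that is new in \<open>A'\<close> and outside the overlap
    \<open>F\<close> is not in \<open>B\<close>, hence lies outside both old cones.\<close>
  have vanA: "vanishes M x" if "x \<in> verts Q" "x \<in> A'" "x \<notin> A" "x \<notin> F" for x
    using van[OF that(1,3)] that(2,4) BB by (auto simp: F_def)
  have NF: "head Q \<alpha> \<in> neighbours F" if "\<alpha> \<in> arcs Q" "tail Q \<alpha> \<in> F" for \<alpha>
    using that by (auto simp: neighbours_def)
  have NF': "tail Q \<alpha> \<in> neighbours F" if "\<alpha> \<in> arcs Q" "head Q \<alpha> \<in> F" for \<alpha>
    using that by (auto simp: neighbours_def)
  have "bar_at M A' B'"
    unfolding bar_at_def
  proof (intro conjI)
    show "\<forall>x\<in>verts Q. x \<notin> A' \<longrightarrow> x \<notin> B' \<longrightarrow> vanishes M x" using van AA BB by blast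
    show "finite {y \<in> verts Q. y \<in> A' \<and> \<not> gen_bij M (into A' y) y}"
    proof (rule finite_subset)
      show "{y \<in> verts Q. y \<in> A' \<and> \<not> gen_bij M (into A' y) y} \<subseteq>
        {y \<in> verts Q. y \<in> A \<and> \<not> gen_bij M (into A y) y} \<union> F \<union> neighbours F"
      proof (rule subsetI, rule ccontr)
        fix y assume "y \<in> {y \<in> verts Q. y \<in> A' \<and> \<not> gen_bij M (into A' y) y}"
          and n: "y \<notin> {y \<in> verts Q. y \<in> A \<and> \<not> gen_bij M (into A y) y} \<union> F \<union> neighbours F"
        then have y: "y \<in> verts Q" "y \<in> A'" "\<not> gen_bij M (into A' y) y" "y \<notin> F" "y \<notin> neighbours F" by auto
        have tails: "vanishes M (tail Q \<alpha>)" if \<alpha>: "\<alpha> \<in> into A' y" "tail Q \<alpha> \<notin> A" for \<alpha>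
        proof -
          have "tail Q \<alpha> \<notin> F" using NF[OF intoD(1)[OF \<alpha>(1)]] intoD(2)[OF \<alpha>(1)] y(5) by auto
          then show ?thesis using vanA[OF tail_verts[OF intoD(1)[OF \<alpha>(1)]] intoD(3)[OF \<alpha>(1)] \<alpha>(2)] by simp
        qed
        show False
        \<comment> \<open>An old vertex only gains arrows whose tails carry the zero space. A new
          one has no tail in \<open>A\<close>, since \<open>A\<close> is successor-closed, so
          everything around it is zero.\<close>
        proof (cases "y \<in> A")
          case True
          then have "gen_bij M (into A y) y" using n y(1) by simp
          moreover have "gen_bij M (into A' y) y \<longleftrightarrow> gen_bij M (into A y) y"
            by (rule gen_bij_change[OF M y(1) into_mono[OF AA]]) (use tails in \<open>auto simp: into_def\<close>)
          ultimately show False using y(3) by simp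
        next
          case False
          have "gen_bij M (into A' y) y"
          proof (rule gen_bij_vanishes[OF M y(1) vanA[OF y(1,2) False y(4)]])
            fix \<alpha> assume \<alpha>: "\<alpha> \<in> into A' y"
            have "tail Q \<alpha> \<notin> A" using Asucc[OF intoD(1)[OF \<alpha>]] intoD(2)[OF \<alpha>] False by auto
            then show "vanishes M (tail Q \<alpha>)" using tails[OF \<alpha>] by simp
          qed
          then show False using y(3) by simp
        qed
      qed
      show "finite ({y \<in> verts Q. y \<in> A \<and> \<not> gen_bij M (into A y) y} \<union> F \<union> neighbours F)"
        using bar F finN by (simp add: bar_at_def A_def B_def)
    qed
    show "finite {x \<in> verts Q. x \<in> B' - A' \<and> \<not> cog_bij M (out_to (B' - A') x) x}"
    proof (rule finite_subset)
      show "{x \<in> verts Q. x \<in> B' - A' \<and> \<not> cog_bij M (out_to (B' - A') x) x} \<subseteq>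
        {x \<in> verts Q. x \<in> B - A \<and> \<not> cog_bij M (out_to (B - A) x) x} \<union> neighbours F"
      proof (rule subsetI, rule ccontr)
        fix x assume "x \<in> {x \<in> verts Q. x \<in> B' - A' \<and> \<not> cog_bij M (out_to (B' - A') x) x}"
          and n: "x \<notin> {x \<in> verts Q. x \<in> B - A \<and> \<not> cog_bij M (out_to (B - A) x) x} \<union> neighbours F"
        then have x: "x \<in> verts Q" "x \<in> B'" "x \<notin> A'" "\<not> cog_bij M (out_to (B' - A') x) x" "x \<notin> neighbours F" by auto
        have xA: "x \<notin> A" using x(3) AA by auto
        show False
        proof (cases "x \<in> B")
          case True
          \<comment> \<open>An arrow lost here would have its head in \<open>B\<close> and in
            \<open>A'\<close>, hence in \<open>F\<close>, making \<open>x\<close> a neighbour of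
            \<open>F\<close>.\<close>
          have sub: "out_to (B - A) x \<subseteq> out_to (B' - A') x"
          proof
            fix \<alpha> assume \<alpha>: "\<alpha> \<in> out_to (B - A) x"
            have "head Q \<alpha> \<notin> F" using NF'[OF out_toD(1)[OF \<alpha>]] out_toD(2)[OF \<alpha>] x(5) by auto
            then show "\<alpha> \<in> out_to (B' - A') x" using \<alpha> BB by (auto simp: out_to_def F_def)
          qed
          have "cog_bij M (out_to (B' - A') x) x \<longleftrightarrow> cog_bij M (out_to (B - A) x) x"
          proof (rule cog_bij_change[OF M x(1) sub])
            fix \<alpha> assume \<alpha>: "\<alpha> \<in> out_to (B' - A') x - out_to (B - A) x"
            then have "head Q \<alpha> \<notin> A" "head Q \<alpha> \<notin> B" "\<alpha> \<in> arcs Q" using AA by (auto simp: out_to_def)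
            then show "vanishes M (head Q \<alpha>)" using van by simp
          qed
          moreover have "cog_bij M (out_to (B - A) x) x" using n x(1) xA True by simp
          ultimately show False using x(4) by simp
        next
          case False
          have "cog_bij M (out_to (B' - A') x) x"
          proof (rule cog_bij_vanishes[OF M x(1) van[OF x(1) xA False]])
            fix \<alpha> assume \<alpha>: "\<alpha> \<in> out_to (B' - A') x"
            have "head Q \<alpha> \<notin> B" using Bpred[OF out_toD(1)[OF \<alpha>]] out_toD(2)[OF \<alpha>] False by auto
            then show "vanishes M (head Q \<alpha>)" using van[OF head_verts[OF out_toD(1)[OF \<alpha>]]] out_toD(3)[OF \<alpha>] AA by auto
          qed
          then show False using x(4) by simp
        qed
      qed
      show "finite ({x \<in> verts Q. x \<in> B - A \<and> \<not> cog_bij M (out_to (B - A) x) x} \<union> neighbours F)"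
        using bar finN by (simp add: bar_at_def A_def B_def)
    qed
    show "finite {\<alpha> \<in> arcs Q. tail Q \<alpha> \<in> B' - A' \<and> head Q \<alpha> \<in> A' \<and> supports Q \<alpha> M}"
    proof (rule finite_subset)
      show "{\<alpha> \<in> arcs Q. tail Q \<alpha> \<in> B' - A' \<and> head Q \<alpha> \<in> A' \<and> supports Q \<alpha> M} \<subseteq>
        {\<alpha> \<in> arcs Q. tail Q \<alpha> \<in> B - A \<and> head Q \<alpha> \<in> A \<and> supports Q \<alpha> M} \<union> arcs_at F"
      proof
        fix \<alpha> assume "\<alpha> \<in> {\<alpha> \<in> arcs Q. tail Q \<alpha> \<in> B' - A' \<and> head Q \<alpha> \<in> A' \<and> supports Q \<alpha> M}"
        then have \<alpha>: "\<alpha> \<in> arcs Q" "tail Q \<alpha> \<in> B'" "tail Q \<alpha> \<notin> A'" "head Q \<alpha> \<in> A'" "supports Q \<alpha> M" by auto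
        note nv = supports_not_vanishes[OF M \<alpha>(1,5)]
        \<comment> \<open>A supporting arrow has nonzero spaces at both ends, which rules out ends
          outside the old cones.\<close>
        have "tail Q \<alpha> \<in> B - A" using nv(1) van[OF tail_verts[OF \<alpha>(1)]] \<alpha>(3) AA by blast
        moreover have "head Q \<alpha> \<in> A \<or> head Q \<alpha> \<in> F" using nv(2) vanA[OF head_verts[OF \<alpha>(1)] \<alpha>(4)] by blast
        ultimately show "\<alpha> \<in> {\<alpha> \<in> arcs Q. tail Q \<alpha> \<in> B - A \<and> head Q \<alpha> \<in> A \<and> supports Q \<alpha> M} \<union> arcs_at F"
          using \<alpha> by (auto simp: arcs_at_def)
      qed
      show "finite ({\<alpha> \<in> arcs Q. tail Q \<alpha> \<in> B - A \<and> head Q \<alpha> \<in> A \<and> supports Q \<alpha> M} \<union> arcs_at F)"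
        using bar finA by (simp add: bar_at_def A_def B_def)
    qed
  qed
  then show ?thesis by (simp add: A'_def B'_def)
qed

sublocale K: field K by (rule field)

section \<open>Projective presentations\<close>

lemma func_space_simps:
  "carrier (ring.func_space K S) = S \<rightarrow>\<^sub>E carrier K"
  "\<zero>\<^bsub>ring.func_space K S\<^esub> = (\<lambda>s\<in>S. \<zero>\<^bsub>K\<^esub>)"
  "f \<oplus>\<^bsub>ring.func_space K S\<^esub> g = (\<lambda>s\<in>S. f s \<oplus>\<^bsub>K\<^esub> g s)"
  "c \<odot>\<^bsub>ring.func_space K S\<^esub> f = (\<lambda>s\<in>S. c \<otimes>\<^bsub>K\<^esub> f s)"
  by (simp_all add: K.func_space_def)

lemma func_space_vectorspace: "vectorspace K (ring.func_space K S)"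
  unfolding vectorspace_def using K.func_space_is_module field by blast

lemma func_space_fin_dim:
  assumes "finite S"
  shows "vectorspace.fin_dim K (ring.func_space K S)"
proof -
  have "separating K (ring.func_space K S) (carrier (ring.func_space K S)) S (\<lambda>s f. f s)"
    unfolding separating_def linear_functional_def
    using assms by (auto simp: func_space_simps PiE_iff fun_eq_iff extensional_def)
  then show ?thesis by (rule fin_dimI_functionals[OF func_space_vectorspace])
qed

text \<open>Appending an arrow is injective on paths, so the sum in \<open>basis_map\<close> has at
  most one term.\<close>

lemma proj_rep_map:
  assumes \<alpha>: "\<alpha> \<in> arcs Q" and f: "f \<in> fiber (proj_rep K Q a) (tail Q \<alpha>)" and q: "q \<in> paths Q a (head Q \<alpha>)"
  shows "map_at (proj_rep K Q a) \<alpha> f q = (if q \<noteq> [] \<and> last q = \<alpha> then f (butlast q) else \<zero>\<^bsub>K\<^esub>)"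
proof -
  have *: "map_at (proj_rep K Q a) \<alpha> f q = (\<Oplus>\<^bsub>K\<^esub>p\<in>{p \<in> paths Q a (tail Q \<alpha>). p @ [\<alpha>] = q}. f p)"
    using q by (simp add: proj_rep_def basis_map_def)
  show ?thesis
  proof (cases "q \<noteq> [] \<and> last q = \<alpha>")
    case True
    then have q': "q = butlast q @ [\<alpha>]" by (metis append_butlast_last_id)
    then have p: "butlast q \<in> paths Q a (tail Q \<alpha>)" using q paths_snoc_iff by metis
    then have "{p \<in> paths Q a (tail Q \<alpha>). p @ [\<alpha>] = q} = {butlast q}" using q' by auto
    moreover have "f (butlast q) \<in> carrier K" using f p by (auto simp: proj_rep_def func_space_simps)
    ultimately show ?thesis using True * by simp
  next
    case False
    then have "{p \<in> paths Q a (tail Q \<alpha>). p @ [\<alpha>] = q} = {}" by auto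
    then show ?thesis using False unfolding * by (simp only: K.finsum_empty if_False)
  qed
qed

lemma proj_rep_rep: "is_rep K Q (proj_rep K Q a)"
  unfolding is_rep_def
proof (intro conjI ballI)
  show V: "vectorspace K (space_at (proj_rep K Q a) x)" for x
    by (simp add: proj_rep_def func_space_vectorspace)
  fix \<alpha> assume \<alpha>: "\<alpha> \<in> arcs Q"
  let ?P = "proj_rep K Q a"
  have ext: "map_at ?P \<alpha> f \<in> extensional (paths Q a (head Q \<alpha>))" for f
    by (simp add: proj_rep_def basis_map_def)
  have val: "f (butlast q) \<in> carrier K" if "f \<in> fiber ?P (tail Q \<alpha>)" "q \<in> paths Q a (head Q \<alpha>)" "q \<noteq> []" "last q = \<alpha>" for f q
  proof -
    have "q = butlast q @ [\<alpha>]" using that(3,4) by (metis append_butlast_last_id)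
    then have "butlast q \<in> paths Q a (tail Q \<alpha>)" using that(2) paths_snoc_iff by metis
    then show ?thesis using that(1) by (auto simp: proj_rep_def func_space_simps)
  qed
  have bl: "butlast q \<in> paths Q a (tail Q \<alpha>)" if "q \<in> paths Q a (head Q \<alpha>)" "q \<noteq> []" "last q = \<alpha>" for q
    using that paths_snoc_iff[of "butlast q" \<alpha> a "head Q \<alpha>"] by auto
  have closed: "map_at ?P \<alpha> f \<in> fiber ?P (head Q \<alpha>)" if f: "f \<in> fiber ?P (tail Q \<alpha>)" for f
  proof -
    have "map_at ?P \<alpha> f \<in> paths Q a (head Q \<alpha>) \<rightarrow>\<^sub>E carrier K"
      using ext proj_rep_map[OF \<alpha> f] val[OF f] by (simp add: PiE_def Pi_def)
    then show ?thesis by (simp add: proj_rep_def func_space_simps)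
  qed
  show "linear_map K (space_at ?P (tail Q \<alpha>)) (space_at ?P (head Q \<alpha>)) (map_at ?P \<alpha>)"
  proof (rule linear_mapI[OF V V closed])
    fix f g assume f: "f \<in> fiber ?P (tail Q \<alpha>)" and g: "g \<in> fiber ?P (tail Q \<alpha>)"
    note fg = vs_add_closed[OF V f g]
    show "map_at ?P \<alpha> (f \<oplus>\<^bsub>space_at ?P (tail Q \<alpha>)\<^esub> g) = map_at ?P \<alpha> f \<oplus>\<^bsub>space_at ?P (head Q \<alpha>)\<^esub> map_at ?P \<alpha> g"
    proof (rule extensionalityI[OF ext])
      show "map_at ?P \<alpha> f \<oplus>\<^bsub>space_at ?P (head Q \<alpha>)\<^esub> map_at ?P \<alpha> g \<in> extensional (paths Q a (head Q \<alpha>))"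
        by (simp add: proj_rep_def func_space_simps)
      fix q assume q: "q \<in> paths Q a (head Q \<alpha>)"
      have "(map_at ?P \<alpha> f \<oplus>\<^bsub>space_at ?P (head Q \<alpha>)\<^esub> map_at ?P \<alpha> g) q = map_at ?P \<alpha> f q \<oplus>\<^bsub>K\<^esub> map_at ?P \<alpha> g q"
        using q by (simp add: proj_rep_def func_space_simps)
      then show "map_at ?P \<alpha> (f \<oplus>\<^bsub>space_at ?P (tail Q \<alpha>)\<^esub> g) q = (map_at ?P \<alpha> f \<oplus>\<^bsub>space_at ?P (head Q \<alpha>)\<^esub> map_at ?P \<alpha> g) q"
        using proj_rep_map[OF \<alpha> f q] proj_rep_map[OF \<alpha> g q] proj_rep_map[OF \<alpha> fg q] bl[OF q]
        by (auto simp: proj_rep_def func_space_simps)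
    qed
  next
    fix c f assume c: "c \<in> carrier K" and f: "f \<in> fiber ?P (tail Q \<alpha>)"
    note cf = vs_smult_closed[OF V c f]
    show "map_at ?P \<alpha> (c \<odot>\<^bsub>space_at ?P (tail Q \<alpha>)\<^esub> f) = c \<odot>\<^bsub>space_at ?P (head Q \<alpha>)\<^esub> map_at ?P \<alpha> f"
    proof (rule extensionalityI[OF ext])
      show "c \<odot>\<^bsub>space_at ?P (head Q \<alpha>)\<^esub> map_at ?P \<alpha> f \<in> extensional (paths Q a (head Q \<alpha>))"
        by (simp add: proj_rep_def func_space_simps)
      fix q assume q: "q \<in> paths Q a (head Q \<alpha>)"
      have "(c \<odot>\<^bsub>space_at ?P (head Q \<alpha>)\<^esub> map_at ?P \<alpha> f) q = c \<otimes>\<^bsub>K\<^esub> map_at ?P \<alpha> f q"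
        using q by (simp add: proj_rep_def func_space_simps)
      then show "map_at ?P \<alpha> (c \<odot>\<^bsub>space_at ?P (tail Q \<alpha>)\<^esub> f) q = (c \<odot>\<^bsub>space_at ?P (head Q \<alpha>)\<^esub> map_at ?P \<alpha> f) q"
        using proj_rep_map[OF \<alpha> f q] proj_rep_map[OF \<alpha> cf q] bl[OF q] c
        by (auto simp: proj_rep_def func_space_simps)
    qed
  qed
qed

abbreviation proj_sum where "proj_sum as \<equiv> sum_rep (map (proj_rep K Q) as)"

lemma proj_sum_rep: "is_rep K Q (proj_sum as)"
  by (rule sum_rep_rep) (auto intro: proj_rep_rep)

lemma proj_sum_fin_dim: "set as \<subseteq> verts Q \<Longrightarrow> locally_fin_dim K Q (proj_sum as)"
  by (rule sum_rep_fin_dim)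
    (auto simp: locally_fin_dim_def proj_rep_rep, auto simp: proj_rep_def intro!: func_space_fin_dim finite_paths)

lemma proj_sum_fiber:
  "fiber (proj_sum as) x = (\<Pi>\<^sub>E i\<in>{..<length as}. paths Q (as ! i) x \<rightarrow>\<^sub>E carrier K)"
  by (simp add: sum_rep_def sum_space_simps) (auto simp: proj_rep_def func_space_simps intro!: PiE_cong)

lemma proj_sum_eqI:
  assumes "c \<in> fiber (proj_sum as) x" and "d \<in> fiber (proj_sum as) x"
    and "\<And>i p. i < length as \<Longrightarrow> p \<in> paths Q (as ! i) x \<Longrightarrow> c i p = d i p"
  shows "c = d"
proof (rule PiE_ext[OF assms(1,2)[unfolded proj_sum_fiber]])
  fix i assume i: "i \<in> {..<length as}"
  then have "c i \<in> paths Q (as ! i) x \<rightarrow>\<^sub>E carrier K" "d i \<in> paths Q (as ! i) x \<rightarrow>\<^sub>E carrier K"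
    using assms(1,2) unfolding proj_sum_fiber by auto
  then show "c i = d i" by (rule PiE_ext) (use assms(3) i in auto)
qed

lemma proj_sum_zero: "i < length as \<Longrightarrow> p \<in> paths Q (as ! i) x \<Longrightarrow> \<zero>\<^bsub>space_at (proj_sum as) x\<^esub> i p = \<zero>\<^bsub>K\<^esub>"
  by (simp add: sum_rep_def sum_space_simps) (simp add: proj_rep_def func_space_simps)

lemma proj_sum_add: "i < length as \<Longrightarrow> p \<in> paths Q (as ! i) x \<Longrightarrow>
    (c \<oplus>\<^bsub>space_at (proj_sum as) x\<^esub> d) i p = c i p \<oplus>\<^bsub>K\<^esub> d i p"
  by (simp add: sum_rep_def sum_space_simps) (simp add: proj_rep_def func_space_simps)

lemma proj_sum_smult: "i < length as \<Longrightarrow> p \<in> paths Q (as ! i) x \<Longrightarrow>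
    (l \<odot>\<^bsub>space_at (proj_sum as) x\<^esub> d) i p = l \<otimes>\<^bsub>K\<^esub> d i p"
  by (simp add: sum_rep_def sum_space_simps) (simp add: proj_rep_def func_space_simps)

lemma proj_sum_entry: "c \<in> fiber (proj_sum as) x \<Longrightarrow> i < length as \<Longrightarrow> p \<in> paths Q (as ! i) x \<Longrightarrow> c i p \<in> carrier K"
  unfolding proj_sum_fiber by (auto simp: PiE_iff)

lemma proj_sum_map:
  assumes \<alpha>: "\<alpha> \<in> arcs Q" and c: "c \<in> fiber (proj_sum as) (tail Q \<alpha>)" and i: "i < length as"
    and q: "q \<in> paths Q (as ! i) (head Q \<alpha>)"
  shows "map_at (proj_sum as) \<alpha> c i q = (if q \<noteq> [] \<and> last q = \<alpha> then c i (butlast q) else \<zero>\<^bsub>K\<^esub>)"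
proof -
  have "c i \<in> fiber (proj_rep K Q (as ! i)) (tail Q \<alpha>)"
    using c i unfolding proj_sum_fiber by (auto simp: proj_rep_def func_space_simps)
  then show ?thesis using proj_rep_map[OF \<alpha> _ q] i by (simp add: sum_rep_def)
qed

lemma proj_sum_vanishes: "x \<in> verts Q \<Longrightarrow> x \<notin> succs (set as) \<Longrightarrow> vanishes (proj_sum as) x"
proof (rule vanishesI[OF proj_sum_rep])
  fix v assume x: "x \<in> verts Q" "x \<notin> succs (set as)" and v: "v \<in> fiber (proj_sum as) x"
  have "paths Q (as ! i) x = {}" if "i < length as" for i using x that by (auto simp: succs_def)
  then show "v = \<zero>\<^bsub>space_at (proj_sum as) x\<^esub>"
    by (intro proj_sum_eqI[OF v vs_zero_closed[OF rep_space[OF proj_sum_rep x(1)]]]) auto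
qed

text \<open>A nontrivial path has a unique last arrow, so exactly one summand contributes to its
  coefficient; a trivial path is reached by none.\<close>

lemma proj_arrow_sum:
  assumes y: "y \<in> verts Q" and w: "w \<in> tail_tuples (proj_sum as) (into UNIV y)"
    and i: "i < length as" and q: "q \<in> paths Q (as ! i) y"
  shows "arrow_sum (proj_sum as) (into UNIV y) y w i q = (if q = [] then \<zero>\<^bsub>K\<^esub> else w (last q) i (butlast q))"
proof -
  let ?P = "proj_sum as"
  have V: "vectorspace K (space_at ?P y)" by (rule rep_space[OF proj_sum_rep y])
  have lf: "linear_functional K (space_at ?P y) (\<lambda>c. c i q)"
    unfolding linear_functional_def
    using i q proj_sum_entry[OF _ i q] proj_sum_add[OF i q] proj_sum_smult[OF i q] by auto
  have wc: "w \<alpha> \<in> fiber ?P (tail Q \<alpha>)" if "\<alpha> \<in> into UNIV y" for \<alpha> using w that by (auto simp: tail_tuples_def)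
  have "arrow_sum ?P (into UNIV y) y w i q = (\<Oplus>\<^bsub>K\<^esub>\<alpha>\<in>into UNIV y. map_at ?P \<alpha> (w \<alpha>) i q)"
    unfolding arrow_sum_def by (rule linear_functional_finsum[OF V lf tail_tuples_map[OF proj_sum_rep w]])
  also have "\<dots> = (\<Oplus>\<^bsub>K\<^esub>\<alpha>\<in>into UNIV y. if q \<noteq> [] \<and> last q = \<alpha> then w \<alpha> i (butlast q) else \<zero>\<^bsub>K\<^esub>)"
  proof (rule K.finsum_cong'[OF refl])
    have eq: "map_at ?P \<alpha> (w \<alpha>) i q = (if q \<noteq> [] \<and> last q = \<alpha> then w \<alpha> i (butlast q) else \<zero>\<^bsub>K\<^esub>)" if \<alpha>: "\<alpha> \<in> into UNIV y" for \<alpha>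
      using proj_sum_map[OF intoD(1)[OF \<alpha>] wc[OF \<alpha>] i] q intoD(2)[OF \<alpha>] by simp
    then show "\<And>\<alpha>. \<alpha> \<in> into UNIV y \<Longrightarrow> map_at ?P \<alpha> (w \<alpha>) i q = (if q \<noteq> [] \<and> last q = \<alpha> then w \<alpha> i (butlast q) else \<zero>\<^bsub>K\<^esub>)" .
    show "(\<lambda>\<alpha>. if q \<noteq> [] \<and> last q = \<alpha> then w \<alpha> i (butlast q) else \<zero>\<^bsub>K\<^esub>) \<in> into UNIV y \<rightarrow> carrier K"
    proof
      fix \<alpha> assume \<alpha>: "\<alpha> \<in> into UNIV y"
      have "map_at ?P \<alpha> (w \<alpha>) i q \<in> carrier K"
        using proj_sum_entry[OF rep_map_closed[OF proj_sum_rep intoD(1)[OF \<alpha>] wc[OF \<alpha>]] i] q intoD(2)[OF \<alpha>] by simp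
      then show "(if q \<noteq> [] \<and> last q = \<alpha> then w \<alpha> i (butlast q) else \<zero>\<^bsub>K\<^esub>) \<in> carrier K" using eq[OF \<alpha>] by simp
    qed
  qed
  also have "\<dots> = (if q = [] then \<zero>\<^bsub>K\<^esub> else w (last q) i (butlast q))"
  proof (cases "q = []")
    case False
    then have q': "butlast q @ [last q] \<in> paths Q (as ! i) y" using q by simp
    then have l: "last q \<in> into UNIV y" and b: "butlast q \<in> paths Q (as ! i) (tail Q (last q))"
      unfolding paths_snoc_iff by (auto simp: into_def)
    have "(\<Oplus>\<^bsub>K\<^esub>\<alpha>\<in>into UNIV y. if q \<noteq> [] \<and> last q = \<alpha> then w \<alpha> i (butlast q) else \<zero>\<^bsub>K\<^esub>) =
        (\<Oplus>\<^bsub>K\<^esub>\<alpha>\<in>into UNIV y. if last q = \<alpha> then w (last q) i (butlast q) else \<zero>\<^bsub>K\<^esub>)"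
      by (rule K.finsum_cong'[OF refl]) (use False proj_sum_entry[OF wc[OF l] i b] in auto)
    also have "\<dots> = w (last q) i (butlast q)"
      using K.add.finprod_singleton[OF l finite_into[OF y], of "\<lambda>_. w (last q) i (butlast q)"] proj_sum_entry[OF wc[OF l] i b]
      by simp
    finally show ?thesis using False by simp
  qed simp
  finally show ?thesis .
qed

text \<open>Each coefficient of each entry survives in the sum: that of \<open>w \<alpha>\<close> at
  \<open>p\<close> is the coefficient at \<open>p @ [\<alpha>]\<close>. Trivial paths play no part,
  so there are no exceptional vertices.\<close>

lemma proj_sum_gen_inj:
  assumes y: "y \<in> verts Q"
  shows "gen_inj (proj_sum as) (into UNIV y) y"
proof (rule gen_injI, rule ballI)
  let ?P = "proj_sum as"
  fix w \<alpha> assume w: "w \<in> tail_tuples ?P (into UNIV y)" and 0: "arrow_sum ?P (into UNIV y) y w = \<zero>\<^bsub>space_at ?P y\<^esub>"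
    and \<alpha>: "\<alpha> \<in> into UNIV y"
  note t = tail_verts[OF intoD(1)[OF \<alpha>]]
  have wc: "w \<alpha> \<in> fiber ?P (tail Q \<alpha>)" using w \<alpha> by (auto simp: tail_tuples_def)
  show "w \<alpha> = \<zero>\<^bsub>space_at ?P (tail Q \<alpha>)\<^esub>"
  proof (rule proj_sum_eqI[OF wc vs_zero_closed[OF rep_space[OF proj_sum_rep t]]])
    fix i p assume i: "i < length as" and p: "p \<in> paths Q (as ! i) (tail Q \<alpha>)"
    have q: "p @ [\<alpha>] \<in> paths Q (as ! i) y" using p \<alpha> by (auto simp: paths_snoc_iff into_def)
    show "w \<alpha> i p = \<zero>\<^bsub>space_at ?P (tail Q \<alpha>)\<^esub> i p"
      using proj_arrow_sum[OF y w i q] proj_sum_zero[OF i q] proj_sum_zero[OF i p] 0 by simp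
  qed
qed

text \<open>The component of \<open>c\<close> on the paths ending with \<open>\<alpha>\<close>,
  moved back to the tail. These components invert the arrow sum up to the coefficients of trivial
  paths.\<close>

definition shift :: "'v list \<Rightarrow> 'a \<Rightarrow> (nat \<Rightarrow> 'a list \<Rightarrow> 'k) \<Rightarrow> nat \<Rightarrow> 'a list \<Rightarrow> 'k"
  where "shift as \<alpha> c = (\<lambda>i\<in>{..<length as}. \<lambda>p\<in>paths Q (as ! i) (tail Q \<alpha>). c i (p @ [\<alpha>]))"

lemma shift_fiber:
  assumes "c \<in> fiber (proj_sum as) y" and \<alpha>: "\<alpha> \<in> into UNIV y"
  shows "shift as \<alpha> c \<in> fiber (proj_sum as) (tail Q \<alpha>)"
proof -
  have "c i (p @ [\<alpha>]) \<in> carrier K" if "i < length as" "p \<in> paths Q (as ! i) (tail Q \<alpha>)" for i p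
    using proj_sum_entry[OF assms(1) that(1)] that(2) \<alpha> by (auto simp: paths_snoc_iff into_def)
  then show ?thesis unfolding proj_sum_fiber shift_def by auto
qed

lemma shift_apply: "i < length as \<Longrightarrow> p \<in> paths Q (as ! i) (tail Q \<alpha>) \<Longrightarrow> shift as \<alpha> c i p = c i (p @ [\<alpha>])"
  by (simp add: shift_def)

text \<open>Only trivial paths fail to end with an arrow, and they occur just at the vertices listed
  in \<open>as\<close>.\<close>

lemma proj_sum_gen_bij:
  assumes y: "y \<in> verts Q" and "y \<notin> set as"
  shows "gen_bij (proj_sum as) (into UNIV y) y"
proof -
  let ?P = "proj_sum as"
  have "gen_surj ?P (into UNIV y) y"
    unfolding gen_surj_def
  proof
    fix c assume c: "c \<in> fiber ?P y"
    have w: "(\<lambda>\<alpha>. shift as \<alpha> c) \<in> tail_tuples ?P (into UNIV y)"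
      using shift_fiber[OF c] by (auto simp: tail_tuples_def)
    have "c = arrow_sum ?P (into UNIV y) y (\<lambda>\<alpha>. shift as \<alpha> c)"
    proof (rule proj_sum_eqI[OF c arrow_sum_closed[OF proj_sum_rep y w]])
      fix i q assume i: "i < length as" and q: "q \<in> paths Q (as ! i) y"
      have "q \<noteq> []" using q assms(2) i by (auto simp: paths_Nil_iff)
      then have q': "butlast q @ [last q] = q" by simp
      then have "butlast q \<in> paths Q (as ! i) (tail Q (last q))" using q paths_snoc_iff by metis
      then show "c i q = arrow_sum ?P (into UNIV y) y (\<lambda>\<alpha>. shift as \<alpha> c) i q"
        using proj_arrow_sum[OF y w i q] \<open>q \<noteq> []\<close> shift_apply[OF i] q' by simp
    qed
    then show "\<exists>w\<in>tail_tuples ?P (into UNIV y). c = arrow_sum ?P (into UNIV y) y w" using w by blast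
  qed
  then show ?thesis using proj_sum_gen_inj[OF y] by (simp add: gen_bij_def)
qed

section \<open>Morphisms from sums of the \<open>P_x\<close>, given by generators\<close>

definition act :: "('v, 'a, 'k, 'u) rep \<Rightarrow> 'a list \<Rightarrow> 'u \<Rightarrow> 'u" where
  "act M p = fold (map_at M) p"

lemma act_simps: "act M [] v = v" "act M (\<alpha> # p) v = act M p (map_at M \<alpha> v)" "act M (p @ [\<alpha>]) v = map_at M \<alpha> (act M p v)"
  by (simp_all add: act_def)

lemma act_closed: "is_rep K Q M \<Longrightarrow> p \<in> paths Q x y \<Longrightarrow> v \<in> fiber M x \<Longrightarrow> act M p v \<in> fiber M y"
proof (induct p arbitrary: x v)
  case (Cons \<alpha> p)
  then have "\<alpha> \<in> arcs Q" "x = tail Q \<alpha>" "p \<in> paths Q (head Q \<alpha>) y" by (auto simp: paths_Cons_iff)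
  then show ?case using Cons rep_map_closed[OF Cons.prems(1)] by (simp add: act_simps)
qed (auto simp: act_simps paths_Nil_iff)

definition path_index :: "'v list \<Rightarrow> 'v \<Rightarrow> (nat \<times> 'a list) set"
  where "path_index as x = Sigma {..<length as} (\<lambda>i. paths Q (as ! i) x)"

text \<open>The morphism given by the Yoneda correspondence: the trivial path of the summand
  \<open>i\<close> goes to \<open>m i\<close>, and every other path to the vector obtained by acting
  with it on \<open>m i\<close>.\<close>

definition gen_map :: "('v, 'a, 'k, 'u) rep \<Rightarrow> 'v list \<Rightarrow> (nat \<Rightarrow> 'u) \<Rightarrow> 'v \<Rightarrow> (nat \<Rightarrow> 'a list \<Rightarrow> 'k) \<Rightarrow> 'u"
  where "gen_map M as m x c =
    (\<Oplus>\<^bsub>space_at M x\<^esub>t\<in>path_index as x. c (fst t) (snd t) \<odot>\<^bsub>space_at M x\<^esub> act M (snd t) (m (fst t)))"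

text \<open>Positions and not vertices are collected, since \<open>as\<close> may list a vertex
  several times.\<close>

definition at_vertex :: "'v list \<Rightarrow> 'v \<Rightarrow> nat set"
  where "at_vertex as y = {i. i < length as \<and> as ! i = y}"

definition gen_sum :: "('v, 'a, 'k, 'u) rep \<Rightarrow> 'v list \<Rightarrow> (nat \<Rightarrow> 'u) \<Rightarrow> 'v \<Rightarrow> (nat \<Rightarrow> 'k) \<Rightarrow> 'u"
  where "gen_sum M as m y l = (\<Oplus>\<^bsub>space_at M y\<^esub>i\<in>at_vertex as y. l i \<odot>\<^bsub>space_at M y\<^esub> m i)"

lemma finite_path_index: "set as \<subseteq> verts Q \<Longrightarrow> x \<in> verts Q \<Longrightarrow> finite (path_index as x)"
  unfolding path_index_def using nth_mem by (intro finite_SigmaI finite_paths) auto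

lemma gen_map_summand:
  assumes M: "is_rep K Q M" and x: "x \<in> verts Q" and m: "\<And>i. i < length as \<Longrightarrow> m i \<in> fiber M (as ! i)"
    and c: "c \<in> fiber (proj_sum as) x" and t: "t \<in> path_index as x"
  shows "c (fst t) (snd t) \<odot>\<^bsub>space_at M x\<^esub> act M (snd t) (m (fst t)) \<in> fiber M x"
proof -
  have t': "fst t < length as" "snd t \<in> paths Q (as ! fst t) x" using t by (auto simp: path_index_def)
  show ?thesis
    by (rule vs_smult_closed[OF rep_space[OF M x] proj_sum_entry[OF c t'] act_closed[OF M t'(2) m[OF t'(1)]]])
qed

lemma gen_map_linear:
  assumes M: "is_rep K Q M" and x: "x \<in> verts Q" and m: "\<And>i. i < length as \<Longrightarrow> m i \<in> fiber M (as ! i)"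
    and as: "set as \<subseteq> verts Q"
  shows "linear_map K (space_at (proj_sum as) x) (space_at M x) (gen_map M as m x)"
proof (rule linear_mapI[OF rep_space[OF proj_sum_rep x] rep_space[OF M x]])
  interpret V: vectorspace K "space_at M x" using rep_space[OF M x] .
  note summand = gen_map_summand[OF M x m]
  have a: "act M (snd t) (m (fst t)) \<in> fiber M x" if "t \<in> path_index as x" for t
    using that act_closed[OF M _ m] by (auto simp: path_index_def)
  have e: "c (fst t) (snd t) \<in> carrier K" if "c \<in> fiber (proj_sum as) x" "t \<in> path_index as x" for c t
    using proj_sum_entry[OF that(1)] that(2) by (auto simp: path_index_def)
  show "gen_map M as m x c \<in> fiber M x" if "c \<in> fiber (proj_sum as) x" for c
    unfolding gen_map_def using summand[OF _ that] by (intro V.M.finsum_closed) auto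
  show "gen_map M as m x (c \<oplus>\<^bsub>space_at (proj_sum as) x\<^esub> d) = gen_map M as m x c \<oplus>\<^bsub>space_at M x\<^esub> gen_map M as m x d"
    if c: "c \<in> fiber (proj_sum as) x" and d: "d \<in> fiber (proj_sum as) x" for c d
  proof -
    have "gen_map M as m x (c \<oplus>\<^bsub>space_at (proj_sum as) x\<^esub> d) =
      (\<Oplus>\<^bsub>space_at M x\<^esub>t\<in>path_index as x. c (fst t) (snd t) \<odot>\<^bsub>space_at M x\<^esub> act M (snd t) (m (fst t)) \<oplus>\<^bsub>space_at M x\<^esub>
        d (fst t) (snd t) \<odot>\<^bsub>space_at M x\<^esub> act M (snd t) (m (fst t)))"
      unfolding gen_map_def
    proof (rule V.M.finsum_cong'[OF refl])
      fix t assume t: "t \<in> path_index as x"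
      then have "(c \<oplus>\<^bsub>space_at (proj_sum as) x\<^esub> d) (fst t) (snd t) = c (fst t) (snd t) \<oplus>\<^bsub>K\<^esub> d (fst t) (snd t)"
        by (intro proj_sum_add) (auto simp: path_index_def)
      then show "(c \<oplus>\<^bsub>space_at (proj_sum as) x\<^esub> d) (fst t) (snd t) \<odot>\<^bsub>space_at M x\<^esub> act M (snd t) (m (fst t)) =
        c (fst t) (snd t) \<odot>\<^bsub>space_at M x\<^esub> act M (snd t) (m (fst t)) \<oplus>\<^bsub>space_at M x\<^esub> d (fst t) (snd t) \<odot>\<^bsub>space_at M x\<^esub> act M (snd t) (m (fst t))"
        using V.smult_l_distr[OF e[OF c t] e[OF d t] a[OF t]] by simp
    qed (use summand[OF _ c] summand[OF _ d] in auto)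
    also have "\<dots> = gen_map M as m x c \<oplus>\<^bsub>space_at M x\<^esub> gen_map M as m x d"
      unfolding gen_map_def by (rule V.M.finsum_addf) (use summand[OF _ c] summand[OF _ d] in auto)
    finally show ?thesis .
  qed
  show "gen_map M as m x (l \<odot>\<^bsub>space_at (proj_sum as) x\<^esub> c) = l \<odot>\<^bsub>space_at M x\<^esub> gen_map M as m x c"
    if l: "l \<in> carrier K" and c: "c \<in> fiber (proj_sum as) x" for l c
  proof -
    have "gen_map M as m x (l \<odot>\<^bsub>space_at (proj_sum as) x\<^esub> c) =
      (\<Oplus>\<^bsub>space_at M x\<^esub>t\<in>path_index as x. l \<odot>\<^bsub>space_at M x\<^esub> (c (fst t) (snd t) \<odot>\<^bsub>space_at M x\<^esub> act M (snd t) (m (fst t))))"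
      unfolding gen_map_def
    proof (rule V.M.finsum_cong'[OF refl])
      fix t assume t: "t \<in> path_index as x"
      then have "(l \<odot>\<^bsub>space_at (proj_sum as) x\<^esub> c) (fst t) (snd t) = l \<otimes>\<^bsub>K\<^esub> c (fst t) (snd t)"
        by (intro proj_sum_smult) (auto simp: path_index_def)
      then show "(l \<odot>\<^bsub>space_at (proj_sum as) x\<^esub> c) (fst t) (snd t) \<odot>\<^bsub>space_at M x\<^esub> act M (snd t) (m (fst t)) =
        l \<odot>\<^bsub>space_at M x\<^esub> (c (fst t) (snd t) \<odot>\<^bsub>space_at M x\<^esub> act M (snd t) (m (fst t)))"
        using V.smult_assoc1[OF l e[OF c t] a[OF t]] by simp
    qed (use summand[OF _ c] l in auto)
    also have "\<dots> = l \<odot>\<^bsub>space_at M x\<^esub> gen_map M as m x c"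
      unfolding gen_map_def by (rule V.finsum_smult[symmetric]) (use summand[OF _ c] l in auto)
    finally show ?thesis .
  qed
qed

lemma gen_map_tail_tuples:
  assumes M: "is_rep K Q M" and m: "\<And>i. i < length as \<Longrightarrow> m i \<in> fiber M (as ! i)"
    and as: "set as \<subseteq> verts Q" and c: "\<And>\<alpha>. \<alpha> \<in> into UNIV y \<Longrightarrow> c \<alpha> \<in> fiber (proj_sum as) (tail Q \<alpha>)"
  shows "(\<lambda>\<alpha>. gen_map M as m (tail Q \<alpha>) (c \<alpha>)) \<in> tail_tuples M (into UNIV y)"
  unfolding tail_tuples_def
proof
  fix \<alpha> assume \<alpha>: "\<alpha> \<in> into UNIV y"
  show "gen_map M as m (tail Q \<alpha>) (c \<alpha>) \<in> fiber M (tail Q \<alpha>)"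
    using linear_map_closed[OF gen_map_linear[OF M tail_verts[OF intoD(1)[OF \<alpha>]] m as] c[OF \<alpha>]] by blast
qed

text \<open>Paths to \<open>y\<close> are either trivial or sorted by their last arrow. This
  recursion from the tails to \<open>y\<close> is the engine for naturality, surjectivity and
  injectivity of \<open>gen_map\<close>.\<close>

lemma gen_map_rec:
  assumes M: "is_rep K Q M" and y: "y \<in> verts Q" and m: "\<And>i. i < length as \<Longrightarrow> m i \<in> fiber M (as ! i)"
    and as: "set as \<subseteq> verts Q" and c: "c \<in> fiber (proj_sum as) y"
  shows "gen_map M as m y c = gen_sum M as m y (\<lambda>i. c i []) \<oplus>\<^bsub>space_at M y\<^esub>
    arrow_sum M (into UNIV y) y (\<lambda>\<alpha>. gen_map M as m (tail Q \<alpha>) (shift as \<alpha> c))"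
proof -
  interpret V: vectorspace K "space_at M y" using rep_space[OF M y] .
  let ?s = "\<lambda>t. c (fst t) (snd t) \<odot>\<^bsub>space_at M y\<^esub> act M (snd t) (m (fst t))"
  let ?JN = "(\<lambda>i. (i, [] :: 'a list)) ` at_vertex as y"
  let ?J = "\<lambda>\<alpha>. (\<lambda>t. (fst t, snd t @ [\<alpha>])) ` path_index as (tail Q \<alpha>)"
  have J: "path_index as y = ?JN \<union> (\<Union>\<alpha>\<in>into UNIV y. ?J \<alpha>)" (is "_ = ?R")
  proof
    show "path_index as y \<subseteq> ?R"
    proof
      fix t assume t: "t \<in> path_index as y"
      obtain i q where iq: "t = (i, q)" "i < length as" "q \<in> paths Q (as ! i) y" using t by (auto simp: path_index_def)
      show "t \<in> ?R"
      proof (cases q rule: rev_cases)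
        case Nil
        then show ?thesis using iq by (auto simp: paths_Nil_iff at_vertex_def)
      next
        case (snoc p \<alpha>)
        then have "\<alpha> \<in> into UNIV y" "(i, p) \<in> path_index as (tail Q \<alpha>)" "t = (fst (i, p), snd (i, p) @ [\<alpha>])"
          using iq by (auto simp: paths_snoc_iff into_def path_index_def)
        then show ?thesis by blast
      qed
    qed
    show "?R \<subseteq> path_index as y"
      using as y by (auto simp: path_index_def at_vertex_def paths_Nil_iff paths_snoc_iff into_def)
  qed
  have fin: "finite ?JN" "finite (into UNIV y)" "\<And>\<alpha>. \<alpha> \<in> into UNIV y \<Longrightarrow> finite (?J \<alpha>)"
    using finite_into[OF y] finite_path_index[OF as tail_verts[OF intoD(1)]] by (auto simp: at_vertex_def)
  have cl: "?s \<in> path_index as y \<rightarrow> fiber M y" using gen_map_summand[OF M y m c] by auto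
  have cl0: "?s \<in> ?JN \<rightarrow> fiber M y" and cl1: "?s \<in> (\<Union>\<alpha>\<in>into UNIV y. ?J \<alpha>) \<rightarrow> fiber M y"
    and cla: "\<And>\<alpha>. \<alpha> \<in> into UNIV y \<Longrightarrow> ?s \<in> ?J \<alpha> \<rightarrow> fiber M y"
    using cl unfolding J by (blast intro: funcsetI funcset_mem)+
  have "gen_map M as m y c = (\<Oplus>\<^bsub>space_at M y\<^esub>t\<in>?JN. ?s t) \<oplus>\<^bsub>space_at M y\<^esub> (\<Oplus>\<^bsub>space_at M y\<^esub>t\<in>(\<Union>\<alpha>\<in>into UNIV y. ?J \<alpha>). ?s t)"
    unfolding gen_map_def J
    by (rule V.M.add.finprod_Un_disjoint[OF fin(1) _ _ cl0 cl1]) (use fin in auto)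
  also have "(\<Oplus>\<^bsub>space_at M y\<^esub>t\<in>?JN. ?s t) = (\<Oplus>\<^bsub>space_at M y\<^esub>i\<in>at_vertex as y. ?s (i, []))"
    by (rule V.M.add.finprod_reindex[OF cl0]) (auto simp: inj_on_def)
  also have "\<dots> = gen_sum M as m y (\<lambda>i. c i [])"
    by (simp add: gen_sum_def act_simps)
  also have "(\<Oplus>\<^bsub>space_at M y\<^esub>t\<in>(\<Union>\<alpha>\<in>into UNIV y. ?J \<alpha>). ?s t) = (\<Oplus>\<^bsub>space_at M y\<^esub>\<alpha>\<in>into UNIV y. \<Oplus>\<^bsub>space_at M y\<^esub>t\<in>?J \<alpha>. ?s t)"
    by (rule V.M.add.finprod_UN_disjoint[OF fin(2)]) (use fin(3) cla in \<open>auto simp: pairwise_def disjnt_def\<close>)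
  also have "\<dots> = arrow_sum M (into UNIV y) y (\<lambda>\<alpha>. gen_map M as m (tail Q \<alpha>) (shift as \<alpha> c))"
    unfolding arrow_sum_def
  proof (rule V.M.finsum_cong'[OF refl])
    show "(\<lambda>\<alpha>. map_at M \<alpha> (gen_map M as m (tail Q \<alpha>) (shift as \<alpha> c))) \<in> into UNIV y \<rightarrow> fiber M y"
      by (rule tail_tuples_map[OF M gen_map_tail_tuples[OF M m as shift_fiber[OF c]]])
    fix \<alpha> assume \<alpha>: "\<alpha> \<in> into UNIV y"
    note arc = intoD(1)[OF \<alpha>] and hd = intoD(2)[OF \<alpha>]
    let ?x = "tail Q \<alpha>"
    note sc = shift_fiber[OF c \<alpha>]
    have "(\<Oplus>\<^bsub>space_at M y\<^esub>t\<in>?J \<alpha>. ?s t) = (\<Oplus>\<^bsub>space_at M y\<^esub>t\<in>path_index as ?x. ?s (fst t, snd t @ [\<alpha>]))"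
      by (rule V.M.add.finprod_reindex[OF cla[OF \<alpha>]]) (auto simp: inj_on_def prod_eq_iff)
    also have "\<dots> = (\<Oplus>\<^bsub>space_at M y\<^esub>t\<in>path_index as ?x.
        map_at M \<alpha> (shift as \<alpha> c (fst t) (snd t) \<odot>\<^bsub>space_at M ?x\<^esub> act M (snd t) (m (fst t))))"
    proof (rule V.M.finsum_cong'[OF refl])
      show "(\<lambda>t. map_at M \<alpha> (shift as \<alpha> c (fst t) (snd t) \<odot>\<^bsub>space_at M ?x\<^esub> act M (snd t) (m (fst t)))) \<in> path_index as ?x \<rightarrow> fiber M y"
        using rep_map_closed[OF M arc gen_map_summand[OF M tail_verts[OF arc] m sc]] hd by auto
      fix t assume t: "t \<in> path_index as ?x"
      then have t': "fst t < length as" "snd t \<in> paths Q (as ! fst t) ?x" by (auto simp: path_index_def)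
      show "?s (fst t, snd t @ [\<alpha>]) = map_at M \<alpha> (shift as \<alpha> c (fst t) (snd t) \<odot>\<^bsub>space_at M ?x\<^esub> act M (snd t) (m (fst t)))"
        using linear_map_smult[OF rep_map[OF M arc] proj_sum_entry[OF sc t'] act_closed[OF M t'(2) m[OF t'(1)]]]
          shift_apply[OF t', of c] hd by (simp add: act_simps)
    qed
    also have "\<dots> = map_at M \<alpha> (gen_map M as m ?x (shift as \<alpha> c))"
      unfolding gen_map_def
      using linear_map_finsum[OF rep_map[OF M arc], of "\<lambda>t. shift as \<alpha> c (fst t) (snd t) \<odot>\<^bsub>space_at M ?x\<^esub> act M (snd t) (m (fst t))" "path_index as ?x"]
        gen_map_summand[OF M tail_verts[OF arc] m sc] hd by (simp add: Pi_iff)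
    finally show "(\<Oplus>\<^bsub>space_at M y\<^esub>t\<in>?J \<alpha>. ?s t) = map_at M \<alpha> (gen_map M as m ?x (shift as \<alpha> c))" .
  qed
  finally show ?thesis .
qed

lemma gen_sum_zero:
  assumes M: "is_rep K Q M" and y: "y \<in> verts Q" and m: "\<And>i. i < length as \<Longrightarrow> m i \<in> fiber M (as ! i)"
    and 0: "\<forall>i\<in>at_vertex as y. l i = \<zero>\<^bsub>K\<^esub>"
  shows "gen_sum M as m y l = \<zero>\<^bsub>space_at M y\<^esub>"
proof -
  interpret V: vectorspace K "space_at M y" using rep_space[OF M y] .
  have "m i \<in> fiber M y" if "i \<in> at_vertex as y" for i using m[of i] that by (auto simp: at_vertex_def)
  then have "gen_sum M as m y l = (\<Oplus>\<^bsub>space_at M y\<^esub>i\<in>at_vertex as y. \<zero>\<^bsub>space_at M y\<^esub>)"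
    unfolding gen_sum_def by (intro V.M.finsum_cong'[OF refl]) (use 0 in auto)
  then show ?thesis by simp
qed

lemma gen_sum_cong:
  assumes M: "is_rep K Q M" and y: "y \<in> verts Q" and m: "\<And>i. i < length as \<Longrightarrow> m i \<in> fiber M (as ! i)"
    and l: "\<And>i. i \<in> at_vertex as y \<Longrightarrow> l i \<in> carrier K" and eq: "\<And>i. i \<in> at_vertex as y \<Longrightarrow> l' i = l i"
  shows "gen_sum M as m y l' = gen_sum M as m y l"
proof -
  have mi: "m i \<in> fiber M y" if "i \<in> at_vertex as y" for i using m[of i] that by (auto simp: at_vertex_def)
  have "(\<lambda>i. l i \<odot>\<^bsub>space_at M y\<^esub> m i) \<in> at_vertex as y \<rightarrow> fiber M y"
    using vs_smult_closed[OF rep_space[OF M y] l mi] by blast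
  then show ?thesis unfolding gen_sum_def
    by (rule abelian_monoid.finsum_cong'[OF vs_abelian_monoid[OF rep_space[OF M y]] refl]) (simp add: eq)
qed

text \<open>Naturality is read off from \<open>gen_map_rec\<close>: moving \<open>c\<close> along
  \<open>\<alpha>\<close> leaves no trivial-path coefficient, its shift along
  \<open>\<alpha>\<close> is \<open>c\<close> again, and its shifts along other arrows are
  zero.\<close>

lemma gen_map_mor:
  assumes M: "is_rep K Q M" and m: "\<And>i. i < length as \<Longrightarrow> m i \<in> fiber M (as ! i)" and as: "set as \<subseteq> verts Q"
  shows "rep_hom (proj_sum as) (gen_map M as m) \<in> rep_mor K Q (proj_sum as) M"
proof (rule rep_hom_mor[OF proj_sum_rep])
  let ?P = "proj_sum as"
  show "linear_map K (space_at ?P x) (space_at M x) (gen_map M as m x)" if "x \<in> verts Q" for x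
    by (rule gen_map_linear[OF M that m as])
  fix \<alpha> c assume \<alpha>: "\<alpha> \<in> arcs Q" and c: "c \<in> fiber ?P (tail Q \<alpha>)"
  note t = tail_verts[OF \<alpha>] and h = head_verts[OF \<alpha>]
  interpret V: vectorspace K "space_at M (head Q \<alpha>)" using rep_space[OF M h] .
  let ?d = "map_at ?P \<alpha> c"
  have d: "?d \<in> fiber ?P (head Q \<alpha>)" by (rule rep_map_closed[OF proj_sum_rep \<alpha> c])
  have \<alpha>': "\<alpha> \<in> into UNIV (head Q \<alpha>)" using \<alpha> by (simp add: into_def)
  have d0: "?d i [] = \<zero>\<^bsub>K\<^esub>" if "i \<in> at_vertex as (head Q \<alpha>)" for i
    using proj_sum_map[OF \<alpha> c, of i "[]"] that h by (auto simp: at_vertex_def paths_Nil_iff)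
  have sh: "shift as \<beta> ?d = (if \<alpha> = \<beta> then c else \<zero>\<^bsub>space_at ?P (tail Q \<beta>)\<^esub>)" if \<beta>: "\<beta> \<in> into UNIV (head Q \<alpha>)" for \<beta>
  proof (rule proj_sum_eqI[OF shift_fiber[OF d \<beta>]])
    show "(if \<alpha> = \<beta> then c else \<zero>\<^bsub>space_at ?P (tail Q \<beta>)\<^esub>) \<in> fiber ?P (tail Q \<beta>)"
      using c vs_zero_closed[OF rep_space[OF proj_sum_rep tail_verts[OF intoD(1)[OF \<beta>]]]] by auto
    fix i p assume i: "i < length as" and p: "p \<in> paths Q (as ! i) (tail Q \<beta>)"
    have "p @ [\<beta>] \<in> paths Q (as ! i) (head Q \<alpha>)" using p \<beta> by (auto simp: paths_snoc_iff into_def)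
    then show "shift as \<beta> ?d i p = (if \<alpha> = \<beta> then c else \<zero>\<^bsub>space_at ?P (tail Q \<beta>)\<^esub>) i p"
      using proj_sum_map[OF \<alpha> c i] shift_apply[OF i p, of ?d] proj_sum_zero[OF i p] by auto
  qed
  note gl = gen_map_linear[OF M t m as]
  have gc: "gen_map M as m (tail Q \<alpha>) c \<in> fiber M (tail Q \<alpha>)" by (rule linear_map_closed[OF gl c])
  note mg = rep_map_closed[OF M \<alpha> gc]
  have "arrow_sum M (into UNIV (head Q \<alpha>)) (head Q \<alpha>) (\<lambda>\<beta>. gen_map M as m (tail Q \<beta>) (shift as \<beta> ?d)) =
      (\<Oplus>\<^bsub>space_at M (head Q \<alpha>)\<^esub>\<beta>\<in>into UNIV (head Q \<alpha>). if \<alpha> = \<beta> then map_at M \<alpha> (gen_map M as m (tail Q \<alpha>) c) else \<zero>\<^bsub>space_at M (head Q \<alpha>)\<^esub>)"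
    unfolding arrow_sum_def
  proof (rule V.M.finsum_cong'[OF refl])
    fix \<beta> assume \<beta>: "\<beta> \<in> into UNIV (head Q \<alpha>)"
    show "map_at M \<beta> (gen_map M as m (tail Q \<beta>) (shift as \<beta> ?d)) =
        (if \<alpha> = \<beta> then map_at M \<alpha> (gen_map M as m (tail Q \<alpha>) c) else \<zero>\<^bsub>space_at M (head Q \<alpha>)\<^esub>)"
      using sh[OF \<beta>] linear_map_zero[OF gen_map_linear[OF M tail_verts[OF intoD(1)[OF \<beta>]] m as]]
        linear_map_zero[OF rep_map[OF M intoD(1)[OF \<beta>]]] intoD(2)[OF \<beta>] by auto
  qed (use mg in auto)
  also have "\<dots> = map_at M \<alpha> (gen_map M as m (tail Q \<alpha>) c)"
    using V.M.add.finprod_singleton[OF \<alpha>' finite_into[OF h], of "\<lambda>_. map_at M \<alpha> (gen_map M as m (tail Q \<alpha>) c)"] mg by simp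
  finally show "gen_map M as m (head Q \<alpha>) ?d = map_at M \<alpha> (gen_map M as m (tail Q \<alpha>) c)"
    using gen_map_rec[OF M h m as d] gen_sum_zero[OF M h m, where l="\<lambda>i. ?d i []"] d0 vs_zero_add[OF rep_space[OF M h] mg]
    by simp
qed

text \<open>Induction on a bound for the lengths of the paths from \<open>a\<close> to
  \<open>y\<close>, which exists by interval finiteness. Passing to a tail lowers the bound by one,
  and with bound zero there is no path at all, so \<open>y\<close> is outside the cone.\<close>

lemma cone_induct [consumes 3, case_names outside step]:
  assumes a: "finite a" "a \<subseteq> verts Q" and y: "y \<in> verts Q"
    and outside: "\<And>y. y \<in> verts Q \<Longrightarrow> y \<notin> succs a \<Longrightarrow> R y"
    and step: "\<And>y. y \<in> verts Q \<Longrightarrow> (\<And>\<alpha>. \<alpha> \<in> into UNIV y \<Longrightarrow> R (tail Q \<alpha>)) \<Longrightarrow> R y"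
  shows "R y"
proof -
  have bounded: "R y" if "y \<in> verts Q" "\<And>x p. x \<in> a \<Longrightarrow> p \<in> paths Q x y \<Longrightarrow> length p < n" for n y
    using that
  proof (induct n arbitrary: y)
    case 0
    then show ?case by (intro outside) (auto simp: succs_def)
  next
    case (Suc n)
    show ?case
    proof (rule step[OF Suc.prems(1)])
      fix \<alpha> assume \<alpha>: "\<alpha> \<in> into UNIV y"
      show "R (tail Q \<alpha>)"
      proof (rule Suc.hyps[OF tail_verts[OF intoD(1)[OF \<alpha>]]])
        fix x p assume "x \<in> a" "p \<in> paths Q x (tail Q \<alpha>)"
        then have "p @ [\<alpha>] \<in> paths Q x y" using \<alpha> by (auto simp: paths_snoc_iff into_def)
        then show "length p < n" using Suc.prems(2)[OF \<open>x \<in> a\<close>] by fastforce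
      qed
    qed
  qed
  have "finite (length ` (\<Union>x\<in>a. paths Q x y))" by (intro finite_imageI finite_UN_I) (use a y finite_paths in auto)
  then obtain n where n: "\<forall>l\<in>length ` (\<Union>x\<in>a. paths Q x y). l < n"
    using finite_nat_set_iff_bounded by blast
  show ?thesis by (rule bounded[OF y, of n]) (use n in blast)
qed

definition generates where
  "generates M as m y \<longleftrightarrow> (\<forall>v\<in>fiber M y. \<exists>l\<in>at_vertex as y \<rightarrow> carrier K. \<exists>w\<in>tail_tuples M (into UNIV y).
    v = gen_sum M as m y l \<oplus>\<^bsub>space_at M y\<^esub> arrow_sum M (into UNIV y) y w)"

text \<open>Joint injectivity of the generators at \<open>y\<close> and the incoming arrows. For
  generators lying in \<open>M(y)\<close>, the case of zero \<open>l\<close> contains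
  \<open>gen_inj\<close> for all arrows into \<open>y\<close>.\<close>

definition independent where
  "independent M as m y \<longleftrightarrow> (\<forall>l\<in>at_vertex as y \<rightarrow> carrier K. \<forall>w\<in>tail_tuples M (into UNIV y).
    gen_sum M as m y l \<oplus>\<^bsub>space_at M y\<^esub> arrow_sum M (into UNIV y) y w = \<zero>\<^bsub>space_at M y\<^esub> \<longrightarrow>
    (\<forall>i\<in>at_vertex as y. l i = \<zero>\<^bsub>K\<^esub>) \<and> (\<forall>\<alpha>\<in>into UNIV y. w \<alpha> = \<zero>\<^bsub>space_at M (tail Q \<alpha>)\<^esub>))"

text \<open>Cone induction over \<open>a\<close>, outside whose successors \<open>M\<close>
  vanishes: a vector at \<open>y\<close> is a combination of generators plus an arrow sum, and the
  entries of the latter already have preimages at the tails.\<close>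

lemma gen_map_surjective:
  assumes M: "is_rep K Q M" and m: "\<And>i. i < length as \<Longrightarrow> m i \<in> fiber M (as ! i)" and as: "set as \<subseteq> verts Q"
    and a: "finite a" "a \<subseteq> verts Q" and van: "\<And>y. y \<in> verts Q \<Longrightarrow> y \<notin> succs a \<Longrightarrow> vanishes M y"
    and gen: "\<And>y. y \<in> verts Q \<Longrightarrow> generates M as m y"
  shows "surjective (proj_sum as) M (rep_hom (proj_sum as) (gen_map M as m))"
proof -
  let ?P = "proj_sum as"
  have "\<forall>v\<in>fiber M y. \<exists>c\<in>fiber ?P y. gen_map M as m y c = v" if "y \<in> verts Q" for y
    using a that
  proof (induct rule: cone_induct)
    case (outside y)
    have "gen_map M as m y \<zero>\<^bsub>space_at ?P y\<^esub> = \<zero>\<^bsub>space_at M y\<^esub>"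
      by (rule linear_map_zero[OF gen_map_linear[OF M outside(1) m as]])
    then show ?case using van[OF outside] vs_zero_closed[OF rep_space[OF proj_sum_rep outside(1)]]
      by (auto simp: vanishes_def)
  next
    case (step y)
    note y = step(1)
    show ?case
    proof
      fix v assume "v \<in> fiber M y"
      then obtain l w where l: "l \<in> at_vertex as y \<rightarrow> carrier K" and w: "w \<in> tail_tuples M (into UNIV y)"
        and v: "v = gen_sum M as m y l \<oplus>\<^bsub>space_at M y\<^esub> arrow_sum M (into UNIV y) y w"
        using gen[OF y] unfolding generates_def by metis
      have "w \<alpha> \<in> gen_map M as m (tail Q \<alpha>) ` fiber ?P (tail Q \<alpha>)" if \<alpha>: "\<alpha> \<in> into UNIV y" for \<alpha>
      proof -
        have "w \<alpha> \<in> fiber M (tail Q \<alpha>)" using w \<alpha> by (auto simp: tail_tuples_def)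
        then obtain u where "u \<in> fiber ?P (tail Q \<alpha>)" "gen_map M as m (tail Q \<alpha>) u = w \<alpha>"
          using step(2)[OF \<alpha>] by blast
        then show ?thesis by (intro image_eqI[of _ _ u]) simp_all
      qed
      then obtain d where d: "d \<in> tail_tuples ?P (into UNIV y)" "\<forall>\<alpha>\<in>into UNIV y. gen_map M as m (tail Q \<alpha>) (d \<alpha>) = w \<alpha>"
        using tail_tuples_lift[of UNIV y w "gen_map M as m" ?P] by blast
      have dc: "d \<alpha> \<in> fiber ?P (tail Q \<alpha>)" if "\<alpha> \<in> into UNIV y" for \<alpha> using d(1) that by (auto simp: tail_tuples_def)
      \<comment> \<open>The preimage is glued from the generator coefficients on trivial paths and,
        on paths with a last arrow, from the preimage at the tail of that arrow; its shifts are then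
        the \<open>d \<alpha>\<close>.\<close>
      define c where "c = (\<lambda>i\<in>{..<length as}. \<lambda>q\<in>paths Q (as ! i) y. if q = [] then l i else d (last q) i (butlast q))"
      have "(if q = [] then l i else d (last q) i (butlast q)) \<in> carrier K" if i: "i < length as" and q: "q \<in> paths Q (as ! i) y" for i q
      proof (cases q rule: rev_cases)
        case Nil
        then show ?thesis using q i l by (auto simp: paths_Nil_iff at_vertex_def)
      next
        case (snoc p \<alpha>)
        then have "\<alpha> \<in> into UNIV y" "p \<in> paths Q (as ! i) (tail Q \<alpha>)" using q by (auto simp: paths_snoc_iff into_def)
        then show ?thesis using proj_sum_entry[OF dc i] snoc by auto
      qed
      then have c: "c \<in> fiber ?P y" unfolding proj_sum_fiber c_def by auto
      have c0: "c i [] = l i" if "i \<in> at_vertex as y" for i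
        using that y by (auto simp: c_def at_vertex_def paths_Nil_iff)
      have sh: "shift as \<alpha> c = d \<alpha>" if \<alpha>: "\<alpha> \<in> into UNIV y" for \<alpha>
      proof (rule proj_sum_eqI[OF shift_fiber[OF c \<alpha>] dc[OF \<alpha>]])
        fix i p assume i: "i < length as" and p: "p \<in> paths Q (as ! i) (tail Q \<alpha>)"
        have "p @ [\<alpha>] \<in> paths Q (as ! i) y" using p \<alpha> by (auto simp: paths_snoc_iff into_def)
        then show "shift as \<alpha> c i p = d \<alpha> i p" using shift_apply[OF i p, of c] i by (simp add: c_def)
      qed
      have "gen_sum M as m y (\<lambda>i. c i []) = gen_sum M as m y l"
        by (rule gen_sum_cong[OF M y m]) (use l c0 in auto)
      moreover have "arrow_sum M (into UNIV y) y (\<lambda>\<alpha>. gen_map M as m (tail Q \<alpha>) (shift as \<alpha> c)) = arrow_sum M (into UNIV y) y w"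
        by (rule arrow_sum_cong[OF M y w]) (use d(2) sh in auto)
      ultimately have "gen_map M as m y c = v" using gen_map_rec[OF M y m as c] v by simp
      then show "\<exists>c\<in>fiber ?P y. gen_map M as m y c = v" using c by blast
    qed
  qed
  then show ?thesis
    unfolding surjective_def
  proof (intro ballI)
    fix x assume *: "\<And>y. y \<in> verts Q \<Longrightarrow> \<forall>v\<in>fiber M y. \<exists>c\<in>fiber ?P y. gen_map M as m y c = v" and x: "x \<in> verts Q"
    show "rep_hom ?P (gen_map M as m) x ` fiber ?P x = fiber M x"
    proof
      show "rep_hom ?P (gen_map M as m) x ` fiber ?P x \<subseteq> fiber M x"
        using linear_map_closed[OF gen_map_linear[OF M x m as]] x by auto
      show "fiber M x \<subseteq> rep_hom ?P (gen_map M as m) x ` fiber ?P x"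
        using *[OF x] x by (force simp: image_def)
    qed
  qed
qed

text \<open>Cone induction over \<open>set as\<close>, outside whose successors the source vanishes:
  by \<open>gen_map_rec\<close> and independence all trivial-path coefficients and all shifts of an
  element of the kernel are zero.\<close>

lemma gen_map_injective:
  assumes M: "is_rep K Q M" and m: "\<And>i. i < length as \<Longrightarrow> m i \<in> fiber M (as ! i)" and as: "set as \<subseteq> verts Q"
    and ind: "\<And>y. y \<in> verts Q \<Longrightarrow> independent M as m y"
  shows "injective (proj_sum as) (rep_hom (proj_sum as) (gen_map M as m))"
proof -
  let ?P = "proj_sum as"
  have zero: "\<forall>c\<in>fiber ?P y. gen_map M as m y c = \<zero>\<^bsub>space_at M y\<^esub> \<longrightarrow> c = \<zero>\<^bsub>space_at ?P y\<^esub>" if "y \<in> verts Q" for y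
    using finite_set as that
  proof (induct rule: cone_induct)
    case (outside y)
    then show ?case using proj_sum_vanishes[OF outside] by (simp add: vanishes_def)
  next
    case (step y)
    note y = step(1)
    show ?case
    proof (intro ballI impI)
      fix c assume c: "c \<in> fiber ?P y" and 0: "gen_map M as m y c = \<zero>\<^bsub>space_at M y\<^esub>"
      have l: "(\<lambda>i. c i []) \<in> at_vertex as y \<rightarrow> carrier K"
        using proj_sum_entry[OF c] y by (auto simp: at_vertex_def paths_Nil_iff)
      have w: "(\<lambda>\<alpha>. gen_map M as m (tail Q \<alpha>) (shift as \<alpha> c)) \<in> tail_tuples M (into UNIV y)"
        by (rule gen_map_tail_tuples[OF M m as shift_fiber[OF c]])
      have "gen_map M as m y c = gen_sum M as m y (\<lambda>i. c i []) \<oplus>\<^bsub>space_at M y\<^esub>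
          arrow_sum M (into UNIV y) y (\<lambda>\<alpha>. gen_map M as m (tail Q \<alpha>) (shift as \<alpha> c))"
        by (rule gen_map_rec[OF M y m as c])
      with 0 have eq: "gen_sum M as m y (\<lambda>i. c i []) \<oplus>\<^bsub>space_at M y\<^esub>
          arrow_sum M (into UNIV y) y (\<lambda>\<alpha>. gen_map M as m (tail Q \<alpha>) (shift as \<alpha> c)) = \<zero>\<^bsub>space_at M y\<^esub>"
        by simp
      have z: "(\<forall>i\<in>at_vertex as y. c i [] = \<zero>\<^bsub>K\<^esub>) \<and>
          (\<forall>\<alpha>\<in>into UNIV y. gen_map M as m (tail Q \<alpha>) (shift as \<alpha> c) = \<zero>\<^bsub>space_at M (tail Q \<alpha>)\<^esub>)"
        by (rule bspec[OF bspec[OF ind[OF y, unfolded independent_def] l] w, THEN mp, OF eq])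
      then have sh: "shift as \<alpha> c = \<zero>\<^bsub>space_at ?P (tail Q \<alpha>)\<^esub>" if "\<alpha> \<in> into UNIV y" for \<alpha>
        using step(2)[OF that] shift_fiber[OF c that] that by blast
      show "c = \<zero>\<^bsub>space_at ?P y\<^esub>"
      proof (rule proj_sum_eqI[OF c vs_zero_closed[OF rep_space[OF proj_sum_rep y]]])
        fix i q assume i: "i < length as" and q: "q \<in> paths Q (as ! i) y"
        have "c i q = \<zero>\<^bsub>K\<^esub>"
        proof (cases q rule: rev_cases)
          case Nil
          then show ?thesis using z q i by (auto simp: at_vertex_def paths_Nil_iff)
        next
          case (snoc p \<alpha>)
          then have \<alpha>: "\<alpha> \<in> into UNIV y" and p: "p \<in> paths Q (as ! i) (tail Q \<alpha>)" using q by (auto simp: paths_snoc_iff into_def)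
          then show ?thesis using shift_apply[OF i p, of c] sh[OF \<alpha>] proj_sum_zero[OF i p] snoc by simp
        qed
        then show "c i q = \<zero>\<^bsub>space_at ?P y\<^esub> i q" using proj_sum_zero[OF i q] by simp
      qed
    qed
  qed
  show ?thesis
    unfolding injective_def
  proof
    fix x assume x: "x \<in> verts Q"
    have "linear_map K (space_at ?P x) (space_at M x) (gen_map M as m x)"
      by (rule gen_map_linear[OF M x m as])
    then have "inj_on (gen_map M as m x) (fiber ?P x)" using zero[OF x] by (simp only: linear_map_inj_iff)
    then show "inj_on (rep_hom ?P (gen_map M as m) x) (fiber ?P x)"
      using x by (simp add: inj_on_def)
  qed
qed

section \<open>Choosing generators at the exceptional vertices\<close>

definition arrow_image where
  "arrow_image M y = arrow_sum M (into UNIV y) y ` tail_tuples M (into UNIV y)"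

lemma arrow_image_subspace:
  assumes M: "is_rep K Q M" and y: "y \<in> verts Q"
  shows "VectorSpace.subspace K (arrow_image M y) (space_at M y)"
proof (rule subspaceI[OF rep_space[OF M y]])
  interpret V: vectorspace K "space_at M y" using rep_space[OF M y] .
  let ?S = "into UNIV y"
  show "arrow_image M y \<subseteq> fiber M y" unfolding arrow_image_def using arrow_sum_closed[OF M y] by blast
  have z: "(\<lambda>\<alpha>. \<zero>\<^bsub>space_at M (tail Q \<alpha>)\<^esub>) \<in> tail_tuples M ?S"
    unfolding tail_tuples_def using vs_zero_closed[OF rep_space[OF M tail_verts[OF intoD(1)]]] by blast
  have "arrow_sum M ?S y (\<lambda>\<alpha>. \<zero>\<^bsub>space_at M (tail Q \<alpha>)\<^esub>) = (\<Oplus>\<^bsub>space_at M y\<^esub>\<alpha>\<in>?S. \<zero>\<^bsub>space_at M y\<^esub>)"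
    unfolding arrow_sum_def
  proof (rule V.M.finsum_cong'[OF refl])
    fix \<alpha> assume \<alpha>: "\<alpha> \<in> ?S"
    show "map_at M \<alpha> \<zero>\<^bsub>space_at M (tail Q \<alpha>)\<^esub> = \<zero>\<^bsub>space_at M y\<^esub>"
      using linear_map_zero[OF rep_map[OF M intoD(1)[OF \<alpha>]]] intoD(2)[OF \<alpha>] by simp
  qed auto
  then have "arrow_sum M ?S y (\<lambda>\<alpha>. \<zero>\<^bsub>space_at M (tail Q \<alpha>)\<^esub>) = \<zero>\<^bsub>space_at M y\<^esub>" by simp
  then show "\<zero>\<^bsub>space_at M y\<^esub> \<in> arrow_image M y" unfolding arrow_image_def by (intro image_eqI[OF _ z]) simp
  show "u \<oplus>\<^bsub>space_at M y\<^esub> v \<in> arrow_image M y" if u: "u \<in> arrow_image M y" and v: "v \<in> arrow_image M y" for u v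
  proof -
    obtain w w' where w: "w \<in> tail_tuples M ?S" "u = arrow_sum M ?S y w" and w': "w' \<in> tail_tuples M ?S" "v = arrow_sum M ?S y w'"
      using u v unfolding arrow_image_def by blast
    have "(\<lambda>\<alpha>. w \<alpha> \<oplus>\<^bsub>space_at M (tail Q \<alpha>)\<^esub> w' \<alpha>) \<in> tail_tuples M ?S"
      unfolding tail_tuples_def
    proof
      fix \<alpha> assume \<alpha>: "\<alpha> \<in> ?S"
      then have "w \<alpha> \<in> fiber M (tail Q \<alpha>)" "w' \<alpha> \<in> fiber M (tail Q \<alpha>)" using w w' by (auto simp: tail_tuples_def)
      then show "w \<alpha> \<oplus>\<^bsub>space_at M (tail Q \<alpha>)\<^esub> w' \<alpha> \<in> fiber M (tail Q \<alpha>)"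
        by (rule vs_add_closed[OF rep_space[OF M tail_verts[OF intoD(1)[OF \<alpha>]]]])
    qed
    then show ?thesis unfolding arrow_image_def w(2) w'(2) arrow_sum_add[OF M y w(1) w'(1), symmetric] by (rule imageI)
  qed
  show "l \<odot>\<^bsub>space_at M y\<^esub> u \<in> arrow_image M y" if l: "l \<in> carrier K" and u: "u \<in> arrow_image M y" for l u
  proof -
    obtain w where w: "w \<in> tail_tuples M ?S" "u = arrow_sum M ?S y w" using u unfolding arrow_image_def by blast
    have wc: "w \<alpha> \<in> fiber M (tail Q \<alpha>)" if "\<alpha> \<in> ?S" for \<alpha> using w(1) that by (auto simp: tail_tuples_def)
    let ?w = "\<lambda>\<alpha>. l \<odot>\<^bsub>space_at M (tail Q \<alpha>)\<^esub> w \<alpha>"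
    have lw: "?w \<in> tail_tuples M ?S"
      unfolding tail_tuples_def using vs_smult_closed[OF rep_space[OF M tail_verts[OF intoD(1)]] l wc] by blast
    have "arrow_sum M ?S y ?w = (\<Oplus>\<^bsub>space_at M y\<^esub>\<alpha>\<in>?S. l \<odot>\<^bsub>space_at M y\<^esub> map_at M \<alpha> (w \<alpha>))"
      unfolding arrow_sum_def
    proof (rule V.M.finsum_cong'[OF refl])
      fix \<alpha> assume \<alpha>: "\<alpha> \<in> ?S"
      show "map_at M \<alpha> (?w \<alpha>) = l \<odot>\<^bsub>space_at M y\<^esub> map_at M \<alpha> (w \<alpha>)"
        using linear_map_smult[OF rep_map[OF M intoD(1)[OF \<alpha>]] l wc[OF \<alpha>]] intoD(2)[OF \<alpha>] by simp
    qed (use tail_tuples_map[OF M w(1)] l in auto)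
    also have "\<dots> = l \<odot>\<^bsub>space_at M y\<^esub> u"
      unfolding w(2) arrow_sum_def by (rule V.finsum_smult[symmetric]) (use tail_tuples_map[OF M w(1)] l in auto)
    finally show ?thesis unfolding arrow_image_def by (intro image_eqI[OF _ lw]) simp
  qed
qed

text \<open>Independence implies \<open>gen_inj\<close> for all incoming arrows, so it can be
  demanded only where that holds; surjectivity of the cover needs \<open>generates\<close>
  alone.\<close>

definition generating_family where
  "generating_family M as m \<longleftrightarrow> set as \<subseteq> verts Q \<and> (\<forall>i<length as. m i \<in> fiber M (as ! i)) \<and>
    (\<forall>y\<in>verts Q. generates M as m y) \<and>
    (\<forall>y\<in>verts Q. gen_inj M (into UNIV y) y \<longrightarrow> independent M as m y)"

text \<open>Lists all pairs of a vertex and an index there. The first components form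
  \<open>as\<close>, so a vertex is repeated once for every generator that it needs.\<close>

lemma vertex_indexing:
  assumes B: "finite B" and T: "\<forall>y\<in>B. finite (T y)"
  shows "\<exists>as h. (\<forall>i<length as. as ! i \<in> B \<and> h i \<in> T (as ! i)) \<and> (\<forall>y\<in>B. bij_betw h (at_vertex as y) (T y))"
proof -
  have "finite (Sigma B T)" using B T by auto
  then obtain gl where gl: "set gl = Sigma B T" "distinct gl" using finite_distinct_list by blast
  define as where "as = map fst gl"
  define h where "h i = snd (gl ! i)" for i
  have gli: "as ! i \<in> B" "h i \<in> T (as ! i)" if "i < length as" for i
    using nth_mem[of i gl] that unfolding gl as_def h_def by auto
  have "bij_betw h (at_vertex as y) (T y)" if y: "y \<in> B" for y
    unfolding bij_betw_def
  proof
    show "inj_on h (at_vertex as y)"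
    proof (rule inj_onI)
      fix i j assume ij: "i \<in> at_vertex as y" "j \<in> at_vertex as y" "h i = h j"
      then have "gl ! i = gl ! j" by (intro prod_eqI) (auto simp: at_vertex_def as_def h_def)
      then show "i = j" using nth_eq_iff_index_eq[OF gl(2)] ij by (auto simp: at_vertex_def as_def)
    qed
    show "h ` at_vertex as y = T y"
    proof
      show "h ` at_vertex as y \<subseteq> T y" using gli(2) by (auto simp: at_vertex_def)
      show "T y \<subseteq> h ` at_vertex as y"
      proof
        fix t assume "t \<in> T y"
        then have "(y, t) \<in> set gl" using y gl by simp
        then obtain i where "i < length gl" "gl ! i = (y, t)" by (auto simp: in_set_conv_nth)
        then show "t \<in> h ` at_vertex as y" by (intro image_eqI[of _ _ i]) (auto simp: h_def at_vertex_def as_def)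
      qed
    qed
  qed
  with gli show ?thesis by (intro exI[of _ as] exI[of _ h]) simp
qed

text \<open>Generators are only needed at the finitely many vertices where the sum over the incoming
  arrows is not bijective; there, a basis of a complement of its image will do.\<close>

lemma generating_family_exists:
  fixes M :: "('v, 'a, 'k, 'u) rep"
  assumes M: "is_rep K Q M" and fd: "locally_fin_dim K Q M"
    and fin: "finite {y \<in> verts Q. \<not> gen_bij M (into UNIV y) y}"
  shows "\<exists>as m. generating_family M as m"
proof -
  define B where "B = {y \<in> verts Q. \<not> gen_bij M (into UNIV y) y}"
  \<comment> \<open>Index set and basis are packed into a pair, so that a single choice at each
    exceptional vertex fixes both.\<close>
  let ?R = "\<lambda>y (p :: 'u set \<times> ('u \<Rightarrow> 'u)). complement_basis K (space_at M y) (arrow_image M y) (fst p) (snd p)"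
  define T u where "T y = fst (Eps (?R y))" and "u y = snd (Eps (?R y))" for y
  have Ry: "complement_basis K (space_at M y) (arrow_image M y) (T y) (u y)" if "y \<in> B" for y
  proof -
    have y: "y \<in> verts Q" using that by (simp add: B_def)
    then have "vectorspace.fin_dim K (space_at M y)" using fd by (simp add: locally_fin_dim_def)
    then obtain T u where "complement_basis K (space_at M y) (arrow_image M y) (T :: 'u set) u"
      using complement_basis_exists[OF arrow_image_subspace[OF M y]] by auto
    then have "?R y (T, u)" by simp
    then show ?thesis unfolding T_def u_def by (rule someI[of "?R y"])
  qed
  have finT: "finite (T y)" if "y \<in> B" for y
    using Ry[OF that] by (simp only: complement_basis_def)
  have uM: "u y t \<in> fiber M y" if "y \<in> B" "t \<in> T y" for y t
    using Ry[OF that(1)] that(2) by (simp only: complement_basis_def)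
  have R: "\<forall>v\<in>fiber M y. \<exists>c\<in>T y \<rightarrow> carrier K. \<exists>s\<in>arrow_image M y. v = (\<Oplus>\<^bsub>space_at M y\<^esub>t\<in>T y. c t \<odot>\<^bsub>space_at M y\<^esub> u y t) \<oplus>\<^bsub>space_at M y\<^esub> s"
    "\<forall>c\<in>T y \<rightarrow> carrier K. \<forall>s\<in>arrow_image M y. (\<Oplus>\<^bsub>space_at M y\<^esub>t\<in>T y. c t \<odot>\<^bsub>space_at M y\<^esub> u y t) \<oplus>\<^bsub>space_at M y\<^esub> s = \<zero>\<^bsub>space_at M y\<^esub> \<longrightarrow>
      (\<forall>t\<in>T y. c t = \<zero>\<^bsub>K\<^esub>) \<and> s = \<zero>\<^bsub>space_at M y\<^esub>" if "y \<in> B" for y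
    by (rule Ry[OF that, unfolded complement_basis_def, THEN conjunct2, THEN conjunct2, THEN conjunct1])
      (rule Ry[OF that, unfolded complement_basis_def, THEN conjunct2, THEN conjunct2, THEN conjunct2])
  have finB: "finite B" using fin by (simp add: B_def)
  obtain as and h :: "nat \<Rightarrow> 'u" where as: "\<forall>i<length as. as ! i \<in> B \<and> h i \<in> T (as ! i)"
    and hbij: "\<forall>y\<in>B. bij_betw h (at_vertex as y) (T y)"
    using vertex_indexing[of B T] finB finT by auto
  note bij = bspec[OF hbij]
  define m where "m i = u (as ! i) (h i)" for i
  have gli: "as ! i \<in> B" "h i \<in> T (as ! i)" "m i = u (as ! i) (h i)" if "i < length as" for i
    using as that by (auto simp: m_def)
  have asV: "set as \<subseteq> verts Q" using gli(1) by (auto simp: B_def in_set_conv_nth)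
  have mM: "m i \<in> fiber M (as ! i)" if "i < length as" for i
    using gli[OF that] uM by simp
  have sum: "gen_sum M as m y (\<lambda>i. c (h i)) = (\<Oplus>\<^bsub>space_at M y\<^esub>t\<in>T y. c t \<odot>\<^bsub>space_at M y\<^esub> u y t)"
    if y: "y \<in> B" and c: "c \<in> T y \<rightarrow> carrier K" for y c
  proof -
    have yv: "y \<in> verts Q" using y by (simp add: B_def)
    interpret V: vectorspace K "space_at M y" using rep_space[OF M yv] .
    have cl: "(\<lambda>t. c t \<odot>\<^bsub>space_at M y\<^esub> u y t) \<in> T y \<rightarrow> fiber M y" using c uM[OF y] by (auto intro!: vs_smult_closed[OF rep_space[OF M yv]])
    have "(\<Oplus>\<^bsub>space_at M y\<^esub>t\<in>h ` at_vertex as y. c t \<odot>\<^bsub>space_at M y\<^esub> u y t) =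
        (\<Oplus>\<^bsub>space_at M y\<^esub>i\<in>at_vertex as y. c (h i) \<odot>\<^bsub>space_at M y\<^esub> u y (h i))"
      by (rule V.M.add.finprod_reindex) (use bij[OF y] cl in \<open>auto simp: bij_betw_def\<close>)
    moreover have "\<dots> = gen_sum M as m y (\<lambda>i. c (h i))"
      unfolding gen_sum_def
    proof (rule V.M.finsum_cong'[OF refl])
      show "(\<lambda>i. c (h i) \<odot>\<^bsub>space_at M y\<^esub> m i) \<in> at_vertex as y \<rightarrow> fiber M y"
      proof
        fix i assume i: "i \<in> at_vertex as y"
        then have "h i \<in> T y" "m i \<in> fiber M y" using mM[of i] gli(2)[of i] by (auto simp: at_vertex_def)
        then show "c (h i) \<odot>\<^bsub>space_at M y\<^esub> m i \<in> fiber M y"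
          using c by (intro vs_smult_closed[OF rep_space[OF M yv]]) auto
      qed
    qed (use gli(3) in \<open>auto simp: at_vertex_def\<close>)
    ultimately show ?thesis using bij[OF y] by (simp add: bij_betw_def)
  qed
  have empty: "at_vertex as y = {}" if "y \<notin> B" for y using gli(1) that by (auto simp: at_vertex_def)
  have "generates M as m y" if y: "y \<in> verts Q" for y
    unfolding generates_def
  proof
    fix v assume v: "v \<in> fiber M y"
    show "\<exists>l\<in>at_vertex as y \<rightarrow> carrier K. \<exists>w\<in>tail_tuples M (into UNIV y).
      v = gen_sum M as m y l \<oplus>\<^bsub>space_at M y\<^esub> arrow_sum M (into UNIV y) y w"
    proof (cases "y \<in> B")
      case True
      obtain c s where c: "c \<in> T y \<rightarrow> carrier K" and s: "s \<in> arrow_image M y"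
        and vs: "v = (\<Oplus>\<^bsub>space_at M y\<^esub>t\<in>T y. c t \<odot>\<^bsub>space_at M y\<^esub> u y t) \<oplus>\<^bsub>space_at M y\<^esub> s"
        using bspec[OF R(1)[OF True] v] by (elim bexE) (rule that)
      obtain w where w: "w \<in> tail_tuples M (into UNIV y)" "s = arrow_sum M (into UNIV y) y w"
        using s unfolding arrow_image_def by blast
      have "(\<lambda>i. c (h i)) \<in> at_vertex as y \<rightarrow> carrier K" using c bij[OF True] by (auto simp: bij_betw_def)
      then show ?thesis using vs w sum[OF True c] by (intro bexI[of _ "\<lambda>i. c (h i)"] bexI[of _ w]) simp_all
    next
      case False
      then have g: "gen_surj M (into UNIV y) y" using y by (simp add: B_def gen_bij_def)
      obtain w where w: "w \<in> tail_tuples M (into UNIV y)" "v = arrow_sum M (into UNIV y) y w"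
        using gen_surjD[OF g v] by blast
      have "gen_sum M as m y (\<lambda>_. \<zero>\<^bsub>K\<^esub>) = \<zero>\<^bsub>space_at M y\<^esub>" by (rule gen_sum_zero[OF M y mM]) auto
      then show ?thesis using w v vs_zero_add[OF rep_space[OF M y] v] empty[OF False]
        by (intro bexI[of _ "\<lambda>_. \<zero>\<^bsub>K\<^esub>"] bexI[of _ w]) auto
    qed
  qed
  moreover have "independent M as m y" if y: "y \<in> verts Q" and inj: "gen_inj M (into UNIV y) y" for y
    unfolding independent_def
  proof (intro ballI impI)
    fix l w assume l: "l \<in> at_vertex as y \<rightarrow> carrier K" and w: "w \<in> tail_tuples M (into UNIV y)"
      and 0: "gen_sum M as m y l \<oplus>\<^bsub>space_at M y\<^esub> arrow_sum M (into UNIV y) y w = \<zero>\<^bsub>space_at M y\<^esub>"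
    \<comment> \<open>A relation is first split by independence modulo the arrow image;
      \<open>gen_inj\<close> then applies to the arrow sum, now known to be zero.\<close>
    have "(\<forall>i\<in>at_vertex as y. l i = \<zero>\<^bsub>K\<^esub>) \<and> arrow_sum M (into UNIV y) y w = \<zero>\<^bsub>space_at M y\<^esub>"
    proof (cases "y \<in> B")
      case True
      define c where "c t = l (inv_into (at_vertex as y) h t)" for t
      have ch: "c (h i) = l i" if "i \<in> at_vertex as y" for i
        using that bij[OF True] by (simp add: c_def bij_betw_def)
      have c: "c \<in> T y \<rightarrow> carrier K"
      proof
        fix t assume "t \<in> T y"
        then obtain i where "i \<in> at_vertex as y" "t = h i" using bij[OF True] by (auto simp: bij_betw_def)
        then show "c t \<in> carrier K" using ch l by auto
      qed
      have "gen_sum M as m y l = gen_sum M as m y (\<lambda>i. c (h i))"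
        by (rule gen_sum_cong[OF M y mM]) (use ch l in auto)
      then have eq: "(\<Oplus>\<^bsub>space_at M y\<^esub>t\<in>T y. c t \<odot>\<^bsub>space_at M y\<^esub> u y t) \<oplus>\<^bsub>space_at M y\<^esub> arrow_sum M (into UNIV y) y w = \<zero>\<^bsub>space_at M y\<^esub>"
        using 0 sum[OF True c] by simp
      have s: "arrow_sum M (into UNIV y) y w \<in> arrow_image M y" unfolding arrow_image_def using w by (rule imageI)
      have z: "(\<forall>t\<in>T y. c t = \<zero>\<^bsub>K\<^esub>) \<and> arrow_sum M (into UNIV y) y w = \<zero>\<^bsub>space_at M y\<^esub>"
        by (rule bspec[OF bspec[OF R(2)[OF True] c] s, THEN mp, OF eq])
      have "l i = \<zero>\<^bsub>K\<^esub>" if i: "i \<in> at_vertex as y" for i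
      proof -
        have "h i \<in> T y" using i gli(2)[of i] by (auto simp: at_vertex_def)
        then show ?thesis using z ch[OF i] by auto
      qed
      then show ?thesis using z by blast
    next
      case False
      have "gen_sum M as m y l = \<zero>\<^bsub>space_at M y\<^esub>" by (rule gen_sum_zero[OF M y mM]) (use empty[OF False] in auto)
      then show ?thesis using 0 empty[OF False] vs_zero_add[OF rep_space[OF M y] arrow_sum_closed[OF M y w]] by simp
    qed
    then show "(\<forall>i\<in>at_vertex as y. l i = \<zero>\<^bsub>K\<^esub>) \<and> (\<forall>\<alpha>\<in>into UNIV y. w \<alpha> = \<zero>\<^bsub>space_at M (tail Q \<alpha>)\<^esub>)"
      using gen_injD[OF inj w] by blast
  qed
  ultimately have "generating_family M as m" unfolding generating_family_def using asV mM by blast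
  then show ?thesis by blast
qed

text \<open>The intrinsic counterpart of being finitely presented. Here all incoming arrows are
  used; since \<open>M\<close> vanishes off the cone, arrows from outside it make no
  difference.\<close>

definition plus_rep where
  "plus_rep M a \<longleftrightarrow> finite a \<and> a \<subseteq> verts Q \<and> (\<forall>y\<in>verts Q. y \<notin> succs a \<longrightarrow> vanishes M y) \<and>
    finite {y \<in> verts Q. \<not> gen_bij M (into UNIV y) y}"

text \<open>The conditional last clause lets one statement serve twice: to cover \<open>M\<close>,
  and to identify the kernel of that cover with a sum of \<open>P_x\<close>.\<close>

lemma projective_cover_exists:
  fixes M :: "('v, 'a, 'k, 'u) rep"
  assumes M: "is_rep K Q M" and fd: "locally_fin_dim K Q M" and plus: "plus_rep M a"
  shows "\<exists>as g. set as \<subseteq> verts Q \<and> g \<in> rep_mor K Q (proj_sum as) M \<and> surjective (proj_sum as) M g \<and>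
    ((\<forall>y\<in>verts Q. gen_inj M (into UNIV y) y) \<longrightarrow> injective (proj_sum as) g)"
proof -
  obtain as m where fam: "generating_family M as m"
    using generating_family_exists[OF M fd] plus unfolding plus_rep_def by blast
  then have as: "set as \<subseteq> verts Q" and m: "\<And>i. i < length as \<Longrightarrow> m i \<in> fiber M (as ! i)"
    unfolding generating_family_def by blast+
  have "surjective (proj_sum as) M (rep_hom (proj_sum as) (gen_map M as m))"
    by (rule gen_map_surjective[OF M m as, where a = a])
      (use plus fam in \<open>auto simp: plus_rep_def generating_family_def\<close>)
  moreover have "injective (proj_sum as) (rep_hom (proj_sum as) (gen_map M as m))"
    if "\<forall>y\<in>verts Q. gen_inj M (into UNIV y) y"
    by (rule gen_map_injective[OF M m as]) (use that fam in \<open>auto simp: generating_family_def\<close>)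
  moreover have "rep_hom (proj_sum as) (gen_map M as m) \<in> rep_mor K Q (proj_sum as) M"
    by (rule gen_map_mor[OF M m as])
  ultimately show ?thesis using as by (intro exI[of _ as] exI[of _ "rep_hom (proj_sum as) (gen_map M as m)"]) simp
qed

lemma short_exact_cokernel:
  assumes "short_exact K Q L M N f g"
  shows "cokernel_of L M f N g" and "kernel_of M N g L f"
  using assms unfolding short_exact_def cokernel_of_def kernel_of_def injective_def surjective_def by auto

lemma short_exactI:
  assumes "is_rep K Q L" "is_rep K Q M" "is_rep K Q N" "f \<in> rep_mor K Q L M" "g \<in> rep_mor K Q M N"
    and "injective L f" and "surjective M N g"
    and "\<And>x. x \<in> verts Q \<Longrightarrow> f x ` fiber L x = {v \<in> fiber M x. g x v = \<zero>\<^bsub>space_at N x\<^esub>}"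
  shows "short_exact K Q L M N f g"
  using assms unfolding short_exact_def injective_def surjective_def by blast

text \<open>\<open>M\<close> is the cokernel of a map between two sums of \<open>P_x\<close>, and
  these are locally bijective away from \<open>as\<close> and \<open>bs\<close>; the cokernel half
  of the five lemma does the rest.\<close>

lemma finitely_presented_plus:
  assumes "finitely_presented K Q M"
  shows "\<exists>a. plus_rep M a"
proof -
  obtain as bs f g where ab: "set as \<subseteq> verts Q" "set bs \<subseteq> verts Q"
    and ex: "short_exact K Q (proj_sum as) (proj_sum bs) M f g"
    using assms unfolding finitely_presented_def by blast
  note cok = short_exact_cokernel(1)[OF ex]
  have f: "f \<in> rep_mor K Q (proj_sum as) (proj_sum bs)" using ex by (simp add: short_exact_def)
  note g = cokernel_ofD[OF cok]
  have "plus_rep M (set bs)"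
    unfolding plus_rep_def
  proof (intro conjI ballI impI)
    show "vanishes M y" if "y \<in> verts Q" "y \<notin> succs (set bs)" for y
      by (rule vanishes_quot[OF g(2,1) surjectiveD[OF g(3) that(1)] that(1) proj_sum_vanishes[OF that]])
    show "finite {y \<in> verts Q. \<not> gen_bij M (into UNIV y) y}"
    proof (rule finite_subset)
      show "{y \<in> verts Q. \<not> gen_bij M (into UNIV y) y} \<subseteq> set as \<union> set bs"
      proof (rule subsetI, rule ccontr)
        fix y assume "y \<in> {y \<in> verts Q. \<not> gen_bij M (into UNIV y) y}" "y \<notin> set as \<union> set bs"
        then have y: "y \<in> verts Q" "\<not> gen_bij M (into UNIV y) y" "y \<notin> set as" "y \<notin> set bs" by auto
        have "gen_bij M (into UNIV y) y"
          by (rule gen_bij_cokernel[OF cok proj_sum_rep proj_sum_rep f y(1)])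
            (use proj_sum_gen_bij[OF y(1,3)] proj_sum_gen_bij[OF y(1,4)] in \<open>auto simp: gen_bij_def\<close>)
        then show False using y(2) by simp
      qed
    qed simp
  qed (use ab in auto)
  then show ?thesis by blast
qed

lemma plus_finitely_presented:
  fixes M :: "('v, 'a, 'k, 'u) rep"
  assumes M: "is_rep K Q M" and fd: "locally_fin_dim K Q M" and plus: "plus_rep M a"
  shows "finitely_presented K Q M"
proof -
  obtain bs g where bs: "set bs \<subseteq> verts Q" and g: "g \<in> rep_mor K Q (proj_sum bs) M" "surjective (proj_sum bs) M g"
    using projective_cover_exists[OF M fd plus] by blast
  obtain N :: "('v, 'a, 'k, nat \<Rightarrow> 'a list \<Rightarrow> 'k) rep" and k where ker: "kernel_of (proj_sum bs) M g N k"
    using kernel_exists[OF proj_sum_rep M g(1)] by blast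
  note k = kernel_ofD[OF ker]
  have fdN: "locally_fin_dim K Q N" by (rule locally_fin_dim_inj[OF k(2,3) proj_sum_fin_dim[OF bs]])
  \<comment> \<open>This is the hereditary property: a subrepresentation of a sum of
    \<open>P_x\<close> inherits joint injectivity of the incoming arrows at every vertex.\<close>
  have injN: "gen_inj N (into UNIV y) y" if y: "y \<in> verts Q" for y
    by (rule gen_inj_sub[OF k(2,1) proj_sum_rep y _ proj_sum_gen_inj[OF y]])
      (rule injectiveD[OF k(3) tail_verts[OF intoD(1)]])
  have "plus_rep N (set bs)"
    unfolding plus_rep_def
  proof (intro conjI ballI impI)
    show "vanishes N y" if "y \<in> verts Q" "y \<notin> succs (set bs)" for y
      by (rule vanishes_sub[OF k(2,1) injectiveD[OF k(3) that(1)] that(1) proj_sum_vanishes[OF that]])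
    show "finite {y \<in> verts Q. \<not> gen_bij N (into UNIV y) y}"
    proof (rule finite_subset)
      show "{y \<in> verts Q. \<not> gen_bij N (into UNIV y) y} \<subseteq> set bs \<union> {y \<in> verts Q. \<not> gen_bij M (into UNIV y) y}"
      proof (rule subsetI, rule ccontr)
        fix y assume "y \<in> {y \<in> verts Q. \<not> gen_bij N (into UNIV y) y}"
          "y \<notin> set bs \<union> {y \<in> verts Q. \<not> gen_bij M (into UNIV y) y}"
        then have y: "y \<in> verts Q" "\<not> gen_bij N (into UNIV y) y" "y \<notin> set bs" "gen_bij M (into UNIV y) y" by auto
        have "gen_bij N (into UNIV y) y"
          by (rule gen_bij_kernel[OF ker proj_sum_rep M g(1) y(1) proj_sum_gen_bij[OF y(1,3)]])
            (use y(4) in \<open>simp add: gen_bij_def\<close>)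
        then show False using y(2) by simp
      qed
      show "finite (set bs \<union> {y \<in> verts Q. \<not> gen_bij M (into UNIV y) y})" using plus by (simp add: plus_rep_def)
    qed
  qed (use bs in auto)
  then obtain as h where as: "set as \<subseteq> verts Q" and h: "h \<in> rep_mor K Q (proj_sum as) N"
      "surjective (proj_sum as) N h" "injective (proj_sum as) h"
    using projective_cover_exists[OF k(1) fdN] injN by blast
  \<comment> \<open>The cover \<open>h\<close> of the kernel is bijective, so following it by the
    inclusion \<open>k\<close> gives an injective map with the same image as
    \<open>k\<close>.\<close>
  let ?f = "rep_hom (proj_sum as) (\<lambda>x v. k x (h x v))"
  have "short_exact K Q (proj_sum as) (proj_sum bs) M ?f g"
  proof (rule short_exactI[OF proj_sum_rep proj_sum_rep M compose_mor[OF proj_sum_rep h(1) k(2)] g(1) _ g(2)])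
    show "injective (proj_sum as) ?f"
      unfolding injective_def
    proof
      fix x assume x: "x \<in> verts Q"
      have "inj_on (\<lambda>v. k x (h x v)) (fiber (proj_sum as) x)"
        using comp_inj_on[OF injectiveD[OF h(3) x], of "k x"] injectiveD[OF k(3) x] surjectiveD[OF h(2) x] by (simp add: comp_def)
      then show "inj_on (?f x) (fiber (proj_sum as) x)" using x by (simp add: inj_on_def)
    qed
    fix x assume x: "x \<in> verts Q"
    have "?f x ` fiber (proj_sum as) x = k x ` h x ` fiber (proj_sum as) x"
      unfolding image_image by (rule image_cong) (use x in simp_all)
    then show "?f x ` fiber (proj_sum as) x = {v \<in> fiber (proj_sum bs) x. g x v = \<zero>\<^bsub>space_at M x\<^esub>}"
      by (simp only: surjectiveD[OF h(2) x] k(4)[OF x])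
  qed
  then show ?thesis unfolding finitely_presented_def using as bs
    by (intro exI[of _ as] exI[of _ bs] exI[of _ ?f] exI[of _ g]) simp
qed

section \<open>Injective copresentations\<close>

lemma inj_rep_rep: "is_rep K Q (inj_rep K Q b)"
  unfolding is_rep_def
proof (intro conjI ballI)
  let ?I = "inj_rep K Q b"
  show V: "vectorspace K (space_at ?I x)" for x
    by (simp add: inj_rep_def func_space_vectorspace)
  fix \<alpha> assume \<alpha>: "\<alpha> \<in> arcs Q"
  have q: "\<alpha> # q \<in> paths Q (tail Q \<alpha>) b" if "q \<in> paths Q (head Q \<alpha>) b" for q
    using that \<alpha> by (simp add: paths_Cons_iff)
  have map: "map_at ?I \<alpha> f = (\<lambda>q\<in>paths Q (head Q \<alpha>) b. f (\<alpha> # q))" for f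
    by (simp add: inj_rep_def basis_map_transpose_def)
  have fib: "fiber ?I x = paths Q x b \<rightarrow>\<^sub>E carrier K" for x by (simp add: inj_rep_def func_space_simps)
  show "linear_map K (space_at ?I (tail Q \<alpha>)) (space_at ?I (head Q \<alpha>)) (map_at ?I \<alpha>)"
  proof (rule linear_mapI[OF V V])
    show "map_at ?I \<alpha> f \<in> fiber ?I (head Q \<alpha>)" if "f \<in> fiber ?I (tail Q \<alpha>)" for f
      using that q unfolding map fib by auto
    show "map_at ?I \<alpha> (f \<oplus>\<^bsub>space_at ?I (tail Q \<alpha>)\<^esub> g) = map_at ?I \<alpha> f \<oplus>\<^bsub>space_at ?I (head Q \<alpha>)\<^esub> map_at ?I \<alpha> g" for f g
      unfolding map using q by (auto simp: inj_rep_def func_space_simps fun_eq_iff)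
    show "map_at ?I \<alpha> (c \<odot>\<^bsub>space_at ?I (tail Q \<alpha>)\<^esub> f) = c \<odot>\<^bsub>space_at ?I (head Q \<alpha>)\<^esub> map_at ?I \<alpha> f" for c f
      unfolding map using q by (auto simp: inj_rep_def func_space_simps fun_eq_iff)
  qed
qed

abbreviation inj_sum where "inj_sum bs \<equiv> sum_rep (map (inj_rep K Q) bs)"

lemma inj_sum_rep: "is_rep K Q (inj_sum bs)"
  by (rule sum_rep_rep) (auto intro: inj_rep_rep)

lemma inj_sum_fin_dim: "set bs \<subseteq> verts Q \<Longrightarrow> locally_fin_dim K Q (inj_sum bs)"
  by (rule sum_rep_fin_dim)
    (auto simp: locally_fin_dim_def inj_rep_rep, auto simp: inj_rep_def intro!: func_space_fin_dim finite_paths)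

lemma inj_sum_fiber:
  "fiber (inj_sum bs) x = (\<Pi>\<^sub>E j\<in>{..<length bs}. paths Q x (bs ! j) \<rightarrow>\<^sub>E carrier K)"
  by (simp add: sum_rep_def sum_space_simps) (auto simp: inj_rep_def func_space_simps intro!: PiE_cong)

lemma inj_sum_eqI:
  assumes "c \<in> fiber (inj_sum bs) x" and "d \<in> fiber (inj_sum bs) x"
    and "\<And>j p. j < length bs \<Longrightarrow> p \<in> paths Q x (bs ! j) \<Longrightarrow> c j p = d j p"
  shows "c = d"
proof (rule PiE_ext[OF assms(1,2)[unfolded inj_sum_fiber]])
  fix j assume j: "j \<in> {..<length bs}"
  then have "c j \<in> paths Q x (bs ! j) \<rightarrow>\<^sub>E carrier K" "d j \<in> paths Q x (bs ! j) \<rightarrow>\<^sub>E carrier K"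
    using assms(1,2) unfolding inj_sum_fiber by auto
  then show "c j = d j" by (rule PiE_ext) (use assms(3) j in auto)
qed

lemma inj_sum_entries:
  assumes "j < length bs" and "p \<in> paths Q x (bs ! j)"
  shows inj_sum_zero: "\<zero>\<^bsub>space_at (inj_sum bs) x\<^esub> j p = \<zero>\<^bsub>K\<^esub>"
    and inj_sum_add: "(c \<oplus>\<^bsub>space_at (inj_sum bs) x\<^esub> d) j p = c j p \<oplus>\<^bsub>K\<^esub> d j p"
    and inj_sum_smult: "(l \<odot>\<^bsub>space_at (inj_sum bs) x\<^esub> d) j p = l \<otimes>\<^bsub>K\<^esub> d j p"
  using assms by (simp add: sum_rep_def sum_space_simps, simp add: inj_rep_def func_space_simps)+

lemma inj_sum_entry: "c \<in> fiber (inj_sum bs) x \<Longrightarrow> j < length bs \<Longrightarrow> p \<in> paths Q x (bs ! j) \<Longrightarrow> c j p \<in> carrier K"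
  unfolding inj_sum_fiber by (auto simp: PiE_iff)

lemma inj_sum_map:
  assumes "j < length bs" and "q \<in> paths Q (head Q \<alpha>) (bs ! j)"
  shows "map_at (inj_sum bs) \<alpha> c j q = c j (\<alpha> # q)"
  using assms by (simp add: sum_rep_def inj_rep_def basis_map_transpose_def)

lemma inj_sum_vanishes: "x \<in> verts Q \<Longrightarrow> x \<notin> preds (set bs) \<Longrightarrow> vanishes (inj_sum bs) x"
proof (rule vanishesI[OF inj_sum_rep])
  fix v assume x: "x \<in> verts Q" "x \<notin> preds (set bs)" and v: "v \<in> fiber (inj_sum bs) x"
  have "paths Q x (bs ! j) = {}" if "j < length bs" for j using x that by (auto simp: preds_def)
  then show "v = \<zero>\<^bsub>space_at (inj_sum bs) x\<^esub>"
    by (intro inj_sum_eqI[OF v vs_zero_closed[OF rep_space[OF inj_sum_rep x(1)]]]) auto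
qed

text \<open>A nontrivial path from \<open>x\<close> has a unique first arrow, so values prescribed
  at the heads fit together to one family of coefficients at \<open>x\<close>.\<close>

lemma inj_sum_cog_surj:
  assumes x: "x \<in> verts Q"
  shows "cog_surj (inj_sum bs) (out_to UNIV x) x"
  unfolding cog_surj_def
proof
  let ?I = "inj_sum bs"
  fix w assume w: "w \<in> head_tuples ?I (out_to UNIV x)"
  \<comment> \<open>The arrows never see the coefficient of the trivial path; zero is an arbitrary
    value there.\<close>
  define c where "c = (\<lambda>j\<in>{..<length bs}. \<lambda>p\<in>paths Q x (bs ! j). if p = [] then \<zero>\<^bsub>K\<^esub> else w (hd p) j (tl p))"
  have wc: "w \<alpha> \<in> fiber ?I (head Q \<alpha>)" if "\<alpha> \<in> out_to UNIV x" for \<alpha> using w that by (auto simp: head_tuples_def)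
  have "(if p = [] then \<zero>\<^bsub>K\<^esub> else w (hd p) j (tl p)) \<in> carrier K" if j: "j < length bs" and p: "p \<in> paths Q x (bs ! j)" for j p
  proof (cases p)
    case (Cons \<alpha> q)
    then have "\<alpha> \<in> out_to UNIV x" "q \<in> paths Q (head Q \<alpha>) (bs ! j)" using p by (auto simp: paths_Cons_iff out_to_def)
    then show ?thesis using inj_sum_entry[OF wc j] Cons by auto
  qed simp
  then have c: "c \<in> fiber ?I x" unfolding inj_sum_fiber c_def by auto
  have "map_at ?I \<alpha> c = w \<alpha>" if \<alpha>: "\<alpha> \<in> out_to UNIV x" for \<alpha>
  proof (rule inj_sum_eqI[OF out_closed[OF inj_sum_rep \<alpha> c] wc[OF \<alpha>]])
    fix j q assume j: "j < length bs" and q: "q \<in> paths Q (head Q \<alpha>) (bs ! j)"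
    have "\<alpha> # q \<in> paths Q x (bs ! j)" using q out_toD[OF \<alpha>] by (simp add: paths_Cons_iff)
    then show "map_at ?I \<alpha> c j q = w \<alpha> j q" using j by (simp add: inj_sum_map[OF j q] c_def)
  qed
  then show "\<exists>c\<in>fiber ?I x. \<forall>\<alpha>\<in>out_to UNIV x. map_at ?I \<alpha> c = w \<alpha>" using c by (intro bexI[of _ c]) simp_all
qed

text \<open>The outgoing arrows detect every coefficient except that of the trivial path, which
  exists only at the vertices in \<open>bs\<close>.\<close>

lemma inj_sum_cog_bij:
  assumes x: "x \<in> verts Q" and "x \<notin> set bs"
  shows "cog_bij (inj_sum bs) (out_to UNIV x) x"
proof -
  let ?I = "inj_sum bs"
  have "cog_inj ?I (out_to UNIV x) x"
    unfolding cog_inj_def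
  proof (intro ballI impI)
    fix c assume c: "c \<in> fiber ?I x" and 0: "\<forall>\<alpha>\<in>out_to UNIV x. map_at ?I \<alpha> c = \<zero>\<^bsub>space_at ?I (head Q \<alpha>)\<^esub>"
    show "c = \<zero>\<^bsub>space_at ?I x\<^esub>"
    proof (rule inj_sum_eqI[OF c vs_zero_closed[OF rep_space[OF inj_sum_rep x]]])
      fix j p assume j: "j < length bs" and p: "p \<in> paths Q x (bs ! j)"
      show "c j p = \<zero>\<^bsub>space_at ?I x\<^esub> j p"
      proof (cases p)
        case Nil
        then show ?thesis using p assms(2) j by (auto simp: paths_Nil_iff)
      next
        case (Cons \<alpha> q)
        then have \<alpha>: "\<alpha> \<in> out_to UNIV x" and q: "q \<in> paths Q (head Q \<alpha>) (bs ! j)"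
          using p by (auto simp: paths_Cons_iff out_to_def)
        have "map_at ?I \<alpha> c = \<zero>\<^bsub>space_at ?I (head Q \<alpha>)\<^esub>" using 0 \<alpha> by (rule bspec)
        then have "map_at ?I \<alpha> c j q = \<zero>\<^bsub>K\<^esub>" using inj_sum_zero[OF j q] by simp
        then show ?thesis using inj_sum_map[OF j q] inj_sum_zero[OF j p] Cons by simp
      qed
    qed
  qed
  then show ?thesis using inj_sum_cog_surj[OF x] by (simp add: cog_bij_def)
qed

text \<open>The dual of the Yoneda correspondence: a functional on the space at \<open>b\<close>
  gives a morphism to \<open>I_b\<close>, whose coefficient at a path \<open>p\<close> is the
  functional evaluated after acting with \<open>p\<close>.\<close>

definition cogen_map :: "('v, 'a, 'k, 'u) rep \<Rightarrow> 'v list \<Rightarrow> (nat \<Rightarrow> 'u \<Rightarrow> 'k) \<Rightarrow> 'v \<Rightarrow> 'u \<Rightarrow> nat \<Rightarrow> 'a list \<Rightarrow> 'k"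
  where "cogen_map M bs \<xi> x v = (\<lambda>j\<in>{..<length bs}. \<lambda>p\<in>paths Q x (bs ! j). \<xi> j (act M p v))"

lemma cogen_map_apply: "j < length bs \<Longrightarrow> p \<in> paths Q x (bs ! j) \<Longrightarrow> cogen_map M bs \<xi> x v j p = \<xi> j (act M p v)"
  by (simp add: cogen_map_def)

lemma act_linear: "is_rep K Q M \<Longrightarrow> p \<in> paths Q x y \<Longrightarrow> linear_map K (space_at M x) (space_at M y) (act M p)"
proof (induct p arbitrary: x)
  case Nil
  then have "linear_map K (space_at M x) (space_at M y) (\<lambda>v. v)"
    using rep_space[OF Nil(1)] by (intro linear_mapI) (auto simp: paths_Nil_iff)
  then show ?case by (rule linear_map_cong) (simp add: act_simps)
next
  case (Cons \<alpha> p)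
  then have \<alpha>: "\<alpha> \<in> arcs Q" "x = tail Q \<alpha>" "p \<in> paths Q (head Q \<alpha>) y" by (auto simp: paths_Cons_iff)
  have "linear_map K (space_at M x) (space_at M y) (\<lambda>v. act M p (map_at M \<alpha> v))"
    using linear_map_compose[OF rep_map[OF Cons.prems(1) \<alpha>(1)] Cons.hyps[OF Cons.prems(1) \<alpha>(3)]] \<alpha>(2) by simp
  then show ?case by (rule linear_map_cong) (simp add: act_simps)
qed

definition functionals_at where
  "functionals_at M bs \<xi> \<longleftrightarrow> (\<forall>j<length bs. linear_functional K (space_at M (bs ! j)) (\<xi> j))"

lemma cogen_map_functional:
  assumes M: "is_rep K Q M" and \<xi>: "functionals_at M bs \<xi>" and j: "j < length bs" and p: "p \<in> paths Q x (bs ! j)"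
  shows "linear_functional K (space_at M x) (\<lambda>v. \<xi> j (act M p v))"
  by (rule linear_functional_compose[OF act_linear[OF M p]]) (use \<xi> j in \<open>simp add: functionals_at_def\<close>)

lemma cogen_map_linear:
  assumes M: "is_rep K Q M" and \<xi>: "functionals_at M bs \<xi>" and x: "x \<in> verts Q"
  shows "linear_map K (space_at M x) (space_at (inj_sum bs) x) (cogen_map M bs \<xi> x)"
proof (rule linear_mapI[OF rep_space[OF M x] rep_space[OF inj_sum_rep x]])
  let ?I = "inj_sum bs" and ?H = "cogen_map M bs \<xi> x"
  note V = rep_space[OF M x] and W = rep_space[OF inj_sum_rep x]
  note lf = cogen_map_functional[OF M \<xi>]
  show cl: "?H v \<in> fiber ?I x" if v: "v \<in> fiber M x" for v
    unfolding inj_sum_fiber cogen_map_def using linear_functional_closed[OF lf v] by auto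
  show "?H (u \<oplus>\<^bsub>space_at M x\<^esub> v) = ?H u \<oplus>\<^bsub>space_at ?I x\<^esub> ?H v" if u: "u \<in> fiber M x" and v: "v \<in> fiber M x" for u v
  proof (rule inj_sum_eqI[OF cl[OF vs_add_closed[OF V u v]] vs_add_closed[OF W cl[OF u] cl[OF v]]])
    fix j p assume j: "j < length bs" and p: "p \<in> paths Q x (bs ! j)"
    show "?H (u \<oplus>\<^bsub>space_at M x\<^esub> v) j p = (?H u \<oplus>\<^bsub>space_at ?I x\<^esub> ?H v) j p"
      unfolding inj_sum_add[OF j p] cogen_map_apply[OF j p] by (rule linear_functional_add[OF lf[OF j p] u v])
  qed
  show "?H (c \<odot>\<^bsub>space_at M x\<^esub> v) = c \<odot>\<^bsub>space_at ?I x\<^esub> ?H v" if c: "c \<in> carrier K" and v: "v \<in> fiber M x" for c v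
  proof (rule inj_sum_eqI[OF cl[OF vs_smult_closed[OF V c v]] vs_smult_closed[OF W c cl[OF v]]])
    fix j p assume j: "j < length bs" and p: "p \<in> paths Q x (bs ! j)"
    show "?H (c \<odot>\<^bsub>space_at M x\<^esub> v) j p = (c \<odot>\<^bsub>space_at ?I x\<^esub> ?H v) j p"
      unfolding inj_sum_smult[OF j p] cogen_map_apply[OF j p] by (rule linear_functional_smult[OF lf[OF j p] c v])
  qed
qed

lemma cogen_map_natural:
  assumes M: "is_rep K Q M" and \<xi>: "functionals_at M bs \<xi>" and \<alpha>: "\<alpha> \<in> arcs Q" and v: "v \<in> fiber M (tail Q \<alpha>)"
  shows "cogen_map M bs \<xi> (head Q \<alpha>) (map_at M \<alpha> v) = map_at (inj_sum bs) \<alpha> (cogen_map M bs \<xi> (tail Q \<alpha>) v)"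
proof (rule inj_sum_eqI)
  note lin = cogen_map_linear[OF M \<xi>]
  show "cogen_map M bs \<xi> (head Q \<alpha>) (map_at M \<alpha> v) \<in> fiber (inj_sum bs) (head Q \<alpha>)"
    by (rule linear_map_closed[OF lin[OF head_verts[OF \<alpha>]] rep_map_closed[OF M \<alpha> v]])
  show "map_at (inj_sum bs) \<alpha> (cogen_map M bs \<xi> (tail Q \<alpha>) v) \<in> fiber (inj_sum bs) (head Q \<alpha>)"
    by (rule rep_map_closed[OF inj_sum_rep \<alpha> linear_map_closed[OF lin[OF tail_verts[OF \<alpha>]] v]])
  fix j q assume j: "j < length bs" and q: "q \<in> paths Q (head Q \<alpha>) (bs ! j)"
  have "\<alpha> # q \<in> paths Q (tail Q \<alpha>) (bs ! j)" using q \<alpha> by (simp add: paths_Cons_iff)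
  then show "cogen_map M bs \<xi> (head Q \<alpha>) (map_at M \<alpha> v) j q = map_at (inj_sum bs) \<alpha> (cogen_map M bs \<xi> (tail Q \<alpha>) v) j q"
    by (simp add: inj_sum_map[OF j q] cogen_map_apply j q act_simps)
qed

lemma cogen_map_mor:
  assumes M: "is_rep K Q M" and \<xi>: "functionals_at M bs \<xi>"
  shows "rep_hom M (cogen_map M bs \<xi>) \<in> rep_mor K Q M (inj_sum bs)"
  by (rule rep_hom_mor[OF M]) (auto intro: cogen_map_linear[OF M \<xi>] cogen_map_natural[OF M \<xi>])

text \<open>As for \<open>cone_induct\<close>, with a bound for the lengths of the paths to
  \<open>b\<close>, which drops by one in passing to a head.\<close>

lemma cocone_induct [consumes 3, case_names outside step]:
  assumes b: "finite b" "b \<subseteq> verts Q" and x: "x \<in> verts Q"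
    and outside: "\<And>x. x \<in> verts Q \<Longrightarrow> x \<notin> preds b \<Longrightarrow> R x"
    and step: "\<And>x. x \<in> verts Q \<Longrightarrow> (\<And>\<alpha>. \<alpha> \<in> out_to UNIV x \<Longrightarrow> R (head Q \<alpha>)) \<Longrightarrow> R x"
  shows "R x"
proof -
  have bounded: "R x" if "x \<in> verts Q" "\<And>y p. y \<in> b \<Longrightarrow> p \<in> paths Q x y \<Longrightarrow> length p < n" for n x
    using that
  proof (induct n arbitrary: x)
    case 0
    then show ?case by (intro outside) (auto simp: preds_def)
  next
    case (Suc n)
    show ?case
    proof (rule step[OF Suc.prems(1)])
      fix \<alpha> assume \<alpha>: "\<alpha> \<in> out_to UNIV x"
      show "R (head Q \<alpha>)"
      proof (rule Suc.hyps[OF head_verts[OF out_toD(1)[OF \<alpha>]]])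
        fix y p assume "y \<in> b" "p \<in> paths Q (head Q \<alpha>) y"
        then have "\<alpha> # p \<in> paths Q x y" using \<alpha> by (auto simp: paths_Cons_iff out_to_def)
        then show "length p < n" using Suc.prems(2)[OF \<open>y \<in> b\<close>] by fastforce
      qed
    qed
  qed
  have "finite (length ` (\<Union>y\<in>b. paths Q x y))" by (intro finite_imageI finite_UN_I) (use b x finite_paths in auto)
  then obtain n where n: "\<forall>l\<in>length ` (\<Union>y\<in>b. paths Q x y). l < n"
    using finite_nat_set_iff_bounded by blast
  show ?thesis by (rule bounded[OF x, of n]) (use n in blast)
qed

definition cogenerates where
  "cogenerates M bs \<xi> x \<longleftrightarrow> (\<forall>v\<in>fiber M x. (\<forall>j\<in>at_vertex bs x. \<xi> j v = \<zero>\<^bsub>K\<^esub>) \<longrightarrow>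
    (\<forall>\<alpha>\<in>out_to UNIV x. map_at M \<alpha> v = \<zero>\<^bsub>space_at M (head Q \<alpha>)\<^esub>) \<longrightarrow> v = \<zero>\<^bsub>space_at M x\<^esub>)"

text \<open>Joint surjectivity of the functionals and the outgoing arrows; it contains
  \<open>cog_surj\<close> at \<open>x\<close>.\<close>

definition coindependent where
  "coindependent M bs \<xi> x \<longleftrightarrow> (\<forall>l\<in>at_vertex bs x \<rightarrow> carrier K. \<forall>w\<in>head_tuples M (out_to UNIV x).
    \<exists>v\<in>fiber M x. (\<forall>j\<in>at_vertex bs x. \<xi> j v = l j) \<and> (\<forall>\<alpha>\<in>out_to UNIV x. map_at M \<alpha> v = w \<alpha>))"

text \<open>Induction from the heads: if \<open>v\<close> is sent to zero, naturality sends its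
  arrow images to zero, so they vanish, while the trivial paths show that the functionals vanish on
  \<open>v\<close>.\<close>

lemma cogen_map_injective:
  assumes M: "is_rep K Q M" and \<xi>: "functionals_at M bs \<xi>"
    and b: "finite b" "b \<subseteq> verts Q" and van: "\<forall>x\<in>verts Q. x \<notin> preds b \<longrightarrow> vanishes M x"
    and cog: "\<forall>x\<in>verts Q. cogenerates M bs \<xi> x"
  shows "injective M (rep_hom M (cogen_map M bs \<xi>))"
proof -
  let ?I = "inj_sum bs" and ?H = "cogen_map M bs \<xi>"
  have zero: "\<forall>v\<in>fiber M x. ?H x v = \<zero>\<^bsub>space_at ?I x\<^esub> \<longrightarrow> v = \<zero>\<^bsub>space_at M x\<^esub>" if "x \<in> verts Q" for x
    using b that
  proof (induct rule: cocone_induct)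
    case (outside x)
    then have "vanishes M x" using van by simp
    then show ?case using vanishesD by auto
  next
    case (step x)
    note x = step(1)
    show ?case
    proof (intro ballI impI)
      fix v assume v: "v \<in> fiber M x" and 0: "?H x v = \<zero>\<^bsub>space_at ?I x\<^esub>"
      have 1: "\<forall>j\<in>at_vertex bs x. \<xi> j v = \<zero>\<^bsub>K\<^esub>"
      proof
        fix j assume "j \<in> at_vertex bs x"
        then have j: "j < length bs" and p: "[] \<in> paths Q x (bs ! j)" using x by (auto simp: at_vertex_def paths_Nil_iff)
        show "\<xi> j v = \<zero>\<^bsub>K\<^esub>" using cogen_map_apply[OF j p, of M \<xi> v] inj_sum_zero[OF j p] 0 by (simp add: act_simps)
      qed
      have 2: "\<forall>\<alpha>\<in>out_to UNIV x. map_at M \<alpha> v = \<zero>\<^bsub>space_at M (head Q \<alpha>)\<^esub>"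
      proof
        fix \<alpha> assume \<alpha>: "\<alpha> \<in> out_to UNIV x"
        have "?H (head Q \<alpha>) (map_at M \<alpha> v) = map_at ?I \<alpha> (?H x v)"
          using cogen_map_natural[OF M \<xi> out_toD(1)[OF \<alpha>]] v out_toD(2)[OF \<alpha>] by simp
        also have "\<dots> = \<zero>\<^bsub>space_at ?I (head Q \<alpha>)\<^esub>"
          using linear_map_zero[OF rep_map[OF inj_sum_rep out_toD(1)[OF \<alpha>]]] 0 out_toD(2)[OF \<alpha>] by simp
        finally show "map_at M \<alpha> v = \<zero>\<^bsub>space_at M (head Q \<alpha>)\<^esub>"
          using step(2)[OF \<alpha>] out_closed[OF M \<alpha> v] by blast
      qed
      show "v = \<zero>\<^bsub>space_at M x\<^esub>"
        by (rule bspec[OF bspec[OF cog x, unfolded cogenerates_def] v, THEN mp, THEN mp, OF 1 2])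
    qed
  qed
  show ?thesis
    unfolding injective_def
  proof
    fix x assume x: "x \<in> verts Q"
    have "inj_on (?H x) (fiber M x)" using zero[OF x] by (simp only: linear_map_inj_iff[OF cogen_map_linear[OF M \<xi> x]])
    then show "inj_on (rep_hom M ?H x) (fiber M x)" using x by (simp add: inj_on_def)
  qed
qed

text \<open>Induction from the heads: preimages \<open>w\<close> of the arrow images of
  \<open>c\<close> exist already, and coindependence yields a vector with these arrow images and the
  right values at the trivial paths.\<close>

lemma cogen_map_surjective:
  assumes M: "is_rep K Q M" and \<xi>: "functionals_at M bs \<xi>" and bs: "set bs \<subseteq> verts Q"
    and ind: "\<forall>x\<in>verts Q. coindependent M bs \<xi> x"
  shows "surjective M (inj_sum bs) (rep_hom M (cogen_map M bs \<xi>))"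
proof -
  let ?I = "inj_sum bs" and ?H = "cogen_map M bs \<xi>"
  note lin = cogen_map_linear[OF M \<xi>]
  have surj: "\<forall>c\<in>fiber ?I x. c \<in> ?H x ` fiber M x" if "x \<in> verts Q" for x
    using finite_set bs that
  proof (induct rule: cocone_induct)
    case (outside x)
    show ?case
    proof
      fix c assume "c \<in> fiber ?I x"
      then have "c = \<zero>\<^bsub>space_at ?I x\<^esub>" by (rule vanishesD[OF inj_sum_vanishes[OF outside]])
      then show "c \<in> ?H x ` fiber M x"
        using linear_map_zero[OF lin[OF outside(1)]] vs_zero_closed[OF rep_space[OF M outside(1)]]
        by (intro image_eqI[of _ _ "\<zero>\<^bsub>space_at M x\<^esub>"]) simp_all
    qed
  next
    case (step x)
    note x = step(1)
    show ?case
    proof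
      fix c assume c: "c \<in> fiber ?I x"
      have "map_at ?I \<alpha> c \<in> ?H (head Q \<alpha>) ` fiber M (head Q \<alpha>)" if \<alpha>: "\<alpha> \<in> out_to UNIV x" for \<alpha>
        using bspec[OF step(2)[OF \<alpha>] out_closed[OF inj_sum_rep \<alpha> c]] .
      then obtain w where w: "w \<in> head_tuples M (out_to UNIV x)" "\<forall>\<alpha>\<in>out_to UNIV x. ?H (head Q \<alpha>) (w \<alpha>) = map_at ?I \<alpha> c"
        using head_tuples_lift[of UNIV x "\<lambda>\<alpha>. map_at ?I \<alpha> c" ?H M] by blast
      have l: "(\<lambda>j. c j []) \<in> at_vertex bs x \<rightarrow> carrier K"
        using inj_sum_entry[OF c] x by (auto simp: at_vertex_def paths_Nil_iff)
      obtain v where v: "v \<in> fiber M x" and vl: "\<forall>j\<in>at_vertex bs x. \<xi> j v = c j []" and vw: "\<forall>\<alpha>\<in>out_to UNIV x. map_at M \<alpha> v = w \<alpha>"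
        using bspec[OF bspec[OF bspec[OF ind x, unfolded coindependent_def] l] w(1)] by blast
      have "c = ?H x v"
      proof (rule inj_sum_eqI[OF c linear_map_closed[OF lin[OF x] v]])
        fix j p assume j: "j < length bs" and p: "p \<in> paths Q x (bs ! j)"
        show "c j p = ?H x v j p"
        proof (cases p)
          case Nil
          then have "j \<in> at_vertex bs x" using p j by (simp add: at_vertex_def paths_Nil_iff)
          then have "\<xi> j v = c j []" using vl by (rule bspec[rotated])
          then show ?thesis using cogen_map_apply[OF j p, of M \<xi> v] Nil by (simp add: act_simps)
        next
          case (Cons \<alpha> q)
          then have \<alpha>: "\<alpha> \<in> out_to UNIV x" and q: "q \<in> paths Q (head Q \<alpha>) (bs ! j)" using p by (auto simp: paths_Cons_iff out_to_def)
          have "c j p = map_at ?I \<alpha> c j q" using inj_sum_map[OF j q] Cons by simp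
          also have "\<dots> = ?H (head Q \<alpha>) (w \<alpha>) j q" using bspec[OF w(2) \<alpha>] by simp
          also have "\<dots> = ?H x v j p"
            using cogen_map_apply[OF j q, of M \<xi> "w \<alpha>"] cogen_map_apply[OF j p, of M \<xi> v] bspec[OF vw \<alpha>] Cons by (simp add: act_simps)
          finally show ?thesis .
        qed
      qed
      then show "c \<in> ?H x ` fiber M x" using v by (rule image_eqI)
    qed
  qed
  show ?thesis
    unfolding surjective_def
  proof
    fix x assume x: "x \<in> verts Q"
    have "rep_hom M ?H x ` fiber M x = ?H x ` fiber M x" by (rule image_cong) (use x in simp_all)
    also have "\<dots> = fiber ?I x"
    proof
      show "?H x ` fiber M x \<subseteq> fiber ?I x" by (rule image_subsetI) (rule linear_map_closed[OF lin[OF x]])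
      show "fiber ?I x \<subseteq> ?H x ` fiber M x" by (rule subsetI) (rule bspec[OF surj[OF x]])
    qed
    finally show "rep_hom M ?H x ` fiber M x = fiber ?I x" .
  qed
qed

section \<open>Choosing functionals at the exceptional vertices\<close>

lemma subspace_finsum:
  assumes W: "VectorSpace.subspace K W V" and "finite S" and "w \<in> S \<rightarrow> W"
  shows "(\<Oplus>\<^bsub>V\<^esub>s\<in>S. w s) \<in> W"
  using assms(2,3)
proof (induct S)
  case empty
  then show ?case by (simp add: subspace_zero[OF W] abelian_monoid.finsum_empty[OF vs_abelian_monoid[OF subspace_ambient[OF W]]])
next
  case (insert s S)
  have "(\<Oplus>\<^bsub>V\<^esub>t\<in>insert s S. w t) = w s \<oplus>\<^bsub>V\<^esub> (\<Oplus>\<^bsub>V\<^esub>t\<in>S. w t)"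
    by (rule abelian_monoid.finsum_insert[OF vs_abelian_monoid[OF subspace_ambient[OF W]] insert(1,2)])
      (use insert(4) subspace_subset[OF W] in auto)
  then show ?case using subspace_add[OF W] insert(3,4) by simp
qed

text \<open>What the outgoing arrows cannot detect and functionals must therefore separate; the dual
  of \<open>arrow_image\<close>.\<close>

definition common_kernel where
  "common_kernel M x = {v \<in> fiber M x. \<forall>\<alpha>\<in>out_to UNIV x. map_at M \<alpha> v = \<zero>\<^bsub>space_at M (head Q \<alpha>)\<^esub>}"

lemma common_kernel_subspace:
  assumes M: "is_rep K Q M" and x: "x \<in> verts Q"
  shows "VectorSpace.subspace K (common_kernel M x) (space_at M x)"
proof (rule subspaceI[OF rep_space[OF M x]])
  note V = rep_space[OF M x]
  have lin: "linear_map K (space_at M x) (space_at M (head Q \<alpha>)) (map_at M \<alpha>)" if "\<alpha> \<in> out_to UNIV x" for \<alpha>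
    using rep_map[OF M out_toD(1)[OF that]] out_toD(2)[OF that] by simp
  have target: "vectorspace K (space_at M (head Q \<alpha>))" if "\<alpha> \<in> out_to UNIV x" for \<alpha>
    by (rule linear_map_target[OF lin[OF that]])
  show "common_kernel M x \<subseteq> fiber M x" by (auto simp: common_kernel_def)
  show "\<zero>\<^bsub>space_at M x\<^esub> \<in> common_kernel M x"
    using vs_zero_closed[OF V] linear_map_zero[OF lin] by (simp add: common_kernel_def)
  show "u \<oplus>\<^bsub>space_at M x\<^esub> v \<in> common_kernel M x" if u: "u \<in> common_kernel M x" and v: "v \<in> common_kernel M x" for u v
    using u v vs_add_closed[OF V] linear_map_add[OF lin] vs_zero_add[OF target vs_zero_closed[OF target]]
    by (auto simp: common_kernel_def)
  show "c \<odot>\<^bsub>space_at M x\<^esub> v \<in> common_kernel M x" if c: "c \<in> carrier K" and v: "v \<in> common_kernel M x" for c v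
  proof -
    have "map_at M \<alpha> (c \<odot>\<^bsub>space_at M x\<^esub> v) = \<zero>\<^bsub>space_at M (head Q \<alpha>)\<^esub>" if \<alpha>: "\<alpha> \<in> out_to UNIV x" for \<alpha>
    proof -
      interpret W: vectorspace K "space_at M (head Q \<alpha>)" by (rule target[OF \<alpha>])
      show ?thesis using linear_map_smult[OF lin[OF \<alpha>] c, of v] v \<alpha> c by (simp add: common_kernel_def)
    qed
    then show ?thesis using v vs_smult_closed[OF V c] by (simp add: common_kernel_def)
  qed
qed

definition cogenerating_family where
  "cogenerating_family M bs \<xi> \<longleftrightarrow> set bs \<subseteq> verts Q \<and> functionals_at M bs \<xi> \<and>
    (\<forall>x\<in>verts Q. cogenerates M bs \<xi> x) \<and>
    (\<forall>x\<in>verts Q. cog_surj M (out_to UNIV x) x \<longrightarrow> coindependent M bs \<xi> x)"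

text \<open>At an exceptional vertex, a dual system for the common kernel supplies both sides: its
  functionals separate what the arrows miss, and its dual vectors adjust functional values without
  changing arrow images.\<close>

lemma cogenerating_family_exists:
  fixes M :: "('v, 'a, 'k, 'u) rep"
  assumes M: "is_rep K Q M" and fd: "locally_fin_dim K Q M"
    and fin: "finite {x \<in> verts Q. \<not> cog_bij M (out_to UNIV x) x}"
  shows "\<exists>bs \<xi>. cogenerating_family M bs \<xi>"
proof -
  define B where "B = {x \<in> verts Q. \<not> cog_bij M (out_to UNIV x) x}"
  let ?R = "\<lambda>x (p :: 'u set \<times> ('u \<Rightarrow> 'u \<Rightarrow> 'k) \<times> ('u \<Rightarrow> 'u)). separating K (space_at M x) (common_kernel M x) (fst p) (fst (snd p)) \<and>
    dual_family K (common_kernel M x) (fst p) (fst (snd p)) (snd (snd p))"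
  define T \<eta> u where "T x = fst (Eps (?R x))" and "\<eta> x = fst (snd (Eps (?R x)))" and "u x = snd (snd (Eps (?R x)))" for x
  have R: "separating K (space_at M x) (common_kernel M x) (T x) (\<eta> x) \<and> dual_family K (common_kernel M x) (T x) (\<eta> x) (u x)"
    if "x \<in> B" for x
  proof -
    have x: "x \<in> verts Q" using that by (simp add: B_def)
    then have "vectorspace.fin_dim K (space_at M x)" using fd by (simp add: locally_fin_dim_def)
    then obtain T0 :: "'u set" and \<eta> where "separating K (space_at M x) (fiber M x) T0 \<eta>"
      using fin_dim_functionals[OF rep_space[OF M x]] by auto
    then have "separating K (space_at M x) (common_kernel M x) T0 \<eta>"
      unfolding separating_def common_kernel_def by simp
    from dual_system[OF common_kernel_subspace[OF M x] this]
    obtain T u where "separating K (space_at M x) (common_kernel M x) T \<eta>" "dual_family K (common_kernel M x) T \<eta> u"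
      by (elim exE conjE) (rule that)
    then have "?R x (T, \<eta>, u)" by simp
    then show ?thesis unfolding T_def \<eta>_def u_def by (rule someI[of "?R x"])
  qed
  note sep = conjunct1[OF R] and dual = conjunct2[OF R]
  have finB: "finite B" using fin by (simp add: B_def)
  obtain bs and h :: "nat \<Rightarrow> 'u" where bs: "\<forall>j<length bs. bs ! j \<in> B \<and> h j \<in> T (bs ! j)"
    and hbij: "\<forall>x\<in>B. bij_betw h (at_vertex bs x) (T x)"
    using vertex_indexing[of B T] finB separating_finite[OF sep] by auto
  define \<xi> where "\<xi> j = \<eta> (bs ! j) (h j)" for j
  have bsj: "bs ! j \<in> B" "h j \<in> T (bs ! j)" if "j < length bs" for j using bs that by auto
  have hx: "h j \<in> T x" "\<xi> j = \<eta> x (h j)" if "j \<in> at_vertex bs x" for j x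
    using that bsj(2) by (auto simp: at_vertex_def \<xi>_def)
  have bsV: "set bs \<subseteq> verts Q" using bsj(1) by (auto simp: B_def in_set_conv_nth)
  have fun_at: "functionals_at M bs \<xi>"
    unfolding functionals_at_def \<xi>_def using separating_functional[OF sep[OF bsj(1)] bsj(2)] by auto
  have empty: "at_vertex bs x = {}" if "x \<notin> B" for x using bsj(1) that by (auto simp: at_vertex_def)
  have "cogenerates M bs \<xi> x" if x: "x \<in> verts Q" for x
    unfolding cogenerates_def
  proof (intro ballI impI)
    fix v assume v: "v \<in> fiber M x" and 1: "\<forall>j\<in>at_vertex bs x. \<xi> j v = \<zero>\<^bsub>K\<^esub>"
      and 2: "\<forall>\<alpha>\<in>out_to UNIV x. map_at M \<alpha> v = \<zero>\<^bsub>space_at M (head Q \<alpha>)\<^esub>"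
    show "v = \<zero>\<^bsub>space_at M x\<^esub>"
    proof (cases "x \<in> B")
      case True
      show ?thesis
      proof (rule separating_eq_zero[OF sep[OF True]])
        show "v \<in> common_kernel M x" using v 2 by (simp add: common_kernel_def)
        fix t assume "t \<in> T x"
        then obtain j where "j \<in> at_vertex bs x" "t = h j" using hbij True by (auto simp: bij_betw_def)
        then show "\<eta> x t v = \<zero>\<^bsub>K\<^esub>" using 1 hx by auto
      qed
    next
      case False
      then have "cog_inj M (out_to UNIV x) x" using x by (simp add: B_def cog_bij_def)
      then show ?thesis using v 2 by (simp add: cog_inj_def)
    qed
  qed
  moreover have "coindependent M bs \<xi> x" if x: "x \<in> verts Q" and surj: "cog_surj M (out_to UNIV x) x" for x
    unfolding coindependent_def
  proof (intro ballI)
    fix l w assume l: "l \<in> at_vertex bs x \<rightarrow> carrier K" and w: "w \<in> head_tuples M (out_to UNIV x)"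
    obtain v where v: "v \<in> fiber M x" and vw: "\<forall>\<alpha>\<in>out_to UNIV x. map_at M \<alpha> v = w \<alpha>"
      using bspec[OF surj[unfolded cog_surj_def] w] by blast
    show "\<exists>v\<in>fiber M x. (\<forall>j\<in>at_vertex bs x. \<xi> j v = l j) \<and> (\<forall>\<alpha>\<in>out_to UNIV x. map_at M \<alpha> v = w \<alpha>)"
    proof (cases "x \<in> B")
      case True
      interpret V: vectorspace K "space_at M x" using rep_space[OF M x] .
      note sub = common_kernel_subspace[OF M x]
      \<comment> \<open>The defect between prescribed and actual functional values of
        \<open>v\<close>. The combination \<open>z\<close> of dual vectors makes it up, and all
        outgoing arrows kill \<open>z\<close>.\<close>
      define c where "c t = l (inv_into (at_vertex bs x) h t) \<ominus>\<^bsub>K\<^esub> \<eta> x t v" for t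
      define z where "z = (\<Oplus>\<^bsub>space_at M x\<^esub>t\<in>T x. c t \<odot>\<^bsub>space_at M x\<^esub> u x t)"
      have lf: "linear_functional K (space_at M x) (\<eta> x t)" if "t \<in> T x" for t
        by (rule separating_functional[OF sep[OF True] that])
      have ch: "c (h j) = l j \<ominus>\<^bsub>K\<^esub> \<xi> j v" if "j \<in> at_vertex bs x" for j
        using that hx[OF that] hbij True by (simp add: c_def bij_betw_def)
      have c: "c \<in> T x \<rightarrow> carrier K"
      proof
        fix t assume t: "t \<in> T x"
        then obtain j where "j \<in> at_vertex bs x" "t = h j" using hbij True by (auto simp: bij_betw_def)
        then show "c t \<in> carrier K" using ch[of j] hx[of j x] l linear_functional_closed[OF lf[OF t] v] by auto
      qed
      have z: "z \<in> common_kernel M x"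
        unfolding z_def by (rule subspace_finsum[OF sub separating_finite[OF sep[OF True]]]) (use c dual_family_in[OF dual[OF True]] subspace_smult[OF sub] in auto)
      then have zM: "z \<in> fiber M x" by (simp add: common_kernel_def)
      have "\<xi> j (v \<oplus>\<^bsub>space_at M x\<^esub> z) = l j" if j: "j \<in> at_vertex bs x" for j
      proof -
        have "\<eta> x (h j) z = l j \<ominus>\<^bsub>K\<^esub> \<xi> j v"
          unfolding z_def using dual_system_expansion[OF sub sep[OF True] dual[OF True] c hx(1)[OF j]] ch[OF j] by simp
        then have "\<xi> j (v \<oplus>\<^bsub>space_at M x\<^esub> z) = \<xi> j v \<oplus>\<^bsub>K\<^esub> (l j \<ominus>\<^bsub>K\<^esub> \<xi> j v)"
          using linear_functional_add[OF lf[OF hx(1)[OF j]] v zM] hx(2)[OF j] by simp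
        moreover have "\<xi> j v \<in> carrier K" "l j \<in> carrier K"
          using linear_functional_closed[OF lf[OF hx(1)[OF j]] v] hx(2)[OF j] l j by auto
        ultimately show ?thesis by (simp add: K.minus_eq K.r_neg2 K.a_lcomm K.r_neg)
      qed
      moreover have "map_at M \<alpha> (v \<oplus>\<^bsub>space_at M x\<^esub> z) = w \<alpha>" if \<alpha>: "\<alpha> \<in> out_to UNIV x" for \<alpha>
      proof -
        have lin: "linear_map K (space_at M x) (space_at M (head Q \<alpha>)) (map_at M \<alpha>)"
          using rep_map[OF M out_toD(1)[OF \<alpha>]] out_toD(2)[OF \<alpha>] by simp
        have "map_at M \<alpha> z = \<zero>\<^bsub>space_at M (head Q \<alpha>)\<^esub>" using z \<alpha> by (simp add: common_kernel_def)
        then show ?thesis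
          using linear_map_add[OF lin v zM] vs_add_zero[OF linear_map_target[OF lin] linear_map_closed[OF lin v]] bspec[OF vw \<alpha>] by simp
      qed
      ultimately show ?thesis using vs_add_closed[OF rep_space[OF M x] v zM] by (intro bexI[of _ "v \<oplus>\<^bsub>space_at M x\<^esub> z"]) auto
    next
      case False
      then show ?thesis using v vw empty by (intro bexI[of _ v]) auto
    qed
  qed
  ultimately have "cogenerating_family M bs \<xi>" unfolding cogenerating_family_def using bsV fun_at by blast
  then show ?thesis by blast
qed

definition minus_rep where
  "minus_rep M b \<longleftrightarrow> finite b \<and> b \<subseteq> verts Q \<and> (\<forall>x\<in>verts Q. x \<notin> preds b \<longrightarrow> vanishes M x) \<and>
    finite {x \<in> verts Q. \<not> cog_bij M (out_to UNIV x) x}"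

lemma injective_hull_exists:
  fixes M :: "('v, 'a, 'k, 'u) rep"
  assumes M: "is_rep K Q M" and fd: "locally_fin_dim K Q M" and minus: "minus_rep M b"
  shows "\<exists>bs g. set bs \<subseteq> verts Q \<and> g \<in> rep_mor K Q M (inj_sum bs) \<and> injective M g \<and>
    ((\<forall>x\<in>verts Q. cog_surj M (out_to UNIV x) x) \<longrightarrow> surjective M (inj_sum bs) g)"
proof -
  obtain bs \<xi> where fam: "cogenerating_family M bs \<xi>"
    using cogenerating_family_exists[OF M fd] minus unfolding minus_rep_def by blast
  then have bs: "set bs \<subseteq> verts Q" and \<xi>: "functionals_at M bs \<xi>"
    unfolding cogenerating_family_def by blast+
  have "injective M (rep_hom M (cogen_map M bs \<xi>))"
    by (rule cogen_map_injective[OF M \<xi>, where b = b])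
      (use minus fam in \<open>auto simp: minus_rep_def cogenerating_family_def\<close>)
  moreover have "surjective M (inj_sum bs) (rep_hom M (cogen_map M bs \<xi>))"
    if "\<forall>x\<in>verts Q. cog_surj M (out_to UNIV x) x"
    by (rule cogen_map_surjective[OF M \<xi> bs]) (use that fam in \<open>auto simp: cogenerating_family_def\<close>)
  moreover have "rep_hom M (cogen_map M bs \<xi>) \<in> rep_mor K Q M (inj_sum bs)"
    by (rule cogen_map_mor[OF M \<xi>])
  ultimately show ?thesis using bs by (intro exI[of _ bs] exI[of _ "rep_hom M (cogen_map M bs \<xi>)"]) simp
qed

text \<open>\<open>M\<close> is the kernel of a map between two sums of \<open>I_x\<close>, which
  are locally bijective away from \<open>as\<close> and \<open>bs\<close>.\<close>

lemma finitely_copresented_minus: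
  assumes "finitely_copresented K Q M"
  shows "\<exists>b. minus_rep M b"
proof -
  obtain as bs f g where ab: "set as \<subseteq> verts Q" "set bs \<subseteq> verts Q"
    and ex: "short_exact K Q M (inj_sum as) (inj_sum bs) f g"
    using assms unfolding finitely_copresented_def by blast
  note ker = short_exact_cokernel(2)[OF ex]
  have g: "g \<in> rep_mor K Q (inj_sum as) (inj_sum bs)" using ex by (simp add: short_exact_def)
  note f = kernel_ofD[OF ker]
  have "minus_rep M (set as)"
    unfolding minus_rep_def
  proof (intro conjI ballI impI)
    show "vanishes M x" if "x \<in> verts Q" "x \<notin> preds (set as)" for x
      by (rule vanishes_sub[OF f(2,1) injectiveD[OF f(3) that(1)] that(1) inj_sum_vanishes[OF that]])
    show "finite {x \<in> verts Q. \<not> cog_bij M (out_to UNIV x) x}"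
    proof (rule finite_subset)
      show "{x \<in> verts Q. \<not> cog_bij M (out_to UNIV x) x} \<subseteq> set as \<union> set bs"
      proof (rule subsetI, rule ccontr)
        fix x assume "x \<in> {x \<in> verts Q. \<not> cog_bij M (out_to UNIV x) x}" "x \<notin> set as \<union> set bs"
        then have x: "x \<in> verts Q" "\<not> cog_bij M (out_to UNIV x) x" "x \<notin> set as" "x \<notin> set bs" by auto
        have "cog_bij M (out_to UNIV x) x"
          by (rule cog_bij_kernel[OF ker inj_sum_rep g x(1)])
            (use inj_sum_cog_bij[OF x(1,3)] inj_sum_cog_bij[OF x(1,4)] in \<open>auto simp: cog_bij_def\<close>)
        then show False using x(2) by simp
      qed
    qed simp
  qed (use ab in auto)
  then show ?thesis by blast
qed

lemma minus_finitely_copresented: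
  fixes M :: "('v, 'a, 'k, 'u) rep"
  assumes M: "is_rep K Q M" and fd: "locally_fin_dim K Q M" and minus: "minus_rep M b"
  shows "finitely_copresented K Q M"
proof -
  obtain bs g where bs: "set bs \<subseteq> verts Q" and g: "g \<in> rep_mor K Q M (inj_sum bs)" "injective M g"
    using injective_hull_exists[OF M fd minus] by blast
  \<comment> \<open>Quotients are modelled by complements, which exist here because interval
    finiteness makes the sum of the \<open>I_x\<close> locally finite dimensional.\<close>
  note fdI = inj_sum_fin_dim[OF bs]
  obtain N :: "('v, 'a, 'k, nat \<Rightarrow> 'a list \<Rightarrow> 'k) rep" and c where cok: "cokernel_of M (inj_sum bs) g N c"
    using cokernel_exists[OF M inj_sum_rep fdI g(1)] by blast
  note c = cokernel_ofD[OF cok]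
  have fdN: "locally_fin_dim K Q N" by (rule locally_fin_dim_surj[OF c(2,3) fdI])
  \<comment> \<open>The dual of the hereditary property: a quotient of a sum of \<open>I_x\<close>
    inherits joint surjectivity at every vertex, so its own embedding into such a sum is an
    isomorphism.\<close>
  have surjN: "cog_surj N (out_to UNIV x) x" if x: "x \<in> verts Q" for x
    by (rule cog_surj_quot[OF c(2) x _ inj_sum_cog_surj[OF x]])
      (rule surjectiveD[OF c(3) head_verts[OF out_toD(1)]])
  have "minus_rep N (set bs)"
    unfolding minus_rep_def
  proof (intro conjI ballI impI)
    show "vanishes N x" if "x \<in> verts Q" "x \<notin> preds (set bs)" for x
      by (rule vanishes_quot[OF c(2,1) surjectiveD[OF c(3) that(1)] that(1) inj_sum_vanishes[OF that]])
    show "finite {x \<in> verts Q. \<not> cog_bij N (out_to UNIV x) x}"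
    proof (rule finite_subset)
      show "{x \<in> verts Q. \<not> cog_bij N (out_to UNIV x) x} \<subseteq> set bs \<union> {x \<in> verts Q. \<not> cog_bij M (out_to UNIV x) x}"
      proof (rule subsetI, rule ccontr)
        fix x assume "x \<in> {x \<in> verts Q. \<not> cog_bij N (out_to UNIV x) x}"
          "x \<notin> set bs \<union> {x \<in> verts Q. \<not> cog_bij M (out_to UNIV x) x}"
        then have x: "x \<in> verts Q" "\<not> cog_bij N (out_to UNIV x) x" "x \<notin> set bs" "cog_bij M (out_to UNIV x) x" by auto
        have "cog_bij N (out_to UNIV x) x"
          by (rule cog_bij_cokernel[OF cok inj_sum_rep g(1) x(1) _ inj_sum_cog_bij[OF x(1,3)]])
            (use x(4) in \<open>simp add: cog_bij_def\<close>)
        then show False using x(2) by simp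
      qed
      show "finite (set bs \<union> {x \<in> verts Q. \<not> cog_bij M (out_to UNIV x) x})" using minus by (simp add: minus_rep_def)
    qed
  qed (use bs in auto)
  then obtain as h where as: "set as \<subseteq> verts Q" and h: "h \<in> rep_mor K Q N (inj_sum as)"
      "injective N h" "surjective N (inj_sum as) h"
    using injective_hull_exists[OF c(1) fdN] surjN by blast
  let ?f = "rep_hom (inj_sum bs) (\<lambda>x v. h x (c x v))"
  have "short_exact K Q M (inj_sum bs) (inj_sum as) g ?f"
  proof (rule short_exactI[OF M inj_sum_rep inj_sum_rep g(1) compose_mor[OF inj_sum_rep c(2) h(1)] g(2)])
    have f: "?f x v = h x (c x v)" if "x \<in> verts Q" "v \<in> fiber (inj_sum bs) x" for x v using that by simp
    show "surjective (inj_sum bs) (inj_sum as) ?f"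
      unfolding surjective_def
    proof
      fix x assume x: "x \<in> verts Q"
      have "?f x ` fiber (inj_sum bs) x = h x ` c x ` fiber (inj_sum bs) x"
        unfolding image_image by (rule image_cong) (use x in simp_all)
      then show "?f x ` fiber (inj_sum bs) x = fiber (inj_sum as) x"
        by (simp only: surjectiveD[OF c(3) x] surjectiveD[OF h(3) x])
    qed
    fix x assume x: "x \<in> verts Q"
    have "?f x v = \<zero>\<^bsub>space_at (inj_sum as) x\<^esub> \<longleftrightarrow> c x v = \<zero>\<^bsub>space_at N x\<^esub>" if v: "v \<in> fiber (inj_sum bs) x" for v
      unfolding f[OF x v] by (rule mor_zero_iff[OF h(1) injectiveD[OF h(2) x] x mor_closed[OF c(2) x v]])
    then have "{v \<in> fiber (inj_sum bs) x. ?f x v = \<zero>\<^bsub>space_at (inj_sum as) x\<^esub>} =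
        {v \<in> fiber (inj_sum bs) x. c x v = \<zero>\<^bsub>space_at N x\<^esub>}" by auto
    then show "g x ` fiber M x = {v \<in> fiber (inj_sum bs) x. ?f x v = \<zero>\<^bsub>space_at (inj_sum as) x\<^esub>}"
      by (simp only: c(4)[OF x])
  qed
  then show ?thesis unfolding finitely_copresented_def using as bs
    by (intro exI[of _ bs] exI[of _ as] exI[of _ g] exI[of _ ?f]) simp
qed

section \<open>Finite extensions\<close>

lemma supports_sum:
  assumes L: "is_rep K Q L" and N: "is_rep K Q N" and \<alpha>: "\<alpha> \<in> arcs Q"
  shows "supports Q \<alpha> (sum_rep [L, N]) \<longleftrightarrow> supports Q \<alpha> L \<or> supports Q \<alpha> N"
proof -
  let ?S = "sum_rep [L, N]" and ?t = "tail Q \<alpha>" and ?h = "head Q \<alpha>"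
  note zL = vs_zero_closed[OF rep_space[OF L tail_verts[OF \<alpha>]]] and zN = vs_zero_closed[OF rep_space[OF N tail_verts[OF \<alpha>]]]
  have I: "{..<Suc (Suc 0)} = {0, Suc 0}" by auto
  have restrict: "restrict u A = restrict v A \<longleftrightarrow> (\<forall>i\<in>A. u i = v i)" for u v :: "nat \<Rightarrow> 'z" and A
    by (metis restrict_apply' restrict_ext)
  have fib: "v \<in> fiber ?S ?t \<longleftrightarrow> v \<in> extensional {0, Suc 0} \<and> v 0 \<in> fiber L ?t \<and> v (Suc 0) \<in> fiber N ?t" for v
    by (simp add: sum_rep_def sum_space_simps PiE_iff I) auto
  have map: "map_at ?S \<alpha> v \<noteq> \<zero>\<^bsub>space_at ?S ?h\<^esub> \<longleftrightarrow>
      map_at L \<alpha> (v 0) \<noteq> \<zero>\<^bsub>space_at L ?h\<^esub> \<or> map_at N \<alpha> (v (Suc 0)) \<noteq> \<zero>\<^bsub>space_at N ?h\<^esub>" for v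
    by (simp add: sum_rep_def sum_space_simps I restrict)
  show ?thesis
  proof
    assume "supports Q \<alpha> ?S"
    then obtain v where v: "v \<in> fiber ?S ?t" "map_at ?S \<alpha> v \<noteq> \<zero>\<^bsub>space_at ?S ?h\<^esub>"
      unfolding supports_def by (elim bexE) (rule that)
    then have "v 0 \<in> fiber L ?t" "v (Suc 0) \<in> fiber N ?t" by (simp_all only: fib)
    then show "supports Q \<alpha> L \<or> supports Q \<alpha> N" using v(2) unfolding map supports_def by blast
  next
    have lift: "supports Q \<alpha> ?S" if "u \<in> fiber L ?t" "v \<in> fiber N ?t"
      "map_at L \<alpha> u \<noteq> \<zero>\<^bsub>space_at L ?h\<^esub> \<or> map_at N \<alpha> v \<noteq> \<zero>\<^bsub>space_at N ?h\<^esub>" for u v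
    proof -
      let ?v = "\<lambda>i\<in>{0, Suc 0}. if i = 0 then u else v"
      have "?v \<in> fiber ?S ?t" unfolding fib using that(1,2) by simp
      moreover have "map_at ?S \<alpha> ?v \<noteq> \<zero>\<^bsub>space_at ?S ?h\<^esub>" unfolding map using that(3) by simp
      ultimately show ?thesis unfolding supports_def by (intro bexI[of _ ?v])
    qed
    assume "supports Q \<alpha> L \<or> supports Q \<alpha> N"
    then show "supports Q \<alpha> ?S"
    proof
      assume "supports Q \<alpha> L"
      then obtain u where u: "u \<in> fiber L ?t" "map_at L \<alpha> u \<noteq> \<zero>\<^bsub>space_at L ?h\<^esub>" by (auto simp: supports_def)
      show ?thesis by (rule lift[OF u(1) zN disjI1[OF u(2)]])
    next
      assume "supports Q \<alpha> N"
      then obtain u where u: "u \<in> fiber N ?t" "map_at N \<alpha> u \<noteq> \<zero>\<^bsub>space_at N ?h\<^esub>" by (auto simp: supports_def)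
      show ?thesis by (rule lift[OF zL u(1) disjI2[OF u(2)]])
    qed
  qed
qed

text \<open>Away from the overlap of the cones and its neighbours, \<open>M\<close> agrees near a
  vertex of \<open>A\<close> with \<open>L\<close>, and near a vertex of \<open>B - A\<close> with
  \<open>N\<close>, so the local conditions carry over. The arrows from \<open>B - A\<close> to
  \<open>A\<close> are controlled by the finiteness condition on the extension.\<close>

lemma finite_extension_bar_at:
  assumes plus: "plus_rep L a" and minus: "minus_rep N b" and ex: "short_exact K Q L M N f g"
    and fin: "finite {\<alpha> \<in> arcs Q. supports Q \<alpha> M \<and> \<not> supports Q \<alpha> (sum_rep [L, N])}"
  shows "bar_at M (succs a) (preds b)"
proof -
  let ?A = "succs a" and ?B = "preds b"
  define F where "F = ?A \<inter> ?B"
  have a: "finite a" "a \<subseteq> verts Q" and vanL: "vanishes L x" if "x \<in> verts Q" "x \<notin> ?A" for x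
    using plus that by (simp_all add: plus_rep_def)
  have b: "finite b" "b \<subseteq> verts Q" and vanN: "vanishes N x" if "x \<in> verts Q" "x \<notin> ?B" for x
    using minus that by (simp_all add: minus_rep_def)
  have finF: "finite F" unfolding F_def
    by (rule finite_succs_preds) (use plus minus in \<open>simp_all add: plus_rep_def minus_rep_def\<close>)
  have FV: "F \<subseteq> verts Q" unfolding F_def using succs_verts by auto
  have L: "is_rep K Q L" and M: "is_rep K Q M" and N: "is_rep K Q N"
    and f: "f \<in> rep_mor K Q L M" and g: "g \<in> rep_mor K Q M N"
    using ex by (simp_all add: short_exact_def)
  have ker: "f x ` fiber L x = {v \<in> fiber M x. g x v = \<zero>\<^bsub>space_at N x\<^esub>}" and inj: "inj_on (f x) (fiber L x)"
    and surj: "g x ` fiber M x = fiber N x" if "x \<in> verts Q" for x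
    using ex that by (simp_all add: short_exact_def)
  \<comment> \<open>Exactness makes \<open>f\<close> bijective wherever \<open>N\<close> vanishes,
    and dually \<open>g\<close> wherever \<open>L\<close> vanishes.\<close>
  have fbij: "bij_at L M f x" if x: "x \<in> verts Q" and van: "vanishes N x" for x
  proof -
    have "g x v = \<zero>\<^bsub>space_at N x\<^esub>" if "v \<in> fiber M x" for v by (rule vanishesD[OF van mor_closed[OF g x that]])
    then have "f x ` fiber L x = fiber M x" using ker[OF x] by auto
    then show ?thesis using inj[OF x] by (simp add: bij_at_def bij_betw_def)
  qed
  have gbij: "bij_at M N g x" if x: "x \<in> verts Q" and van: "vanishes L x" for x
  proof -
    have "f x ` fiber L x = {\<zero>\<^bsub>space_at M x\<^esub>}"
      using van linear_map_zero[OF mor_map[OF f x]] by (simp add: vanishes_def)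
    then have "\<forall>v\<in>fiber M x. g x v = \<zero>\<^bsub>space_at N x\<^esub> \<longrightarrow> v = \<zero>\<^bsub>space_at M x\<^esub>" using ker[OF x] by auto
    then have "inj_on (g x) (fiber M x)" by (simp only: linear_map_inj_iff[OF mor_map[OF g x]])
    then show ?thesis using surj[OF x] by (simp add: bij_at_def bij_betw_def)
  qed
  show ?thesis
    unfolding bar_at_def
  proof (intro conjI ballI impI)
    show "vanishes M x" if "x \<in> verts Q" "x \<notin> ?A" "x \<notin> ?B" for x
      by (rule vanishes_quot[OF f M bij_atD(2)[OF fbij[OF that(1) vanN[OF that(1,3)]]] that(1) vanL[OF that(1,2)]])
    show "finite {y \<in> verts Q. y \<in> ?A \<and> \<not> gen_bij M (into ?A y) y}"
    proof (rule finite_subset)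
      show "finite (F \<union> neighbours F \<union> {y \<in> verts Q. \<not> gen_bij L (into UNIV y) y})"
        using finF finite_neighbours[OF finF FV] plus by (simp add: plus_rep_def)
      show "{y \<in> verts Q. y \<in> ?A \<and> \<not> gen_bij M (into ?A y) y} \<subseteq> F \<union> neighbours F \<union> {y \<in> verts Q. \<not> gen_bij L (into UNIV y) y}"
      proof (rule subsetI, rule ccontr)
        fix y assume "y \<in> {y \<in> verts Q. y \<in> ?A \<and> \<not> gen_bij M (into ?A y) y}"
          "y \<notin> F \<union> neighbours F \<union> {y \<in> verts Q. \<not> gen_bij L (into UNIV y) y}"
        then have y: "y \<in> verts Q" "y \<in> ?A" "\<not> gen_bij M (into ?A y) y" "y \<notin> F" "y \<notin> neighbours F"
          "gen_bij L (into UNIV y) y" by auto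
        have "gen_bij L (into UNIV y) y \<longleftrightarrow> gen_bij L (into ?A y) y"
          by (rule gen_bij_change[OF L y(1) into_mono]) (auto simp: into_def intro!: vanL)
        \<comment> \<open>Being neither in \<open>F\<close> nor a neighbour of it, \<open>y\<close>
          and the tails in \<open>A\<close> lie outside \<open>B\<close>, where \<open>N\<close>
          vanishes and \<open>f\<close> is bijective.\<close>
        moreover have "gen_bij L (into ?A y) y \<longleftrightarrow> gen_bij M (into ?A y) y"
        proof (rule gen_bij_transfer[OF f L M y(1)])
          show "bij_at L M f y" using y by (intro fbij vanN) (auto simp: F_def)
          fix \<alpha> assume \<alpha>: "\<alpha> \<in> into ?A y"
          then have "tail Q \<alpha> \<notin> ?B" using y(5) by (auto simp: F_def neighbours_def into_def)
          then show "bij_at L M f (tail Q \<alpha>)" using tail_verts[OF intoD(1)[OF \<alpha>]] by (intro fbij vanN)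
        qed
        ultimately show False using y(3,6) by simp
      qed
    qed
    show "finite {x \<in> verts Q. x \<in> ?B - ?A \<and> \<not> cog_bij M (out_to (?B - ?A) x) x}"
    proof (rule finite_subset)
      show "finite (neighbours F \<union> {x \<in> verts Q. \<not> cog_bij N (out_to UNIV x) x})"
        using finite_neighbours[OF finF FV] minus by (simp add: minus_rep_def)
      show "{x \<in> verts Q. x \<in> ?B - ?A \<and> \<not> cog_bij M (out_to (?B - ?A) x) x} \<subseteq> neighbours F \<union> {x \<in> verts Q. \<not> cog_bij N (out_to UNIV x) x}"
      proof (rule subsetI, rule ccontr)
        fix x assume "x \<in> {x \<in> verts Q. x \<in> ?B - ?A \<and> \<not> cog_bij M (out_to (?B - ?A) x) x}"
          "x \<notin> neighbours F \<union> {x \<in> verts Q. \<not> cog_bij N (out_to UNIV x) x}"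
        then have x: "x \<in> verts Q" "x \<in> ?B" "x \<notin> ?A" "\<not> cog_bij M (out_to (?B - ?A) x) x" "x \<notin> neighbours F"
          "cog_bij N (out_to UNIV x) x" by auto
        have "cog_bij N (out_to UNIV x) x \<longleftrightarrow> cog_bij N (out_to (?B - ?A) x) x"
        proof (rule cog_bij_change[OF N x(1) out_to_mono])
          fix \<alpha> assume "\<alpha> \<in> out_to UNIV x - out_to (?B - ?A) x"
          \<comment> \<open>A head in both cones would make \<open>x\<close> a neighbour of
            \<open>F\<close>.\<close>
          then have "\<alpha> \<in> arcs Q" "head Q \<alpha> \<notin> ?B" using x(5) by (auto simp: F_def neighbours_def out_to_def)
          then show "vanishes N (head Q \<alpha>)" by (intro vanN head_verts)
        qed simp
        moreover have "cog_bij M (out_to (?B - ?A) x) x \<longleftrightarrow> cog_bij N (out_to (?B - ?A) x) x"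
          by (rule cog_bij_transfer[OF g M N x(1)]) (use x in \<open>auto simp: out_to_def intro!: gbij vanL\<close>)
        ultimately show False using x(4,6) by simp
      qed
    qed
    show "finite {\<alpha> \<in> arcs Q. tail Q \<alpha> \<in> ?B - ?A \<and> head Q \<alpha> \<in> ?A \<and> supports Q \<alpha> M}"
    proof (rule finite_subset)
      show "finite (arcs_at F \<union> {\<alpha> \<in> arcs Q. supports Q \<alpha> M \<and> \<not> supports Q \<alpha> (sum_rep [L, N])})"
        using fin finite_arcs_at_set[OF finF FV] by simp
      show "{\<alpha> \<in> arcs Q. tail Q \<alpha> \<in> ?B - ?A \<and> head Q \<alpha> \<in> ?A \<and> supports Q \<alpha> M} \<subseteq>
        arcs_at F \<union> {\<alpha> \<in> arcs Q. supports Q \<alpha> M \<and> \<not> supports Q \<alpha> (sum_rep [L, N])}"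
      proof (rule subsetI, rule ccontr)
        fix \<alpha> assume "\<alpha> \<in> {\<alpha> \<in> arcs Q. tail Q \<alpha> \<in> ?B - ?A \<and> head Q \<alpha> \<in> ?A \<and> supports Q \<alpha> M}"
          "\<alpha> \<notin> arcs_at F \<union> {\<alpha> \<in> arcs Q. supports Q \<alpha> M \<and> \<not> supports Q \<alpha> (sum_rep [L, N])}"
        then have \<alpha>: "\<alpha> \<in> arcs Q" "tail Q \<alpha> \<notin> ?A" "head Q \<alpha> \<in> ?A" "head Q \<alpha> \<notin> F" "supports Q \<alpha> (sum_rep [L, N])"
          by (auto simp: arcs_at_def)
        \<comment> \<open>With the tail outside \<open>A\<close> and the head outside
          \<open>B\<close>, the arrow can support neither \<open>L\<close> nor \<open>N\<close>;
          such arrows supporting \<open>M\<close> are finite in number by the definition of a finite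
          extension.\<close>
        then have "vanishes L (tail Q \<alpha>)" "vanishes N (head Q \<alpha>)" by (auto simp: F_def intro!: vanL vanN)
        then show False
          using \<alpha>(5) supports_not_vanishes(1)[OF L \<alpha>(1)] supports_not_vanishes(2)[OF N \<alpha>(1)]
          unfolding supports_sum[OF L N \<alpha>(1)] by auto
      qed
    qed
  qed
qed

lemma subspace_zero_space:
  assumes V: "vectorspace K V"
  shows "VectorSpace.subspace K {\<zero>\<^bsub>V\<^esub>} V"
proof -
  interpret vectorspace K V by (rule V)
  show ?thesis by (rule subspaceI[OF V]) (use vs_zero_closed[OF V] vs_zero_add[OF V] in auto)
qed

text \<open>The subrepresentation supported on the successor-closed set \<open>succs a\<close> has quotient supported
  off it, and this is the finite extension required.\<close>

lemma bar_at_finite_extension: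
  fixes M :: "('v, 'a, 'k, 'u) rep"
  assumes M: "is_rep K Q M" and fd: "locally_fin_dim K Q M" and bar: "bar_at M (succs a) (preds b)"
    and a: "finite a" "a \<subseteq> verts Q" and b: "finite b" "b \<subseteq> verts Q"
  shows "\<exists>(L :: ('v, 'a, 'k, 'u) rep) (N :: ('v, 'a, 'k, 'u) rep). plus_rep L a \<and> minus_rep N b \<and>
    finite_extension_rep K Q M N L"
proof -
  let ?A = "succs a" and ?B = "preds b"
  define W where "W x = (if x \<in> ?A then fiber M x else {\<zero>\<^bsub>space_at M x\<^esub>})" for x
  have "VectorSpace.subspace K (W x) (space_at M x)" if x: "x \<in> verts Q" for x
    using subspace_carrier[OF rep_space[OF M x]] subspace_zero_space[OF rep_space[OF M x]] by (simp add: W_def)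
  moreover have "map_at M \<alpha> ` W (tail Q \<alpha>) \<subseteq> W (head Q \<alpha>)" if \<alpha>: "\<alpha> \<in> arcs Q" for \<alpha>
    using succs_closed[OF \<alpha>] rep_map_closed[OF M \<alpha>] linear_map_zero[OF rep_map[OF M \<alpha>]]
      vs_zero_closed[OF rep_space[OF M head_verts[OF \<alpha>]]] by (auto simp: W_def)
  ultimately have W: "stable M W" unfolding stable_def by blast
  obtain L :: "('v, 'a, 'k, 'u) rep" and k where L: "is_rep K Q L" and k: "k \<in> rep_mor K Q L M" "injective L k"
    and kW: "\<forall>x\<in>verts Q. k x ` fiber L x = W x"
    using subrep_exists[OF M W] by blast
  obtain N :: "('v, 'a, 'k, 'u) rep" and c where N: "is_rep K Q N" and c: "c \<in> rep_mor K Q M N" "surjective M N c"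
    and cW: "\<forall>x\<in>verts Q. {v \<in> fiber M x. c x v = \<zero>\<^bsub>space_at N x\<^esub>} = W x"
    using quotient_exists[OF M fd W] by blast
  have vanM: "vanishes M x" if "x \<in> verts Q" "x \<notin> ?A" "x \<notin> ?B" for x
    using bar that by (simp add: bar_at_def)
  have kbij: "bij_at L M k x" if x: "x \<in> verts Q" and "x \<in> ?A" for x
    using bspec[OF kW x] that injectiveD[OF k(2) x] by (simp add: W_def bij_at_def bij_betw_def)
  have vanL: "vanishes L x" if x: "x \<in> verts Q" and "x \<notin> ?A" for x
  proof (rule vanishesI[OF L x])
    fix v assume v: "v \<in> fiber L x"
    have "k x v \<in> W x" using bspec[OF kW x] v by blast
    then show "v = \<zero>\<^bsub>space_at L x\<^esub>" using that mor_zero_iff[OF k(1) injectiveD[OF k(2) x] x v] by (simp add: W_def)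
  qed
  have cbij: "bij_at M N c x" if x: "x \<in> verts Q" and "x \<notin> ?A" for x
  proof -
    have "\<forall>v\<in>fiber M x. c x v = \<zero>\<^bsub>space_at N x\<^esub> \<longrightarrow> v = \<zero>\<^bsub>space_at M x\<^esub>"
      using bspec[OF cW x] that by (auto simp: W_def)
    then have "inj_on (c x) (fiber M x)" by (simp only: linear_map_inj_iff[OF mor_map[OF c(1) x]])
    then show ?thesis using surjectiveD[OF c(2) x] by (simp add: bij_at_def bij_betw_def)
  qed
  have vanN: "vanishes N x" if x: "x \<in> verts Q" and "x \<in> ?A \<or> x \<notin> ?B" for x
  proof (cases "x \<in> ?A")
    case True
    show ?thesis
    proof (rule vanishesI[OF N x])
      fix v assume "v \<in> fiber N x"
      then obtain u where "u \<in> fiber M x" "v = c x u" using surjectiveD[OF c(2) x] by blast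
      then show "v = \<zero>\<^bsub>space_at N x\<^esub>" using bspec[OF cW x] True by (auto simp: W_def)
    qed
  next
    case False
    then show ?thesis using vanishes_quot[OF c(1) N surjectiveD[OF c(2) x] x vanM[OF x False]] that by simp
  qed
  have "plus_rep L a"
    unfolding plus_rep_def
  proof (intro conjI ballI impI)
    show "finite {y \<in> verts Q. \<not> gen_bij L (into UNIV y) y}"
    proof (rule finite_subset)
      show "finite {y \<in> verts Q. y \<in> ?A \<and> \<not> gen_bij M (into ?A y) y}" using bar by (simp add: bar_at_def)
      show "{y \<in> verts Q. \<not> gen_bij L (into UNIV y) y} \<subseteq> {y \<in> verts Q. y \<in> ?A \<and> \<not> gen_bij M (into ?A y) y}"
      proof
        fix y assume "y \<in> {y \<in> verts Q. \<not> gen_bij L (into UNIV y) y}"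
        then have y: "y \<in> verts Q" and bad: "\<not> gen_bij L (into UNIV y) y" by auto
        \<comment> \<open>Off the cone \<open>L\<close> vanishes at \<open>y\<close> and, by closure
          under successors, at every tail of an arrow into \<open>y\<close>, so no exceptional
          vertex lies there.\<close>
        have yA: "y \<in> ?A"
        proof (rule ccontr)
          assume "y \<notin> ?A"
          then have "gen_bij L (into UNIV y) y"
            using succs_closed[of _ a] by (intro gen_bij_vanishes[OF L y] vanL) (auto simp: into_def y)
          then show False using bad by simp
        qed
        have "gen_bij L (into UNIV y) y \<longleftrightarrow> gen_bij L (into ?A y) y"
          by (rule gen_bij_change[OF L y into_mono]) (auto simp: into_def intro!: vanL)
        moreover have "gen_bij L (into ?A y) y \<longleftrightarrow> gen_bij M (into ?A y) y"
          by (rule gen_bij_transfer[OF k(1) L M y]) (use y yA in \<open>auto simp: into_def intro!: kbij\<close>)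
        ultimately show "y \<in> {y \<in> verts Q. y \<in> ?A \<and> \<not> gen_bij M (into ?A y) y}" using y yA bad by simp
      qed
    qed
  qed (use a vanL in auto)
  moreover have "minus_rep N b"
    unfolding minus_rep_def
  proof (intro conjI ballI impI)
    show "finite {x \<in> verts Q. \<not> cog_bij N (out_to UNIV x) x}"
    proof (rule finite_subset)
      show "finite {x \<in> verts Q. x \<in> ?B - ?A \<and> \<not> cog_bij M (out_to (?B - ?A) x) x}" using bar by (simp add: bar_at_def)
      show "{x \<in> verts Q. \<not> cog_bij N (out_to UNIV x) x} \<subseteq> {x \<in> verts Q. x \<in> ?B - ?A \<and> \<not> cog_bij M (out_to (?B - ?A) x) x}"
      proof
        fix x assume "x \<in> {x \<in> verts Q. \<not> cog_bij N (out_to UNIV x) x}"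
        then have x: "x \<in> verts Q" and bad: "\<not> cog_bij N (out_to UNIV x) x" by auto
        \<comment> \<open>If \<open>x\<close> lies in \<open>A\<close>, so do the heads of its
          arrows; if it lies outside \<open>B\<close>, so do the heads. In both cases
          \<open>N\<close> is zero at \<open>x\<close> and at these heads.\<close>
        have xBA: "x \<in> ?B - ?A"
        proof (rule ccontr)
          assume n: "x \<notin> ?B - ?A"
          have "cog_bij N (out_to UNIV x) x"
          proof (rule cog_bij_vanishes[OF N x vanN[OF x]])
            show "x \<in> ?A \<or> x \<notin> ?B" using n by auto
            fix \<alpha> assume "\<alpha> \<in> out_to UNIV x"
            then have "\<alpha> \<in> arcs Q" "tail Q \<alpha> \<in> ?A \<or> tail Q \<alpha> \<notin> ?B" using n by (auto simp: out_to_def)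
            then show "vanishes N (head Q \<alpha>)" using succs_closed[of \<alpha> a] preds_closed[of \<alpha> b] by (intro vanN) auto
          qed
          then show False using bad by simp
        qed
        have "cog_bij N (out_to UNIV x) x \<longleftrightarrow> cog_bij N (out_to (?B - ?A) x) x"
          by (rule cog_bij_change[OF N x out_to_mono]) (auto simp: out_to_def intro!: vanN)
        moreover have "cog_bij M (out_to (?B - ?A) x) x \<longleftrightarrow> cog_bij N (out_to (?B - ?A) x) x"
          by (rule cog_bij_transfer[OF c(1) M N x]) (use x xBA in \<open>auto simp: out_to_def intro!: cbij\<close>)
        ultimately show "x \<in> {x \<in> verts Q. x \<in> ?B - ?A \<and> \<not> cog_bij M (out_to (?B - ?A) x) x}" using x xBA bad by simp
      qed
    qed
  qed (use b vanN in auto)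
  moreover have "finite_extension_rep K Q M N L"
    unfolding finite_extension_rep_def
  proof (intro conjI)
    have obj: "X \<in> Obj (rep_cat K Q) \<longleftrightarrow> is_rep K Q X \<and> locally_fin_dim K Q X" for X :: "('v, 'a, 'k, 'u) rep"
      by (simp add: rep_cat_def)
    show "L \<in> Obj (rep_cat K Q)" "M \<in> Obj (rep_cat K Q)" "N \<in> Obj (rep_cat K Q)"
      unfolding obj using L M N fd locally_fin_dim_inj[OF k fd] locally_fin_dim_surj[OF c fd] by simp_all
    have "short_exact K Q L M N k c"
      by (rule short_exactI[OF L M N k(1) c(1) k(2) c(2)]) (simp only: bspec[OF kW] bspec[OF cW])
    then show "\<exists>f g. short_exact K Q L M N f g" by blast
    show "finite {\<alpha> \<in> arcs Q. supports Q \<alpha> M \<and> \<not> supports Q \<alpha> (sum_rep [L, N])}"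
    proof (rule finite_subset)
      show "finite {\<alpha> \<in> arcs Q. tail Q \<alpha> \<in> ?B - ?A \<and> head Q \<alpha> \<in> ?A \<and> supports Q \<alpha> M}" using bar by (simp add: bar_at_def)
      show "{\<alpha> \<in> arcs Q. supports Q \<alpha> M \<and> \<not> supports Q \<alpha> (sum_rep [L, N])} \<subseteq>
        {\<alpha> \<in> arcs Q. tail Q \<alpha> \<in> ?B - ?A \<and> head Q \<alpha> \<in> ?A \<and> supports Q \<alpha> M}"
      proof
        fix \<alpha> assume "\<alpha> \<in> {\<alpha> \<in> arcs Q. supports Q \<alpha> M \<and> \<not> supports Q \<alpha> (sum_rep [L, N])}"
        then have \<alpha>: "\<alpha> \<in> arcs Q" and sM: "supports Q \<alpha> M" and not: "\<not> supports Q \<alpha> (sum_rep [L, N])" by auto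
        have nL: "\<not> supports Q \<alpha> L" and nN: "\<not> supports Q \<alpha> N" using not supports_sum[OF L N \<alpha>] by auto
        note t = tail_verts[OF \<alpha>] and h = head_verts[OF \<alpha>]
        obtain v where v: "v \<in> fiber M (tail Q \<alpha>)" "map_at M \<alpha> v \<noteq> \<zero>\<^bsub>space_at M (head Q \<alpha>)\<^esub>"
          using sM by (auto simp: supports_def)
        \<comment> \<open>Over \<open>A\<close> the inclusion \<open>k\<close> is bijective, so an
          arrow that starts there and supports \<open>M\<close> supports \<open>L\<close>.\<close>
        have tA: "tail Q \<alpha> \<notin> ?A"
        proof
          assume tA: "tail Q \<alpha> \<in> ?A"
          then obtain u where u: "u \<in> fiber L (tail Q \<alpha>)" "v = k (tail Q \<alpha>) u"
            using v(1) bij_atD(2)[OF kbij[OF t tA]] by blast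
          have "map_at L \<alpha> u = \<zero>\<^bsub>space_at L (head Q \<alpha>)\<^esub>" using nL u(1) by (auto simp: supports_def)
          then have "map_at M \<alpha> v = \<zero>\<^bsub>space_at M (head Q \<alpha>)\<^esub>"
            using mor_natural[OF k(1) \<alpha> u(1)] linear_map_zero[OF mor_map[OF k(1) h]] u(2) by simp
          then show False using v(2) by simp
        qed
        \<comment> \<open>Off \<open>A\<close> the quotient map is injective, so an arrow that ends
          there and supports \<open>M\<close> supports \<open>N\<close>.\<close>
        moreover have "head Q \<alpha> \<in> ?A"
        proof (rule ccontr)
          assume hA: "head Q \<alpha> \<notin> ?A"
          have "map_at N \<alpha> (c (tail Q \<alpha>) v) = \<zero>\<^bsub>space_at N (head Q \<alpha>)\<^esub>"
            using nN mor_closed[OF c(1) t v(1)] by (auto simp: supports_def)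
          then show False
            using mor_natural[OF c(1) \<alpha> v(1)] mor_zero_iff[OF c(1) bij_atD(1)[OF cbij[OF h hA]] h rep_map_closed[OF M \<alpha> v(1)]] v(2)
            by simp
        qed
        moreover have "tail Q \<alpha> \<in> ?B" using supports_not_vanishes(1)[OF M \<alpha> sM] vanM[OF t tA] by blast
        ultimately show "\<alpha> \<in> {\<alpha> \<in> arcs Q. tail Q \<alpha> \<in> ?B - ?A \<and> head Q \<alpha> \<in> ?A \<and> supports Q \<alpha> M}" using \<alpha> sM by simp
      qed
    qed
  qed
  ultimately show ?thesis by blast
qed

section \<open>The category \<open>rep_bar\<close> and its closure properties\<close>

definition bar_rep where
  "bar_rep M \<longleftrightarrow> (\<exists>a b. finite a \<and> a \<subseteq> verts Q \<and> finite b \<and> b \<subseteq> verts Q \<and> bar_at M (succs a) (preds b))"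

text \<open>Both sides are full subcategories of \<open>rep_cat\<close>, so it suffices to compare
  the defining properties on locally finite dimensional representations.\<close>

lemma rep_bar_eq: "(rep_bar K Q :: (('v, 'a, 'k, 'u) rep, 'v \<Rightarrow> 'u \<Rightarrow> 'u) add_cat) = subcat bar_rep"
proof -
  let ?E = "\<lambda>M :: ('v, 'a, 'k, 'u) rep. \<exists>L\<in>Obj (rep_plus K Q). \<exists>N\<in>Obj (rep_minus K Q). finite_extension_rep K Q M N L"
  have obj: "X \<in> Obj (rep_cat K Q) \<longleftrightarrow> is_rep K Q X \<and> locally_fin_dim K Q X" for X :: "('v, 'a, 'k, 'u) rep"
    by (simp add: rep_cat_def)
  have plus: "X \<in> Obj (rep_plus K Q) \<longleftrightarrow> is_rep K Q X \<and> locally_fin_dim K Q X \<and> finitely_presented K Q X"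
    and minus: "X \<in> Obj (rep_minus K Q) \<longleftrightarrow> is_rep K Q X \<and> locally_fin_dim K Q X \<and> finitely_copresented K Q X"
    for X :: "('v, 'a, 'k, 'u) rep"
    by (simp_all add: rep_plus_def rep_minus_def full_subcategory_def obj)
  have "?E M \<longleftrightarrow> bar_rep M" if M: "is_rep K Q M" "locally_fin_dim K Q M" for M :: "('v, 'a, 'k, 'u) rep"
  proof
    assume "?E M"
    then obtain L N :: "('v, 'a, 'k, 'u) rep" where LN: "L \<in> Obj (rep_plus K Q)" "N \<in> Obj (rep_minus K Q)"
      and E: "finite_extension_rep K Q M N L"
      by blast
    then have L: "finitely_presented K Q L" and N: "finitely_copresented K Q N" by (simp_all only: plus minus)
    obtain a b where ab: "plus_rep L a" "minus_rep N b"
      using finitely_presented_plus[OF L] finitely_copresented_minus[OF N] by blast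
    obtain f g where "short_exact K Q L M N f g" using E by (auto simp: finite_extension_rep_def)
    then have "bar_at M (succs a) (preds b)"
      by (rule finite_extension_bar_at[OF ab]) (use E in \<open>simp add: finite_extension_rep_def\<close>)
    then show "bar_rep M" unfolding bar_rep_def using ab
      by (intro exI[of _ a] exI[of _ b]) (simp add: plus_rep_def minus_rep_def)
  next
    assume "bar_rep M"
    then obtain a b where ab: "finite a" "a \<subseteq> verts Q" "finite b" "b \<subseteq> verts Q" and bar: "bar_at M (succs a) (preds b)"
      unfolding bar_rep_def by blast
    obtain L N :: "('v, 'a, 'k, 'u) rep" where L: "plus_rep L a" and N: "minus_rep N b" and E: "finite_extension_rep K Q M N L"
      using bar_at_finite_extension[OF M bar ab] by blast
    have LN: "is_rep K Q L" "locally_fin_dim K Q L" "is_rep K Q N" "locally_fin_dim K Q N"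
      using E by (simp_all add: finite_extension_rep_def obj)
    then have "L \<in> Obj (rep_plus K Q)" "N \<in> Obj (rep_minus K Q)"
      using plus_finitely_presented[OF LN(1,2) L] minus_finitely_copresented[OF LN(3,4) N] by (simp_all add: plus minus)
    then show "?E M" using E by blast
  qed
  then have "{X \<in> Obj (rep_cat K Q). ?E X} = {X \<in> Obj (rep_cat K Q). bar_rep X}"
    by (intro Collect_cong) (auto simp only: obj)
  then show ?thesis by (simp only: rep_bar_def subcat_def full_subcategory_def)
qed

text \<open>Supplies the common cones that the chases for two representations require, by enlarging
  both pairs to their unions.\<close>

lemma bar_rep_common:
  assumes X: "is_rep K Q X" "bar_rep X" and Y: "is_rep K Q Y" "bar_rep Y"
  obtains a b where "finite a" "a \<subseteq> verts Q" "finite b" "b \<subseteq> verts Q"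
    and "bar_at X (succs a) (preds b)" and "bar_at Y (succs a) (preds b)"
proof -
  obtain a b where ab: "finite a" "a \<subseteq> verts Q" "finite b" "b \<subseteq> verts Q" "bar_at X (succs a) (preds b)"
    using X(2) unfolding bar_rep_def by blast
  obtain a' b' where ab': "finite a'" "a' \<subseteq> verts Q" "finite b'" "b' \<subseteq> verts Q" "bar_at Y (succs a') (preds b')"
    using Y(2) unfolding bar_rep_def by blast
  have fin: "finite (a \<union> a')" "a \<union> a' \<subseteq> verts Q" "finite (b \<union> b')" "b \<union> b' \<subseteq> verts Q" using ab ab' by auto
  have "bar_at X (succs (a \<union> a')) (preds (b \<union> b'))" by (rule bar_at_mono[OF X(1) ab(5) _ fin(1,2) _ fin(3,4)]) auto
  moreover have "bar_at Y (succs (a \<union> a')) (preds (b \<union> b'))" by (rule bar_at_mono[OF Y(1) ab'(5) _ fin(1,2) _ fin(3,4)]) auto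
  ultimately show ?thesis by (rule that[OF fin])
qed

lemma bar_repI: "finite a \<Longrightarrow> a \<subseteq> verts Q \<Longrightarrow> finite b \<Longrightarrow> b \<subseteq> verts Q \<Longrightarrow> bar_at M (succs a) (preds b) \<Longrightarrow> bar_rep M"
  unfolding bar_rep_def by (intro exI[of _ a] exI[of _ b]) simp

text \<open>The zero representation satisfies the condition with empty cones. In the other closure
  properties the two given representations are first brought to common cones, which the new object
  then shares.\<close>

lemma rep_bar_abelian:
  fixes \<iota> :: "'k list \<Rightarrow> 'u"
  assumes \<iota>: "inj_on \<iota> (lists (carrier K))"
  shows "abelian_category (rep_bar K Q :: (('v, 'a, 'k, 'u) rep, 'v \<Rightarrow> 'u \<Rightarrow> 'u) add_cat)"
  unfolding rep_bar_eq
proof (rule subcat_abelian[OF \<iota>])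
  fix Z :: "('v, 'a, 'k, 'u) rep" assume "zero_rep Z"
  then have "bar_at Z {} {}" by (rule bar_at_zero)
  moreover have "succs {} = {}" "preds {} = {}" by (auto simp: succs_def preds_def)
  ultimately show "bar_rep Z" by (intro bar_repI[of "{}" "{}"]) simp_all
next
  fix X Y A :: "('v, 'a, 'k, 'u) rep" and f k
  assume X: "X \<in> Obj (subcat bar_rep)" and Y: "Y \<in> Obj (subcat bar_rep)" and f: "f \<in> rep_mor K Q X Y"
    and ker: "kernel_of X Y f A k"
  have XY: "is_rep K Q X" "bar_rep X" "is_rep K Q Y" "bar_rep Y" using X Y by (simp_all add: subcat_simps)
  obtain a b where ab: "finite a" "a \<subseteq> verts Q" "finite b" "b \<subseteq> verts Q"
    and bars: "bar_at X (succs a) (preds b)" "bar_at Y (succs a) (preds b)"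
    by (rule bar_rep_common[OF XY])
  show "bar_rep A" by (rule bar_repI[OF ab bar_at_kernel[OF ker XY(1,3) f bars]])
next
  fix X Y B :: "('v, 'a, 'k, 'u) rep" and f c
  assume X: "X \<in> Obj (subcat bar_rep)" and Y: "Y \<in> Obj (subcat bar_rep)" and f: "f \<in> rep_mor K Q X Y"
    and cok: "cokernel_of X Y f B c"
  have XY: "is_rep K Q X" "bar_rep X" "is_rep K Q Y" "bar_rep Y" using X Y by (simp_all add: subcat_simps)
  obtain a b where ab: "finite a" "a \<subseteq> verts Q" "finite b" "b \<subseteq> verts Q"
    and bars: "bar_at X (succs a) (preds b)" "bar_at Y (succs a) (preds b)"
    by (rule bar_rep_common[OF XY])
  show "bar_rep B" by (rule bar_repI[OF ab bar_at_cokernel[OF cok XY(1,3) f bars]])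
next
  fix X Y S :: "('v, 'a, 'k, 'u) rep" and p q
  assume X: "X \<in> Obj (subcat bar_rep)" and Y: "Y \<in> Obj (subcat bar_rep)" and P: "product_of X Y S p q"
  have XY: "is_rep K Q X" "bar_rep X" "is_rep K Q Y" "bar_rep Y" using X Y by (simp_all add: subcat_simps)
  obtain a b where ab: "finite a" "a \<subseteq> verts Q" "finite b" "b \<subseteq> verts Q"
    and bars: "bar_at X (succs a) (preds b)" "bar_at Y (succs a) (preds b)"
    by (rule bar_rep_common[OF XY])
  show "bar_rep S" by (rule bar_repI[OF ab bar_at_product[OF P XY(1,3) bars]])
qed

end

theorem proposition3p1:
  fixes K :: "('k, 'r) ring_scheme"
    and Q :: "('v, 'a) pre_digraph"
    and \<iota> :: "'k list \<Rightarrow> 'u"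
  assumes field: "field K"
    and quiver: "strongly_locally_finite Q"
    and universe: "inj_on \<iota> (lists (carrier K))"
  shows "abelian_category (rep_bar K Q :: (('v, 'a, 'k, 'u) rep, 'v \<Rightarrow> 'u \<Rightarrow> 'u) add_cat)"
proof -
  interpret quiver_reps K Q by (rule quiver_reps.intro[OF field quiver])
  show ?thesis by (rule rep_bar_abelian[OF universe])
qed

end
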